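(* Let $\mathcal{H}$ be a hereditary category. Then the lift map $\phi$ and the trace map $\psi$ are mutually inverse bijections between the class of all torsion pairs $(\mathcal{T},\mathcal{F})$ in $\mathcal{H}$ and the class of all $t$-structures $(\mathcal{U},\mathcal{U}^{\perp}[1])$ in $\mathcal{D}^b(\mathcal{H})$ such that $\mathcal{H}[1]\subseteq\mathcal{U}$ and $\mathcal{H}[-1]\subseteq\mathcal{U}^{\perp}$.
   Context: $k$ is an algebraically closed field; all categories are additive Krull-Schmidt $k$-categories. A hereditary category is a connected abelian $k$-category $\mathcal{H}$ with $\mathrm{Ext}^2_{\mathcal{H}}(X,Y)=0$ and with $\mathrm{Hom}_{\mathcal{H}}(X,Y)$, $\mathrm{Ext}^1_{\mathcal{H}}(X,Y)$ finite dimensional for all $X,Y\in\mathcal{H}$. $\mathcal{H}$ is identified with the complexes concentrated in degree $0$ in $\mathcal{D}^b(\mathcal{H})$, and $[\cdot]$ denotes the shift. A torsion pair $(\mathcal{T},\mathcal{F})$ in $\mathcal{H}$ is a pair of full subcategories such that $\mathrm{Hom}(X,Y)=0$ for $X\in\mathcal{T}$, $Y\in\mathcal{F}$, and each $Y\in\mathcal{H}$ admits a short exact sequence $0\to X\to Y\to Z\to 0$ with $X\in\mathcal{T}$, $Z\in\mathcal{F}$; equivalently $\mathcal{T}={}^{\perp}\mathcal{F}$ and $\mathcal{F}=\mathcal{T}^{\perp}$. For a full subcategory $\mathcal{U}$ of a category $\mathcal{C}$, $\mathcal{U}^{\perp}$ is the full subcategory of objects $Y$ with $\mathrm{Hom}_{\mathcal{C}}(X,Y)=0$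 for all $X\in\mathcal{U}$. A $t$-structure in a triangulated category $\mathcal{C}$ is a pair $(\mathcal{U},\mathcal{V})$ of full subcategories such that $\mathrm{Hom}(X,Y)=0$ for $X\in\mathcal{U}$, $Y\in\mathcal{V}[-1]$; $\mathcal{U}\subseteq\mathcal{U}[-1]$ and $\mathcal{V}\supseteq\mathcal{V}[-1]$; and each $Y\in\mathcal{C}$ admits a triangle $X\to Y\to Z\to X[1]$ with $X\in\mathcal{U}$, $Z\in\mathcal{V}[-1]$. (One then has $\mathcal{V}=\mathcal{U}^{\perp}[1]$.) The lift map $\phi$ sends a torsion pair $(\mathcal{T},\mathcal{F})$ in $\mathcal{H}$ to the $t$-structure $(\mathcal{U}_{\mathcal{T}},\mathcal{U}_{\mathcal{T}}^{\perp}[1])$ with $\mathcal{U}_{\mathcal{T}}=\{X\in\mathcal{D}^b(\mathcal{H})\mid \mathrm{H}^i(X)=0 \text{ for all } i>0,\ \mathrm{H}^0(X)\in\mathcal{T}\}$. The trace map $\psi$ sends a $t$-structure $(\mathcal{U},\mathcal{U}^{\perp}[1])$ with $\mathcal{H}[1]\subseteq\mathcal{U}$ and $\mathcal{H}[-1]\subseteq\mathcal{U}^{\perp}$ to the pair $(\mathcal{U}\cap\mathcal{H},\mathcal{U}^{\perp}\cap\mathcal{H})$. *)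

theory Defs
  imports "HOL-Computational_Algebra.Computational_Algebra"
begin

text \<open>
  A category over the field \<open>'k\<close> is given by carrier sets of objects and arrows.  Every arrow has a
  domain and a codomain, so distinct hom-sets are disjoint.  Composition \<open>g \<cdot> f\<close> (first \<open>f\<close>),
  addition and scalar multiplication are only meaningful on suitable arrows of the carrier.
  A full subcategory is represented by its set of objects.
\<close>

record ('o, 'm, 'k) lincat =
  Obj :: "'o set"
  Arr :: "'m set"
  Dom :: "'m \<Rightarrow> 'o"
  Cod :: "'m \<Rightarrow> 'o"
  Ident :: "'o \<Rightarrow> 'm" ("\<one>\<index>")
  Comp :: "'m \<Rightarrow> 'm \<Rightarrow> 'm" (infixr "\<cdot>\<index>" 70)
  Null :: "'o \<Rightarrow> 'o \<Rightarrow> 'm"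
  Plus :: "'m \<Rightarrow> 'm \<Rightarrow> 'm" (infixl "\<oplus>\<index>" 65)
  Scale :: "'k \<Rightarrow> 'm \<Rightarrow> 'm" (infixr "\<odot>\<index>" 75)

definition hom :: "('o, 'm, 'k, 'z) lincat_scheme \<Rightarrow> 'o \<Rightarrow> 'o \<Rightarrow> 'm set" where
  "hom C X Y = {f \<in> Arr C. Dom C f = X \<and> Cod C f = Y}"

definition is_iso :: "('o, 'm, 'k, 'z) lincat_scheme \<Rightarrow> 'm \<Rightarrow> bool" where
  "is_iso C f \<longleftrightarrow> f \<in> Arr C \<and>
     (\<exists>g \<in> hom C (Cod C f) (Dom C f).
        g \<cdot>\<^bsub>C\<^esub> f = \<one>\<^bsub>C\<^esub> (Dom C f) \<and> f \<cdot>\<^bsub>C\<^esub> g = \<one>\<^bsub>C\<^esub> (Cod C f))"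

definition isomorphic :: "('o, 'm, 'k, 'z) lincat_scheme \<Rightarrow> 'o \<Rightarrow> 'o \<Rightarrow> bool" where
  "isomorphic C X Y \<longleftrightarrow> (\<exists>f \<in> hom C X Y. is_iso C f)"

definition zero_object :: "('o, 'm, 'k, 'z) lincat_scheme \<Rightarrow> 'o \<Rightarrow> bool" where
  "zero_object C Z \<longleftrightarrow> Z \<in> Obj C \<and>
     (\<forall>X \<in> Obj C. (\<exists>!f. f \<in> hom C X Z) \<and> (\<exists>!f. f \<in> hom C Z X))"

definition is_biproduct ::
    "('o, 'm, 'k, 'z) lincat_scheme \<Rightarrow> 'o \<Rightarrow> 'o \<Rightarrow> 'o \<Rightarrow> 'm \<Rightarrow> 'm \<Rightarrow> 'm \<Rightarrow> 'm \<Rightarrow> bool" where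
  "is_biproduct C X A B i j p q \<longleftrightarrow> X \<in> Obj C \<and> A \<in> Obj C \<and> B \<in> Obj C \<and>
     i \<in> hom C A X \<and> j \<in> hom C B X \<and> p \<in> hom C X A \<and> q \<in> hom C X B \<and>
     p \<cdot>\<^bsub>C\<^esub> i = \<one>\<^bsub>C\<^esub> A \<and> q \<cdot>\<^bsub>C\<^esub> j = \<one>\<^bsub>C\<^esub> B \<and>
     q \<cdot>\<^bsub>C\<^esub> i = Null C A B \<and> p \<cdot>\<^bsub>C\<^esub> j = Null C B A \<and>
     (i \<cdot>\<^bsub>C\<^esub> p) \<oplus>\<^bsub>C\<^esub> (j \<cdot>\<^bsub>C\<^esub> q) = \<one>\<^bsub>C\<^esub> X"

definition direct_sum :: "('o, 'm, 'k, 'z) lincat_scheme \<Rightarrow> 'o \<Rightarrow> 'o \<Rightarrow> 'o \<Rightarrow> bool" where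
  "direct_sum C X A B \<longleftrightarrow> (\<exists>i j p q. is_biproduct C X A B i j p q)"

definition is_kernel :: "('o, 'm, 'k, 'z) lincat_scheme \<Rightarrow> 'm \<Rightarrow> 'm \<Rightarrow> bool" where
  "is_kernel C k f \<longleftrightarrow> k \<in> Arr C \<and> f \<in> Arr C \<and> Cod C k = Dom C f \<and>
     f \<cdot>\<^bsub>C\<^esub> k = Null C (Dom C k) (Cod C f) \<and>
     (\<forall>h \<in> Arr C. Cod C h = Dom C f \<and> f \<cdot>\<^bsub>C\<^esub> h = Null C (Dom C h) (Cod C f) \<longrightarrow>
        (\<exists>!u. u \<in> hom C (Dom C h) (Dom C k) \<and> k \<cdot>\<^bsub>C\<^esub> u = h))"

definition is_cokernel :: "('o, 'm, 'k, 'z) lincat_scheme \<Rightarrow> 'm \<Rightarrow> 'm \<Rightarrow> bool" where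
  "is_cokernel C p f \<longleftrightarrow> p \<in> Arr C \<and> f \<in> Arr C \<and> Dom C p = Cod C f \<and>
     p \<cdot>\<^bsub>C\<^esub> f = Null C (Dom C f) (Cod C p) \<and>
     (\<forall>h \<in> Arr C. Dom C h = Cod C f \<and> h \<cdot>\<^bsub>C\<^esub> f = Null C (Dom C f) (Cod C h) \<longrightarrow>
        (\<exists>!u. u \<in> hom C (Cod C p) (Cod C h) \<and> u \<cdot>\<^bsub>C\<^esub> p = h))"

definition is_mono :: "('o, 'm, 'k, 'z) lincat_scheme \<Rightarrow> 'm \<Rightarrow> bool" where
  "is_mono C f \<longleftrightarrow> f \<in> Arr C \<and>
     (\<forall>W \<in> Obj C. \<forall>g \<in> hom C W (Dom C f). \<forall>h \<in> hom C W (Dom C f).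
        f \<cdot>\<^bsub>C\<^esub> g = f \<cdot>\<^bsub>C\<^esub> h \<longrightarrow> g = h)"

definition is_epi :: "('o, 'm, 'k, 'z) lincat_scheme \<Rightarrow> 'm \<Rightarrow> bool" where
  "is_epi C f \<longleftrightarrow> f \<in> Arr C \<and>
     (\<forall>W \<in> Obj C. \<forall>g \<in> hom C (Cod C f) W. \<forall>h \<in> hom C (Cod C f) W.
        g \<cdot>\<^bsub>C\<^esub> f = h \<cdot>\<^bsub>C\<^esub> f \<longrightarrow> g = h)"

definition short_exact :: "('o, 'm, 'k, 'z) lincat_scheme \<Rightarrow> 'm \<Rightarrow> 'm \<Rightarrow> bool" where
  "short_exact C f g \<longleftrightarrow> is_kernel C f g \<and> is_cokernel C g f"

locale linear_category =
  fixes C :: "('o, 'm, 'k::field, 'z) lincat_scheme" (structure)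
  assumes dom_obj: "f \<in> Arr C \<Longrightarrow> Dom C f \<in> Obj C"
    and cod_obj: "f \<in> Arr C \<Longrightarrow> Cod C f \<in> Obj C"
    and ident_hom: "X \<in> Obj C \<Longrightarrow> \<one> X \<in> hom C X X"
    and comp_hom: "\<lbrakk>f \<in> hom C X Y; g \<in> hom C Y Z\<rbrakk> \<Longrightarrow> g \<cdot> f \<in> hom C X Z"
    and comp_assoc:
      "\<lbrakk>f \<in> hom C W X; g \<in> hom C X Y; h \<in> hom C Y Z\<rbrakk> \<Longrightarrow> (h \<cdot> g) \<cdot> f = h \<cdot> (g \<cdot> f)"
    and comp_ident_right: "f \<in> hom C X Y \<Longrightarrow> f \<cdot> \<one> X = f"
    and comp_ident_left: "f \<in> hom C X Y \<Longrightarrow> \<one> Y \<cdot> f = f"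
    and null_hom: "\<lbrakk>X \<in> Obj C; Y \<in> Obj C\<rbrakk> \<Longrightarrow> Null C X Y \<in> hom C X Y"
    and plus_hom: "\<lbrakk>f \<in> hom C X Y; g \<in> hom C X Y\<rbrakk> \<Longrightarrow> f \<oplus> g \<in> hom C X Y"
    and scale_hom: "f \<in> hom C X Y \<Longrightarrow> a \<odot> f \<in> hom C X Y"
    and plus_assoc:
      "\<lbrakk>f \<in> hom C X Y; g \<in> hom C X Y; h \<in> hom C X Y\<rbrakk> \<Longrightarrow> (f \<oplus> g) \<oplus> h = f \<oplus> (g \<oplus> h)"
    and plus_commute: "\<lbrakk>f \<in> hom C X Y; g \<in> hom C X Y\<rbrakk> \<Longrightarrow> f \<oplus> g = g \<oplus> f"
    and plus_null: "f \<in> hom C X Y \<Longrightarrow> f \<oplus> Null C X Y = f"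
    and plus_inverse: "f \<in> hom C X Y \<Longrightarrow> f \<oplus> ((- 1) \<odot> f) = Null C X Y"
    and scale_one: "f \<in> hom C X Y \<Longrightarrow> 1 \<odot> f = f"
    and scale_scale: "f \<in> hom C X Y \<Longrightarrow> a \<odot> (b \<odot> f) = (a * b) \<odot> f"
    and scale_plus_left: "f \<in> hom C X Y \<Longrightarrow> (a + b) \<odot> f = (a \<odot> f) \<oplus> (b \<odot> f)"
    and scale_plus_right:
      "\<lbrakk>f \<in> hom C X Y; g \<in> hom C X Y\<rbrakk> \<Longrightarrow> a \<odot> (f \<oplus> g) = (a \<odot> f) \<oplus> (a \<odot> g)"
    and comp_plus_left:
      "\<lbrakk>f \<in> hom C X Y; g \<in> hom C Y Z; h \<in> hom C Y Z\<rbrakk> \<Longrightarrow> (g \<oplus> h) \<cdot> f = (g \<cdot> f) \<oplus> (h \<cdot> f)"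
    and comp_plus_right:
      "\<lbrakk>f \<in> hom C X Y; g \<in> hom C X Y; h \<in> hom C Y Z\<rbrakk> \<Longrightarrow> h \<cdot> (f \<oplus> g) = (h \<cdot> f) \<oplus> (h \<cdot> g)"
    and comp_scale_left:
      "\<lbrakk>f \<in> hom C X Y; g \<in> hom C Y Z\<rbrakk> \<Longrightarrow> (a \<odot> g) \<cdot> f = a \<odot> (g \<cdot> f)"
    and comp_scale_right:
      "\<lbrakk>f \<in> hom C X Y; g \<in> hom C Y Z\<rbrakk> \<Longrightarrow> g \<cdot> (a \<odot> f) = a \<odot> (g \<cdot> f)"

locale additive_category = linear_category +
  assumes ex_zero_object: "\<exists>Z. zero_object C Z"
    and ex_direct_sum: "\<lbrakk>A \<in> Obj C; B \<in> Obj C\<rbrakk> \<Longrightarrow> \<exists>X. direct_sum C X A B"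

locale abelian_category = additive_category +
  assumes ex_kernel: "f \<in> Arr C \<Longrightarrow> \<exists>k. is_kernel C k f"
    and ex_cokernel: "f \<in> Arr C \<Longrightarrow> \<exists>p. is_cokernel C p f"
    and mono_normal: "is_mono C f \<Longrightarrow> \<exists>g. is_kernel C f g"
    and epi_normal: "is_epi C f \<Longrightarrow> \<exists>g. is_cokernel C f g"

text \<open>Connected: not the direct sum of two full subcategories which are both nonzero.\<close>

definition connected_category :: "('o, 'm, 'k, 'z) lincat_scheme \<Rightarrow> bool" where
  "connected_category C \<longleftrightarrow>
     (\<forall>A B. A \<subseteq> Obj C \<and> B \<subseteq> Obj C \<and>
        (\<forall>X \<in> A. \<forall>Y \<in> B. hom C X Y = {Null C X Y} \<and> hom C Y X = {Null C Y X}) \<and>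
        (\<forall>Z \<in> Obj C. \<exists>X \<in> A. \<exists>Y \<in> B. direct_sum C Z X Y) \<longrightarrow>
        (\<forall>X \<in> A. zero_object C X) \<or> (\<forall>Y \<in> B. zero_object C Y))"

definition local_endo :: "('o, 'm, 'k, 'z) lincat_scheme \<Rightarrow> 'o \<Rightarrow> bool" where
  "local_endo C X \<longleftrightarrow> X \<in> Obj C \<and> \<one>\<^bsub>C\<^esub> X \<noteq> Null C X X \<and>
     (\<forall>f \<in> hom C X X. \<forall>g \<in> hom C X X.
        \<not> is_iso C f \<and> \<not> is_iso C g \<longrightarrow> \<not> is_iso C (f \<oplus>\<^bsub>C\<^esub> g))"

inductive_set finite_sums :: "('o, 'm, 'k, 'z) lincat_scheme \<Rightarrow> 'o set \<Rightarrow> 'o set"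
  for C :: "('o, 'm, 'k, 'z) lincat_scheme" and P :: "'o set" where
  "zero_object C Z \<Longrightarrow> Z \<in> finite_sums C P"
| "\<lbrakk>A \<in> finite_sums C P; B \<in> P; direct_sum C X A B\<rbrakk> \<Longrightarrow> X \<in> finite_sums C P"

definition krull_schmidt :: "('o, 'm, 'k, 'z) lincat_scheme \<Rightarrow> bool" where
  "krull_schmidt C \<longleftrightarrow> Obj C \<subseteq> finite_sums C {X. local_endo C X}"

inductive_set lin_span :: "('o, 'm, 'k, 'z) lincat_scheme \<Rightarrow> 'o \<Rightarrow> 'o \<Rightarrow> 'm set \<Rightarrow> 'm set"
  for C :: "('o, 'm, 'k, 'z) lincat_scheme" and X Y :: 'o and B :: "'m set" where
  "Null C X Y \<in> lin_span C X Y B"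
| "\<lbrakk>b \<in> B; f \<in> lin_span C X Y B\<rbrakk> \<Longrightarrow> (a \<odot>\<^bsub>C\<^esub> b) \<oplus>\<^bsub>C\<^esub> f \<in> lin_span C X Y B"

definition fin_dim_hom :: "('o, 'm, 'k, 'z) lincat_scheme \<Rightarrow> 'o \<Rightarrow> 'o \<Rightarrow> bool" where
  "fin_dim_hom C X Y \<longleftrightarrow>
     (\<exists>B. finite B \<and> B \<subseteq> hom C X Y \<and> hom C X Y \<subseteq> lin_span C X Y B)"

text \<open>As usual, the subcategories are understood to be closed under isomorphisms.\<close>

definition strict_subcat :: "('o, 'm, 'k, 'z) lincat_scheme \<Rightarrow> 'o set \<Rightarrow> bool" where
  "strict_subcat C U \<longleftrightarrow> U \<subseteq> Obj C \<and>
     (\<forall>X \<in> U. \<forall>Y \<in> Obj C. isomorphic C X Y \<longrightarrow> Y \<in> U)"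

definition right_perp :: "('o, 'm, 'k, 'z) lincat_scheme \<Rightarrow> 'o set \<Rightarrow> 'o set" where
  "right_perp C U = {Y \<in> Obj C. \<forall>X \<in> U. hom C X Y = {Null C X Y}}"

definition torsion_pair :: "('o, 'm, 'k, 'z) lincat_scheme \<Rightarrow> 'o set \<times> 'o set \<Rightarrow> bool" where
  "torsion_pair C = (\<lambda>(T, F). strict_subcat C T \<and> strict_subcat C F \<and>
     (\<forall>X \<in> T. \<forall>Y \<in> F. hom C X Y = {Null C X Y}) \<and>
     (\<forall>Y \<in> Obj C. \<exists>X \<in> T. \<exists>Z \<in> F. \<exists>f \<in> hom C X Y. \<exists>g \<in> hom C Y Z. short_exact C f g))"

text \<open>
  The data of a triangulated category: \<open>Shift C n X\<close> is \<open>X[n]\<close>, and \<open>(u, v, w) \<in> Triangles C\<close> means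
  that the arrows \<open>u : X \<rightarrow> Y\<close>, \<open>v : Y \<rightarrow> Z\<close>, \<open>w : Z \<rightarrow> X[1]\<close> form a distinguished triangle.
\<close>

record ('o, 'm, 'k) tricat = "('o, 'm, 'k) lincat" +
  Shift :: "int \<Rightarrow> 'o \<Rightarrow> 'o"
  Triangles :: "('m \<times> 'm \<times> 'm) set"

definition t_structure :: "('o, 'm, 'k, 'z) tricat_scheme \<Rightarrow> 'o set \<times> 'o set \<Rightarrow> bool" where
  "t_structure C = (\<lambda>(U, V). strict_subcat C U \<and> strict_subcat C V \<and>
     (\<forall>X \<in> U. \<forall>Y \<in> Shift C (-1) ` V. hom C X Y = {Null C X Y}) \<and>
     U \<subseteq> Shift C (-1) ` U \<and> Shift C (-1) ` V \<subseteq> V \<and>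
     (\<forall>Y \<in> Obj C. \<exists>X \<in> U. \<exists>Z \<in> Shift C (-1) ` V.
        \<exists>u \<in> hom C X Y. \<exists>v \<in> hom C Y Z. \<exists>w \<in> hom C Z (Shift C 1 X). (u, v, w) \<in> Triangles C))"

record ('o, 'm) complex_data =
  ob :: "int \<Rightarrow> 'o"
  diff :: "int \<Rightarrow> 'm"

definition bounded_complexes :: "('o, 'm, 'k, 'z) lincat_scheme \<Rightarrow> ('o, 'm) complex_data set" where
  "bounded_complexes H = {X.
     (\<forall>i. ob X i \<in> Obj H \<and> diff X i \<in> hom H (ob X i) (ob X (i + 1)) \<and>
        diff X (i + 1) \<cdot>\<^bsub>H\<^esub> diff X i = Null H (ob X i) (ob X (i + 2))) \<and>
     (\<exists>a b. \<forall>i. i < a \<or> b < i \<longrightarrow> zero_object H (ob X i))}"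

record ('o, 'm) chain_map =
  src :: "('o, 'm) complex_data"
  tgt :: "('o, 'm) complex_data"
  cpt :: "int \<Rightarrow> 'm"

definition chain_maps :: "('o, 'm, 'k, 'z) lincat_scheme \<Rightarrow> ('o, 'm) chain_map set" where
  "chain_maps H = {f. src f \<in> bounded_complexes H \<and> tgt f \<in> bounded_complexes H \<and>
     (\<forall>i. cpt f i \<in> hom H (ob (src f) i) (ob (tgt f) i) \<and>
        cpt f (i + 1) \<cdot>\<^bsub>H\<^esub> diff (src f) i = diff (tgt f) i \<cdot>\<^bsub>H\<^esub> cpt f i)}"

definition Cb :: "('o, 'm, 'k, 'z) lincat_scheme \<Rightarrow>
    (('o, 'm) complex_data, ('o, 'm) chain_map, 'k) lincat" where
  "Cb H = \<lparr>
     Obj = bounded_complexes H,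
     Arr = chain_maps H,
     Dom = src,
     Cod = tgt,
     Ident = (\<lambda>X. \<lparr>src = X, tgt = X, cpt = (\<lambda>i. \<one>\<^bsub>H\<^esub> (ob X i))\<rparr>),
     Comp = (\<lambda>g f. \<lparr>src = src f, tgt = tgt g, cpt = (\<lambda>i. cpt g i \<cdot>\<^bsub>H\<^esub> cpt f i)\<rparr>),
     Null = (\<lambda>X Y. \<lparr>src = X, tgt = Y, cpt = (\<lambda>i. Null H (ob X i) (ob Y i))\<rparr>),
     Plus = (\<lambda>f g. \<lparr>src = src f, tgt = tgt f, cpt = (\<lambda>i. cpt f i \<oplus>\<^bsub>H\<^esub> cpt g i)\<rparr>),
     Scale = (\<lambda>a f. \<lparr>src = src f, tgt = tgt f, cpt = (\<lambda>i. a \<odot>\<^bsub>H\<^esub> cpt f i)\<rparr>)\<rparr>"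

definition null_homotopic :: "('o, 'm, 'k, 'z) lincat_scheme \<Rightarrow> ('o, 'm) chain_map set" where
  "null_homotopic H = {f \<in> chain_maps H. \<exists>h. \<forall>i.
     h i \<in> hom H (ob (src f) i) (ob (tgt f) (i - 1)) \<and>
     cpt f i = (diff (tgt f) (i - 1) \<cdot>\<^bsub>H\<^esub> h i) \<oplus>\<^bsub>H\<^esub> (h (i + 1) \<cdot>\<^bsub>H\<^esub> diff (src f) i)}"

definition shift_complex ::
    "('o, 'm, 'k::field, 'z) lincat_scheme \<Rightarrow> int \<Rightarrow> ('o, 'm) complex_data \<Rightarrow> ('o, 'm) complex_data"
  where
  "shift_complex H n X =
     \<lparr>ob = (\<lambda>i. ob X (i + n)), diff = (\<lambda>i. ((- 1) powi n) \<odot>\<^bsub>H\<^esub> diff X (i + n))\<rparr>"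

definition shift_chain_map ::
    "('o, 'm, 'k::field, 'z) lincat_scheme \<Rightarrow> int \<Rightarrow> ('o, 'm) chain_map \<Rightarrow> ('o, 'm) chain_map" where
  "shift_chain_map H n f =
     \<lparr>src = shift_complex H n (src f), tgt = shift_complex H n (tgt f), cpt = (\<lambda>i. cpt f (i + n))\<rparr>"

text \<open>The complex concentrated in degree \<open>0\<close> (with a chosen zero object in the other degrees).\<close>

definition stalk :: "('o, 'm, 'k, 'z) lincat_scheme \<Rightarrow> 'o \<Rightarrow> ('o, 'm) complex_data" where
  "stalk H X = (let E = (\<lambda>i::int. if i = 0 then X else (SOME Z. zero_object H Z))
     in \<lparr>ob = E, diff = (\<lambda>i. Null H (E i) (E (i + 1)))\<rparr>)"

text \<open>
  The cohomology of \<open>X\<close> in degree \<open>i\<close> is the cokernel \<open>p\<close> of the arrow \<open>X\<^sup>i\<^sup>-\<^sup>1 \<rightarrow> Ker d\<^sup>i\<close> induced by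
  \<open>d\<^sup>i\<^sup>-\<^sup>1\<close>, where \<open>k : Ker d\<^sup>i \<rightarrow> X\<^sup>i\<close> is a kernel of \<open>d\<^sup>i\<close>.  It is well defined up to unique
  isomorphism only; \<open>cohom_choice\<close> fixes one such pair \<open>(k, p)\<close>.
\<close>

definition cohom_data ::
    "('o, 'm, 'k, 'z) lincat_scheme \<Rightarrow> ('o, 'm) complex_data \<Rightarrow> int \<Rightarrow> 'm \<times> 'm \<Rightarrow> bool" where
  "cohom_data H X i = (\<lambda>(k, p). is_kernel H k (diff X i) \<and>
     (\<exists>j \<in> hom H (ob X (i - 1)) (Dom H k). k \<cdot>\<^bsub>H\<^esub> j = diff X (i - 1) \<and> is_cokernel H p j))"

definition cohom_choice ::
    "('o, 'm, 'k, 'z) lincat_scheme \<Rightarrow> ('o, 'm) complex_data \<Rightarrow> int \<Rightarrow> 'm \<times> 'm" where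
  "cohom_choice H X i = (SOME kp. cohom_data H X i kp)"

definition cohom :: "('o, 'm, 'k, 'z) lincat_scheme \<Rightarrow> int \<Rightarrow> ('o, 'm) complex_data \<Rightarrow> 'o" where
  "cohom H i X = Cod H (snd (cohom_choice H X i))"

definition cohom_map :: "('o, 'm, 'k, 'z) lincat_scheme \<Rightarrow> int \<Rightarrow> ('o, 'm) chain_map \<Rightarrow> 'm" where
  "cohom_map H i f =
     (let (k, p) = cohom_choice H (src f) i; (k', p') = cohom_choice H (tgt f) i
      in THE h. h \<in> hom H (cohom H i (src f)) (cohom H i (tgt f)) \<and>
           (\<exists>u \<in> hom H (Dom H k) (Dom H k').
              k' \<cdot>\<^bsub>H\<^esub> u = cpt f i \<cdot>\<^bsub>H\<^esub> k \<and> h \<cdot>\<^bsub>H\<^esub> p = p' \<cdot>\<^bsub>H\<^esub> u))"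

definition quasi_isos :: "('o, 'm, 'k, 'z) lincat_scheme \<Rightarrow> ('o, 'm) chain_map set" where
  "quasi_isos H = {f \<in> chain_maps H. \<forall>i. is_iso H (cohom_map H i f)}"

text \<open>
  The triangle \<open>X \<rightarrow> Y \<rightarrow> C \<rightarrow> X[1]\<close> of a mapping cone \<open>C\<close> of \<open>f : X \<rightarrow> Y\<close>, with arrows \<open>f\<close>, \<open>\<iota>\<close>, \<open>\<pi>\<close>:
  in each degree \<open>C\<^sup>i = X\<^sup>i\<^sup>+\<^sup>1 \<oplus> Y\<^sup>i\<close>, with differential \<open>(x, y) \<mapsto> (- d x, f x + d y)\<close>.
\<close>

definition cone_triangle ::
    "('o, 'm, 'k::field, 'z) lincat_scheme \<Rightarrow>
       ('o, 'm) chain_map \<Rightarrow> ('o, 'm) chain_map \<Rightarrow> ('o, 'm) chain_map \<Rightarrow> bool" where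
  "cone_triangle H f \<iota> \<pi> \<longleftrightarrow>
     f \<in> chain_maps H \<and> \<iota> \<in> chain_maps H \<and> \<pi> \<in> chain_maps H \<and>
     src \<iota> = tgt f \<and> src \<pi> = tgt \<iota> \<and> tgt \<pi> = shift_complex H 1 (src f) \<and>
     (\<exists>\<kappa> \<rho>. \<forall>i.
        is_biproduct H (ob (tgt \<iota>) i) (ob (src f) (i + 1)) (ob (tgt f) i)
          (\<kappa> i) (cpt \<iota> i) (cpt \<pi> i) (\<rho> i) \<and>
        diff (tgt \<iota>) i =
          (\<kappa> (i + 1) \<cdot>\<^bsub>H\<^esub> ((- 1) \<odot>\<^bsub>H\<^esub> diff (src f) (i + 1)) \<cdot>\<^bsub>H\<^esub> cpt \<pi> i)
          \<oplus>\<^bsub>H\<^esub> (cpt \<iota> (i + 1) \<cdot>\<^bsub>H\<^esub> cpt f (i + 1) \<cdot>\<^bsub>H\<^esub> cpt \<pi> i)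
          \<oplus>\<^bsub>H\<^esub> (cpt \<iota> (i + 1) \<cdot>\<^bsub>H\<^esub> diff (tgt f) i \<cdot>\<^bsub>H\<^esub> \<rho> i))"

text \<open>The quotient of a linear category by an ideal \<open>I\<close>; its arrows are the cosets modulo \<open>I\<close>.\<close>

definition coset :: "('o, 'm, 'k, 'z) lincat_scheme \<Rightarrow> 'm set \<Rightarrow> 'm \<Rightarrow> 'm set" where
  "coset C I f = {f \<oplus>\<^bsub>C\<^esub> n | n. n \<in> I \<inter> hom C (Dom C f) (Cod C f)}"

definition some_rep :: "'a set \<Rightarrow> 'a" where
  "some_rep A = (SOME a. a \<in> A)"

definition quotient_cat ::
    "('o, 'm, 'k, 'z) lincat_scheme \<Rightarrow> 'm set \<Rightarrow> ('o, 'm set, 'k) lincat" where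
  "quotient_cat C I = \<lparr>
     Obj = Obj C,
     Arr = coset C I ` Arr C,
     Dom = (\<lambda>F. Dom C (some_rep F)),
     Cod = (\<lambda>F. Cod C (some_rep F)),
     Ident = (\<lambda>X. coset C I (\<one>\<^bsub>C\<^esub> X)),
     Comp = (\<lambda>G F. coset C I (some_rep G \<cdot>\<^bsub>C\<^esub> some_rep F)),
     Null = (\<lambda>X Y. coset C I (Null C X Y)),
     Plus = (\<lambda>F G. coset C I (some_rep F \<oplus>\<^bsub>C\<^esub> some_rep G)),
     Scale = (\<lambda>a F. coset C I (a \<odot>\<^bsub>C\<^esub> some_rep F))\<rparr>"

definition Kb :: "('o, 'm, 'k, 'z) lincat_scheme \<Rightarrow>
    (('o, 'm) complex_data, ('o, 'm) chain_map set, 'k) lincat" where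
  "Kb H = quotient_cat (Cb H) (null_homotopic H)"

definition Kb_class ::
    "('o, 'm, 'k, 'z) lincat_scheme \<Rightarrow> ('o, 'm) chain_map \<Rightarrow> ('o, 'm) chain_map set" where
  "Kb_class H f = coset (Cb H) (null_homotopic H) f"

text \<open>
  Localisation of \<open>C\<close> at a class \<open>S\<close> of arrows admitting a calculus of fractions.  An arrow
  \<open>X \<rightarrow> Y\<close> is an equivalence class of roofs \<open>(s, f)\<close>, \<open>X \<leftarrow> Z \<rightarrow> Y\<close> with \<open>s \<in> S\<close>, standing for \<open>f s\<^sup>-\<^sup>1\<close>.
  Roofs are composed by completing \<open>Z \<rightarrow> Y \<leftarrow> W\<close> to a commutative square with an arrow
  of \<open>S\<close> opposite to \<open>W \<rightarrow> Y\<close>, and added after passing to a common denominator.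
\<close>

definition roofs :: "('o, 'm, 'k, 'z) lincat_scheme \<Rightarrow> 'm set \<Rightarrow> ('m \<times> 'm) set" where
  "roofs C S = {(s, f). s \<in> S \<inter> Arr C \<and> f \<in> Arr C \<and> Dom C s = Dom C f}"

definition roof_eq ::
    "('o, 'm, 'k, 'z) lincat_scheme \<Rightarrow> 'm set \<Rightarrow> 'm \<times> 'm \<Rightarrow> 'm \<times> 'm \<Rightarrow> bool" where
  "roof_eq C S = (\<lambda>(s, f) (s', f'). Cod C s = Cod C s' \<and> Cod C f = Cod C f' \<and>
     (\<exists>u \<in> Arr C. \<exists>v \<in> Arr C. Dom C u = Dom C v \<and> Cod C u = Dom C s \<and> Cod C v = Dom C s' \<and>
        s \<cdot>\<^bsub>C\<^esub> u \<in> S \<and> s \<cdot>\<^bsub>C\<^esub> u = s' \<cdot>\<^bsub>C\<^esub> v \<and> f \<cdot>\<^bsub>C\<^esub> u = f' \<cdot>\<^bsub>C\<^esub> v))"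

definition frac :: "('o, 'm, 'k, 'z) lincat_scheme \<Rightarrow> 'm set \<Rightarrow> 'm \<Rightarrow> 'm \<Rightarrow> ('m \<times> 'm) set" where
  "frac C S s f = {r \<in> roofs C S. roof_eq C S (s, f) r}"

definition frac_comp ::
    "('o, 'm, 'k, 'z) lincat_scheme \<Rightarrow> 'm set \<Rightarrow>
       ('m \<times> 'm) set \<Rightarrow> ('m \<times> 'm) set \<Rightarrow> ('m \<times> 'm) set" where
  "frac_comp C S G F = (THE E. \<exists>s f t g s' f'.
     (s, f) \<in> F \<and> (t, g) \<in> G \<and> s' \<in> S \<inter> Arr C \<and> f' \<in> Arr C \<and>
     Dom C s' = Dom C f' \<and> Cod C s' = Dom C f \<and> Cod C f' = Dom C t \<and>
     f \<cdot>\<^bsub>C\<^esub> s' = t \<cdot>\<^bsub>C\<^esub> f' \<and> E = frac C S (s \<cdot>\<^bsub>C\<^esub> s') (g \<cdot>\<^bsub>C\<^esub> f'))"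

definition frac_plus ::
    "('o, 'm, 'k, 'z) lincat_scheme \<Rightarrow> 'm set \<Rightarrow>
       ('m \<times> 'm) set \<Rightarrow> ('m \<times> 'm) set \<Rightarrow> ('m \<times> 'm) set" where
  "frac_plus C S F G = (THE E. \<exists>s f g.
     (s, f) \<in> F \<and> (s, g) \<in> G \<and> E = frac C S s (f \<oplus>\<^bsub>C\<^esub> g))"

definition frac_scale ::
    "('o, 'm, 'k, 'z) lincat_scheme \<Rightarrow> 'm set \<Rightarrow> 'k \<Rightarrow> ('m \<times> 'm) set \<Rightarrow> ('m \<times> 'm) set" where
  "frac_scale C S a F = (THE E. \<exists>s f. (s, f) \<in> F \<and> E = frac C S s (a \<odot>\<^bsub>C\<^esub> f))"

definition localisation ::
    "('o, 'm, 'k, 'z) lincat_scheme \<Rightarrow> 'm set \<Rightarrow> ('o, ('m \<times> 'm) set, 'k) lincat" where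
  "localisation C S = \<lparr>
     Obj = Obj C,
     Arr = {frac C S s f | s f. (s, f) \<in> roofs C S},
     Dom = (\<lambda>F. Cod C (fst (some_rep F))),
     Cod = (\<lambda>F. Cod C (snd (some_rep F))),
     Ident = (\<lambda>X. frac C S (\<one>\<^bsub>C\<^esub> X) (\<one>\<^bsub>C\<^esub> X)),
     Comp = frac_comp C S,
     Null = (\<lambda>X Y. frac C S (\<one>\<^bsub>C\<^esub> X) (Null C X Y)),
     Plus = frac_plus C S,
     Scale = frac_scale C S\<rparr>"

type_synonym ('o, 'm) Db_arrow = "(('o, 'm) chain_map set \<times> ('o, 'm) chain_map set) set"

definition Kb_quasi_isos :: "('o, 'm, 'k, 'z) lincat_scheme \<Rightarrow> ('o, 'm) chain_map set set" where
  "Kb_quasi_isos H = Kb_class H ` quasi_isos H"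

definition Db_lin :: "('o, 'm, 'k, 'z) lincat_scheme \<Rightarrow>
    (('o, 'm) complex_data, ('o, 'm) Db_arrow, 'k) lincat" where
  "Db_lin H = localisation (Kb H) (Kb_quasi_isos H)"

definition Db_class ::
    "('o, 'm, 'k, 'z) lincat_scheme \<Rightarrow> ('o, 'm) chain_map \<Rightarrow> ('o, 'm) Db_arrow" where
  "Db_class H f = frac (Kb H) (Kb_quasi_isos H) (Kb_class H (\<one>\<^bsub>Cb H\<^esub> (src f))) (Kb_class H f)"

definition Db_shift_arrow ::
    "('o, 'm, 'k::field, 'z) lincat_scheme \<Rightarrow> int \<Rightarrow> ('o, 'm) Db_arrow \<Rightarrow> ('o, 'm) Db_arrow" where
  "Db_shift_arrow H n F = (\<lambda>(s, f). (shift_chain_map H n ` s, shift_chain_map H n ` f)) ` F"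

text \<open>Distinguished triangles: those isomorphic in the derived category to a mapping cone triangle.\<close>

definition Db_triangles ::
    "('o, 'm, 'k::field, 'z) lincat_scheme \<Rightarrow>
       (('o, 'm) Db_arrow \<times> ('o, 'm) Db_arrow \<times> ('o, 'm) Db_arrow) set" where
  "Db_triangles H = (let D = Db_lin H in {(u, v, w).
     u \<in> Arr D \<and> v \<in> Arr D \<and> w \<in> Arr D \<and>
     Cod D u = Dom D v \<and> Cod D v = Dom D w \<and> Cod D w = shift_complex H 1 (Dom D u) \<and>
     (\<exists>f \<iota> \<pi>. cone_triangle H f \<iota> \<pi> \<and>
        (\<exists>a b c.
           a \<in> hom D (Dom D u) (src f) \<and> b \<in> hom D (Dom D v) (tgt f) \<and>
           c \<in> hom D (Dom D w) (tgt \<iota>) \<and> is_iso D a \<and> is_iso D b \<and> is_iso D c \<and>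
           b \<cdot>\<^bsub>D\<^esub> u = Db_class H f \<cdot>\<^bsub>D\<^esub> a \<and>
           c \<cdot>\<^bsub>D\<^esub> v = Db_class H \<iota> \<cdot>\<^bsub>D\<^esub> b \<and>
           Db_shift_arrow H 1 a \<cdot>\<^bsub>D\<^esub> w = Db_class H \<pi> \<cdot>\<^bsub>D\<^esub> c))})"

definition Db :: "('o, 'm, 'k::field, 'z) lincat_scheme \<Rightarrow>
    (('o, 'm) complex_data, ('o, 'm) Db_arrow, 'k) tricat" where
  "Db H = lincat.extend (Db_lin H)
     \<lparr>Shift = shift_complex H, Triangles = Db_triangles H\<rparr>"

text \<open>\<open>Ext\<^sup>n(X, Y)\<close> is the space \<open>Hom(X, Y[n])\<close> of the derived category.\<close>

locale hereditary_category = abelian_category H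
  for H :: "('o, 'm, 'k::alg_closed_field, 'z) lincat_scheme" (structure) +
  assumes krull_schmidt: "krull_schmidt H"
    and connected: "connected_category H"
    and fin_dim_Hom: "\<lbrakk>X \<in> Obj H; Y \<in> Obj H\<rbrakk> \<Longrightarrow> fin_dim_hom H X Y"
    and fin_dim_Ext1: "\<lbrakk>X \<in> Obj H; Y \<in> Obj H\<rbrakk> \<Longrightarrow>
      fin_dim_hom (Db H) (stalk H X) (Shift (Db H) 1 (stalk H Y))"
    and Ext2_zero: "\<lbrakk>X \<in> Obj H; Y \<in> Obj H\<rbrakk> \<Longrightarrow>
      hom (Db H) (stalk H X) (Shift (Db H) 2 (stalk H Y))
        = {Null (Db H) (stalk H X) (Shift (Db H) 2 (stalk H Y))}"

definition lift_aisle :: "('o, 'm, 'k::field, 'z) lincat_scheme \<Rightarrow> 'o set \<Rightarrow> ('o, 'm) complex_data set"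
  where
  "lift_aisle H T = {X \<in> Obj (Db H). (\<forall>i > 0. zero_object H (cohom H i X)) \<and> cohom H 0 X \<in> T}"

definition lift_map ::
    "('o, 'm, 'k::field, 'z) lincat_scheme \<Rightarrow> 'o set \<times> 'o set \<Rightarrow>
       ('o, 'm) complex_data set \<times> ('o, 'm) complex_data set" where
  "lift_map H = (\<lambda>(T, F).
     (lift_aisle H T, Shift (Db H) 1 ` right_perp (Db H) (lift_aisle H T)))"

definition trace_map ::
    "('o, 'm, 'k::field, 'z) lincat_scheme \<Rightarrow>
       ('o, 'm) complex_data set \<times> ('o, 'm) complex_data set \<Rightarrow> 'o set \<times> 'o set" where
  "trace_map H = (\<lambda>(U, V).
     ({X \<in> Obj H. stalk H X \<in> U}, {X \<in> Obj H. stalk H X \<in> right_perp (Db H) U}))"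

definition torsion_pairs :: "('o, 'm, 'k, 'z) lincat_scheme \<Rightarrow> ('o set \<times> 'o set) set" where
  "torsion_pairs H = {(T, F). torsion_pair H (T, F)}"

definition intermediate_t_structures ::
    "('o, 'm, 'k::field, 'z) lincat_scheme \<Rightarrow>
       (('o, 'm) complex_data set \<times> ('o, 'm) complex_data set) set" where
  "intermediate_t_structures H = {(U, V). t_structure (Db H) (U, V) \<and>
     V = Shift (Db H) 1 ` right_perp (Db H) U \<and>
     (\<forall>X \<in> Obj H. Shift (Db H) 1 (stalk H X) \<in> U) \<and>
     (\<forall>X \<in> Obj H. Shift (Db H) (-1) (stalk H X) \<in> right_perp (Db H) U)}"

end

theory Submission
  imports Defs
begin

text \<open>
  For a torsion pair one truncates a complex \<open>Y\<close> at the torsion part of its zeroth cohomology; the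
  cone of the inclusion of this subcomplex has cohomology in degrees \<open>\<ge> 0\<close> with a torsion-free part
  in degree \<open>0\<close>, and there are no nonzero maps to it from the aisle.  Conversely, if \<open>U\<close> contains
  \<open>H[1]\<close> and \<open>U\<^sup>\<bottom>\<close> contains \<open>H[-1]\<close>, then orthogonality and the truncation triangles force \<open>U\<close> to have
  cohomology in degrees \<open>\<le> 0\<close> and \<open>U\<^sup>\<bottom>\<close> in degrees \<open>\<ge> 0\<close>, and membership in \<open>U\<close> depends on \<open>H\<^sup>0\<close> only.
  The long exact sequence of the triangle that decomposes an object of \<open>H\<close> then reduces
  to a short exact sequence with the terms required of a torsion pair.

  Diagram chases use generalised elements \<open>W \<rightarrow> A\<close>, which may be lifted along an epimorphism after an
  epimorphic change of \<open>W\<close>.  Arrows of the derived category are handled as roofs of chain maps.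
\<close>

section \<open>Generalised elements\<close>

text \<open>The derived category is given by explicit sets: cosets of chain maps, then classes of
  roofs, with composition, domains and cohomology fixed by choice operators. These choices have to
  be shown harmless first, and this shapes the proof. Apart from its triangles, the derived category
  then enters through two questions only: when two objects are isomorphic, and when all arrows
  between two objects vanish. Both are answered by chain maps (\<open>Db_isomorphic_iff\<close>,
  \<open>Db_null_iff\<close>). The long exact Hom sequences of a triangle are replaced by five
  statements, \<open>hvanish_cone_source\<close> and its relatives, each of which derives the
  vanishing of one term from that of its two neighbours.

  A bounded complex is built from its cohomology objects by finitely many cones, one degree at a
  time. The conditions on H[1] and H[-1] thereby decide the fate of all complexes with cohomology in
  degrees at most -1, or at least 1. Only degree 0 remains free, and there the torsion pair
  lives.\<close>

text \<open>
  Hom-sets are mere carrier sets.  To compute in a type of class \<open>ab_group_add\<close>, let an element of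
  \<open>gelt\<close> select an arrow from every hom-set of every linear category; the arrow \<open>f\<close> embeds as the
  family \<open>emb f\<close> which is zero elsewhere.
\<close>

definition homs_ok :: "('o, 'm, 'k::field, 'z) lincat_scheme \<Rightarrow> 'o \<Rightarrow> 'o \<Rightarrow> bool" where
  "homs_ok C X Y \<longleftrightarrow> linear_category C \<and> X \<in> Obj C \<and> Y \<in> Obj C"

typedef (overloaded) ('o, 'm, 'k::field, 'z) gelt =
  "{s :: ('o, 'm, 'k, 'z) lincat_scheme \<Rightarrow> 'o \<Rightarrow> 'o \<Rightarrow> 'm.
     \<forall>C X Y. if homs_ok C X Y then s C X Y \<in> hom C X Y else s C X Y = undefined}"
  morphisms comp_at Abs_gelt
proof (intro exI CollectI allI)
  fix C :: "('o, 'm, 'k, 'z) lincat_scheme" and X Y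
  let ?s = "\<lambda>(C :: ('o, 'm, 'k, 'z) lincat_scheme) X Y. if homs_ok C X Y then Null C X Y else undefined"
  show "if homs_ok C X Y then ?s C X Y \<in> hom C X Y else ?s C X Y = undefined"
    by (auto simp: homs_ok_def linear_category.null_hom)
qed

text \<open>The family has the category as an argument because a type definition cannot mention the
  locale parameter \<open>C\<close>. Off the valid hom-sets its value is pinned to
  \<open>undefined\<close>, so that two families are equal once they agree on valid
  hom-sets.\<close>

definition mk_gelt :: "(('o, 'm, 'k::field, 'z) lincat_scheme \<Rightarrow> 'o \<Rightarrow> 'o \<Rightarrow> 'm) \<Rightarrow> ('o, 'm, 'k, 'z) gelt"
  where "mk_gelt s = Abs_gelt (\<lambda>C X Y. if homs_ok C X Y then s C X Y else undefined)"

lemma comp_at_hom: "homs_ok C X Y \<Longrightarrow> comp_at x C X Y \<in> hom C X Y"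
  using comp_at[of x] by (auto split: if_splits)

lemma comp_at_mk:
  assumes "\<And>C X Y. homs_ok C X Y \<Longrightarrow> s C X Y \<in> hom C X Y" "homs_ok C X Y"
  shows "comp_at (mk_gelt s) C X Y = s C X Y"
  using assms by (simp add: mk_gelt_def Abs_gelt_inverse)

lemma gelt_eqI:
  assumes "\<And>C X Y. homs_ok C X Y \<Longrightarrow> comp_at x C X Y = comp_at y C X Y"
  shows "x = y"
proof -
  have "comp_at x C X Y = comp_at y C X Y" for C X Y
    using assms[of C X Y] comp_at[of x] comp_at[of y] by (cases "homs_ok C X Y") auto
  then have "comp_at x = comp_at y" by (intro ext)
  then show ?thesis by (simp add: comp_at_inject)
qed

section \<open>Abelian group structure on families of arrows\<close>

instantiation gelt :: (type, type, field, type) ab_group_add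
begin

definition "0 = mk_gelt (\<lambda>C X Y. Null C X Y)"
definition "x + y = mk_gelt (\<lambda>C X Y. Plus C (comp_at x C X Y) (comp_at y C X Y))"
definition "- x = mk_gelt (\<lambda>C X Y. Scale C (- 1) (comp_at x C X Y))"
definition "x - (y :: ('a, 'b, 'c, 'd) gelt) = x + - y"

lemma comp_at_zero [simp]: "homs_ok C X Y \<Longrightarrow> comp_at 0 C X Y = Null C X Y"
  unfolding zero_gelt_def by (rule comp_at_mk) (auto simp: homs_ok_def linear_category.null_hom)

lemma comp_at_plus [simp]:
  "homs_ok C X Y \<Longrightarrow> comp_at (x + y) C X Y = Plus C (comp_at x C X Y) (comp_at y C X Y)"
  unfolding plus_gelt_def
  by (rule comp_at_mk) (auto intro!: linear_category.plus_hom comp_at_hom simp: homs_ok_def)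

lemma comp_at_uminus [simp]:
  "homs_ok C X Y \<Longrightarrow> comp_at (- x) C X Y = Scale C (- 1) (comp_at x C X Y)"
  unfolding uminus_gelt_def
  by (rule comp_at_mk) (auto intro!: linear_category.scale_hom comp_at_hom simp: homs_ok_def)

instance
proof
  fix a b c :: "('a, 'b, 'c, 'd) gelt"
  show "a + b + c = a + (b + c)"
  proof (rule gelt_eqI)
    fix C :: "('a, 'b, 'c, 'd) lincat_scheme" and X Y
    assume ok: "homs_ok C X Y"
    then interpret linear_category C by (simp add: homs_ok_def)
    from ok show "comp_at (a + b + c) C X Y = comp_at (a + (b + c)) C X Y"
      using plus_assoc[OF comp_at_hom[OF ok] comp_at_hom[OF ok] comp_at_hom[OF ok]] by simp
  qed
  show "a + b = b + a"
  proof (rule gelt_eqI)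
    fix C :: "('a, 'b, 'c, 'd) lincat_scheme" and X Y
    assume ok: "homs_ok C X Y"
    then interpret linear_category C by (simp add: homs_ok_def)
    from ok show "comp_at (a + b) C X Y = comp_at (b + a) C X Y"
      using plus_commute[OF comp_at_hom[OF ok] comp_at_hom[OF ok]] by simp
  qed
  show "0 + a = a"
  proof (rule gelt_eqI)
    fix C :: "('a, 'b, 'c, 'd) lincat_scheme" and X Y
    assume ok: "homs_ok C X Y"
    then interpret linear_category C by (simp add: homs_ok_def)
    from ok show "comp_at (0 + a) C X Y = comp_at a C X Y"
      using plus_null[OF comp_at_hom[OF ok]] plus_commute[OF comp_at_hom[OF ok] null_hom]
      by (auto simp: homs_ok_def)
  qed
  show "- a + a = 0"
  proof (rule gelt_eqI)
    fix C :: "('a, 'b, 'c, 'd) lincat_scheme" and X Y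
    assume ok: "homs_ok C X Y"
    then interpret linear_category C by (simp add: homs_ok_def)
    from ok show "comp_at (- a + a) C X Y = comp_at 0 C X Y"
      using plus_inverse[OF comp_at_hom[OF ok]]
        plus_commute[OF comp_at_hom[OF ok] scale_hom[OF comp_at_hom[OF ok]]]
      by simp
  qed
  show "a - b = a + - b" by (rule minus_gelt_def)
qed

end

section \<open>Action of arrows on elements from both sides\<close>

context linear_category
begin

text \<open>Post-composition with \<open>f\<close> as an operator on families; \<open>ract\<close>
  is pre-composition, that is, change of the test object. Both return zero wherever the composite
  makes no sense. They are therefore additive without any typing hypothesis, and sums can be
  expanded freely by simplification.\<close>

definition lact :: "'m \<Rightarrow> ('o, 'm, 'k, 'z) gelt \<Rightarrow> ('o, 'm, 'k, 'z) gelt" (infixr "\<rhd>" 75) where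
  "f \<rhd> x = mk_gelt (\<lambda>D W Y. if D = C \<and> f \<in> Arr C \<and> Y = Cod C f
     then f \<cdot> comp_at x C W (Dom C f) else Null D W Y)"

definition ract :: "('o, 'm, 'k, 'z) gelt \<Rightarrow> 'm \<Rightarrow> ('o, 'm, 'k, 'z) gelt" (infixl "\<lhd>" 80) where
  "x \<lhd> e = mk_gelt (\<lambda>D W Y. if D = C \<and> e \<in> Arr C \<and> W = Dom C e
     then comp_at x C (Cod C e) Y \<cdot> e else Null D W Y)"

definition emb :: "'m \<Rightarrow> ('o, 'm, 'k, 'z) gelt" where
  "emb f = mk_gelt (\<lambda>D W Y. if D = C \<and> f \<in> Arr C \<and> W = Dom C f \<and> Y = Cod C f
     then f else Null D W Y)"

definition El :: "'o \<Rightarrow> 'o \<Rightarrow> ('o, 'm, 'k, 'z) gelt set" where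
  "El W A = emb ` hom C W A"

lemma homD: assumes "f \<in> hom C X Y" shows "f \<in> Arr C" "Dom C f = X" "Cod C f = Y" "X \<in> Obj C" "Y \<in> Obj C"
  using assms dom_obj cod_obj by (auto simp: hom_def)

lemma arr_hom: "f \<in> Arr C \<Longrightarrow> f \<in> hom C (Dom C f) (Cod C f)"
  by (simp add: hom_def)

lemma arr_comp [simp]:
  assumes "f \<in> Arr C" "g \<in> Arr C" "Cod C f = Dom C g"
  shows "g \<cdot> f \<in> Arr C" "Dom C (g \<cdot> f) = Dom C f" "Cod C (g \<cdot> f) = Cod C g"
  using comp_hom[of f "Dom C f" "Dom C g" g "Cod C g"] assms by (auto simp: hom_def)

lemma arr_plus [simp]:
  assumes "f \<in> Arr C" "g \<in> Arr C" "Dom C f = Dom C g" "Cod C f = Cod C g"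
  shows "f \<oplus> g \<in> Arr C" "Dom C (f \<oplus> g) = Dom C g" "Cod C (f \<oplus> g) = Cod C g"
  using plus_hom[of f "Dom C g" "Cod C g" g] assms by (auto simp: hom_def)

lemma arr_scale [simp]:
  assumes "f \<in> Arr C"
  shows "a \<odot> f \<in> Arr C" "Dom C (a \<odot> f) = Dom C f" "Cod C (a \<odot> f) = Cod C f"
  using scale_hom[of f "Dom C f" "Cod C f" a] assms by (auto simp: hom_def)

lemma arr_null [simp]:
  assumes "X \<in> Obj C" "Y \<in> Obj C"
  shows "Null C X Y \<in> Arr C" "Dom C (Null C X Y) = X" "Cod C (Null C X Y) = Y"
  using null_hom[OF assms] by (auto simp: hom_def)

lemma arr_ident [simp]:
  assumes "X \<in> Obj C"
  shows "\<one> X \<in> Arr C" "Dom C (\<one> X) = X" "Cod C (\<one> X) = X"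
  using ident_hom[OF assms] by (auto simp: hom_def)

text \<open>The axioms of a linear category do not mention composites or multiples of
  \<open>Null\<close>. Bilinearity shows that such an arrow equals its own double, and subtracting
  it once gives zero.\<close>

lemma hom_add_cancel:
  assumes "f \<in> hom C X Y" "f \<oplus> f = f"
  shows "f = Null C X Y"
proof -
  have s: "(- 1) \<odot> f \<in> hom C X Y" using scale_hom assms(1) .
  have "f \<oplus> (f \<oplus> (- 1) \<odot> f) = f \<oplus> (- 1) \<odot> f"
    using plus_assoc[OF assms(1) assms(1) s] assms(2) by simp
  then show ?thesis using plus_inverse[OF assms(1)] plus_null[OF assms(1)] by simp
qed

lemma comp_null_right:
  assumes "g \<in> hom C Y Z" "X \<in> Obj C"
  shows "g \<cdot> Null C X Y = Null C X Z"
proof (rule hom_add_cancel)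
  have Y: "Y \<in> Obj C" using homD(4)[OF assms(1)] .
  have n: "Null C X Y \<in> hom C X Y" using null_hom assms(2) Y .
  show "g \<cdot> Null C X Y \<in> hom C X Z" using comp_hom n assms(1) .
  show "g \<cdot> Null C X Y \<oplus> g \<cdot> Null C X Y = g \<cdot> Null C X Y"
    using comp_plus_right[OF n n assms(1)] plus_null[OF n] by simp
qed

lemma comp_null_left:
  assumes "f \<in> hom C X Y" "Z \<in> Obj C"
  shows "Null C Y Z \<cdot> f = Null C X Z"
proof (rule hom_add_cancel)
  have Y: "Y \<in> Obj C" using homD(5)[OF assms(1)] .
  have n: "Null C Y Z \<in> hom C Y Z" using null_hom assms(2) Y by blast
  show "Null C Y Z \<cdot> f \<in> hom C X Z" using comp_hom assms(1) n .
  show "Null C Y Z \<cdot> f \<oplus> Null C Y Z \<cdot> f = Null C Y Z \<cdot> f"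
    using comp_plus_left[OF assms(1) n n] plus_null[OF n] by simp
qed

lemma scale_null:
  assumes "X \<in> Obj C" "Y \<in> Obj C" shows "a \<odot> Null C X Y = Null C X Y"
proof (rule hom_add_cancel)
  have n: "Null C X Y \<in> hom C X Y" using null_hom assms .
  show "a \<odot> Null C X Y \<in> hom C X Y" using scale_hom n .
  show "a \<odot> Null C X Y \<oplus> a \<odot> Null C X Y = a \<odot> Null C X Y"
    using scale_plus_right[OF n n] plus_null[OF n] by simp
qed

lemma self_ok: "homs_ok C X Y \<longleftrightarrow> X \<in> Obj C \<and> Y \<in> Obj C"
  using linear_category_axioms by (simp add: homs_ok_def)

lemma comp_at_self: "X \<in> Obj C \<Longrightarrow> Y \<in> Obj C \<Longrightarrow> comp_at x C X Y \<in> hom C X Y"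
  by (simp add: comp_at_hom self_ok)

lemma ok_null: "homs_ok D X Y \<Longrightarrow> Null D X Y \<in> hom D X Y"
  by (simp add: homs_ok_def linear_category.null_hom)

lemma ok_null_plus: "homs_ok D X Y \<Longrightarrow> Plus D (Null D X Y) (Null D X Y) = Null D X Y"
  by (simp add: homs_ok_def linear_category.null_hom linear_category.plus_null)

lemma ok_scale_null: "homs_ok D X Y \<Longrightarrow> Scale D a (Null D X Y) = Null D X Y"
  by (simp add: homs_ok_def linear_category.scale_null)

lemma comp_at_lact:
  assumes "homs_ok D W Y"
  shows "comp_at (f \<rhd> x) D W Y =
    (if D = C \<and> f \<in> Arr C \<and> Y = Cod C f then f \<cdot> comp_at x C W (Dom C f) else Null D W Y)"
  unfolding lact_def
  by (rule comp_at_mk[OF _ assms])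
    (auto simp: ok_null self_ok intro!: comp_hom[OF comp_at_self arr_hom] dom_obj)

lemma comp_at_ract:
  assumes "homs_ok D W Y"
  shows "comp_at (x \<lhd> e) D W Y =
    (if D = C \<and> e \<in> Arr C \<and> W = Dom C e then comp_at x C (Cod C e) Y \<cdot> e else Null D W Y)"
  unfolding ract_def
  by (rule comp_at_mk[OF _ assms])
    (auto simp: ok_null self_ok intro!: comp_hom[OF arr_hom comp_at_self] cod_obj)

lemma comp_at_emb:
  assumes "homs_ok D W Y"
  shows "comp_at (emb f) D W Y =
    (if D = C \<and> f \<in> Arr C \<and> W = Dom C f \<and> Y = Cod C f then f else Null D W Y)"
  unfolding emb_def
  by (rule comp_at_mk[OF _ assms]) (auto simp: ok_null arr_hom)

lemmas gelt_simps = comp_at_lact comp_at_ract comp_at_emb ok_null_plus ok_scale_null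

lemma lact_add [simp]: "f \<rhd> (x + y) = f \<rhd> x + f \<rhd> y"
  by (rule gelt_eqI)
    (auto simp: gelt_simps self_ok dom_obj comp_plus_right[OF comp_at_self comp_at_self arr_hom])

lemma ract_add [simp]: "(x + y) \<lhd> e = x \<lhd> e + y \<lhd> e"
  by (rule gelt_eqI)
    (auto simp: gelt_simps self_ok cod_obj comp_plus_left[OF arr_hom comp_at_self comp_at_self])

lemma lact_zero [simp]: "f \<rhd> 0 = 0"
  using lact_add[of f 0 0] by simp

lemma ract_zero [simp]: "0 \<lhd> e = 0"
  using ract_add[of 0 0 e] by simp

lemma lact_uminus [simp]: "f \<rhd> (- x) = - (f \<rhd> x)"
  using lact_add[of f x "- x"] by (simp add: eq_neg_iff_add_eq_0 add.commute)

lemma ract_uminus [simp]: "(- x) \<lhd> e = - (x \<lhd> e)"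
  using ract_add[of x "- x" e] by (simp add: eq_neg_iff_add_eq_0 add.commute)

lemma lact_diff [simp]: "f \<rhd> (x - y) = f \<rhd> x - f \<rhd> y"
  using lact_add[of f x "- y"] by simp

lemma ract_diff [simp]: "(x - y) \<lhd> e = x \<lhd> e - y \<lhd> e"
  using ract_add[of x "- y" e] by simp

text \<open>Associativity of composition where the composites are typed; elsewhere both sides are
  zero. As a rewrite rule it moves every change of test object inwards to the innermost
  element.\<close>

lemma lact_ract [simp]: "(f \<rhd> x) \<lhd> e = f \<rhd> (x \<lhd> e)"
proof (rule gelt_eqI)
  fix D :: "('o, 'm, 'k, 'z) lincat_scheme" and W Y
  assume ok: "homs_ok D W Y"
  show "comp_at ((f \<rhd> x) \<lhd> e) D W Y = comp_at (f \<rhd> x \<lhd> e) D W Y"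
  proof (cases "D = C \<and> f \<in> Arr C \<and> Y = Cod C f \<and> e \<in> Arr C \<and> W = Dom C e")
    case True
    with ok show ?thesis
      by (simp add: gelt_simps self_ok dom_obj cod_obj comp_assoc[OF arr_hom comp_at_self arr_hom])
  next
    case False
    with ok show ?thesis
      using comp_null_right[OF arr_hom, of f W] comp_null_left[OF arr_hom, of e Y]
      by (auto simp: gelt_simps self_ok dom_obj cod_obj)
  qed
qed

lemma lact_comp [simp]:
  assumes "f \<in> Arr C" "g \<in> Arr C" "Cod C f = Dom C g"
  shows "(g \<cdot> f) \<rhd> x = g \<rhd> (f \<rhd> x)"
proof -
  have g: "g \<in> hom C (Cod C f) (Cod C g)" using assms by (simp add: hom_def)
  show ?thesis
    using assms
    by (intro gelt_eqI) (auto simp: gelt_simps self_ok dom_obj cod_obj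
        comp_assoc[OF comp_at_self arr_hom[of f] g])
qed

lemma ract_comp:
  assumes "f \<in> Arr C" "g \<in> Arr C" "Cod C f = Dom C g"
  shows "x \<lhd> (g \<cdot> f) = x \<lhd> g \<lhd> f"
proof -
  have g: "g \<in> hom C (Cod C f) (Cod C g)" using assms by (simp add: hom_def)
  show ?thesis
    using assms
    by (intro gelt_eqI) (auto simp: gelt_simps self_ok dom_obj cod_obj
        comp_assoc[OF arr_hom[of f] g comp_at_self])
qed

lemma lact_plus [simp]:
  assumes "f \<in> Arr C" "g \<in> Arr C" "Dom C f = Dom C g" "Cod C f = Cod C g"
  shows "(f \<oplus> g) \<rhd> x = f \<rhd> x + g \<rhd> x"
proof -
  have f: "f \<in> hom C (Dom C g) (Cod C g)" using assms by (simp add: hom_def)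
  show ?thesis
    using assms
    by (intro gelt_eqI) (auto simp: gelt_simps self_ok dom_obj cod_obj
        comp_plus_left[OF comp_at_self f arr_hom[of g]])
qed

lemma lact_scale_uminus [simp]:
  assumes "f \<in> Arr C"
  shows "((- 1) \<odot> f) \<rhd> x = - (f \<rhd> x)"
  using assms
  by (intro gelt_eqI) (auto simp: gelt_simps self_ok dom_obj cod_obj
      comp_scale_left[OF comp_at_self arr_hom])

lemma lact_null [simp]:
  assumes "X \<in> Obj C" "Y \<in> Obj C"
  shows "Null C X Y \<rhd> x = 0"
  using assms
  by (intro gelt_eqI) (auto simp: gelt_simps self_ok comp_null_left[OF comp_at_self])

lemma emb_inj:
  assumes "f \<in> hom C X Y" "g \<in> hom C X Y" "emb f = emb g" shows "f = g"
proof -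
  note h = homD[OF assms(1)] homD[OF assms(2)]
  have ok: "homs_ok C X Y" using h by (simp add: self_ok)
  show ?thesis
    using arg_cong[OF assms(3), of "\<lambda>x. comp_at x C X Y"] h by (simp add: comp_at_emb[OF ok])
qed

lemma emb_El: "f \<in> hom C W A \<Longrightarrow> emb f \<in> El W A"
  by (simp add: El_def)

lemma El_obj: "x \<in> El W A \<Longrightarrow> W \<in> Obj C \<and> A \<in> Obj C"
  by (auto simp: El_def homD)

lemma El_obtain:
  assumes "x \<in> El W A" obtains f where "f \<in> hom C W A" "x = emb f"
  using assms by (auto simp: El_def)

lemma emb_comp_lact:
  assumes "f \<in> hom C W A" "g \<in> hom C A B"
  shows "emb (g \<cdot> f) = g \<rhd> emb f"
proof -
  have g: "g \<in> hom C (Cod C f) (Cod C g)" "g \<in> Arr C" "f \<in> Arr C" "Cod C f = Dom C g"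
    using assms by (auto simp: hom_def)
  then show ?thesis
    by (intro gelt_eqI) (auto simp: gelt_simps self_ok dom_obj cod_obj comp_null_right[OF g(1)[unfolded g(4)]])
qed

lemma emb_comp_ract:
  assumes "f \<in> hom C V W" "g \<in> hom C W A"
  shows "emb (g \<cdot> f) = emb g \<lhd> f"
proof -
  have g: "f \<in> hom C (Dom C f) (Cod C f)" "g \<in> Arr C" "f \<in> Arr C" "Cod C f = Dom C g"
    using assms by (auto simp: hom_def)
  then show ?thesis
    by (intro gelt_eqI) (auto simp: gelt_simps self_ok dom_obj cod_obj comp_null_left[OF g(1)[unfolded g(4)]])
qed

lemma emb_null:
  assumes "W \<in> Obj C" "A \<in> Obj C" shows "emb (Null C W A) = 0"
  using assms by (intro gelt_eqI) (auto simp: gelt_simps self_ok)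

lemma emb_plus:
  assumes "f \<in> hom C W A" "g \<in> hom C W A" shows "emb (f \<oplus> g) = emb f + emb g"
  using homD[OF assms(1)] homD[OF assms(2)]
  by (intro gelt_eqI) (auto simp: gelt_simps self_ok)

lemma emb_scale_uminus:
  assumes "f \<in> hom C W A" shows "emb ((- 1) \<odot> f) = - emb f"
  using homD[OF assms(1)]
  by (intro gelt_eqI) (auto simp: gelt_simps self_ok)

lemma El_zero [simp]: "W \<in> Obj C \<Longrightarrow> A \<in> Obj C \<Longrightarrow> 0 \<in> El W A"
  using emb_El[OF null_hom] emb_null by metis

lemma El_add [intro, simp]: "x \<in> El W A \<Longrightarrow> y \<in> El W A \<Longrightarrow> x + y \<in> El W A"
  by (metis El_obtain emb_El emb_plus plus_hom)

lemma El_uminus [intro]: "x \<in> El W A \<Longrightarrow> - x \<in> El W A"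
  by (metis El_obtain emb_El emb_scale_uminus scale_hom)

lemma El_uminus_iff [simp]: "- x \<in> El W A \<longleftrightarrow> x \<in> El W A"
  using El_uminus[of x] El_uminus[of "- x"] by auto

lemma El_diff [intro, simp]: "x \<in> El W A \<Longrightarrow> y \<in> El W A \<Longrightarrow> x - y \<in> El W A"
  using El_add[of x W A "- y"] by simp

lemma El_lact: "f \<in> hom C A B \<Longrightarrow> x \<in> El W A \<Longrightarrow> f \<rhd> x \<in> El W B"
  by (auto simp: El_def emb_comp_lact[symmetric] intro!: imageI comp_hom)

lemma El_ract: "x \<in> El W A \<Longrightarrow> e \<in> hom C V W \<Longrightarrow> x \<lhd> e \<in> El V A"
  by (auto simp: El_def emb_comp_ract[symmetric] intro!: imageI comp_hom)

lemma El_lact' [simp]: "f \<in> Arr C \<Longrightarrow> Cod C f = B \<Longrightarrow> x \<in> El W (Dom C f) \<Longrightarrow> f \<rhd> x \<in> El W B"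
  using El_lact[OF arr_hom] by blast

lemma ident_lact [simp]: "x \<in> El W A \<Longrightarrow> \<one> A \<rhd> x = x"
  by (auto simp: El_def emb_comp_lact[OF _ ident_hom, symmetric] comp_ident_left homD)

lemma ident_ract [simp]: "x \<in> El W A \<Longrightarrow> x \<lhd> \<one> W = x"
  by (auto simp: El_def emb_comp_ract[OF ident_hom, symmetric] comp_ident_right homD)

text \<open>The Yoneda argument: an arrow is determined by its value on the universal element, the
  identity of its domain.\<close>

lemma arr_eqI:
  assumes "f \<in> hom C X Y" "g \<in> hom C X Y" "\<And>x W. x \<in> El W X \<Longrightarrow> f \<rhd> x = g \<rhd> x"
  shows "f = g"
proof -
  have i: "\<one> X \<in> hom C X X" using ident_hom homD(4)[OF assms(1)] .
  have "emb (f \<cdot> \<one> X) = emb (g \<cdot> \<one> X)"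
    using assms(3)[OF emb_El[OF i]] emb_comp_lact[OF i] assms(1,2) by simp
  then show ?thesis using emb_inj assms(1,2) comp_ident_right by metis
qed

lemma emb_ident_lact: "f \<in> hom C X Y \<Longrightarrow> f \<rhd> emb (\<one> X) = emb f"
  using emb_comp_lact[of "\<one> X" X X f Y] comp_ident_right ident_hom homD(4) by metis

lemma emb_eq_iff: "f \<in> hom C X Y \<Longrightarrow> g \<in> hom C X Y \<Longrightarrow> emb f = emb g \<longleftrightarrow> f = g"
  using emb_inj by blast

lemma emb_eq_0_iff: "f \<in> hom C X Y \<Longrightarrow> emb f = 0 \<longleftrightarrow> f = Null C X Y"
  using emb_eq_iff[OF _ null_hom] emb_null homD(4,5) by metis

section \<open>Monomorphisms, epimorphisms, kernels and cokernels on elements\<close>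

lemma mono_iff:
  assumes "f \<in> hom C A B"
  shows "is_mono C f \<longleftrightarrow> (\<forall>W. \<forall>x\<in>El W A. f \<rhd> x = 0 \<longrightarrow> x = 0)"
proof
  assume m: "is_mono C f"
  show "\<forall>W. \<forall>x\<in>El W A. f \<rhd> x = 0 \<longrightarrow> x = 0"
  proof (intro allI ballI impI)
    fix W x assume x: "x \<in> El W A" and 0: "f \<rhd> x = 0"
    obtain g where g: "g \<in> hom C W A" "x = emb g" using El_obtain[OF x] .
    note W = homD(4,5)[OF g(1)]
    have n: "Null C W A \<in> hom C W A" using null_hom W by blast
    have "emb (f \<cdot> g) = emb (f \<cdot> Null C W A)"
      using 0 g emb_comp_lact[OF g(1) assms] emb_comp_lact[OF n assms] emb_null W by simp
    then have "f \<cdot> g = f \<cdot> Null C W A"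
      using emb_inj[OF comp_hom[OF g(1) assms] comp_hom[OF n assms]] by blast
    then have "g = Null C W A" using m g(1) n homD[OF assms] W unfolding is_mono_def by blast
    then show "x = 0" using g(2) emb_null W by simp
  qed
next
  assume r: "\<forall>W. \<forall>x\<in>El W A. f \<rhd> x = 0 \<longrightarrow> x = 0"
  show "is_mono C f"
    unfolding is_mono_def
  proof (intro conjI ballI impI)
    show "f \<in> Arr C" using homD[OF assms] by simp
    fix W g h assume a: "W \<in> Obj C" "g \<in> hom C W (Dom C f)" "h \<in> hom C W (Dom C f)" "f \<cdot> g = f \<cdot> h"
    have g: "g \<in> hom C W A" "h \<in> hom C W A" using a homD(2)[OF assms] by auto
    have "f \<rhd> (emb g - emb h) = 0"
      using emb_comp_lact[OF g(1) assms] emb_comp_lact[OF g(2) assms] a(4) by simp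
    then have "emb g - emb h = 0" using r El_diff[OF emb_El[OF g(1)] emb_El[OF g(2)]] by blast
    then show "g = h" using emb_inj[OF g] by simp
  qed
qed

lemma epi_iff:
  assumes "f \<in> hom C A B"
  shows "is_epi C f \<longleftrightarrow> (\<forall>W. \<forall>x\<in>El B W. x \<lhd> f = 0 \<longrightarrow> x = 0)"
proof
  assume m: "is_epi C f"
  show "\<forall>W. \<forall>x\<in>El B W. x \<lhd> f = 0 \<longrightarrow> x = 0"
  proof (intro allI ballI impI)
    fix W x assume x: "x \<in> El B W" and 0: "x \<lhd> f = 0"
    obtain g where g: "g \<in> hom C B W" "x = emb g" using El_obtain[OF x] .
    note W = homD(4,5)[OF g(1)]
    have n: "Null C B W \<in> hom C B W" using null_hom W by blast
    have "emb (g \<cdot> f) = emb (Null C B W \<cdot> f)"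
      using 0 g emb_comp_ract[OF assms g(1)] emb_comp_ract[OF assms n] emb_null W by simp
    then have "g \<cdot> f = Null C B W \<cdot> f"
      using emb_inj[OF comp_hom[OF assms g(1)] comp_hom[OF assms n]] by blast
    then have "g = Null C B W" using m g(1) n homD[OF assms] W unfolding is_epi_def by blast
    then show "x = 0" using g(2) emb_null W by simp
  qed
next
  assume r: "\<forall>W. \<forall>x\<in>El B W. x \<lhd> f = 0 \<longrightarrow> x = 0"
  show "is_epi C f"
    unfolding is_epi_def
  proof (intro conjI ballI impI)
    show "f \<in> Arr C" using homD[OF assms] by simp
    fix W g h assume a: "W \<in> Obj C" "g \<in> hom C (Cod C f) W" "h \<in> hom C (Cod C f) W" "g \<cdot> f = h \<cdot> f"
    have g: "g \<in> hom C B W" "h \<in> hom C B W" using a homD(3)[OF assms] by auto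
    have "(emb g - emb h) \<lhd> f = 0"
      using emb_comp_ract[OF assms g(1)] emb_comp_ract[OF assms g(2)] a(4) by simp
    then have "emb g - emb h = 0" using r El_diff[OF emb_El[OF g(1)] emb_El[OF g(2)]] by blast
    then show "g = h" using emb_inj[OF g] by simp
  qed
qed

definition epis :: "'o \<Rightarrow> 'o \<Rightarrow> 'm set" where
  "epis V W = {e \<in> hom C V W. is_epi C e}"

lemma epis_hom: "e \<in> epis V W \<Longrightarrow> e \<in> hom C V W"
  by (simp add: epis_def)

lemma episD: assumes "e \<in> epis V W"
  shows "e \<in> Arr C" "Dom C e = V" "Cod C e = W" "V \<in> Obj C" "W \<in> Obj C"
  using homD[OF epis_hom[OF assms]] by auto

text \<open>Epimorphisms of test objects separate elements. An equation may therefore be checked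
  after such a restriction, which is what makes locally chosen lifts harmless.\<close>

lemma epis_cancel: "e \<in> epis V W \<Longrightarrow> x \<in> El W A \<Longrightarrow> x \<lhd> e = 0 \<Longrightarrow> x = 0"
  using epi_iff[of e V W] by (auto simp: epis_def)

lemma epis_cancel_eq:
  "e \<in> epis V W \<Longrightarrow> x \<in> El W A \<Longrightarrow> y \<in> El W A \<Longrightarrow> x \<lhd> e = y \<lhd> e \<Longrightarrow> x = y"
  using epis_cancel[of e V W "x - y" A] by simp

lemma episI:
  assumes "e \<in> hom C V W" "\<And>A x. x \<in> El W A \<Longrightarrow> x \<lhd> e = 0 \<Longrightarrow> x = 0" shows "e \<in> epis V W"
  using assms epi_iff[OF assms(1)] by (auto simp: epis_def)

lemma epis_comp:
  assumes "e \<in> epis V W" "e' \<in> epis U V" shows "e \<cdot> e' \<in> epis U W"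
proof (rule episI)
  show "e \<cdot> e' \<in> hom C U W" using assms epis_hom comp_hom by blast
  fix A x assume x: "x \<in> El W A" "x \<lhd> (e \<cdot> e') = 0"
  have "x \<lhd> e \<lhd> e' = 0" using x ract_comp episD[OF assms(1)] episD[OF assms(2)] by simp
  then show "x = 0"
    using epis_cancel[OF assms(1) x(1)] epis_cancel[OF assms(2)] El_ract[OF x(1) epis_hom[OF assms(1)]] by blast
qed

lemma epis_ident: "W \<in> Obj C \<Longrightarrow> \<one> W \<in> epis W W"
  by (rule episI) (auto simp: ident_hom)

lemma ract_epis_comp [simp]:
  "e \<in> epis V W \<Longrightarrow> e' \<in> epis U V \<Longrightarrow> x \<lhd> (e \<cdot> e') = x \<lhd> e \<lhd> e'"
  by (rule ract_comp) (auto dest: episD homD)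

text \<open>On elements a kernel behaves as in a category of modules, with the lift over the same
  test object. For the image of an arrow a lift exists only after a restriction, see
  \<open>cokernel_lift\<close>.\<close>

lemma kernelD:
  assumes "is_kernel C k f" "f \<in> hom C A B"
  shows "k \<in> hom C (Dom C k) A" "f \<rhd> (k \<rhd> z) = 0"
    "z \<in> El W (Dom C k) \<Longrightarrow> k \<rhd> z = 0 \<Longrightarrow> z = 0"
    "x \<in> El W A \<Longrightarrow> f \<rhd> x = 0 \<Longrightarrow> \<exists>z\<in>El W (Dom C k). k \<rhd> z = x"
proof -
  have f: "f \<in> Arr C" "Dom C f = A" "Cod C f = B" "A \<in> Obj C" "B \<in> Obj C" using homD[OF assms(2)] by auto
  have k: "k \<in> Arr C" "Cod C k = A" "f \<cdot> k = Null C (Dom C k) B" "Dom C k \<in> Obj C"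
    using assms(1) f dom_obj unfolding is_kernel_def by auto
  have u: "\<exists>!u. u \<in> hom C (Dom C h) (Dom C k) \<and> k \<cdot> u = h"
    if "h \<in> Arr C" "Cod C h = A" "f \<cdot> h = Null C (Dom C h) B" for h
    using assms(1) f that unfolding is_kernel_def by auto
  show kh: "k \<in> hom C (Dom C k) A" using k by (simp add: hom_def)
  show "f \<rhd> (k \<rhd> z) = 0" using lact_comp[of k f z] k f by (simp del: lact_comp)
  have ex: "\<exists>!u. u \<in> hom C W (Dom C k) \<and> k \<rhd> emb u = x" if x: "x \<in> El W A" "f \<rhd> x = 0" for x W
  proof -
    obtain h where h: "h \<in> hom C W A" "x = emb h" using El_obtain[OF x(1)] .
    have "emb (f \<cdot> h) = 0" using h x emb_comp_lact assms(2) by auto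
    then have "f \<cdot> h = Null C W B" using emb_eq_0_iff[OF comp_hom[OF h(1) assms(2)]] by blast
    then have e: "\<exists>!u. u \<in> hom C W (Dom C k) \<and> k \<cdot> u = h" using u[of h] homD[OF h(1)] by auto
    have "k \<rhd> emb v = x \<longleftrightarrow> k \<cdot> v = h" if v: "v \<in> hom C W (Dom C k)" for v
      using emb_comp_lact[OF v kh] emb_eq_iff[OF comp_hom[OF v kh] h(1)] h(2) by simp
    then show ?thesis using e by metis
  qed
  show "\<exists>z\<in>El W (Dom C k). k \<rhd> z = x" if "x \<in> El W A" "f \<rhd> x = 0"
    using ex[OF that] by (auto simp: El_def)
  show "z = 0" if z: "z \<in> El W (Dom C k)" "k \<rhd> z = 0"
  proof -
    have W: "W \<in> Obj C" using El_obj z by blast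
    obtain v where v: "v \<in> hom C W (Dom C k)" "z = emb v" using El_obtain[OF z(1)] .
    have n: "Null C W (Dom C k) \<in> hom C W (Dom C k)" "k \<rhd> emb (Null C W (Dom C k)) = 0"
      using null_hom W k emb_null by auto
    have "v = Null C W (Dom C k)" using ex[of 0 W] v z n W f by auto
    then show ?thesis using v emb_null W k by simp
  qed
qed

lemma kernelI:
  assumes "k \<in> hom C K A" "f \<in> hom C A B" "\<And>z. f \<rhd> (k \<rhd> z) = 0"
    "\<And>z W. z \<in> El W K \<Longrightarrow> k \<rhd> z = 0 \<Longrightarrow> z = 0"
    "\<And>x W. x \<in> El W A \<Longrightarrow> f \<rhd> x = 0 \<Longrightarrow> \<exists>z\<in>El W K. k \<rhd> z = x"
  shows "is_kernel C k f"
  unfolding is_kernel_def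
proof (intro conjI ballI impI)
  note h = homD[OF assms(1)] homD[OF assms(2)]
  show "k \<in> Arr C" "f \<in> Arr C" "Cod C k = Dom C f" using h by auto
  show "f \<cdot> k = Null C (Dom C k) (Cod C f)"
    using h assms(3) by (intro arr_eqI[of _ K B]) (auto simp: hom_def)
  fix g assume g: "g \<in> Arr C" "Cod C g = Dom C f \<and> f \<cdot> g = Null C (Dom C g) (Cod C f)"
  then have gh: "g \<in> hom C (Dom C g) A" using h by (simp add: hom_def)
  have "f \<rhd> emb g = 0"
    using emb_comp_lact[OF gh assms(2)] g h emb_null by (simp add: homD(4)[OF gh])
  then obtain z where z: "z \<in> El (Dom C g) K" "k \<rhd> z = emb g" using assms(5) emb_El[OF gh] by blast
  obtain u where u: "u \<in> hom C (Dom C g) K" "z = emb u" using El_obtain[OF z(1)] .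
  have eq: "k \<cdot> v = g \<longleftrightarrow> k \<rhd> emb v = emb g" if v: "v \<in> hom C (Dom C g) K" for v
    using emb_comp_lact[OF v assms(1)] emb_eq_iff[OF comp_hom[OF v assms(1)] gh] by simp
  have uniq: "v = u" if v: "v \<in> hom C (Dom C g) K" "k \<cdot> v = g" for v
  proof -
    have "k \<rhd> (emb v - emb u) = 0" using v eq z u by simp
    then have "emb v - emb u = 0" using assms(4) El_diff[OF emb_El[OF v(1)] emb_El[OF u(1)]] by blast
    then show ?thesis using emb_inj v u by simp
  qed
  show "\<exists>!v. v \<in> hom C (Dom C g) (Dom C k) \<and> k \<cdot> v = g"
    unfolding h(2) using u z eq uniq by blast
qed

lemma cokernelD:
  assumes "is_cokernel C p f" "f \<in> hom C A B"
  shows "p \<in> hom C B (Cod C p)" "p \<rhd> (f \<rhd> z) = 0" "p \<in> epis B (Cod C p)"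
    "g \<in> hom C B V \<Longrightarrow> g \<cdot> f = Null C A V \<Longrightarrow> \<exists>u\<in>hom C (Cod C p) V. u \<cdot> p = g"
proof -
  have f: "f \<in> Arr C" "Dom C f = A" "Cod C f = B" "A \<in> Obj C" "B \<in> Obj C" using homD[OF assms(2)] by auto
  have p: "p \<in> Arr C" "Dom C p = B" "p \<cdot> f = Null C A (Cod C p)" "Cod C p \<in> Obj C"
    using assms(1) f cod_obj unfolding is_cokernel_def by auto
  have u: "\<exists>!u. u \<in> hom C (Cod C p) V \<and> u \<cdot> p = h"
    if "h \<in> hom C B V" "h \<cdot> f = Null C A V" for h V
  proof -
    have h: "h \<in> Arr C" "Dom C h = B" "Cod C h = V" using homD[OF that(1)] by auto
    have "\<forall>h\<in>Arr C. Dom C h = Cod C f \<and> h \<cdot> f = Null C (Dom C f) (Cod C h) \<longrightarrow>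
        (\<exists>!u. u \<in> hom C (Cod C p) (Cod C h) \<and> u \<cdot> p = h)"
      using assms(1) by (simp add: is_cokernel_def)
    from bspec[OF this h(1)] show ?thesis using h f that(2) by simp
  qed
  show ph: "p \<in> hom C B (Cod C p)" using p by (simp add: hom_def)
  show "p \<rhd> (f \<rhd> z) = 0" using lact_comp[of f p z] p f by (simp del: lact_comp)
  show "g \<in> hom C B V \<Longrightarrow> g \<cdot> f = Null C A V \<Longrightarrow> \<exists>u\<in>hom C (Cod C p) V. u \<cdot> p = g" using u by blast
  show "p \<in> epis B (Cod C p)"
  proof (rule episI[OF ph])
    fix V x assume x: "x \<in> El (Cod C p) V" "x \<lhd> p = 0"
    obtain v where v: "v \<in> hom C (Cod C p) V" "x = emb v" using El_obtain[OF x(1)] .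
    have V: "V \<in> Obj C" using homD v by blast
    have "emb (v \<cdot> p) = 0" using x v emb_comp_ract[OF ph] by simp
    then have "v \<cdot> p = Null C B V" using emb_eq_0_iff[OF comp_hom[OF ph v(1)]] by blast
    moreover have "Null C (Cod C p) V \<cdot> p = Null C B V" using comp_null_left ph V by blast
    moreover have "Null C B V \<cdot> f = Null C A V" using comp_null_left assms(2) V by blast
    ultimately have "v = Null C (Cod C p) V"
      using u[of "Null C B V" V] v(1) null_hom[OF p(4) V] null_hom[OF f(5) V] by auto
    then show "x = 0" using v emb_null p V by simp
  qed
qed

lemma cokernelI:
  assumes "p \<in> epis B P" "f \<in> hom C A B" "\<And>z. p \<rhd> (f \<rhd> z) = 0"
    "\<And>g V. g \<in> hom C B V \<Longrightarrow> g \<cdot> f = Null C A V \<Longrightarrow> \<exists>u\<in>hom C P V. u \<cdot> p = g"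
  shows "is_cokernel C p f"
  unfolding is_cokernel_def
proof (intro conjI ballI impI)
  note h = episD[OF assms(1)] homD[OF assms(2)]
  show "p \<in> Arr C" "f \<in> Arr C" "Dom C p = Cod C f" using h by auto
  show "p \<cdot> f = Null C (Dom C f) (Cod C p)"
    using h assms(3) by (intro arr_eqI[of _ A P]) (auto simp: hom_def)
  fix g assume g: "g \<in> Arr C" "Dom C g = Cod C f \<and> g \<cdot> f = Null C (Dom C f) (Cod C g)"
  then have gh: "g \<in> hom C B (Cod C g)" using h by (simp add: hom_def)
  obtain u where u: "u \<in> hom C P (Cod C g)" "u \<cdot> p = g" using assms(4)[OF gh] g h by auto
  have "v = u" if v: "v \<in> hom C P (Cod C g)" "v \<cdot> p = g" for v
  proof -
    have "(emb v - emb u) \<lhd> p = 0"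
      using emb_comp_ract[OF epis_hom[OF assms(1)] v(1)] emb_comp_ract[OF epis_hom[OF assms(1)] u(1)] v u by simp
    then have "emb v - emb u = 0"
      using epis_cancel[OF assms(1)] El_diff[OF emb_El[OF v(1)] emb_El[OF u(1)]] by blast
    then show ?thesis using emb_inj v u by simp
  qed
  then show "\<exists>!v. v \<in> hom C (Cod C p) (Cod C g) \<and> v \<cdot> p = g" unfolding h(3) using u by blast
qed

lemma null_compI: "f \<in> hom C A B \<Longrightarrow> g \<in> hom C B D \<Longrightarrow> (\<And>z. g \<rhd> (f \<rhd> z) = 0) \<Longrightarrow> g \<cdot> f = Null C A D"
  by (rule arr_eqI[of _ A D]) (auto simp: hom_def dom_obj cod_obj dest: homD)

lemma is_iso_iff:
  "f \<in> hom C A B \<Longrightarrow> is_iso C f \<longleftrightarrow> (\<exists>g\<in>hom C B A. g \<cdot> f = \<one> A \<and> f \<cdot> g = \<one> B)"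
  by (auto simp: is_iso_def hom_def)

lemma biproductD:
  assumes "is_biproduct C X A B i j p q"
  shows "i \<in> hom C A X" "j \<in> hom C B X" "p \<in> hom C X A" "q \<in> hom C X B"
    "a \<in> El W A \<Longrightarrow> p \<rhd> (i \<rhd> a) = a" "b \<in> El W B \<Longrightarrow> q \<rhd> (j \<rhd> b) = b"
    "q \<rhd> (i \<rhd> x) = 0" "p \<rhd> (j \<rhd> x) = 0"
    "x \<in> El W X \<Longrightarrow> x = i \<rhd> (p \<rhd> x) + j \<rhd> (q \<rhd> x)"
proof -
  show h: "i \<in> hom C A X" "j \<in> hom C B X" "p \<in> hom C X A" "q \<in> hom C X B"
    using assms by (auto simp: is_biproduct_def)
  have o: "p \<cdot> i = \<one> A" "q \<cdot> j = \<one> B" "q \<cdot> i = Null C A B" "p \<cdot> j = Null C B A"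
    "(i \<cdot> p) \<oplus> (j \<cdot> q) = \<one> X" using assms by (auto simp: is_biproduct_def)
  note d = homD[OF h(1)] homD[OF h(2)] homD[OF h(3)] homD[OF h(4)]
  show "a \<in> El W A \<Longrightarrow> p \<rhd> (i \<rhd> a) = a" using lact_comp[of i p a] d o by (simp del: lact_comp)
  show "b \<in> El W B \<Longrightarrow> q \<rhd> (j \<rhd> b) = b" using lact_comp[of j q b] d o by (simp del: lact_comp)
  show "q \<rhd> (i \<rhd> x) = 0" using lact_comp[of i q x] d o by (simp del: lact_comp)
  show "p \<rhd> (j \<rhd> x) = 0" using lact_comp[of j p x] d o by (simp del: lact_comp)
  have "(i \<cdot> p \<oplus> j \<cdot> q) \<rhd> x = i \<rhd> (p \<rhd> x) + j \<rhd> (q \<rhd> x)" using d by simp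
  then show "x \<in> El W X \<Longrightarrow> x = i \<rhd> (p \<rhd> x) + j \<rhd> (q \<rhd> x)" using o by simp
qed

lemma zero_object_iff:
  assumes "Z \<in> Obj C"
  shows "zero_object C Z \<longleftrightarrow> (\<forall>W. \<forall>x\<in>El W Z. x = 0)"
proof
  assume z: "zero_object C Z"
  show "\<forall>W. \<forall>x\<in>El W Z. x = 0"
  proof (intro allI ballI)
    fix W x assume x: "x \<in> El W Z"
    obtain f where f: "f \<in> hom C W Z" "x = emb f" using El_obtain[OF x] .
    then have "f = Null C W Z" using z null_hom[of W Z] El_obj[OF x] unfolding zero_object_def by blast
    then show "x = 0" using f emb_null El_obj[OF x] by simp
  qed
next
  assume r: "\<forall>W. \<forall>x\<in>El W Z. x = 0"
  have "emb (\<one> Z) = 0" using r emb_El[OF ident_hom[OF assms]] by blast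
  then have i: "\<one> Z = Null C Z Z" using emb_eq_0_iff[OF ident_hom[OF assms]] by blast
  have 1: "f = Null C X Z" if "f \<in> hom C X Z" for f X
    using comp_ident_left[OF that] i comp_null_left[OF that assms] by simp
  have 2: "f = Null C Z X" if "f \<in> hom C Z X" for f X
    using comp_ident_right[OF that] i comp_null_right[OF that assms] by simp
  show "zero_object C Z" unfolding zero_object_def using assms 1 2 null_hom by metis
qed

lemma zero_object_El: "zero_object C Z \<Longrightarrow> x \<in> El W Z \<Longrightarrow> x = 0"
  using zero_object_iff[of Z] by (auto simp: zero_object_def)

lemma zero_object_El_left: "zero_object C Z \<Longrightarrow> x \<in> El Z A \<Longrightarrow> x = 0"
  by (metis El_obtain El_obj emb_null null_hom zero_object_def)

end

section \<open>Kernels and cokernels\<close>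

context abelian_category
begin

text \<open>An epimorphism is the cokernel of some \<open>g\<close>. As \<open>g\<close> factors
  through the kernel \<open>k\<close>, every arrow that kills \<open>k\<close> also kills
  \<open>g\<close> and so factors through \<open>p\<close>.\<close>

lemma epi_cokernel_kernel:
  assumes "is_epi C p" "is_kernel C k p" shows "is_cokernel C p k"
proof -
  have p: "p \<in> hom C (Dom C p) (Cod C p)" using assms(1) by (simp add: is_epi_def arr_hom)
  note k = kernelD[OF assms(2) p]
  obtain g where g: "is_cokernel C p g" using epi_normal assms(1) by blast
  then have gh: "g \<in> hom C (Dom C g) (Dom C p)" by (auto simp: is_cokernel_def hom_def)
  note go = homD[OF gh]
  note gD = cokernelD[OF g gh]
  have "p \<rhd> emb g = 0"
    using gD(2)[of "emb (\<one> (Dom C g))"] emb_ident_lact[OF gh] by simp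
  then obtain z where z: "z \<in> El (Dom C g) (Dom C k)" "k \<rhd> z = emb g"
    using k(4)[OF emb_El[OF gh]] by blast
  then obtain u where u: "u \<in> hom C (Dom C g) (Dom C k)" "z = emb u" using El_obtain by blast
  have ku: "k \<cdot> u = g"
    using emb_inj[OF comp_hom[OF u(1) k(1)] gh] z u emb_comp_lact[OF u(1) k(1)] by simp
  show ?thesis
  proof (rule cokernelI[OF _ k(1)])
    show "p \<in> epis (Dom C p) (Cod C p)" using p assms(1) by (simp add: epis_def)
    show "p \<rhd> (k \<rhd> z) = 0" for z using k(2) .
    fix h V assume h: "h \<in> hom C (Dom C p) V" "h \<cdot> k = Null C (Dom C k) V"
    have "h \<cdot> g = h \<cdot> (k \<cdot> u)" using ku by simp
    also have "\<dots> = (h \<cdot> k) \<cdot> u" using comp_assoc[OF u(1) k(1) h(1)] by simp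
    also have "\<dots> = Null C (Dom C g) V" using h(2) comp_null_left[OF u(1)] homD(5)[OF h(1)] by simp
    finally show "\<exists>u\<in>hom C (Cod C p) V. u \<cdot> p = h" using gD(4) h(1) by blast
  qed
qed

text \<open>Pullbacks of epimorphisms are epimorphisms; the diagram chases rest on this. The
  pullback of \<open>p\<close> along \<open>y\<close> is the kernel \<open>k\<close> of the
  difference map \<open>f\<close> from the direct sum of \<open>A\<close> and \<open>W\<close> to
  \<open>B\<close>. Its domain is the new test object, and its two projections are \<open>e\<close>
  and \<open>x\<close>.\<close>

lemma epi_lift:
  assumes "p \<in> epis A B" "y \<in> El W B"
  obtains V e x where "e \<in> epis V W" "x \<in> El V A" "p \<rhd> x = y \<lhd> e"
proof -
  note p = epis_hom[OF assms(1)]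
  obtain y' where y': "y' \<in> hom C W B" "y = emb y'" using El_obtain[OF assms(2)] .
  note o = homD[OF p] homD[OF y'(1)]
  obtain X i j q r where b: "is_biproduct C X A W i j q r"
    using ex_direct_sum[of A W] o by (auto simp: direct_sum_def)
  note bD = biproductD[OF b]
  define f where "f = (p \<cdot> q) \<oplus> (- 1) \<odot> (y' \<cdot> r)"
  have f: "f \<in> hom C X B" unfolding f_def
    using plus_hom scale_hom comp_hom bD(3,4) p y' by metis
  have fx: "f \<rhd> x = p \<rhd> (q \<rhd> x) - y' \<rhd> (r \<rhd> x)" for x
    unfolding f_def using homD[OF bD(3)] homD[OF bD(4)] o by simp
  have fe: "f \<in> epis X B"
  proof (rule episI[OF f])
    fix D x assume x: "x \<in> El B D" "x \<lhd> f = 0"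
    obtain g where g: "g \<in> hom C B D" "x = emb g" using El_obtain[OF x(1)] .
    have "f \<cdot> i = p"
    proof (rule arr_eqI[of _ A B])
      show "f \<cdot> i \<in> hom C A B" using comp_hom bD(1) f .
      fix z W assume z: "z \<in> El W A"
      have "(f \<cdot> i) \<rhd> z = f \<rhd> (i \<rhd> z)" using lact_comp homD[OF bD(1)] homD[OF f] by simp
      then show "(f \<cdot> i) \<rhd> z = p \<rhd> z" using fx bD(5)[OF z] bD(7) by simp
    qed (fact p)
    then have "x \<lhd> p = x \<lhd> f \<lhd> i" using ract_comp[of i f x] homD[OF bD(1)] homD[OF f] by simp
    then show "x = 0" using epis_cancel[OF assms(1) x(1)] x(2) by simp
  qed
  obtain k where k: "is_kernel C k f" using ex_kernel f homD(1) by blast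
  note kD = kernelD[OF k f]
  have c: "is_cokernel C f k" using epi_cokernel_kernel fe k by (simp add: epis_def)
  note cD = cokernelD[OF c kD(1)]
  let ?V = "Dom C k"
  have e: "r \<cdot> k \<in> epis ?V W"
  proof (rule episI)
    show "r \<cdot> k \<in> hom C ?V W" using comp_hom kD(1) bD(4) .
    fix D x assume x: "x \<in> El W D" "x \<lhd> (r \<cdot> k) = 0"
    obtain g where g: "g \<in> hom C W D" "x = emb g" using El_obtain[OF x(1)] .
    have D: "D \<in> Obj C" using g homD by blast
    have gr: "g \<cdot> r \<in> hom C X D" using comp_hom bD(4) g(1) .
    have "emb ((g \<cdot> r) \<cdot> k) = 0"
      using x(2) g emb_comp_ract[OF kD(1) gr] emb_comp_ract[OF bD(4) g(1)]
        ract_comp[of k r x] homD[OF kD(1)] homD[OF bD(4)] by simp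
    then have "(g \<cdot> r) \<cdot> k = Null C ?V D" using emb_eq_0_iff[OF comp_hom[OF kD(1) gr]] by blast
    \<comment> \<open>As \<open>f\<close> is the cokernel of \<open>k\<close>, the arrow g r factors
      as u f. Restriction to the summand \<open>A\<close>, which \<open>r\<close> kills, gives u p =
      0, hence u = 0. Restriction to the summand \<open>W\<close> then gives g = 0.\<close>
    then obtain u where u: "u \<in> hom C (Cod C f) D" "u \<cdot> f = g \<cdot> r" using cD(4)[OF gr] by blast
    have uB: "u \<in> hom C B D" using u homD(3)[OF f] by simp
    have uf: "u \<rhd> (f \<rhd> z) = g \<rhd> (r \<rhd> z)" for z
      using lact_comp[of f u z] lact_comp[of r g z] u(2) homD[OF f] homD[OF uB] homD[OF bD(4)] homD[OF g(1)] by simp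
    have "u \<cdot> p = Null C A D"
    proof (rule arr_eqI[of _ A D])
      show "u \<cdot> p \<in> hom C A D" "Null C A D \<in> hom C A D" using comp_hom p uB null_hom o D by auto
      fix z W assume z: "z \<in> El W A"
      have "u \<rhd> (p \<rhd> z) = u \<rhd> (f \<rhd> (i \<rhd> z))" using fx bD(5)[OF z] bD(7) by simp
      also have "\<dots> = 0" using uf bD(7) by simp
      finally show "(u \<cdot> p) \<rhd> z = Null C A D \<rhd> z" using homD[OF uB] o D by simp
    qed
    then have "emb u \<lhd> p = 0" using emb_comp_ract[OF p uB] emb_null o D by simp
    then have "emb u = 0" using epis_cancel[OF assms(1) emb_El[OF uB]] by blast
    then have "u = Null C B D" using emb_eq_0_iff[OF uB] by blast
    then have u0: "u \<rhd> z = 0" for z using o D by simp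
    have "g \<rhd> z = 0" if z: "z \<in> El W' W" for z W'
      using uf[of "j \<rhd> z"] u0 bD(6)[OF z] by simp
    then have "g = Null C W D" using o D by (intro arr_eqI[OF g(1) null_hom]) auto
    then show "x = 0" using g emb_null o D by simp
  qed
  let ?x = "emb (q \<cdot> k)"
  have x: "?x \<in> El ?V A" using emb_El comp_hom kD(1) bD(3) by blast
  have "p \<rhd> ?x - y \<lhd> (r \<cdot> k) = f \<rhd> emb k"
  proof -
    have "y' \<rhd> (r \<rhd> emb k) = y \<lhd> (r \<cdot> k)"
      using emb_comp_lact[OF kD(1) bD(4)] emb_comp_lact[OF comp_hom[OF kD(1) bD(4)] y'(1)]
        emb_comp_ract[OF comp_hom[OF kD(1) bD(4)] y'(1)] y'(2) by simp
    then show ?thesis using fx[of "emb k"] emb_comp_lact[OF kD(1) bD(3)] by simp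
  qed
  also have "\<dots> = 0"
    using kD(2)[of "emb (\<one> ?V)"] emb_ident_lact[OF kD(1)] by simp
  finally show ?thesis using that[OF e x] by simp
qed

text \<open>A monomorphism is the kernel of some \<open>g\<close>. If it is also epi then g = 0, so
  the identity of \<open>B\<close> lifts along \<open>f\<close> to a right inverse; cancelling the
  monomorphism \<open>f\<close> makes it two-sided.\<close>

lemma mono_epi_iso:
  assumes "f \<in> hom C A B" "is_mono C f" "is_epi C f" shows "is_iso C f"
proof -
  obtain g where g: "is_kernel C f g" using mono_normal assms by blast
  then have gh: "g \<in> hom C B (Cod C g)" using homD[OF assms(1)] by (auto simp: is_kernel_def hom_def)
  note gD = kernelD[OF g gh]
  note o = homD[OF assms(1)]
  have "emb g \<lhd> f = 0"
    using gD(2)[of "emb (\<one> A)"] emb_ident_lact[OF assms(1)] emb_comp_ract[OF assms(1) gh]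
      emb_comp_lact[OF assms(1) gh] by simp
  then have "emb g = 0" using epis_cancel[of f A B] assms emb_El[OF gh] by (simp add: epis_def)
  then have "g = Null C B (Cod C g)" using emb_eq_0_iff[OF gh] by blast
  then have g0: "g \<rhd> z = 0" for z using lact_null[of B "Cod C g" z] homD[OF gh] by metis
  obtain h where h: "h \<in> El B A" "f \<rhd> h = emb (\<one> B)"
    using gD(4)[OF emb_El[OF ident_hom[OF o(5)]] g0] o by auto
  then obtain k where k: "k \<in> hom C B A" "h = emb k" using El_obtain by blast
  have fk: "f \<cdot> k = \<one> B"
    using emb_inj[OF comp_hom[OF k(1) assms(1)] ident_hom[OF o(5)]] h k emb_comp_lact[OF k(1) assms(1)] by simp
  have "k \<cdot> f = \<one> A"
  proof (rule arr_eqI[of _ A A])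
    show "k \<cdot> f \<in> hom C A A" "\<one> A \<in> hom C A A" using comp_hom assms(1) k ident_hom o by auto
    fix x W assume x: "x \<in> El W A"
    have fx: "f \<rhd> x \<in> El W B" using El_lact assms(1) x .
    have "f \<rhd> (k \<rhd> (f \<rhd> x)) = f \<rhd> x"
      using lact_comp[of k f "f \<rhd> x"] homD[OF k(1)] o fk fx by simp
    then have "f \<rhd> (k \<rhd> (f \<rhd> x) - x) = 0" by simp
    then have "k \<rhd> (f \<rhd> x) - x = 0"
      using assms(2) mono_iff[OF assms(1)] El_diff[OF El_lact[OF k(1) fx] x] by blast
    then show "(k \<cdot> f) \<rhd> x = \<one> A \<rhd> x" using x homD[OF k(1)] o by simp
  qed
  then show ?thesis using is_iso_iff[OF assms(1)] k fk by blast
qed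

lemma iso_mono_epi:
  assumes "f \<in> hom C A B" "is_iso C f" shows "is_mono C f" "f \<in> epis A B"
proof -
  obtain g where g: "g \<in> hom C B A" "g \<cdot> f = \<one> A" "f \<cdot> g = \<one> B" using is_iso_iff assms by blast
  note o = homD[OF assms(1)] homD[OF g(1)]
  show "is_mono C f"
    unfolding mono_iff[OF assms(1)]
  proof (intro allI ballI impI)
    fix W x assume x: "x \<in> El W A" "f \<rhd> x = 0"
    then show "x = 0" using lact_comp[of f g x] g o by simp
  qed
  show "f \<in> epis A B"
  proof (rule episI[OF assms(1)])
    fix D x assume x: "x \<in> El B D" "x \<lhd> f = 0"
    then show "x = 0" using ract_comp[of g f x] g o by simp
  qed
qed

text \<open>An element killed by the cokernel lies in the kernel \<open>m\<close> of the cokernel,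
  which is the image of \<open>f\<close>. It remains to see that the factor \<open>q\<close> in f =
  m q is epi; then \<open>epi_lift\<close> provides the preimage.\<close>

lemma cokernel_lift:
  assumes "is_cokernel C p f" "f \<in> hom C A B" "y \<in> El W B" "p \<rhd> y = 0"
  obtains V e x where "e \<in> epis V W" "x \<in> El V A" "f \<rhd> x = y \<lhd> e"
proof -
  note pD = cokernelD[OF assms(1,2)]
  note o = homD[OF assms(2)] homD[OF pD(1)]
  obtain m where m: "is_kernel C m p" using ex_kernel o by blast
  note mD = kernelD[OF m pD(1)]
  let ?I = "Dom C m"
  have "p \<rhd> emb f = 0" using pD(2)[of "emb (\<one> A)"] emb_ident_lact[OF assms(2)] by simp
  then obtain z where z: "z \<in> El A ?I" "m \<rhd> z = emb f" using mD(4)[OF emb_El[OF assms(2)]] by blast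
  then obtain q where q: "q \<in> hom C A ?I" "z = emb q" using El_obtain by blast
  have mq: "m \<cdot> q = f"
    using emb_inj[OF comp_hom[OF q(1) mD(1)] assms(2)] z q emb_comp_lact[OF q(1) mD(1)] by simp
  have mqx: "m \<rhd> (q \<rhd> x) = f \<rhd> x" for x
    using lact_comp[of q m x] mq homD[OF q(1)] homD[OF mD(1)] by simp
  have qe: "q \<in> epis A ?I"
  proof (rule episI[OF q(1)])
    fix D x assume x: "x \<in> El ?I D" "x \<lhd> q = 0"
    obtain g where g: "g \<in> hom C ?I D" "x = emb g" using El_obtain[OF x(1)] .
    have "g \<rhd> emb q = 0"
      using x g emb_comp_lact[OF q(1) g(1)] emb_comp_ract[OF q(1) g(1)] by simp
    obtain n where n: "is_kernel C n g" using ex_kernel g homD by blast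
    note nD = kernelD[OF n g(1)]
    obtain z' where z': "z' \<in> El A (Dom C n)" "n \<rhd> z' = emb q"
      using nD(4)[OF emb_El[OF q(1)] \<open>g \<rhd> emb q = 0\<close>] by blast
    have mn: "m \<cdot> n \<in> hom C (Dom C n) B" using comp_hom nD(1) mD(1) .
    have mnx: "(m \<cdot> n) \<rhd> x = m \<rhd> (n \<rhd> x)" for x
      using homD[OF nD(1)] homD[OF mD(1)] by simp
    \<comment> \<open>The subobject m n contains the image of \<open>f\<close>. If it is the kernel
      of \<open>h\<close>, then \<open>h\<close> kills \<open>f\<close>, so it factors through the
      cokernel \<open>p\<close> and kills \<open>m\<close>. Hence \<open>m\<close> factors through m
      n, the identity of its domain factors through \<open>n\<close>, and \<open>g\<close>, which
      kills \<open>n\<close>, is zero.\<close>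
    have "is_mono C (m \<cdot> n)"
      unfolding mono_iff[OF mn] mnx using nD(3) mD(3) El_lact[OF nD(1)] by blast
    then obtain h where h: "is_kernel C (m \<cdot> n) h" using mono_normal by blast
    then have hh: "h \<in> hom C B (Cod C h)" using homD[OF mn] by (auto simp: is_kernel_def hom_def)
    note hD = kernelD[OF h hh]
    have "h \<cdot> f = Null C A (Cod C h)"
    proof -
      have "h \<rhd> (m \<rhd> (n \<rhd> z')) = 0" using hD(2)[of z'] mnx by simp
      then have "emb (h \<cdot> f) = 0" using z' q z emb_comp_lact[OF assms(2) hh] by simp
      then show ?thesis using emb_eq_0_iff[OF comp_hom[OF assms(2) hh]] by blast
    qed
    then obtain u where u: "u \<in> hom C (Cod C p) (Cod C h)" "u \<cdot> p = h" using pD(4)[OF hh] by blast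
    have "h \<rhd> emb m = 0"
    proof -
      have "h \<rhd> emb m = u \<rhd> (p \<rhd> emb m)"
        using lact_comp[of p u "emb m"] u homD[OF u(1)] o by simp
      moreover have "p \<rhd> emb m = 0"
        using mD(2)[of "emb (\<one> ?I)"] emb_ident_lact[OF mD(1)] by simp
      ultimately show ?thesis by simp
    qed
    then obtain w where w: "w \<in> El ?I (Dom C n)" "(m \<cdot> n) \<rhd> w = emb m"
      using hD(4)[OF emb_El[OF mD(1)]] homD[OF mn] by auto
    have I: "?I \<in> Obj C" using homD[OF mD(1)] by simp
    have "m \<rhd> (n \<rhd> w - emb (\<one> ?I)) = 0"
      using w mnx emb_ident_lact[OF mD(1)] by simp
    then have "n \<rhd> w - emb (\<one> ?I) = 0"
      using mD(3)[OF El_diff[OF El_lact[OF nD(1) w(1)] emb_El[OF ident_hom[OF I]]]] by blast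
    then have "emb g = g \<rhd> (n \<rhd> w)" using emb_ident_lact[OF g(1)] by simp
    then show "x = 0" using nD(2) g by simp
  qed
  obtain t where t: "t \<in> El W ?I" "m \<rhd> t = y" using mD(4)[OF assms(3,4)] by blast
  obtain V e x where e: "e \<in> epis V W" "x \<in> El V A" "q \<rhd> x = t \<lhd> e" using epi_lift[OF qe t(1)] .
  have "f \<rhd> x = y \<lhd> e" using mqx[of x] e(3) t(2) lact_ract[of m t e] by simp
  then show ?thesis using that e by blast
qed

text \<open>For the identity of \<open>B\<close> the lifting property yields an epimorphism that
  factors through \<open>p\<close>; an arrow that kills \<open>p\<close> also kills this
  epimorphism.\<close>

lemma episI_lift:
  assumes "p \<in> hom C A B"
    "\<And>y W. y \<in> El W B \<Longrightarrow> \<exists>V e x. e \<in> epis V W \<and> x \<in> El V A \<and> p \<rhd> x = y \<lhd> e"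
  shows "p \<in> epis A B"
proof (rule episI[OF assms(1)])
  fix D x assume x: "x \<in> El B D" "x \<lhd> p = 0"
  obtain g where g: "g \<in> hom C B D" "x = emb g" using El_obtain[OF x(1)] .
  have B: "B \<in> Obj C" using homD[OF assms(1)] by simp
  obtain V e z where z: "e \<in> epis V B" "z \<in> El V A" "p \<rhd> z = emb (\<one> B) \<lhd> e"
    using assms(2)[OF emb_El[OF ident_hom[OF B]]] by blast
  have "emb (g \<cdot> p) = 0" using x g emb_comp_ract[OF assms(1) g(1)] by simp
  then have "g \<cdot> p = Null C A D" using emb_eq_0_iff[OF comp_hom[OF assms(1) g(1)]] by blast
  then have gp: "g \<rhd> (p \<rhd> z) = 0"
    using lact_comp[of p g z] homD[OF assms(1)] homD[OF g(1)] by simp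
  have "x \<lhd> e = g \<rhd> (emb (\<one> B) \<lhd> e)"
    using emb_ident_lact[OF g(1)] g(2) lact_ract[of g "emb (\<one> B)" e] by simp
  then have "x \<lhd> e = 0" using gp z(3) by simp
  then show "x = 0" using epis_cancel[OF z(1) x(1)] by blast
qed

end

context linear_category
begin

lemma isomorphicI: "f \<in> hom C A B \<Longrightarrow> is_iso C f \<Longrightarrow> isomorphic C A B"
  by (auto simp: isomorphic_def)

lemma isomorphic_sym: "isomorphic C A B \<Longrightarrow> isomorphic C B A"
  unfolding isomorphic_def using is_iso_iff by metis

lemma isomorphic_trans:
  assumes "isomorphic C A B" "isomorphic C B D" shows "isomorphic C A D"
proof -
  obtain f f' where f: "f \<in> hom C A B" "f' \<in> hom C B A" "f' \<cdot> f = \<one> A" "f \<cdot> f' = \<one> B"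
    using assms(1) is_iso_iff unfolding isomorphic_def by blast
  obtain g g' where g: "g \<in> hom C B D" "g' \<in> hom C D B" "g' \<cdot> g = \<one> B" "g \<cdot> g' = \<one> D"
    using assms(2) is_iso_iff unfolding isomorphic_def by blast
  have gf: "g \<cdot> f \<in> hom C A D" "f' \<cdot> g' \<in> hom C D A" using comp_hom f g by blast+
  have "(f' \<cdot> g') \<cdot> (g \<cdot> f) = f' \<cdot> ((g' \<cdot> g) \<cdot> f)"
    using comp_assoc[OF gf(1) g(2) f(2)] comp_assoc[OF f(1) g(1) g(2)] by simp
  moreover have "(g \<cdot> f) \<cdot> (f' \<cdot> g') = g \<cdot> ((f \<cdot> f') \<cdot> g')"
    using comp_assoc[OF gf(2) f(1) g(1)] comp_assoc[OF g(2) f(2) f(1)] by simp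
  ultimately have "is_iso C (g \<cdot> f)"
    using is_iso_iff[OF gf(1)] gf(2) f g comp_ident_left by metis
  then show ?thesis using isomorphicI gf by blast
qed

end

section \<open>Complexes and their cohomology\<close>

context abelian_category
begin

text \<open>The arrow form of \<open>epi_lift\<close>: an epimorphic cover of a test object can be
  pulled back along any change of test object.\<close>

lemma epis_pullback:
  assumes "e \<in> epis V W" "g \<in> hom C U W"
  obtains P e' g' where "e' \<in> epis P U" "g' \<in> hom C P V" "e \<cdot> g' = g \<cdot> e'"
proof -
  obtain P e' x where x: "e' \<in> epis P U" "x \<in> El P V" "e \<rhd> x = emb g \<lhd> e'"
    using epi_lift[OF assms(1) emb_El[OF assms(2)]] .
  obtain g' where g': "g' \<in> hom C P V" "x = emb g'" using El_obtain[OF x(2)] .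
  note e = epis_hom[OF assms(1)] and e' = epis_hom[OF x(1)]
  have "emb (e \<cdot> g') = emb (g \<cdot> e')"
    using x g' emb_comp_lact[OF g'(1) e] emb_comp_ract[OF e' assms(2)] by simp
  then have "e \<cdot> g' = g \<cdot> e'" using emb_inj[OF comp_hom[OF g'(1) e] comp_hom[OF e' assms(2)]] by blast
  then show ?thesis using that x(1) g'(1) by blast
qed

abbreviation complexes :: "('a, 'b) complex_data set" where
  "complexes \<equiv> bounded_complexes C"

definition chmap :: "('a, 'b) chain_map \<Rightarrow> ('a, 'b) complex_data \<Rightarrow> ('a, 'b) complex_data \<Rightarrow> bool" where
  "chmap f X Y \<longleftrightarrow> f \<in> chain_maps C \<and> src f = X \<and> tgt f = Y"

lemma complexD:
  assumes "X \<in> complexes"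
  shows "ob X i \<in> Obj C" "diff X i \<in> hom C (ob X i) (ob X (i + 1))"
    "diff X (i + 1) \<rhd> (diff X i \<rhd> x) = 0" "diff X i \<rhd> (diff X (i - 1) \<rhd> x) = 0"
proof -
  show o: "ob X i \<in> Obj C" "diff X i \<in> hom C (ob X i) (ob X (i + 1))" for i
    using assms by (auto simp: bounded_complexes_def)
  have n: "diff X (i + 1) \<cdot> diff X i = Null C (ob X i) (ob X (i + 2))" for i
    using assms by (auto simp: bounded_complexes_def)
  show *: "diff X (i + 1) \<rhd> (diff X i \<rhd> x) = 0" for i
    using lact_comp[of "diff X i" "diff X (i + 1)" x] n[of i] homD[OF o(2)[of i]] homD[OF o(2)[of "i + 1"]] o
    by (simp del: lact_comp)
  show "diff X i \<rhd> (diff X (i - 1) \<rhd> x) = 0" using *[of "i - 1"] by simp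
qed

lemma complex_simps [simp]:
  assumes "X \<in> complexes"
  shows "ob X i \<in> Obj C" "diff X i \<in> Arr C" "Dom C (diff X i) = ob X i" "Cod C (diff X i) = ob X (i + 1)"
    "diff X (i + 1) \<rhd> (diff X i \<rhd> x) = 0" "diff X i \<rhd> (diff X (i - 1) \<rhd> x) = 0"
  using complexD[OF assms] homD[OF complexD(2)[OF assms]] by auto

lemma El_diff_prev: "X \<in> complexes \<Longrightarrow> y \<in> El W (ob X (i - 1)) \<Longrightarrow> diff X (i - 1) \<rhd> y \<in> El W (ob X i)"
  using El_lact[OF complexD(2)[of X "i - 1"]] by simp

lemma chmapD:
  assumes "chmap f X Y"
  shows "X \<in> complexes" "Y \<in> complexes" "cpt f i \<in> hom C (ob X i) (ob Y i)"
    "cpt f (i + 1) \<cdot> diff X i = diff Y i \<cdot> cpt f i"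
  using assms by (auto simp: chmap_def chain_maps_def)

lemma chmap_simps [simp]:
  assumes "chmap f X Y"
  shows "cpt f i \<in> Arr C" "Dom C (cpt f i) = ob X i" "Cod C (cpt f i) = ob Y i"
  using homD[OF chmapD(3)[OF assms]] assms by (auto simp: chmap_def)

lemma chmap_ends: "chmap f X Y \<Longrightarrow> src f = X" "chmap f X Y \<Longrightarrow> tgt f = Y"
  by (auto simp: chmap_def)

lemma chmap_unique: "chmap f X Y \<Longrightarrow> chmap f X' Y' \<Longrightarrow> X' = X \<and> Y' = Y"
  by (auto simp: chmap_def)

lemma chmap_commute:
  assumes "chmap f X Y" shows "diff Y i \<rhd> (cpt f i \<rhd> x) = cpt f (i + 1) \<rhd> (diff X i \<rhd> x)"
  using lact_comp[of "cpt f i" "diff Y i" x] lact_comp[of "diff X i" "cpt f (i + 1)" x]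
    chmapD[OF assms] assms by simp

lemma chmap_commute_prev:
  assumes "chmap f X Y" shows "diff Y (i - 1) \<rhd> (cpt f (i - 1) \<rhd> x) = cpt f i \<rhd> (diff X (i - 1) \<rhd> x)"
  using chmap_commute[OF assms, of "i - 1" x] by simp

lemma chmapI:
  assumes "X \<in> complexes" "Y \<in> complexes" "src f = X" "tgt f = Y"
    "\<And>i. cpt f i \<in> hom C (ob X i) (ob Y i)"
    "\<And>i W x. x \<in> El W (ob X i) \<Longrightarrow> diff Y i \<rhd> (cpt f i \<rhd> x) = cpt f (i + 1) \<rhd> (diff X i \<rhd> x)"
  shows "chmap f X Y"
  unfolding chmap_def chain_maps_def
proof (intro conjI CollectI allI)
  fix i
  note h = homD[OF assms(5)[of i]] homD[OF assms(5)[of "i + 1"]]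
  show "cpt f (i + 1) \<cdot> diff (src f) i = diff (tgt f) i \<cdot> cpt f i"
    unfolding assms(3,4)
    using assms h by (intro arr_eqI[of _ "ob X i" "ob Y (i + 1)"]) (auto simp: hom_def)
qed (use assms in auto)

lemma El_chmap: "chmap f X Y \<Longrightarrow> x \<in> El W (ob X i) \<Longrightarrow> cpt f i \<rhd> x \<in> El W (ob Y i)"
  using El_lact chmapD(3) by blast

definition cycs :: "('a, 'b) complex_data \<Rightarrow> int \<Rightarrow> 'a \<Rightarrow> ('a, 'b, 'c, 'd) gelt set" where
  "cycs X i W = {x \<in> El W (ob X i). diff X i \<rhd> x = 0}"

text \<open>Epimorphisms of the test object play the role of coverings: a boundary has a preimage
  locally only.\<close>

definition bds :: "('a, 'b) complex_data \<Rightarrow> int \<Rightarrow> 'a \<Rightarrow> ('a, 'b, 'c, 'd) gelt set" where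
  "bds X i W = {x \<in> El W (ob X i).
     \<exists>V. \<exists>e\<in>epis V W. \<exists>y\<in>El V (ob X (i - 1)). x \<lhd> e = diff X (i - 1) \<rhd> y}"

lemma cycsI: "x \<in> El W (ob X i) \<Longrightarrow> diff X i \<rhd> x = 0 \<Longrightarrow> x \<in> cycs X i W"
  by (simp add: cycs_def)

lemma cycsD: assumes "x \<in> cycs X i W" shows "x \<in> El W (ob X i)" "diff X i \<rhd> x = 0"
  using assms by (auto simp: cycs_def)

lemma cycs_add: "x \<in> cycs X i W \<Longrightarrow> y \<in> cycs X i W \<Longrightarrow> x + y \<in> cycs X i W"
  by (simp add: cycs_def)

lemma cycs_uminus: "x \<in> cycs X i W \<Longrightarrow> - x \<in> cycs X i W"
  by (simp add: cycs_def)

lemma cycs_diff: "x \<in> cycs X i W \<Longrightarrow> y \<in> cycs X i W \<Longrightarrow> x - y \<in> cycs X i W"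
  by (simp add: cycs_def)

lemma cycs_ract: "x \<in> cycs X i W \<Longrightarrow> e \<in> hom C V W \<Longrightarrow> x \<lhd> e \<in> cycs X i V"
  using lact_ract[of "diff X i" x e] by (auto simp: cycs_def El_ract)

lemma cycs_chmap: "chmap f X Y \<Longrightarrow> x \<in> cycs X i W \<Longrightarrow> cpt f i \<rhd> x \<in> cycs Y i W"
  using chmap_commute by (auto simp: cycs_def El_chmap)

lemma cycs_boundary: "X \<in> complexes \<Longrightarrow> y \<in> El W (ob X (i - 1)) \<Longrightarrow> diff X (i - 1) \<rhd> y \<in> cycs X i W"
  by (simp add: cycs_def El_diff_prev)

lemma bdsI: "x \<in> El W (ob X i) \<Longrightarrow> e \<in> epis V W \<Longrightarrow> y \<in> El V (ob X (i - 1)) \<Longrightarrow>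
    x \<lhd> e = diff X (i - 1) \<rhd> y \<Longrightarrow> x \<in> bds X i W"
  by (auto simp: bds_def)

lemma bdsE:
  assumes "x \<in> bds X i W"
  obtains V e y where "x \<in> El W (ob X i)" "e \<in> epis V W" "y \<in> El V (ob X (i - 1))"
    "x \<lhd> e = diff X (i - 1) \<rhd> y"
  using assms by (auto simp: bds_def)

lemma bds_El: "x \<in> bds X i W \<Longrightarrow> x \<in> El W (ob X i)"
  by (simp add: bds_def)

lemma bds_boundary:
  assumes "X \<in> complexes" "y \<in> El W (ob X (i - 1))" shows "diff X (i - 1) \<rhd> y \<in> bds X i W"
  using assms El_obj[OF assms(2)] El_diff_prev[OF assms]
  by (intro bdsI[of _ W X i "\<one> W" W y]) (auto simp: epis_ident)

lemma bds_cycs: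
  assumes "X \<in> complexes" "x \<in> bds X i W" shows "x \<in> cycs X i W"
proof -
  obtain V e y where y: "x \<in> El W (ob X i)" "e \<in> epis V W" "y \<in> El V (ob X (i - 1))"
    "x \<lhd> e = diff X (i - 1) \<rhd> y" using bdsE[OF assms(2)] .
  have "(diff X i \<rhd> x) \<lhd> e = 0" using y(4) assms by simp
  then have "diff X i \<rhd> x = 0"
    using epis_cancel[OF y(2) El_lact[OF complexD(2)[OF assms(1)] y(1)]] by blast
  then show ?thesis using y(1) by (simp add: cycs_def)
qed

lemma bds_zero: "X \<in> complexes \<Longrightarrow> W \<in> Obj C \<Longrightarrow> 0 \<in> bds X i W"
  using bds_boundary[of X 0 W i] by simp

text \<open>A primitive of \<open>x\<close> lives over a cover of \<open>W\<close>. Over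
  \<open>U\<close> it lives over the pullback of that cover, which is again a cover.\<close>

lemma bds_ract:
  assumes "x \<in> bds X i W" "g \<in> hom C U W" shows "x \<lhd> g \<in> bds X i U"
proof -
  obtain V e y where y: "x \<in> El W (ob X i)" "e \<in> epis V W" "y \<in> El V (ob X (i - 1))"
    "x \<lhd> e = diff X (i - 1) \<rhd> y" using bdsE[OF assms(1)] .
  obtain P e' g' where p: "e' \<in> epis P U" "g' \<in> hom C P V" "e \<cdot> g' = g \<cdot> e'"
    using epis_pullback[OF y(2) assms(2)] .
  have "x \<lhd> g \<lhd> e' = x \<lhd> e \<lhd> g'"
    using ract_comp[of e' g x] ract_comp[of g' e x] p homD[OF p(2)] episD[OF p(1)] episD[OF y(2)]
      homD[OF assms(2)] by simp
  then have "x \<lhd> g \<lhd> e' = diff X (i - 1) \<rhd> (y \<lhd> g')" using y(4) by simp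
  then show ?thesis using bdsI[OF El_ract[OF y(1) assms(2)] p(1) El_ract[OF y(3) p(2)]] by simp
qed

text \<open>Covers compose, so a primitive over a cover of a cover is good enough. This removes the
  restrictions that accumulate in a diagram chase.\<close>

lemma bds_local:
  assumes "x \<in> El W (ob X i)" "e \<in> epis V W" "x \<lhd> e \<in> bds X i V" shows "x \<in> bds X i W"
proof -
  obtain U e' y where y: "e' \<in> epis U V" "y \<in> El U (ob X (i - 1))"
    "x \<lhd> e \<lhd> e' = diff X (i - 1) \<rhd> y" using bdsE[OF assms(3)] .
  have "x \<lhd> (e \<cdot> e') = diff X (i - 1) \<rhd> y"
    using y assms(2) by simp
  then show ?thesis using bdsI[OF assms(1) epis_comp[OF assms(2) y(1)] y(2)] by simp
qed

lemma bds_add: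
  assumes "X \<in> complexes" "x \<in> bds X i W" "y \<in> bds X i W" shows "x + y \<in> bds X i W"
proof -
  obtain V e x' where x: "x \<in> El W (ob X i)" "e \<in> epis V W" "x' \<in> El V (ob X (i - 1))"
    "x \<lhd> e = diff X (i - 1) \<rhd> x'" using bdsE[OF assms(2)] .
  have "y \<lhd> e \<in> bds X i V" using bds_ract[OF assms(3)] epis_hom x(2) by blast
  then obtain U e' y' where y: "e' \<in> epis U V" "y' \<in> El U (ob X (i - 1))"
    "y \<lhd> e \<lhd> e' = diff X (i - 1) \<rhd> y'" using bdsE by metis
  have "(x + y) \<lhd> (e \<cdot> e') = diff X (i - 1) \<rhd> (x' \<lhd> e' + y')"
    using x y by simp
  then show ?thesis
    using bdsI[OF El_add[OF x(1) bds_El[OF assms(3)]] epis_comp[OF x(2) y(1)]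
      El_add[OF El_ract[OF x(3) epis_hom[OF y(1)]] y(2)]] by simp
qed

lemma bds_uminus:
  assumes "x \<in> bds X i W" shows "- x \<in> bds X i W"
proof -
  obtain V e x' where x: "x \<in> El W (ob X i)" "e \<in> epis V W" "x' \<in> El V (ob X (i - 1))"
    "x \<lhd> e = diff X (i - 1) \<rhd> x'" using bdsE[OF assms] .
  then show ?thesis using bdsI[of "- x" W X i e V "- x'"] by simp
qed

lemma bds_diff:
  "X \<in> complexes \<Longrightarrow> x \<in> bds X i W \<Longrightarrow> y \<in> bds X i W \<Longrightarrow> x - y \<in> bds X i W"
  using bds_add[of X x i W "- y"] bds_uminus by simp

lemma bds_chmap:
  assumes "chmap f X Y" "x \<in> bds X i W" shows "cpt f i \<rhd> x \<in> bds Y i W"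
proof -
  obtain V e x' where x: "x \<in> El W (ob X i)" "e \<in> epis V W" "x' \<in> El V (ob X (i - 1))"
    "x \<lhd> e = diff X (i - 1) \<rhd> x'" using bdsE[OF assms(2)] .
  have "(cpt f i \<rhd> x) \<lhd> e = diff Y (i - 1) \<rhd> (cpt f (i - 1) \<rhd> x')"
    using x chmap_commute_prev[OF assms(1)] by simp
  then show ?thesis using bdsI[OF El_chmap[OF assms(1) x(1)] x(2) El_chmap[OF assms(1) x(3)]] by simp
qed

definition exact_at :: "('a, 'b) complex_data \<Rightarrow> int \<Rightarrow> bool" where
  "exact_at X i \<longleftrightarrow> (\<forall>W. cycs X i W \<subseteq> bds X i W)"

text \<open>Says that the arrow induced on the i-th cohomology is a monomorphism without naming a
  cohomology object; \<open>H_surj\<close> does so for epimorphisms. The two halves are kept apart,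
  and degree by degree, because truncation maps have them only in a range of degrees.\<close>

definition H_inj :: "('a, 'b) chain_map \<Rightarrow> int \<Rightarrow> bool" where
  "H_inj f i \<longleftrightarrow> (\<forall>W. \<forall>x\<in>cycs (src f) i W. cpt f i \<rhd> x \<in> bds (tgt f) i W \<longrightarrow> x \<in> bds (src f) i W)"

definition H_surj :: "('a, 'b) chain_map \<Rightarrow> int \<Rightarrow> bool" where
  "H_surj f i \<longleftrightarrow> (\<forall>W. \<forall>y\<in>cycs (tgt f) i W.
     \<exists>V. \<exists>e\<in>epis V W. \<exists>x\<in>cycs (src f) i V. y \<lhd> e - cpt f i \<rhd> x \<in> bds (tgt f) i V)"

lemma H_injD: "H_inj f i \<Longrightarrow> chmap f X Y \<Longrightarrow> x \<in> cycs X i W \<Longrightarrow> cpt f i \<rhd> x \<in> bds Y i W \<Longrightarrow> x \<in> bds X i W"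
  by (auto simp: H_inj_def chmap_ends)

lemma H_surjE:
  assumes "H_surj f i" "chmap f X Y" "y \<in> cycs Y i W"
  obtains V e x where "e \<in> epis V W" "x \<in> cycs X i V" "y \<lhd> e - cpt f i \<rhd> x \<in> bds Y i V"
proof -
  have "\<exists>V. \<exists>e\<in>epis V W. \<exists>x\<in>cycs X i V. y \<lhd> e - cpt f i \<rhd> x \<in> bds Y i V"
    using assms by (simp add: H_surj_def chmap_ends)
  then show ?thesis using that by blast
qed

lemma H_injI: "chmap f X Y \<Longrightarrow> (\<And>W x. x \<in> cycs X i W \<Longrightarrow> cpt f i \<rhd> x \<in> bds Y i W \<Longrightarrow> x \<in> bds X i W) \<Longrightarrow> H_inj f i"
  by (auto simp: H_inj_def chmap_ends)

lemma H_surjI: "chmap f X Y \<Longrightarrow>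
    (\<And>W y. y \<in> cycs Y i W \<Longrightarrow> \<exists>V. \<exists>e\<in>epis V W. \<exists>x\<in>cycs X i V. y \<lhd> e - cpt f i \<rhd> x \<in> bds Y i V) \<Longrightarrow> H_surj f i"
  by (auto simp: H_surj_def chmap_ends)

lemma exact_atD: "exact_at X i \<Longrightarrow> x \<in> cycs X i W \<Longrightarrow> x \<in> bds X i W"
  by (auto simp: exact_at_def)

section \<open>Cohomology objects in terms of cocycles and coboundaries\<close>

lemma cohom_data_ex:
  assumes "X \<in> complexes" shows "\<exists>kp. cohom_data C X i kp"
proof -
  note d = complexD(2)[OF assms, of i] and d' = complexD(2)[OF assms, of "i - 1", simplified]
  obtain k where k: "is_kernel C k (diff X i)" using ex_kernel homD(1)[OF d] by blast
  note kD = kernelD[OF k d]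
  have "diff X i \<rhd> emb (diff X (i - 1)) = 0"
    using emb_ident_lact[OF d'] complexD(4)[OF assms, of i "emb (\<one> (ob X (i - 1)))"] by simp
  then obtain z where z: "z \<in> El (ob X (i - 1)) (Dom C k)" "k \<rhd> z = emb (diff X (i - 1))"
    using kD(4)[OF emb_El[OF d']] by blast
  obtain j where j: "j \<in> hom C (ob X (i - 1)) (Dom C k)" "z = emb j" using El_obtain[OF z(1)] .
  have "k \<cdot> j = diff X (i - 1)"
    using emb_inj[OF comp_hom[OF j(1) kD(1)] d'] z j emb_comp_lact[OF j(1) kD(1)] by simp
  moreover obtain p where "is_cokernel C p j" using ex_cokernel homD(1)[OF j(1)] by blast
  ultimately have "cohom_data C X i (k, p)" using k j(1) unfolding cohom_data_def by auto
  then show ?thesis by blast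
qed

text \<open>The dictionary between a pair (k, p) and elements: \<open>k\<close> identifies the
  elements of its domain with the cocycles, and those killed by \<open>p\<close> are the
  coboundaries. The latter rests on \<open>cokernel_lift\<close>, which produces primitives over a
  cover. The last fact is the universal property of the quotient by coboundaries.\<close>

lemma cohom_dataD:
  assumes "X \<in> complexes" "cohom_data C X i (k, p)"
  shows "k \<in> hom C (Dom C k) (ob X i)" "p \<in> epis (Dom C k) (Cod C p)"
    "z \<in> El W (Dom C k) \<Longrightarrow> k \<rhd> z \<in> cycs X i W"
    "x \<in> cycs X i W \<Longrightarrow> \<exists>z\<in>El W (Dom C k). k \<rhd> z = x"
    "z \<in> El W (Dom C k) \<Longrightarrow> k \<rhd> z = 0 \<Longrightarrow> z = 0"
    "z \<in> El W (Dom C k) \<Longrightarrow> p \<rhd> z = 0 \<longleftrightarrow> k \<rhd> z \<in> bds X i W"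
    "g \<in> hom C (Dom C k) V \<Longrightarrow> (\<And>W z. z \<in> El W (Dom C k) \<Longrightarrow> k \<rhd> z \<in> bds X i W \<Longrightarrow> g \<rhd> z = 0) \<Longrightarrow>
       \<exists>u\<in>hom C (Cod C p) V. u \<cdot> p = g"
proof -
  note d = complexD(2)[OF assms(1), of i] and d' = complexD(2)[OF assms(1), of "i - 1", simplified]
  obtain j where j: "j \<in> hom C (ob X (i - 1)) (Dom C k)" "k \<cdot> j = diff X (i - 1)" "is_cokernel C p j"
    and k: "is_kernel C k (diff X i)" using assms(2) unfolding cohom_data_def by auto
  note kD = kernelD[OF k d]
  note pD = cokernelD[OF j(3) j(1)]
  have kj: "k \<rhd> (j \<rhd> y) = diff X (i - 1) \<rhd> y" for y
    using lact_comp[of j k y] j homD[OF j(1)] homD[OF kD(1)] by simp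
  show k0: "k \<in> hom C (Dom C k) (ob X i)" using kD(1) .
  show p0: "p \<in> epis (Dom C k) (Cod C p)" using pD(3) .
  show "z \<in> El W (Dom C k) \<Longrightarrow> k \<rhd> z \<in> cycs X i W" using kD(2) El_lact[OF kD(1)] by (simp add: cycs_def)
  show "x \<in> cycs X i W \<Longrightarrow> \<exists>z\<in>El W (Dom C k). k \<rhd> z = x" using kD(4) by (auto simp: cycs_def)
  show k1: "z \<in> El W (Dom C k) \<Longrightarrow> k \<rhd> z = 0 \<Longrightarrow> z = 0" for z W using kD(3) .
  show "p \<rhd> z = 0 \<longleftrightarrow> k \<rhd> z \<in> bds X i W" if z: "z \<in> El W (Dom C k)"
  proof
    assume "p \<rhd> z = 0"
    then obtain V e y where y: "e \<in> epis V W" "y \<in> El V (ob X (i - 1))" "j \<rhd> y = z \<lhd> e"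
      using cokernel_lift[OF j(3) j(1) z] by blast
    have "(k \<rhd> z) \<lhd> e = diff X (i - 1) \<rhd> y" using kj[of y] y(3) by simp
    then show "k \<rhd> z \<in> bds X i W" using bdsI[OF El_lact[OF kD(1) z] y(1,2)] by simp
  next
    assume "k \<rhd> z \<in> bds X i W"
    then obtain V e y where y: "e \<in> epis V W" "y \<in> El V (ob X (i - 1))"
      "(k \<rhd> z) \<lhd> e = diff X (i - 1) \<rhd> y" using bdsE by metis
    have "k \<rhd> (z \<lhd> e - j \<rhd> y) = 0" using y kj by simp
    then have "z \<lhd> e = j \<rhd> y"
      using k1[OF El_diff[OF El_ract[OF z epis_hom[OF y(1)]] El_lact[OF j(1) y(2)]]] by simp
    then have "(p \<rhd> z) \<lhd> e = 0" using pD(2) by simp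
    then show "p \<rhd> z = 0" using epis_cancel[OF y(1) El_lact[OF pD(1) z]] by blast
  qed
  show "\<exists>u\<in>hom C (Cod C p) V. u \<cdot> p = g"
    if g: "g \<in> hom C (Dom C k) V" "\<And>W z. z \<in> El W (Dom C k) \<Longrightarrow> k \<rhd> z \<in> bds X i W \<Longrightarrow> g \<rhd> z = 0"
  proof -
    have "g \<cdot> j = Null C (ob X (i - 1)) V"
    proof (rule arr_eqI)
      show "g \<cdot> j \<in> hom C (ob X (i - 1)) V" using comp_hom j(1) g(1) .
      show "Null C (ob X (i - 1)) V \<in> hom C (ob X (i - 1)) V" using null_hom homD(4)[OF j(1)] homD(5)[OF g(1)] .
      fix y W assume y: "y \<in> El W (ob X (i - 1))"
      have "k \<rhd> (j \<rhd> y) \<in> bds X i W" unfolding kj using bds_boundary assms(1) y .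
      then have "g \<rhd> (j \<rhd> y) = 0" using g(2) El_lact[OF j(1) y] by blast
      then show "(g \<cdot> j) \<rhd> y = Null C (ob X (i - 1)) V \<rhd> y"
        using homD[OF j(1)] homD[OF g(1)] by simp
    qed
    then show ?thesis using pD(4) g(1) by blast
  qed
qed

text \<open>The induced arrow exists since chain maps preserve cocycles and coboundaries; it is
  unique since \<open>k'\<close> is mono and \<open>p\<close> is epi. Translating elements along
  \<open>k\<close> and \<open>p\<close> turns mono and epi into \<open>H_inj\<close> and
  \<open>H_surj\<close>, and an arrow that is both is invertible.\<close>

lemma cohom_data_map:
  assumes "chmap f X Y" "cohom_data C X i (k, p)" "cohom_data C Y i (k', p')"
  shows "\<exists>!h. h \<in> hom C (Cod C p) (Cod C p') \<and>
      (\<exists>u\<in>hom C (Dom C k) (Dom C k'). k' \<cdot> u = cpt f i \<cdot> k \<and> h \<cdot> p = p' \<cdot> u)"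
    and "h \<in> hom C (Cod C p) (Cod C p') \<Longrightarrow>
      \<exists>u\<in>hom C (Dom C k) (Dom C k'). k' \<cdot> u = cpt f i \<cdot> k \<and> h \<cdot> p = p' \<cdot> u \<Longrightarrow>
      is_iso C h \<longleftrightarrow> H_inj f i \<and> H_surj f i"
proof -
  note XY = chmapD(1,2)[OF assms(1)]
  note f = chmapD(3)[OF assms(1), of i]
  note a = cohom_dataD[OF XY(1) assms(2)] and b = cohom_dataD[OF XY(2) assms(3)]
  note pe = epis_hom[OF a(2)] and pe' = epis_hom[OF b(2)]
  let ?P = "\<lambda>u. u\<in>hom C (Dom C k) (Dom C k') \<and> k' \<cdot> u = cpt f i \<cdot> k"
  have uE: "k' \<rhd> (u \<rhd> z) = cpt f i \<rhd> (k \<rhd> z)" if "?P u" for u z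
    using lact_comp[of u k' z] lact_comp[of k "cpt f i" z] that homD[OF a(1)] homD[OF b(1)] homD[OF f]
      homD[of u "Dom C k" "Dom C k'"] by simp
  obtain u where u: "?P u"
  proof -
    have "cpt f i \<rhd> emb k \<in> cycs Y i (Dom C k)"
      using cycs_chmap[OF assms(1) a(3)[OF emb_El[OF ident_hom[OF homD(4)[OF a(1)]]]]] emb_ident_lact[OF a(1)]
      by simp
    then obtain z where z: "z \<in> El (Dom C k) (Dom C k')" "k' \<rhd> z = cpt f i \<rhd> emb k" using b(4) by blast
    obtain u where u: "u \<in> hom C (Dom C k) (Dom C k')" "z = emb u" using El_obtain[OF z(1)] .
    have "k' \<cdot> u = cpt f i \<cdot> k"
      using emb_inj[OF comp_hom[OF u(1) b(1)] comp_hom[OF a(1) f]] z u emb_comp_lact[OF u(1) b(1)]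
        emb_comp_lact[OF a(1) f] by simp
    then show ?thesis using u that by blast
  qed
  have uu: "v = u" if "?P v" for v
  proof (rule arr_eqI)
    show vh: "v \<in> hom C (Dom C k) (Dom C k')" and uh: "u \<in> hom C (Dom C k) (Dom C k')" using that u by auto
    fix x W assume x: "x \<in> El W (Dom C k)"
    have "k' \<rhd> (v \<rhd> x - u \<rhd> x) = 0" using uE that u by simp
    then have "v \<rhd> x - u \<rhd> x = 0" using b(5)[OF El_diff[OF El_lact[OF vh x] El_lact[OF uh x]]] by blast
    then show "v \<rhd> x = u \<rhd> x" by simp
  qed
  have uh: "u \<in> hom C (Dom C k) (Dom C k')" using u by simp
  have pu: "p' \<cdot> u \<in> hom C (Dom C k) (Cod C p')" using comp_hom uh pe' .
  have pux: "(p' \<cdot> u) \<rhd> z = p' \<rhd> (u \<rhd> z)" for z using homD[OF uh] homD[OF pe'] by simp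
  have "\<exists>h\<in>hom C (Cod C p) (Cod C p'). h \<cdot> p = p' \<cdot> u"
  proof (rule a(7)[OF pu])
    fix W z assume z: "z \<in> El W (Dom C k)" "k \<rhd> z \<in> bds X i W"
    then have "k' \<rhd> (u \<rhd> z) \<in> bds Y i W" using uE[OF u] bds_chmap[OF assms(1)] by simp
    then show "(p' \<cdot> u) \<rhd> z = 0" using pux b(6)[OF El_lact[OF uh z(1)]] by simp
  qed
  then obtain g where g: "g \<in> hom C (Cod C p) (Cod C p')" "g \<cdot> p = p' \<cdot> u" by blast
  have "h' = g" if h': "h' \<in> hom C (Cod C p) (Cod C p')" "h' \<cdot> p = p' \<cdot> u" for h'
  proof -
    have "emb h' \<lhd> p = emb g \<lhd> p" using emb_comp_ract[OF pe] g h' by metis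
    then show ?thesis using epis_cancel_eq[OF a(2) emb_El[OF h'(1)] emb_El[OF g(1)]] emb_inj[OF h'(1) g(1)] by blast
  qed
  then show "\<exists>!h. h \<in> hom C (Cod C p) (Cod C p') \<and>
      (\<exists>u\<in>hom C (Dom C k) (Dom C k'). k' \<cdot> u = cpt f i \<cdot> k \<and> h \<cdot> p = p' \<cdot> u)"
    using g u uu by metis
  assume h: "h \<in> hom C (Cod C p) (Cod C p')"
    and "\<exists>u\<in>hom C (Dom C k) (Dom C k'). k' \<cdot> u = cpt f i \<cdot> k \<and> h \<cdot> p = p' \<cdot> u"
  then have hp: "h \<cdot> p = p' \<cdot> u" using uu by metis
  have hpx: "h \<rhd> (p \<rhd> z) = p' \<rhd> (u \<rhd> z)" for z
    using lact_comp[of p h z] pux hp homD[OF h] homD[OF pe] by simp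
  have ux: "k' \<rhd> (u \<rhd> z) = cpt f i \<rhd> (k \<rhd> z)" for z using uE[OF u] .
  have 1: "H_inj f i \<longleftrightarrow> is_mono C h"
  proof
    assume inj: "H_inj f i"
    show "is_mono C h"
      unfolding mono_iff[OF h]
    proof (intro allI ballI impI)
      fix W x assume x: "x \<in> El W (Cod C p)" "h \<rhd> x = 0"
      obtain V e z where z: "e \<in> epis V W" "z \<in> El V (Dom C k)" "p \<rhd> z = x \<lhd> e"
        using epi_lift[OF a(2) x(1)] .
      have "p' \<rhd> (u \<rhd> z) = (h \<rhd> x) \<lhd> e" using z(3) hpx[of z] by simp
      then have "p' \<rhd> (u \<rhd> z) = 0" using x by simp
      then have "cpt f i \<rhd> (k \<rhd> z) \<in> bds Y i V" using b(6)[OF El_lact[OF uh z(2)]] ux by simp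
      then have "k \<rhd> z \<in> bds X i V" using H_injD[OF inj assms(1) a(3)[OF z(2)]] by blast
      then have "x \<lhd> e = 0" using a(6)[OF z(2)] z(3) by simp
      then show "x = 0" using epis_cancel z x by blast
    qed
  next
    assume m: "is_mono C h"
    show "H_inj f i"
    proof (rule H_injI[OF assms(1)])
      fix W x assume x: "x \<in> cycs X i W" "cpt f i \<rhd> x \<in> bds Y i W"
      obtain z where z: "z \<in> El W (Dom C k)" "k \<rhd> z = x" using a(4)[OF x(1)] by blast
      have "h \<rhd> (p \<rhd> z) = 0" using b(6)[OF El_lact[OF uh z(1)]] ux x z hpx by simp
      then have "p \<rhd> z = 0" using m El_lact[OF pe z(1)] unfolding mono_iff[OF h] by blast
      then show "x \<in> bds X i W" using a(6)[OF z(1)] z by simp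
    qed
  qed
  have 2: "H_surj f i \<longleftrightarrow> h \<in> epis (Cod C p) (Cod C p')"
  proof
    assume s: "H_surj f i"
    show "h \<in> epis (Cod C p) (Cod C p')"
    proof (rule episI_lift[OF h])
      fix y W assume y: "y \<in> El W (Cod C p')"
      obtain V e z where z: "e \<in> epis V W" "z \<in> El V (Dom C k')" "p' \<rhd> z = y \<lhd> e"
        using epi_lift[OF b(2) y] .
      obtain U e' x where x: "e' \<in> epis U V" "x \<in> cycs X i U" "(k' \<rhd> z) \<lhd> e' - cpt f i \<rhd> x \<in> bds Y i U"
        using H_surjE[OF s assms(1) b(3)[OF z(2)]] .
      obtain w where w: "w \<in> El U (Dom C k)" "k \<rhd> w = x" using a(4)[OF x(2)] by blast
      have "k' \<rhd> (z \<lhd> e' - u \<rhd> w) \<in> bds Y i U" using x(3) w ux by simp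
      then have "p' \<rhd> (z \<lhd> e' - u \<rhd> w) = 0"
        using b(6)[OF El_diff[OF El_ract[OF z(2) epis_hom[OF x(1)]] El_lact[OF uh w(1)]]] by simp
      then have "h \<rhd> (p \<rhd> w) = (p' \<rhd> z) \<lhd> e'" using hpx by simp
      then have "h \<rhd> (p \<rhd> w) = y \<lhd> (e \<cdot> e')" using z(1,3) x(1) epis_hom by simp
      then show "\<exists>V e x. e \<in> epis V W \<and> x \<in> El V (Cod C p) \<and> h \<rhd> x = y \<lhd> e"
        using epis_comp[OF z(1) x(1)] El_lact[OF pe w(1)] by blast
    qed
  next
    assume he: "h \<in> epis (Cod C p) (Cod C p')"
    show "H_surj f i"
    proof (rule H_surjI[OF assms(1)])
      fix W y assume y: "y \<in> cycs Y i W"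
      obtain z where z: "z \<in> El W (Dom C k')" "k' \<rhd> z = y" using b(4)[OF y] by blast
      obtain V e q where q: "e \<in> epis V W" "q \<in> El V (Cod C p)" "h \<rhd> q = (p' \<rhd> z) \<lhd> e"
        using epi_lift[OF he El_lact[OF pe' z(1)]] .
      obtain U e' w where w: "e' \<in> epis U V" "w \<in> El U (Dom C k)" "p \<rhd> w = q \<lhd> e'"
        using epi_lift[OF a(2) q(2)] .
      have ee: "e \<cdot> e' \<in> epis U W" using epis_comp q w by blast
      have "p' \<rhd> (u \<rhd> w) = (h \<rhd> q) \<lhd> e'" using hpx[of w] w(3) by simp
      then have "p' \<rhd> (z \<lhd> (e \<cdot> e') - u \<rhd> w) = 0" using q(1,3) w(1) epis_hom by simp
      then have "k' \<rhd> (z \<lhd> (e \<cdot> e') - u \<rhd> w) \<in> bds Y i U"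
        using b(6)[OF El_diff[OF El_ract[OF z(1) epis_hom[OF ee]] El_lact[OF uh w(2)]]] by simp
      then have "y \<lhd> (e \<cdot> e') - cpt f i \<rhd> (k \<rhd> w) \<in> bds Y i U" using z ux by (simp flip: lact_ract)
      then show "\<exists>V. \<exists>e\<in>epis V W. \<exists>x\<in>cycs X i V. y \<lhd> e - cpt f i \<rhd> x \<in> bds Y i V"
        using ee a(3)[OF w(2)] by blast
    qed
  qed
  show "is_iso C h \<longleftrightarrow> H_inj f i \<and> H_surj f i"
    using 1 2 iso_mono_epi[OF h] mono_epi_iso[OF h] by (auto simp: epis_def)
qed

lemma cohom_data_choice: "X \<in> complexes \<Longrightarrow> cohom_data C X i (cohom_choice C X i)"
  unfolding cohom_choice_def using someI_ex[OF cohom_data_ex] .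

lemma cohom_data_isomorphic:
  assumes "chmap f X Y" "H_inj f i" "H_surj f i" "cohom_data C X i (k, p)" "cohom_data C Y i (k', p')"
  shows "isomorphic C (Cod C p) (Cod C p')"
  using cohom_data_map[OF assms(1,4,5)] assms(2,3) isomorphicI by blast

definition qis :: "('a, 'b) chain_map \<Rightarrow> bool" where
  "qis f \<longleftrightarrow> f \<in> chain_maps C \<and> (\<forall>i. H_inj f i \<and> H_surj f i)"

lemma chain_maps_chmap: "f \<in> chain_maps C \<longleftrightarrow> chmap f (src f) (tgt f)"
  unfolding chmap_def by blast

lemma cohom_map_iso_iff:
  assumes "chmap f X Y" shows "is_iso C (cohom_map C i f) \<longleftrightarrow> H_inj f i \<and> H_surj f i"
proof -
  obtain k p where kp: "cohom_choice C X i = (k, p)" by force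
  obtain k' p' where kp': "cohom_choice C Y i = (k', p')" by force
  have d: "cohom_data C X i (k, p)" "cohom_data C Y i (k', p')"
    using cohom_data_choice[of X i] cohom_data_choice[of Y i] kp kp' chmapD[OF assms] by simp_all
  have "cohom_map C i f = (THE h. h \<in> hom C (Cod C p) (Cod C p') \<and>
      (\<exists>u\<in>hom C (Dom C k) (Dom C k'). k' \<cdot> u = cpt f i \<cdot> k \<and> h \<cdot> p = p' \<cdot> u))"
    using assms by (simp add: cohom_map_def cohom_def kp kp' chmap_ends)
  then have "cohom_map C i f \<in> hom C (Cod C p) (Cod C p') \<and>
      (\<exists>u\<in>hom C (Dom C k) (Dom C k'). k' \<cdot> u = cpt f i \<cdot> k \<and> cohom_map C i f \<cdot> p = p' \<cdot> u)"
    using theI'[OF cohom_data_map(1)[OF assms d]] by simp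
  then show ?thesis using cohom_data_map(2)[OF assms d] by blast
qed

lemma quasi_isos_eq: "quasi_isos C = {f. qis f}"
  using cohom_map_iso_iff chain_maps_chmap by (auto simp: quasi_isos_def qis_def)

lemma cohom_isomorphic:
  assumes "chmap f X Y" "H_inj f i" "H_surj f i" shows "isomorphic C (cohom C i X) (cohom C i Y)"
  using cohom_data_isomorphic[OF assms, of "fst (cohom_choice C X i)" "snd (cohom_choice C X i)"
    "fst (cohom_choice C Y i)" "snd (cohom_choice C Y i)"] cohom_data_choice chmapD[OF assms(1)]
  by (simp add: cohom_def)

lemma zero_cohom_iff:
  assumes "X \<in> complexes" shows "zero_object C (cohom C i X) \<longleftrightarrow> exact_at X i"
proof -
  obtain k p where kp: "cohom_choice C X i = (k, p)" by force
  have d: "cohom_data C X i (k, p)" using cohom_data_choice[OF assms, of i] kp by simp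
  note a = cohom_dataD[OF assms d]
  have c: "cohom C i X = Cod C p" by (simp add: cohom_def kp)
  have o: "Cod C p \<in> Obj C" using episD[OF a(2)] by simp
  show ?thesis
    unfolding c zero_object_iff[OF o]
  proof
    assume z: "\<forall>W. \<forall>x\<in>El W (Cod C p). x = 0"
    show "exact_at X i"
      unfolding exact_at_def
    proof (intro allI subsetI)
      fix W x assume x: "x \<in> cycs X i W"
      obtain y where y: "y \<in> El W (Dom C k)" "k \<rhd> y = x" using a(4)[OF x] by blast
      have "p \<rhd> y = 0" using z El_lact[OF epis_hom[OF a(2)] y(1)] by blast
      then show "x \<in> bds X i W" using a(6)[OF y(1)] y by simp
    qed
  next
    assume e: "exact_at X i"
    show "\<forall>W. \<forall>x\<in>El W (Cod C p). x = 0"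
    proof (intro allI ballI)
      fix W x assume x: "x \<in> El W (Cod C p)"
      obtain V e z where z: "e \<in> epis V W" "z \<in> El V (Dom C k)" "p \<rhd> z = x \<lhd> e" using epi_lift[OF a(2) x] .
      have "x \<lhd> e = 0" using exact_atD[OF e a(3)[OF z(2)]] a(6)[OF z(2)] z(3) by simp
      then show "x = 0" using epis_cancel z x by blast
    qed
  qed
qed

end

text \<open>The shifts considered are those by 1 and -1. Both change the sign of the differential,
  so the lemmas on shifts treat the two values together.\<close>

lemma powi_unit_one: "n = 1 \<or> n = - 1 \<Longrightarrow> (- 1 :: 'k::field) powi n = - 1"
  by auto

section \<open>Chain homotopies\<close>

context abelian_category
begin

definition htpy :: "('a, 'b) complex_data \<Rightarrow> ('a, 'b) complex_data \<Rightarrow> ('a, 'b) chain_map \<Rightarrow> ('a, 'b) chain_map \<Rightarrow> (int \<Rightarrow> 'b) \<Rightarrow> bool" where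
  "htpy X Y f g h \<longleftrightarrow> chmap f X Y \<and> chmap g X Y \<and> (\<forall>i. h i \<in> hom C (ob X i) (ob Y (i - 1))) \<and>
     (\<forall>i W. \<forall>x\<in>El W (ob X i).
        cpt f i \<rhd> x = cpt g i \<rhd> x + diff Y (i - 1) \<rhd> h i \<rhd> x + h (i + 1) \<rhd> diff X i \<rhd> x)"

text \<open>Homotopy as a relation on bare chain maps: a chain map records its source and target, so
  these can be hidden here and recovered by \<open>hpicE\<close>.\<close>

definition hpic :: "('a, 'b) chain_map \<Rightarrow> ('a, 'b) chain_map \<Rightarrow> bool" where
  "hpic f g \<longleftrightarrow> (\<exists>X Y h. htpy X Y f g h)"

lemma htpyD:
  assumes "htpy X Y f g h"
  shows "chmap g X Y" "h i \<in> hom C (ob X i) (ob Y (i - 1))"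
    "x \<in> El W (ob X i) \<Longrightarrow>
      cpt f i \<rhd> x = cpt g i \<rhd> x + diff Y (i - 1) \<rhd> h i \<rhd> x + h (i + 1) \<rhd> diff X i \<rhd> x"
  using assms by (auto simp: htpy_def)

lemma hpicI:
  assumes "chmap f X Y" "chmap g X Y" "\<And>i. h i \<in> hom C (ob X i) (ob Y (i - 1))"
    "\<And>i W x. x \<in> El W (ob X i) \<Longrightarrow>
      cpt f i \<rhd> x = cpt g i \<rhd> x + diff Y (i - 1) \<rhd> h i \<rhd> x + h (i + 1) \<rhd> diff X i \<rhd> x"
  shows "hpic f g"
proof -
  have "htpy X Y f g h" unfolding htpy_def using assms by auto
  then show ?thesis unfolding hpic_def by blast
qed

lemma hpicE:
  assumes "hpic f g" "chmap f X Y"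
  obtains h where "htpy X Y f g h"
proof -
  obtain X' Y' h where h: "htpy X' Y' f g h" using assms(1) unfolding hpic_def by blast
  then have "chmap f X' Y'" by (simp add: htpy_def)
  then have "X' = X" "Y' = Y" using chmap_unique[OF assms(2)] by auto
  then show ?thesis using that h by blast
qed

lemma hpic_obtain: assumes "hpic f g" obtains X Y where "chmap f X Y"
  using assms unfolding hpic_def htpy_def by blast

lemma hpic_chmap: "hpic f g \<Longrightarrow> chmap f X Y \<Longrightarrow> chmap g X Y" "hpic f g \<Longrightarrow> chmap g X Y \<Longrightarrow> chmap f X Y"
  using chmap_unique unfolding hpic_def htpy_def by blast+

lemma hpic_refl: assumes "chmap f X Y" shows "hpic f f"
proof (rule hpicI[OF assms assms, of "\<lambda>i. Null C (ob X i) (ob Y (i - 1))"])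
  fix i note c = chmapD[OF assms]
  show "Null C (ob X i) (ob Y (i - 1)) \<in> hom C (ob X i) (ob Y (i - 1))" using null_hom c by simp
  show "cpt f i \<rhd> x = cpt f i \<rhd> x + diff Y (i - 1) \<rhd> Null C (ob X i) (ob Y (i - 1)) \<rhd> x +
      Null C (ob X (i + 1)) (ob Y (i + 1 - 1)) \<rhd> diff X i \<rhd> x" for x using c(1,2) by simp
qed

lemma hpic_sym: assumes "hpic f g" shows "hpic g f"
proof -
  obtain X Y where f: "chmap f X Y" using hpic_obtain[OF assms] .
  obtain h where h0: "htpy X Y f g h" using hpicE[OF assms f] .
  note h = htpyD[OF h0]
  show ?thesis
  proof (rule hpicI[OF h(1) f, of "\<lambda>i. (- 1) \<odot> h i"])
    fix i
    show "(- 1) \<odot> h i \<in> hom C (ob X i) (ob Y (i - 1))" using scale_hom h(2) .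
    show "cpt g i \<rhd> x = cpt f i \<rhd> x + diff Y (i - 1) \<rhd> (- 1 \<odot> h i) \<rhd> x + (- 1 \<odot> h (i + 1)) \<rhd> diff X i \<rhd> x"
      if "x \<in> El W (ob X i)" for x W
      using h(3)[OF that] homD(1)[OF h(2)[of i]] homD(1)[OF h(2)[of "i + 1"]] by simp
  qed
qed

lemma hpic_trans: assumes "hpic f g" "hpic g k" shows "hpic f k"
proof -
  obtain X Y where f: "chmap f X Y" using hpic_obtain[OF assms(1)] .
  obtain h where h0: "htpy X Y f g h" using hpicE[OF assms(1) f] .
  note h = htpyD[OF h0]
  obtain h' where h'0: "htpy X Y g k h'" using hpicE[OF assms(2) h(1)] .
  note h' = htpyD[OF h'0]
  show ?thesis
  proof (rule hpicI[OF f h'(1), of "\<lambda>i. h i \<oplus> h' i"])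
    fix i
    show "h i \<oplus> h' i \<in> hom C (ob X i) (ob Y (i - 1))" using plus_hom h(2) h'(2) .
    show "cpt f i \<rhd> x = cpt k i \<rhd> x + diff Y (i - 1) \<rhd> (h i \<oplus> h' i) \<rhd> x + (h (i + 1) \<oplus> h' (i + 1)) \<rhd> diff X i \<rhd> x"
      if "x \<in> El W (ob X i)" for x W
      using h(3)[OF that] h'(3)[OF that] homD[OF h(2)[of i]] homD[OF h(2)[of "i + 1"]]
        homD[OF h'(2)[of i]] homD[OF h'(2)[of "i + 1"]] by simp
  qed
qed

definition ccomp :: "('a, 'b) chain_map \<Rightarrow> ('a, 'b) chain_map \<Rightarrow> ('a, 'b) chain_map" where
  "ccomp g f = \<lparr>src = src f, tgt = tgt g, cpt = (\<lambda>i. cpt g i \<cdot> cpt f i)\<rparr>"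

definition cnull :: "('a, 'b) complex_data \<Rightarrow> ('a, 'b) complex_data \<Rightarrow> ('a, 'b) chain_map" where
  "cnull X Y = \<lparr>src = X, tgt = Y, cpt = (\<lambda>i. Null C (ob X i) (ob Y i))\<rparr>"

definition cident :: "('a, 'b) complex_data \<Rightarrow> ('a, 'b) chain_map" where
  "cident X = \<lparr>src = X, tgt = X, cpt = (\<lambda>i. \<one> (ob X i))\<rparr>"

definition csub :: "('a, 'b) chain_map \<Rightarrow> ('a, 'b) chain_map \<Rightarrow> ('a, 'b) chain_map" where
  "csub f g = \<lparr>src = src f, tgt = tgt f, cpt = (\<lambda>i. cpt f i \<oplus> (- 1) \<odot> cpt g i)\<rparr>"

lemma cpt_ccomp [simp]:
  assumes "chmap f X Y" "chmap g Y Z"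
  shows "cpt (ccomp g f) i \<rhd> x = cpt g i \<rhd> cpt f i \<rhd> x"
  using assms by (simp add: ccomp_def)

lemma cpt_cnull [simp]:
  "X \<in> complexes \<Longrightarrow> Y \<in> complexes \<Longrightarrow> cpt (cnull X Y) i \<rhd> x = 0"
  by (simp add: cnull_def)

lemma cpt_cident [simp]: "x \<in> El W (ob X i) \<Longrightarrow> cpt (cident X) i \<rhd> x = x"
  by (simp add: cident_def)

lemma cpt_csub [simp]:
  assumes "chmap f X Y" "chmap g X Y" shows "cpt (csub f g) i \<rhd> x = cpt f i \<rhd> x - cpt g i \<rhd> x"
  using assms by (simp add: csub_def)

lemma chmap_ccomp: assumes "chmap f X Y" "chmap g Y Z" shows "chmap (ccomp g f) X Z"
proof (rule chmapI)
  fix i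
  show "cpt (ccomp g f) i \<in> hom C (ob X i) (ob Z i)"
    using comp_hom[OF chmapD(3)[OF assms(1)] chmapD(3)[OF assms(2)]] by (simp add: ccomp_def)
  show "diff Z i \<rhd> cpt (ccomp g f) i \<rhd> x = cpt (ccomp g f) (i + 1) \<rhd> diff X i \<rhd> x" for x
    using assms by (simp add: chmap_commute[OF assms(1)] chmap_commute[OF assms(2)])
qed (use assms chmapD(1,2)[OF assms(1)] chmapD(1,2)[OF assms(2)] in \<open>auto simp: ccomp_def chmap_ends\<close>)

lemma chmap_cnull: "X \<in> complexes \<Longrightarrow> Y \<in> complexes \<Longrightarrow> chmap (cnull X Y) X Y"
  by (rule chmapI) (auto simp: null_hom, auto simp: cnull_def null_hom)

lemma chmap_cident: "X \<in> complexes \<Longrightarrow> chmap (cident X) X X"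
proof (rule chmapI)
  fix i W x assume X: "X \<in> complexes" and x: "x \<in> El W (ob X i)"
  have "diff X i \<rhd> x \<in> El W (ob X (i + 1))" using El_lact complexD(2) X x by blast
  then show "diff X i \<rhd> cpt (cident X) i \<rhd> x = cpt (cident X) (i + 1) \<rhd> diff X i \<rhd> x" using x by simp
qed (auto simp: cident_def ident_hom)

lemma chmap_csub: assumes "chmap f X Y" "chmap g X Y" shows "chmap (csub f g) X Y"
proof (rule chmapI)
  fix i
  show "cpt (csub f g) i \<in> hom C (ob X i) (ob Y i)"
    using plus_hom[OF chmapD(3)[OF assms(1)] scale_hom[OF chmapD(3)[OF assms(2)]]] by (simp add: csub_def)
  show "diff Y i \<rhd> cpt (csub f g) i \<rhd> x = cpt (csub f g) (i + 1) \<rhd> diff X i \<rhd> x" for x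
    using assms by (simp add: chmap_commute[OF assms(1)] chmap_commute[OF assms(2)])
qed (use assms chmapD(1,2)[OF assms(1)] in \<open>auto simp: csub_def chmap_ends\<close>)

lemma hpic_eqI:
  assumes "chmap f X Y" "chmap g X Y" "\<And>i W x. x \<in> El W (ob X i) \<Longrightarrow> cpt f i \<rhd> x = cpt g i \<rhd> x"
  shows "hpic f g"
proof -
  obtain h where h0: "htpy X Y g g h" using hpicE[OF hpic_refl[OF assms(2)] assms(2)] .
  note h = htpyD[OF h0]
  show ?thesis using assms(3) h(3) by (intro hpicI[OF assms(1,2) h(2)]) simp
qed

lemma hpic_ccomp_left:
  assumes "hpic f g" "chmap f X Y" "chmap k Y Z" shows "hpic (ccomp k f) (ccomp k g)"
proof -
  obtain h where h0: "htpy X Y f g h" using hpicE[OF assms(1,2)] .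
  note h = htpyD[OF h0]
  show ?thesis
  proof (rule hpicI[OF chmap_ccomp[OF assms(2,3)] chmap_ccomp[OF h(1) assms(3)], of "\<lambda>i. cpt k (i - 1) \<cdot> h i"])
    fix i
    show "cpt k (i - 1) \<cdot> h i \<in> hom C (ob X i) (ob Z (i - 1))" using comp_hom h(2) chmapD(3) assms(3) by blast
    show "cpt (ccomp k f) i \<rhd> x = cpt (ccomp k g) i \<rhd> x + diff Z (i - 1) \<rhd> (cpt k (i - 1) \<cdot> h i) \<rhd> x
       + (cpt k (i + 1 - 1) \<cdot> h (i + 1)) \<rhd> diff X i \<rhd> x" if "x \<in> El W (ob X i)" for x W
      using h(3)[OF that] homD[OF h(2)[of i]] homD[OF h(2)[of "i + 1"]] assms h(1)
      by (simp add: chmap_commute_prev[OF assms(3)])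
  qed
qed

lemma hpic_ccomp_right:
  assumes "hpic f g" "chmap f X Y" "chmap k Z X" shows "hpic (ccomp f k) (ccomp g k)"
proof -
  obtain h where h0: "htpy X Y f g h" using hpicE[OF assms(1,2)] .
  note h = htpyD[OF h0]
  show ?thesis
  proof (rule hpicI[OF chmap_ccomp[OF assms(3,2)] chmap_ccomp[OF assms(3) h(1)], of "\<lambda>i. h i \<cdot> cpt k i"])
    fix i
    show "h i \<cdot> cpt k i \<in> hom C (ob Z i) (ob Y (i - 1))" using comp_hom h(2) chmapD(3) assms(3) by blast
    show "cpt (ccomp f k) i \<rhd> x = cpt (ccomp g k) i \<rhd> x + diff Y (i - 1) \<rhd> (h i \<cdot> cpt k i) \<rhd> x
       + (h (i + 1) \<cdot> cpt k (i + 1)) \<rhd> diff Z i \<rhd> x" if "x \<in> El W (ob Z i)" for x W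
      using h(3)[OF El_chmap[OF assms(3) that]] homD[OF h(2)[of i]] homD[OF h(2)[of "i + 1"]] assms h(1)
      by (simp add: chmap_commute[OF assms(3)])
  qed
qed

lemma hpic_csub_iff:
  assumes "chmap f X Y" "chmap g X Y" shows "hpic (csub f g) (cnull X Y) \<longleftrightarrow> hpic f g"
proof
  note XY = chmapD(1,2)[OF assms(1)]
  assume hp: "hpic f g"
  obtain h where h0: "htpy X Y f g h" using hpicE[OF hp assms(1)] .
  note h = htpyD[OF h0]
  show "hpic (csub f g) (cnull X Y)"
    using h(3) assms XY
    by (intro hpicI[OF chmap_csub[OF assms] chmap_cnull[OF XY] h(2)]) (simp add: algebra_simps)
next
  note XY = chmapD(1,2)[OF assms(1)]
  assume hp: "hpic (csub f g) (cnull X Y)"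
  obtain h where h0: "htpy X Y (csub f g) (cnull X Y) h" using hpicE[OF hp chmap_csub[OF assms]] .
  note h = htpyD[OF h0]
  show "hpic f g"
  proof (rule hpicI[OF assms h(2)])
    fix i W x assume x: "x \<in> El W (ob X i)"
    show "cpt f i \<rhd> x = cpt g i \<rhd> x + diff Y (i - 1) \<rhd> h i \<rhd> x + h (i + 1) \<rhd> diff X i \<rhd> x"
      using h(3)[OF x] assms XY by (simp add: algebra_simps)
  qed
qed

lemma hpic_null_comp:
  assumes "hpic f (cnull X Y)" "chmap f X Y" "chmap k Y Z" shows "hpic (ccomp k f) (cnull X Z)"
  using hpic_trans[OF hpic_ccomp_left[OF assms] hpic_eqI[OF chmap_ccomp[OF hpic_chmap(1)[OF assms(1,2)] assms(3)]
      chmap_cnull]] chmapD(1,2)[OF assms(2)] chmapD(1,2)[OF assms(3)] hpic_chmap(1)[OF assms(1,2)] assms(3)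
  by simp

lemma hpic_null_comp_right:
  assumes "hpic f (cnull X Y)" "chmap f X Y" "chmap k Z X" shows "hpic (ccomp f k) (cnull Z Y)"
  using hpic_trans[OF hpic_ccomp_right[OF assms] hpic_eqI[OF chmap_ccomp[OF assms(3) hpic_chmap(1)[OF assms(1,2)]]
      chmap_cnull]] chmapD(1,2)[OF assms(2)] chmapD(1,2)[OF assms(3)] hpic_chmap(1)[OF assms(1,2)] assms(3)
  by simp

lemma ccomp_assoc:
  assumes "chmap f X Y" "chmap g Y Z" "chmap k Z W" shows "ccomp (ccomp k g) f = ccomp k (ccomp g f)"
  using comp_assoc[OF chmapD(3)[OF assms(1)] chmapD(3)[OF assms(2)] chmapD(3)[OF assms(3)]]
  by (simp add: ccomp_def)

lemma ccomp_cident: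
  assumes "chmap f X Y" shows "ccomp f (cident X) = f" "ccomp (cident Y) f = f"
  using comp_ident_right[OF chmapD(3)[OF assms]] comp_ident_left[OF chmapD(3)[OF assms]] assms
  by (auto simp: ccomp_def cident_def chmap_def)

lemma hpic_bds:
  assumes "hpic f g" "chmap f X Y" "x \<in> cycs X i W" shows "cpt f i \<rhd> x - cpt g i \<rhd> x \<in> bds Y i W"
proof -
  obtain h where h0: "htpy X Y f g h" using hpicE[OF assms(1,2)] .
  note h = htpyD[OF h0]
  have "cpt f i \<rhd> x - cpt g i \<rhd> x = diff Y (i - 1) \<rhd> h i \<rhd> x"
    using h(3)[OF cycsD(1)[OF assms(3)]] cycsD(2)[OF assms(3)] by simp
  then show ?thesis
    using bds_boundary[OF chmapD(2)[OF assms(2)] El_lact[OF h(2) cycsD(1)[OF assms(3)]]] by simp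
qed

lemma hpic_H:
  assumes "hpic f g" "chmap f X Y" shows "H_inj f i \<Longrightarrow> H_inj g i" "H_surj f i \<Longrightarrow> H_surj g i"
proof -
  note g = hpic_chmap(1)[OF assms] and Y = chmapD(2)[OF assms(2)]
  show "H_inj g i" if "H_inj f i"
  proof (rule H_injI[OF g])
    fix W x assume x: "x \<in> cycs X i W" "cpt g i \<rhd> x \<in> bds Y i W"
    have "cpt f i \<rhd> x \<in> bds Y i W" using bds_add[OF Y hpic_bds[OF assms x(1)] x(2)] by simp
    then show "x \<in> bds X i W" using H_injD[OF that assms(2) x(1)] by blast
  qed
  show "H_surj g i" if s: "H_surj f i"
  proof (rule H_surjI[OF g])
    fix W y assume y: "y \<in> cycs Y i W"
    obtain V e x where x: "e \<in> epis V W" "x \<in> cycs X i V" "y \<lhd> e - cpt f i \<rhd> x \<in> bds Y i V"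
      using H_surjE[OF s assms(2) y] .
    have "y \<lhd> e - cpt g i \<rhd> x \<in> bds Y i V" using bds_add[OF Y x(3) hpic_bds[OF assms x(2)]] by simp
    then show "\<exists>V. \<exists>e\<in>epis V W. \<exists>x\<in>cycs X i V. y \<lhd> e - cpt g i \<rhd> x \<in> bds Y i V" using x by blast
  qed
qed

text \<open>Two-out-of-three in a single degree, split into the implications that hold for
  monomorphisms and for epimorphisms separately. Composition and cancellation of quasi-isomorphisms
  combine several of them; the saturation argument in \<open>Kb_fraction_system\<close> uses single
  ones.\<close>

lemma H_comp:
  assumes "chmap f X Y" "chmap g Y Z"
  shows "H_inj f i \<Longrightarrow> H_inj g i \<Longrightarrow> H_inj (ccomp g f) i"
    "H_surj f i \<Longrightarrow> H_surj g i \<Longrightarrow> H_surj (ccomp g f) i"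
    "H_inj (ccomp g f) i \<Longrightarrow> H_inj f i"
    "H_surj (ccomp g f) i \<Longrightarrow> H_surj g i"
    "H_inj (ccomp g f) i \<Longrightarrow> H_surj f i \<Longrightarrow> H_inj g i"
    "H_surj (ccomp g f) i \<Longrightarrow> H_inj g i \<Longrightarrow> H_surj f i"
proof -
  note gf = chmap_ccomp[OF assms]
  note [simp] = cpt_ccomp[OF assms]
  note X = chmapD(1)[OF assms(1)] and Y = chmapD(2)[OF assms(1)] and Z = chmapD(2)[OF assms(2)]
  show "H_inj (ccomp g f) i" if h: "H_inj f i" "H_inj g i"
  proof (rule H_injI[OF gf])
    fix W x assume x: "x \<in> cycs X i W" "cpt (ccomp g f) i \<rhd> x \<in> bds Z i W"
    show "x \<in> bds X i W"
      using H_injD[OF h(1) assms(1) x(1)] H_injD[OF h(2) assms(2) cycs_chmap[OF assms(1) x(1)]] x(2) by simp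
  qed
  show "H_surj (ccomp g f) i" if h: "H_surj f i" "H_surj g i"
  proof (rule H_surjI[OF gf])
    fix W y assume y: "y \<in> cycs Z i W"
    obtain V e x where x: "e \<in> epis V W" "x \<in> cycs Y i V" "y \<lhd> e - cpt g i \<rhd> x \<in> bds Z i V"
      using H_surjE[OF h(2) assms(2) y] .
    obtain U e' w where w: "e' \<in> epis U V" "w \<in> cycs X i U" "x \<lhd> e' - cpt f i \<rhd> w \<in> bds Y i U"
      using H_surjE[OF h(1) assms(1) x(2)] .
    have "(y \<lhd> e - cpt g i \<rhd> x) \<lhd> e' + cpt g i \<rhd> (x \<lhd> e' - cpt f i \<rhd> w) \<in> bds Z i U"
      using bds_add[OF Z bds_ract[OF x(3) epis_hom[OF w(1)]] bds_chmap[OF assms(2) w(3)]] .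
    then have "y \<lhd> (e \<cdot> e') - cpt (ccomp g f) i \<rhd> w \<in> bds Z i U" using x(1) w(1) by simp
    then show "\<exists>V. \<exists>e\<in>epis V W. \<exists>x\<in>cycs X i V. y \<lhd> e - cpt (ccomp g f) i \<rhd> x \<in> bds Z i V"
      using epis_comp[OF x(1) w(1)] w(2) by blast
  qed
  show "H_inj f i" if h: "H_inj (ccomp g f) i"
  proof (rule H_injI[OF assms(1)])
    fix W x assume x: "x \<in> cycs X i W" "cpt f i \<rhd> x \<in> bds Y i W"
    show "x \<in> bds X i W" using H_injD[OF h gf x(1)] bds_chmap[OF assms(2) x(2)] by simp
  qed
  show "H_surj g i" if h: "H_surj (ccomp g f) i"
  proof (rule H_surjI[OF assms(2)])
    fix W y assume y: "y \<in> cycs Z i W"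
    obtain V e x where x: "e \<in> epis V W" "x \<in> cycs X i V" "y \<lhd> e - cpt (ccomp g f) i \<rhd> x \<in> bds Z i V"
      using H_surjE[OF h gf y] .
    then show "\<exists>V. \<exists>e\<in>epis V W. \<exists>x\<in>cycs Y i V. y \<lhd> e - cpt g i \<rhd> x \<in> bds Z i V"
      using cycs_chmap[OF assms(1) x(2)] by auto
  qed
  show "H_inj g i" if h: "H_inj (ccomp g f) i" "H_surj f i"
  proof (rule H_injI[OF assms(2)])
    fix W y assume y: "y \<in> cycs Y i W" "cpt g i \<rhd> y \<in> bds Z i W"
    obtain V e x where x: "e \<in> epis V W" "x \<in> cycs X i V" "y \<lhd> e - cpt f i \<rhd> x \<in> bds Y i V"
      using H_surjE[OF h(2) assms(1) y(1)] .
    have "(cpt g i \<rhd> y) \<lhd> e - cpt g i \<rhd> (y \<lhd> e - cpt f i \<rhd> x) \<in> bds Z i V"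
      using bds_diff[OF Z bds_ract[OF y(2) epis_hom[OF x(1)]] bds_chmap[OF assms(2) x(3)]] .
    then have xb: "x \<in> bds X i V" using H_injD[OF h(1) gf x(2)] by simp
    have "y \<lhd> e \<in> bds Y i V" using bds_add[OF Y x(3) bds_chmap[OF assms(1) xb]] by simp
    then show "y \<in> bds Y i W" using bds_local cycsD(1)[OF y(1)] x(1) by blast
  qed
  show "H_surj f i" if h: "H_surj (ccomp g f) i" "H_inj g i"
  proof (rule H_surjI[OF assms(1)])
    fix W y assume y: "y \<in> cycs Y i W"
    obtain V e x where x: "e \<in> epis V W" "x \<in> cycs X i V" "(cpt g i \<rhd> y) \<lhd> e - cpt (ccomp g f) i \<rhd> x \<in> bds Z i V"
      using H_surjE[OF h(1) gf cycs_chmap[OF assms(2) y]] .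
    have c: "y \<lhd> e - cpt f i \<rhd> x \<in> cycs Y i V"
      using cycs_diff[OF cycs_ract[OF y epis_hom[OF x(1)]] cycs_chmap[OF assms(1) x(2)]] .
    have "y \<lhd> e - cpt f i \<rhd> x \<in> bds Y i V" using H_injD[OF h(2) assms(2) c] x(3) by simp
    then show "\<exists>V. \<exists>e\<in>epis V W. \<exists>x\<in>cycs X i V. y \<lhd> e - cpt f i \<rhd> x \<in> bds Y i V" using x by blast
  qed
qed

lemma H_cident: "X \<in> complexes \<Longrightarrow> H_inj (cident X) i" "X \<in> complexes \<Longrightarrow> H_surj (cident X) i"
proof -
  assume X: "X \<in> complexes"
  note c = chmap_cident[OF X]
  show "H_inj (cident X) i" by (rule H_injI[OF c]) (auto dest!: cycsD(1))
  show "H_surj (cident X) i"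
  proof (rule H_surjI[OF c])
    fix W y assume y: "y \<in> cycs X i W"
    have W: "W \<in> Obj C" using El_obj[OF cycsD(1)[OF y]] by simp
    show "\<exists>V. \<exists>e\<in>epis V W. \<exists>x\<in>cycs X i V. y \<lhd> e - cpt (cident X) i \<rhd> x \<in> bds X i V"
      using epis_ident[OF W] y cycsD(1)[OF y] bds_zero[OF X W]
      by (intro exI[of _ W] bexI[of _ "\<one> W"] bexI[of _ y]) auto
  qed
qed

lemma qisD: "qis f \<Longrightarrow> H_inj f i" "qis f \<Longrightarrow> H_surj f i"
  by (auto simp: qis_def)

lemma qisI: "chmap f X Y \<Longrightarrow> (\<And>i. H_inj f i) \<Longrightarrow> (\<And>i. H_surj f i) \<Longrightarrow> qis f"
  by (auto simp: qis_def chmap_def)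

lemma qis_cident: "X \<in> complexes \<Longrightarrow> qis (cident X)"
  using qisI chmap_cident H_cident by blast

lemma qis_ccomp: "chmap f X Y \<Longrightarrow> chmap g Y Z \<Longrightarrow> qis f \<Longrightarrow> qis g \<Longrightarrow> qis (ccomp g f)"
  using qisI[OF chmap_ccomp] H_comp(1,2) qisD by metis

lemma qis_hpic: "hpic f g \<Longrightarrow> chmap f X Y \<Longrightarrow> qis f \<Longrightarrow> qis g"
  using qisI[OF hpic_chmap(1)] hpic_H qisD by metis

lemma qis_cancel_left: "chmap f X Y \<Longrightarrow> chmap g Y Z \<Longrightarrow> qis (ccomp g f) \<Longrightarrow> qis g \<Longrightarrow> qis f"
  using qisI H_comp(3,6) qisD by metis

end

section \<open>Mapping cones\<close>

context abelian_category
begin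

lemma complexI:
  assumes "\<And>i. ob X i \<in> Obj C" "\<And>i. diff X i \<in> hom C (ob X i) (ob X (i + 1))"
    "\<And>i W x. x \<in> El W (ob X i) \<Longrightarrow> diff X (i + 1) \<rhd> diff X i \<rhd> x = 0"
    "\<forall>i. i < a \<or> b < i \<longrightarrow> zero_object C (ob X i)"
  shows "X \<in> complexes"
  unfolding bounded_complexes_def
proof (intro CollectI conjI allI)
  fix i
  have h: "diff X (i + 1) \<in> hom C (ob X (i + 1)) (ob X (i + 2))" using assms(2)[of "i + 1"] by (simp add: ac_simps)
  show "diff X (i + 1) \<cdot> diff X i = Null C (ob X i) (ob X (i + 2))"
  proof (rule arr_eqI)
    show "diff X (i + 1) \<cdot> diff X i \<in> hom C (ob X i) (ob X (i + 2))" using comp_hom[OF assms(2) h] .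
    show "Null C (ob X i) (ob X (i + 2)) \<in> hom C (ob X i) (ob X (i + 2))" using null_hom assms(1) by blast
    fix x W assume "x \<in> El W (ob X i)"
    then show "(diff X (i + 1) \<cdot> diff X i) \<rhd> x = Null C (ob X i) (ob X (i + 2)) \<rhd> x"
      using assms(1,3) homD[OF h] homD[OF assms(2)[of i]] by simp
  qed
  show "\<exists>a b. \<forall>i. i < a \<or> b < i \<longrightarrow> zero_object C (ob X i)" using assms(4) by blast
qed (use assms(1,2) in auto)

section \<open>The shift of complexes\<close>

lemma ob_shift [simp]: "ob (shift_complex C n X) i = ob X (i + n)"
  by (simp add: shift_complex_def)

lemma ends_shift: "src (shift_chain_map C n f) = shift_complex C n (src f)"
    "tgt (shift_chain_map C n f) = shift_complex C n (tgt f)"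
  by (simp_all add: shift_chain_map_def)

lemma cpt_shift [simp]: "cpt (shift_chain_map C n f) i = cpt f (i + n)"
  by (simp add: shift_chain_map_def)

lemma diff_shift [simp]:
  assumes "X \<in> complexes" "n = 1 \<or> n = - 1"
  shows "diff (shift_complex C n X) i \<rhd> x = - (diff X (i + n) \<rhd> x)"
  using assms by (simp add: shift_complex_def powi_unit_one[OF assms(2)])

lemma complex_bounded:
  assumes "X \<in> complexes" obtains a b where "\<forall>i. i < a \<or> b < i \<longrightarrow> zero_object C (ob X i)"
proof -
  have "\<exists>a b. \<forall>i. i < a \<or> b < i \<longrightarrow> zero_object C (ob X i)"
    using assms unfolding bounded_complexes_def by blast
  then show ?thesis using that by blast
qed

lemma shift_complexes:
  assumes "X \<in> complexes" "n = 1 \<or> n = - 1" shows "shift_complex C n X \<in> complexes"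
proof -
  note d = complexD(2)[OF assms(1)]
  have o: "diff (shift_complex C n X) i = - 1 \<odot> diff X (i + n)" for i
    by (simp add: shift_complex_def powi_unit_one[OF assms(2)])
  obtain a b where ab: "\<forall>i. i < a \<or> b < i \<longrightarrow> zero_object C (ob X i)"
    using complex_bounded[OF assms(1)] .
  show ?thesis
  proof (rule complexI)
    fix i
    show "ob (shift_complex C n X) i \<in> Obj C" using complexD(1)[OF assms(1)] by simp
    show "diff (shift_complex C n X) i \<in> hom C (ob (shift_complex C n X) i) (ob (shift_complex C n X) (i + 1))"
      unfolding o using scale_hom[OF d[of "i + n"]] by (simp add: ac_simps)
    show "diff (shift_complex C n X) (i + 1) \<rhd> diff (shift_complex C n X) i \<rhd> x = 0" for x
      using assms complexD(3)[OF assms(1), of "i + n" x] by (simp add: ac_simps)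
    show "\<forall>i. i < a - n \<or> b - n < i \<longrightarrow> zero_object C (ob (shift_complex C n X) i)"
      unfolding ob_shift by (intro allI impI ab[rule_format]) linarith
  qed
qed

text \<open>The two signs multiply to 1, so shifting back returns the very same complex and not only
  an isomorphic one. Hence sets of complexes can be shifted back and forth literally, as in the
  equation between \<open>V\<close> and the shifted orthogonal of \<open>U\<close>.\<close>

lemma shift_inverse:
  assumes "X \<in> complexes" "n = 1 \<or> n = - 1"
  shows "shift_complex C (- n) (shift_complex C n X) = X"
proof -
  have m: "(- 1 :: 'c) powi n = - 1" "(- 1 :: 'c) powi (- n) = - 1"
    using powi_unit_one[OF assms(2)] powi_unit_one[of "- n"] assms(2) by auto
  have "- 1 \<odot> - 1 \<odot> diff X i = diff X i" for i
    using scale_scale[OF complexD(2)[OF assms(1)], of "- 1" "- 1" i] scale_one[OF complexD(2)[OF assms(1)], of i] by simp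
  then show ?thesis by (simp add: shift_complex_def m)
qed

lemma shift_1_inverse [simp]:
  assumes "X \<in> complexes"
  shows "shift_complex C (- 1) (shift_complex C 1 X) = X" "shift_complex C 1 (shift_complex C (- 1) X) = X"
  using shift_inverse[OF assms, of 1] shift_inverse[OF assms, of "- 1"] by auto

lemma chmap_shift:
  assumes "chmap f X Y" "n = 1 \<or> n = - 1"
  shows "chmap (shift_chain_map C n f) (shift_complex C n X) (shift_complex C n Y)"
proof -
  note XY = chmapD(1,2)[OF assms(1)]
  show ?thesis
  proof (rule chmapI[OF shift_complexes[OF XY(1) assms(2)] shift_complexes[OF XY(2) assms(2)]])
    fix i x
    show "cpt (shift_chain_map C n f) i \<in> hom C (ob (shift_complex C n X) i) (ob (shift_complex C n Y) i)"
      using chmapD(3)[OF assms(1)] by simp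
    show "diff (shift_complex C n Y) i \<rhd> cpt (shift_chain_map C n f) i \<rhd> x =
        cpt (shift_chain_map C n f) (i + 1) \<rhd> diff (shift_complex C n X) i \<rhd> x"
      using XY assms(2) chmap_commute[OF assms(1), of "i + n" x] by (simp add: ac_simps)
  qed (use chmap_ends[OF assms(1)] chmapD(3)[OF assms(1)] in \<open>auto simp: ends_shift\<close>)
qed

lemma shift_chain_map_inverse:
  assumes "chmap f X Y" "n = 1 \<or> n = - 1"
  shows "shift_chain_map C (- n) (shift_chain_map C n f) = f"
  using shift_inverse[OF chmapD(1)[OF assms(1)] assms(2)] shift_inverse[OF chmapD(2)[OF assms(1)] assms(2)]
    chmap_ends[OF assms(1)] by (simp add: shift_chain_map_def)

lemma cycs_shift [simp]:
  "X \<in> complexes \<Longrightarrow> n = 1 \<or> n = - 1 \<Longrightarrow> cycs (shift_complex C n X) i W = cycs X (i + n) W"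
  by (simp add: cycs_def)

text \<open>The differential of the shift is the negative of the old one; the sign is absorbed by
  the primitive.\<close>

lemma bds_shift [simp]:
  assumes "X \<in> complexes" "n = 1 \<or> n = - 1" shows "bds (shift_complex C n X) i W = bds X (i + n) W"
proof -
  have i: "i - 1 + n = i + n - 1" by simp
  have "(\<exists>y\<in>El V (ob X (i + n - 1)). z = - (diff X (i + n - 1) \<rhd> y)) \<longleftrightarrow>
    (\<exists>y\<in>El V (ob X (i + n - 1)). z = diff X (i + n - 1) \<rhd> y)" (is "?L \<longleftrightarrow> ?R") for V z
  proof
    assume ?L then obtain y where "y\<in>El V (ob X (i + n - 1))" "z = - (diff X (i + n - 1) \<rhd> y)" by blast
    then show ?R by (intro bexI[of _ "- y"]) auto
  next
    assume ?R then obtain y where "y\<in>El V (ob X (i + n - 1))" "z = diff X (i + n - 1) \<rhd> y" by blast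
    then show ?L by (intro bexI[of _ "- y"]) auto
  qed
  then show ?thesis unfolding bds_def ob_shift diff_shift[OF assms] i by simp
qed

lemma exact_at_shift [simp]:
  "X \<in> complexes \<Longrightarrow> n = 1 \<or> n = - 1 \<Longrightarrow> exact_at (shift_complex C n X) i \<longleftrightarrow> exact_at X (i + n)"
  by (simp add: exact_at_def)

lemma H_shift:
  assumes "chmap f X Y" "n = 1 \<or> n = - 1"
  shows "H_inj (shift_chain_map C n f) i \<longleftrightarrow> H_inj f (i + n)"
    "H_surj (shift_chain_map C n f) i \<longleftrightarrow> H_surj f (i + n)"
  using assms chmapD(1,2)[OF assms(1)] by (simp_all add: H_inj_def H_surj_def ends_shift chmap_ends)

lemma qis_shift: "chmap f X Y \<Longrightarrow> n = 1 \<or> n = - 1 \<Longrightarrow> qis f \<Longrightarrow> qis (shift_chain_map C n f)"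
  using qisI[OF chmap_shift] H_shift qisD by metis

lemma hpic_shift:
  assumes "hpic f g" "n = 1 \<or> n = - 1" shows "hpic (shift_chain_map C n f) (shift_chain_map C n g)"
proof -
  obtain X Y where f: "chmap f X Y" using hpic_obtain[OF assms(1)] .
  obtain h where h0: "htpy X Y f g h" using hpicE[OF assms(1) f] .
  note h = htpyD[OF h0] and XY = chmapD(1,2)[OF f]
  \<comment> \<open>Both differentials change sign under the shift, so the homotopy has to change
    sign as well.\<close>
  show ?thesis
  proof (rule hpicI[OF chmap_shift[OF f assms(2)] chmap_shift[OF h(1) assms(2)], of "\<lambda>i. - 1 \<odot> h (i + n)"])
    fix i W x assume x: "x \<in> El W (ob (shift_complex C n X) i)"
    have i: "i - 1 + n = i + n - 1" "i + 1 + n = i + n + 1" by simp_all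
    show "cpt (shift_chain_map C n f) i \<rhd> x = cpt (shift_chain_map C n g) i \<rhd> x +
        diff (shift_complex C n Y) (i - 1) \<rhd> (- 1 \<odot> h (i + n)) \<rhd> x +
        (- 1 \<odot> h (i + 1 + n)) \<rhd> diff (shift_complex C n X) i \<rhd> x"
      using h(3)[of x W "i + n"] x XY assms(2) homD[OF h(2)[of "i + n"]] homD[OF h(2)[of "i + n + 1"]]
      by (simp add: i)
  next
    fix i
    have i: "i - 1 + n = i + n - 1" by simp
    show "- 1 \<odot> h (i + n) \<in> hom C (ob (shift_complex C n X) i) (ob (shift_complex C n Y) (i - 1))"
      using scale_hom[OF h(2)[of "i + n"]] by (simp add: i)
  qed
qed

text \<open>\<open>cone_triangle\<close> with the objects and the splitting made explicit. In each
  degree \<kappa> is the inclusion of X^(i+1) and \<rho> the projection to Y^i. Unlike \<iota> and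
  \<pi> they are not chain maps, and the map \<open>f\<close> is what measures their failure to be
  so.\<close>

definition is_cone where
  "is_cone X Y f Z \<iota> \<pi> \<kappa> \<rho> \<longleftrightarrow> chmap f X Y \<and> chmap \<iota> Y Z \<and> chmap \<pi> Z (shift_complex C 1 X) \<and>
     (\<forall>i. is_biproduct C (ob Z i) (ob X (i + 1)) (ob Y i) (\<kappa> i) (cpt \<iota> i) (cpt \<pi> i) (\<rho> i) \<and>
        diff Z i = (\<kappa> (i + 1) \<cdot> ((- 1) \<odot> diff X (i + 1)) \<cdot> cpt \<pi> i)
          \<oplus> (cpt \<iota> (i + 1) \<cdot> cpt f (i + 1) \<cdot> cpt \<pi> i) \<oplus> (cpt \<iota> (i + 1) \<cdot> diff Y i \<cdot> \<rho> i))"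

lemma cone_triangle_iff:
  "cone_triangle C f \<iota> \<pi> \<longleftrightarrow> (\<exists>X Y Z \<kappa> \<rho>. is_cone X Y f Z \<iota> \<pi> \<kappa> \<rho>)"
proof
  assume "cone_triangle C f \<iota> \<pi>"
  then have "\<exists>\<kappa> \<rho>. is_cone (src f) (tgt f) f (tgt \<iota>) \<iota> \<pi> \<kappa> \<rho>"
    unfolding cone_triangle_def is_cone_def chmap_def by blast
  then show "\<exists>X Y Z \<kappa> \<rho>. is_cone X Y f Z \<iota> \<pi> \<kappa> \<rho>" by blast
next
  assume "\<exists>X Y Z \<kappa> \<rho>. is_cone X Y f Z \<iota> \<pi> \<kappa> \<rho>"
  then obtain X Y Z \<kappa> \<rho> where c: "is_cone X Y f Z \<iota> \<pi> \<kappa> \<rho>" by blast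
  have "chmap f X Y" "chmap \<iota> Y Z" "chmap \<pi> Z (shift_complex C 1 X)" using c by (auto simp: is_cone_def)
  then have e: "X = src f" "Y = tgt f" "Z = tgt \<iota>" "f \<in> chain_maps C" "\<iota> \<in> chain_maps C" "\<pi> \<in> chain_maps C"
    "src \<iota> = tgt f" "src \<pi> = tgt \<iota>" "tgt \<pi> = shift_complex C 1 (src f)" by (auto simp: chmap_def)
  show "cone_triangle C f \<iota> \<pi>"
    unfolding cone_triangle_def
    using c[unfolded is_cone_def e(1-3)] e(4-9) by blast
qed

lemma coneD:
  assumes "is_cone X Y f Z \<iota> \<pi> \<kappa> \<rho>"
  shows "chmap f X Y" "chmap \<iota> Y Z" "chmap \<pi> Z (shift_complex C 1 X)"
    "X \<in> complexes" "Y \<in> complexes" "Z \<in> complexes"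
    "cpt \<iota> i \<in> hom C (ob Y i) (ob Z i)" "cpt \<pi> i \<in> hom C (ob Z i) (ob X (i + 1))"
    "\<kappa> i \<in> hom C (ob X (i + 1)) (ob Z i)" "\<rho> i \<in> hom C (ob Z i) (ob Y i)"
    "a \<in> El W (ob X (i + 1)) \<Longrightarrow> cpt \<pi> i \<rhd> \<kappa> i \<rhd> a = a"
    "b \<in> El W (ob Y i) \<Longrightarrow> \<rho> i \<rhd> cpt \<iota> i \<rhd> b = b"
    "\<rho> i \<rhd> \<kappa> i \<rhd> x = 0" "cpt \<pi> i \<rhd> cpt \<iota> i \<rhd> x = 0"
    "c \<in> El W (ob Z i) \<Longrightarrow> \<kappa> i \<rhd> cpt \<pi> i \<rhd> c + cpt \<iota> i \<rhd> \<rho> i \<rhd> c = c"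
    "c \<in> El W (ob Z i) \<Longrightarrow> \<rho> (i + 1) \<rhd> diff Z i \<rhd> c = cpt f (i + 1) \<rhd> cpt \<pi> i \<rhd> c + diff Y i \<rhd> \<rho> i \<rhd> c"
    "cpt \<pi> (i + 1) \<rhd> diff Z i \<rhd> c = - (diff X (i + 1) \<rhd> cpt \<pi> i \<rhd> c)"
    "a \<in> El W (ob X (i + 1)) \<Longrightarrow>
       diff Z i \<rhd> \<kappa> i \<rhd> a = cpt \<iota> (i + 1) \<rhd> cpt f (i + 1) \<rhd> a - \<kappa> (i + 1) \<rhd> diff X (i + 1) \<rhd> a"
    "diff Z i \<rhd> cpt \<iota> i \<rhd> b = cpt \<iota> (i + 1) \<rhd> diff Y i \<rhd> b"
proof -
  show m: "chmap f X Y" "chmap \<iota> Y Z" "chmap \<pi> Z (shift_complex C 1 X)"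
    using assms by (auto simp: is_cone_def)
  show XYZ: "X \<in> complexes" "Y \<in> complexes" "Z \<in> complexes" using chmapD m by auto
  have bi: "is_biproduct C (ob Z i) (ob X (i + 1)) (ob Y i) (\<kappa> i) (cpt \<iota> i) (cpt \<pi> i) (\<rho> i)" for i
    using assms by (simp add: is_cone_def)
  have di: "diff Z i = (\<kappa> (i + 1) \<cdot> ((- 1) \<odot> diff X (i + 1)) \<cdot> cpt \<pi> i)
          \<oplus> (cpt \<iota> (i + 1) \<cdot> cpt f (i + 1) \<cdot> cpt \<pi> i) \<oplus> (cpt \<iota> (i + 1) \<cdot> diff Y i \<cdot> \<rho> i)" for i
    using assms by (simp add: is_cone_def)
  note b = biproductD[OF bi]
  show h: "cpt \<iota> i \<in> hom C (ob Y i) (ob Z i)" "cpt \<pi> i \<in> hom C (ob Z i) (ob X (i + 1))"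
    "\<kappa> i \<in> hom C (ob X (i + 1)) (ob Z i)" "\<rho> i \<in> hom C (ob Z i) (ob Y i)" for i
    using b(1-4) by auto
  note hs = homD(1-3)[OF h(1)] homD(1-3)[OF h(2)] homD(1-3)[OF h(3)] homD(1-3)[OF h(4)]
  show p: "a \<in> El W (ob X (i + 1)) \<Longrightarrow> cpt \<pi> i \<rhd> \<kappa> i \<rhd> a = a" for a W i using b(5) .
  show r: "b \<in> El W (ob Y i) \<Longrightarrow> \<rho> i \<rhd> cpt \<iota> i \<rhd> b = b" for b W i using b(6) .
  show 0: "\<rho> i \<rhd> \<kappa> i \<rhd> x = 0" "cpt \<pi> i \<rhd> cpt \<iota> i \<rhd> x = 0" for x i using b(7,8) by auto
  show "c \<in> El W (ob Z i) \<Longrightarrow> \<kappa> i \<rhd> cpt \<pi> i \<rhd> c + cpt \<iota> i \<rhd> \<rho> i \<rhd> c = c" using b(9) by metis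
  have d: "diff Z i \<rhd> c = cpt \<iota> (i + 1) \<rhd> cpt f (i + 1) \<rhd> cpt \<pi> i \<rhd> c
      + cpt \<iota> (i + 1) \<rhd> diff Y i \<rhd> \<rho> i \<rhd> c - \<kappa> (i + 1) \<rhd> diff X (i + 1) \<rhd> cpt \<pi> i \<rhd> c" for c i
    unfolding di using XYZ m(1) hs by (simp add: algebra_simps)
  show "\<rho> (i + 1) \<rhd> diff Z i \<rhd> c = cpt f (i + 1) \<rhd> cpt \<pi> i \<rhd> c + diff Y i \<rhd> \<rho> i \<rhd> c"
    if "c \<in> El W (ob Z i)"
    unfolding d using 0 r[of _ W] XYZ m(1) hs that by simp
  show "diff Z i \<rhd> \<kappa> i \<rhd> a = cpt \<iota> (i + 1) \<rhd> cpt f (i + 1) \<rhd> a - \<kappa> (i + 1) \<rhd> diff X (i + 1) \<rhd> a"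
    if "a \<in> El W (ob X (i + 1))"
    unfolding d using 0 p that by simp
  show "diff Z i \<rhd> cpt \<iota> i \<rhd> b = cpt \<iota> (i + 1) \<rhd> diff Y i \<rhd> b" using chmap_commute[OF m(2)] .
  show "cpt \<pi> (i + 1) \<rhd> diff Z i \<rhd> c = - (diff X (i + 1) \<rhd> cpt \<pi> i \<rhd> c)"
    using chmap_commute[OF m(3), of i c] XYZ by simp
qed

lemma direct_sum_zero:
  assumes "is_biproduct C Z A B i j p q" "zero_object C A" "zero_object C B" shows "zero_object C Z"
proof -
  note b = biproductD[OF assms(1)]
  have Z: "Z \<in> Obj C" using assms(1) by (simp add: is_biproduct_def)
  show ?thesis
    unfolding zero_object_iff[OF Z]
  proof (intro allI ballI)
    fix W x assume x: "x \<in> El W Z"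
    have "p \<rhd> x = 0" "q \<rhd> x = 0"
      using zero_object_El[OF assms(2) El_lact[OF b(3) x]] zero_object_El[OF assms(3) El_lact[OF b(4) x]] by auto
    then show "x = 0" using b(9)[OF x] by simp
  qed
qed

lemma cone_ex:
  assumes f: "chmap f X Y" shows "\<exists>Z \<iota> \<pi> \<kappa> \<rho>. is_cone X Y f Z \<iota> \<pi> \<kappa> \<rho>"
proof -
  note XY = chmapD(1,2)[OF f]
  have "\<forall>i. \<exists>Z k j p r. is_biproduct C Z (ob X (i + 1)) (ob Y i) k j p r"
    using ex_direct_sum complexD(1)[OF XY(1)] complexD(1)[OF XY(2)] by (auto simp: direct_sum_def)
  then obtain Zo k j p r where bi: "\<And>i. is_biproduct C (Zo i) (ob X (i + 1)) (ob Y i) (k i) (j i) (p i) (r i)"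
    by metis
  note b = biproductD[OF bi]
  have Zobj: "Zo i \<in> Obj C" for i using bi[of i] by (simp add: is_biproduct_def)
  note hs = homD(1-3)[OF b(1)] homD(1-3)[OF b(2)] homD(1-3)[OF b(3)] homD(1-3)[OF b(4)]
  define d where "d i = (k (i + 1) \<cdot> ((- 1) \<odot> diff X (i + 1)) \<cdot> p i)
          \<oplus> (j (i + 1) \<cdot> cpt f (i + 1) \<cdot> p i) \<oplus> (j (i + 1) \<cdot> diff Y i \<cdot> r i)" for i
  have dh: "d i \<in> hom C (Zo i) (Zo (i + 1))" for i
    unfolding d_def using XY f hs by (simp add: hom_def)
  have dx: "d i \<rhd> c = j (i + 1) \<rhd> cpt f (i + 1) \<rhd> p i \<rhd> c
      + j (i + 1) \<rhd> diff Y i \<rhd> r i \<rhd> c - k (i + 1) \<rhd> diff X (i + 1) \<rhd> p i \<rhd> c" for c i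
    unfolding d_def using XY f hs by (simp add: algebra_simps)
  define Z where "Z = \<lparr>ob = Zo, diff = d\<rparr>"
  have Z: "Z \<in> complexes"
  proof -
    obtain a b where ab: "\<forall>i. i < a \<or> b < i \<longrightarrow> zero_object C (ob X i)"
      using complex_bounded[OF XY(1)] .
    obtain a' b' where ab': "\<forall>i. i < a' \<or> b' < i \<longrightarrow> zero_object C (ob Y i)"
      using complex_bounded[OF XY(2)] .
    show ?thesis
    proof (rule complexI)
      show "ob Z i \<in> Obj C" "diff Z i \<in> hom C (ob Z i) (ob Z (i + 1))" for i
        using Zobj dh by (simp_all add: Z_def)
      show "\<forall>i. i < min (a - 1) a' \<or> max b b' < i \<longrightarrow> zero_object C (ob Z i)"
        using direct_sum_zero[OF bi ab[rule_format] ab'[rule_format]] by (auto simp: Z_def)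
      fix i W c assume "c \<in> El W (ob Z i)"
      then have c: "c \<in> El W (Zo i)" by (simp add: Z_def)
      have e: "p i \<rhd> c \<in> El W (ob X (i + 1))" "r i \<rhd> c \<in> El W (ob Y i)"
        using El_lact[OF b(3) c] El_lact[OF b(4) c] .
      have e1: "diff X (i + 1) \<rhd> p i \<rhd> c \<in> El W (ob X (i + 1 + 1))"
         "cpt f (i + 1) \<rhd> p i \<rhd> c \<in> El W (ob Y (i + 1))" "diff Y i \<rhd> r i \<rhd> c \<in> El W (ob Y (i + 1))"
        using El_lact[OF complexD(2)[OF XY(1)] e(1)] El_chmap[OF f e(1)] El_lact[OF complexD(2)[OF XY(2)] e(2)] .
      have p1: "p (i + 1) \<rhd> d i \<rhd> c = - (diff X (i + 1) \<rhd> p i \<rhd> c)"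
        unfolding dx using b(8) b(5)[OF e1(1)] by simp
      have r1: "r (i + 1) \<rhd> d i \<rhd> c = cpt f (i + 1) \<rhd> p i \<rhd> c + diff Y i \<rhd> r i \<rhd> c"
        unfolding dx using b(7) b(6)[OF e1(2)] b(6)[OF e1(3)] by simp
      have "d (i + 1) \<rhd> d i \<rhd> c = 0"
        unfolding dx[of "i + 1"] p1 r1 using XY chmap_commute[OF f, of "i + 1" "p i \<rhd> c"]
          complexD(3)[OF XY(1), of "i + 1" "p i \<rhd> c"] complexD(3)[OF XY(2), of i "r i \<rhd> c"] by simp
      then show "diff Z (i + 1) \<rhd> diff Z i \<rhd> c = 0" by (simp add: Z_def)
    qed
  qed
  let ?i = "\<lparr>src = Y, tgt = Z, cpt = j\<rparr>" and ?p = "\<lparr>src = Z, tgt = shift_complex C 1 X, cpt = p\<rparr>"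
  have ic: "chmap ?i Y Z"
  proof (rule chmapI[OF XY(2) Z])
    fix i W x assume x: "x \<in> El W (ob Y i)"
    show "diff Z i \<rhd> cpt ?i i \<rhd> x = cpt ?i (i + 1) \<rhd> diff Y i \<rhd> x"
      using dx[of i "j i \<rhd> x"] b(8) b(6)[OF x] by (simp add: Z_def)
  qed (use b(2) in \<open>auto simp: Z_def\<close>)
  have pc: "chmap ?p Z (shift_complex C 1 X)"
  proof (rule chmapI[OF Z shift_complexes[OF XY(1)]])
    fix i W c assume "c \<in> El W (ob Z i)"
    then have c: "c \<in> El W (Zo i)" by (simp add: Z_def)
    have e: "p i \<rhd> c \<in> El W (ob X (i + 1))" using El_lact[OF b(3) c] .
    have e1: "diff X (i + 1) \<rhd> p i \<rhd> c \<in> El W (ob X (i + 1 + 1))"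
      using El_lact[OF complexD(2)[OF XY(1)] e(1)] .
    have p1: "p (i + 1) \<rhd> d i \<rhd> c = - (diff X (i + 1) \<rhd> p i \<rhd> c)"
      unfolding dx using b(8) b(5)[OF e1(1)] by simp
    then show "diff (shift_complex C 1 X) i \<rhd> cpt ?p i \<rhd> c = cpt ?p (i + 1) \<rhd> diff Z i \<rhd> c"
      using XY by (simp add: Z_def)
  qed (use b(3) in \<open>auto simp: Z_def\<close>)
  have "is_cone X Y f Z ?i ?p k r"
    unfolding is_cone_def using f ic pc bi by (simp add: Z_def d_def)
  then show ?thesis by blast
qed

text \<open>The formulas of \<open>coneD\<close> one degree lower, where the primitives of cocycles
  of degree \<open>i\<close> live, with \<open>i - 1 + 1\<close> already simplified.\<close>

lemma coneD_prev:
  assumes "is_cone X Y f Z \<iota> \<pi> \<kappa> \<rho>"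
  shows "cpt \<pi> (i - 1) \<in> hom C (ob Z (i - 1)) (ob X i)" "\<kappa> (i - 1) \<in> hom C (ob X i) (ob Z (i - 1))"
    "a \<in> El W (ob X i) \<Longrightarrow> cpt \<pi> (i - 1) \<rhd> \<kappa> (i - 1) \<rhd> a = a"
    "c \<in> El W (ob Z (i - 1)) \<Longrightarrow>
       \<rho> i \<rhd> diff Z (i - 1) \<rhd> c = cpt f i \<rhd> cpt \<pi> (i - 1) \<rhd> c + diff Y (i - 1) \<rhd> \<rho> (i - 1) \<rhd> c"
    "cpt \<pi> i \<rhd> diff Z (i - 1) \<rhd> c = - (diff X i \<rhd> cpt \<pi> (i - 1) \<rhd> c)"
    "a \<in> El W (ob X i) \<Longrightarrow>
       diff Z (i - 1) \<rhd> \<kappa> (i - 1) \<rhd> a = cpt \<iota> i \<rhd> cpt f i \<rhd> a - \<kappa> i \<rhd> diff X i \<rhd> a"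
    "diff Z (i - 1) \<rhd> cpt \<iota> (i - 1) \<rhd> b = cpt \<iota> i \<rhd> diff Y (i - 1) \<rhd> b"
  using coneD(8,9,11,16-19)[OF assms, where i = "i - 1"] by simp_all

lemma cone_cycle_iff:
  assumes "is_cone X Y f Z \<iota> \<pi> \<kappa> \<rho>" "a \<in> El W (ob X (i + 1))" "b \<in> El W (ob Y i)"
  shows "\<kappa> i \<rhd> a + cpt \<iota> i \<rhd> b \<in> cycs Z i W \<longleftrightarrow> a \<in> cycs X (i + 1) W \<and> cpt f (i + 1) \<rhd> a + diff Y i \<rhd> b = 0"
proof -
  note c = coneD[OF assms(1)]
  let ?c = "\<kappa> i \<rhd> a + cpt \<iota> i \<rhd> b"
  have cE: "?c \<in> El W (ob Z i)" using El_lact[OF c(9) assms(2)] El_lact[OF c(7) assms(3)] by simp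
  have da: "diff X (i + 1) \<rhd> a \<in> El W (ob X (i + 1 + 1))" using El_lact[OF complexD(2)[OF c(4)] assms(2)] .
  have s: "cpt f (i + 1) \<rhd> a + diff Y i \<rhd> b \<in> El W (ob Y (i + 1))"
    using El_chmap[OF c(1) assms(2)] El_lact[OF complexD(2)[OF c(5)] assms(3)] by simp
  have d: "diff Z i \<rhd> ?c = cpt \<iota> (i + 1) \<rhd> (cpt f (i + 1) \<rhd> a + diff Y i \<rhd> b) - \<kappa> (i + 1) \<rhd> diff X (i + 1) \<rhd> a"
    using c(18)[OF assms(2)] c(19) by (simp add: algebra_simps)
  have "diff Z i \<rhd> ?c = 0 \<longleftrightarrow> diff X (i + 1) \<rhd> a = 0 \<and> cpt f (i + 1) \<rhd> a + diff Y i \<rhd> b = 0"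
  proof
    assume 0: "diff Z i \<rhd> ?c = 0"
    have "cpt \<pi> (i + 1) \<rhd> diff Z i \<rhd> ?c = - (diff X (i + 1) \<rhd> a)"
      unfolding d using c(14) c(11)[OF da] by simp
    moreover have "\<rho> (i + 1) \<rhd> diff Z i \<rhd> ?c = cpt f (i + 1) \<rhd> a + diff Y i \<rhd> b"
      unfolding d lact_diff c(13) c(12)[OF s] by simp
    ultimately show "diff X (i + 1) \<rhd> a = 0 \<and> cpt f (i + 1) \<rhd> a + diff Y i \<rhd> b = 0"
      unfolding 0 lact_zero by simp
  next
    assume "diff X (i + 1) \<rhd> a = 0 \<and> cpt f (i + 1) \<rhd> a + diff Y i \<rhd> b = 0"
    then show "diff Z i \<rhd> ?c = 0" unfolding d by simp
  qed
  then show ?thesis using cE assms(2) by (simp add: cycs_def)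
qed

lemma cone_decompose:
  assumes "is_cone X Y f Z \<iota> \<pi> \<kappa> \<rho>" "c \<in> cycs Z i W"
  shows "cpt \<pi> i \<rhd> c \<in> cycs X (i + 1) W" "\<rho> i \<rhd> c \<in> El W (ob Y i)"
    "cpt f (i + 1) \<rhd> cpt \<pi> i \<rhd> c + diff Y i \<rhd> \<rho> i \<rhd> c = 0"
    "\<kappa> i \<rhd> cpt \<pi> i \<rhd> c + cpt \<iota> i \<rhd> \<rho> i \<rhd> c = c"
proof -
  note k = coneD[OF assms(1)] and cE = cycsD(1)[OF assms(2)]
  show r: "\<rho> i \<rhd> c \<in> El W (ob Y i)" using El_lact[OF k(10) cE] .
  show e: "\<kappa> i \<rhd> cpt \<pi> i \<rhd> c + cpt \<iota> i \<rhd> \<rho> i \<rhd> c = c" using k(15)[OF cE] .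
  show "cpt \<pi> i \<rhd> c \<in> cycs X (i + 1) W" "cpt f (i + 1) \<rhd> cpt \<pi> i \<rhd> c + diff Y i \<rhd> \<rho> i \<rhd> c = 0"
    using cone_cycle_iff[OF assms(1) El_lact[OF k(8) cE] r] assms(2) e by auto
qed

text \<open>One degree of the long exact cohomology sequence: H^i(Z) sits between the cokernel of
  H^i(f) and the kernel of H^(i+1)(f), so it vanishes iff both of them do. A cocycle of the cone is
  a pair of a cocycle a of \<open>X\<close> and an element b of \<open>Y\<close> with f a + d b =
  0.\<close>

lemma cone_exact_iff:
  assumes "is_cone X Y f Z \<iota> \<pi> \<kappa> \<rho>"
  shows "exact_at Z i \<longleftrightarrow> H_inj f (i + 1) \<and> H_surj f i"
proof
  note k = coneD[OF assms] and kp = coneD_prev[OF assms, where i = i]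
  assume ex: "exact_at Z i"
  show "H_inj f (i + 1) \<and> H_surj f i"
  proof
    show "H_inj f (i + 1)"
    proof (rule H_injI[OF k(1)])
      fix W a assume a: "a \<in> cycs X (i + 1) W" "cpt f (i + 1) \<rhd> a \<in> bds Y (i + 1) W"
      obtain V e b where b: "e \<in> epis V W" "b \<in> El V (ob Y i)" "(cpt f (i + 1) \<rhd> a) \<lhd> e = diff Y i \<rhd> b"
        using bdsE[OF a(2)] by simp metis
      have ae: "a \<lhd> e \<in> cycs X (i + 1) V" using cycs_ract[OF a(1) epis_hom[OF b(1)]] .
      \<comment> \<open>With \<open>b\<close> a primitive of f a, the pair (a, -b) is a cocycle of
        the cone. Exactness makes it a coboundary, and its projection \<open>a\<close> is then a
        coboundary of \<open>X\<close>.\<close>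
      have "\<kappa> i \<rhd> (a \<lhd> e) + cpt \<iota> i \<rhd> (- b) \<in> cycs Z i V"
        using cone_cycle_iff[OF assms cycsD(1)[OF ae], of "- b"] b ae by simp
      then have bd: "\<kappa> i \<rhd> (a \<lhd> e) + cpt \<iota> i \<rhd> (- b) \<in> bds Z i V" using exact_atD[OF ex] by blast
      have "cpt \<pi> i \<rhd> (\<kappa> i \<rhd> (a \<lhd> e) + cpt \<iota> i \<rhd> (- b)) \<in> bds X (i + 1) V"
        using bds_chmap[OF k(3) bd] k(4) by simp
      then have "a \<lhd> e \<in> bds X (i + 1) V" using k(11)[OF cycsD(1)[OF ae]] k(14) by simp
      then show "a \<in> bds X (i + 1) W" using bds_local[OF cycsD(1)[OF a(1)] b(1)] by blast
    qed
    show "H_surj f i"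
    proof (rule H_surjI[OF k(1)])
      fix W y assume y: "y \<in> cycs Y i W"
      have "cpt \<iota> i \<rhd> y \<in> bds Z i W" using exact_atD[OF ex cycs_chmap[OF k(2) y]] .
      then obtain V e c where c: "e \<in> epis V W" "c \<in> El V (ob Z (i - 1))"
        "(cpt \<iota> i \<rhd> y) \<lhd> e = diff Z (i - 1) \<rhd> c" using bdsE by metis
      have ye: "y \<lhd> e \<in> cycs Y i V" using cycs_ract[OF y epis_hom[OF c(1)]] .
      have eq: "cpt \<iota> i \<rhd> (y \<lhd> e) = diff Z (i - 1) \<rhd> c" using c(3) by simp
      have "y \<lhd> e = cpt f i \<rhd> cpt \<pi> (i - 1) \<rhd> c + diff Y (i - 1) \<rhd> \<rho> (i - 1) \<rhd> c"
        using arg_cong[OF eq, of "\<lambda>z. \<rho> i \<rhd> z"] k(12)[OF cycsD(1)[OF ye]] kp(4)[OF c(2)] by simp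
      then have 1: "y \<lhd> e - cpt f i \<rhd> cpt \<pi> (i - 1) \<rhd> c \<in> bds Y i V"
        using bds_boundary[OF k(5) El_lact[OF k(10) c(2)]] by simp
      have "diff X i \<rhd> cpt \<pi> (i - 1) \<rhd> c = 0"
        using arg_cong[OF eq, of "\<lambda>z. cpt \<pi> i \<rhd> z"] k(14) kp(5)[of c] by simp
      then have "cpt \<pi> (i - 1) \<rhd> c \<in> cycs X i V" using cycsI[OF El_lact[OF kp(1) c(2)]] by blast
      then show "\<exists>V. \<exists>e\<in>epis V W. \<exists>x\<in>cycs X i V. y \<lhd> e - cpt f i \<rhd> x \<in> bds Y i V" using 1 c(1) by blast
    qed
  qed
next
  note k = coneD[OF assms] and kp = coneD_prev[OF assms, where i = i]
  assume h: "H_inj f (i + 1) \<and> H_surj f i"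
  show "exact_at Z i"
    unfolding exact_at_def
  proof (intro allI subsetI)
    fix W c assume c: "c \<in> cycs Z i W"
    note cd = cone_decompose[OF assms c]
    let ?a = "cpt \<pi> i \<rhd> c" and ?b = "\<rho> i \<rhd> c"
    have "cpt f (i + 1) \<rhd> ?a = diff Y i \<rhd> (- ?b)" using cd(3) by (simp add: eq_neg_iff_add_eq_0)
    then have "cpt f (i + 1) \<rhd> ?a \<in> bds Y (i + 1) W"
      using bds_boundary[OF k(5), of "- ?b" W "i + 1"] cd(2) by simp
    then have "?a \<in> bds X (i + 1) W" using H_injD[OF conjunct1[OF h] k(1) cd(1)] by blast
    then obtain V e a where a: "e \<in> epis V W" "a \<in> El V (ob X i)" "?a \<lhd> e = diff X i \<rhd> a"
      using bdsE[of ?a X "i + 1" W] by simp metis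
    have ka: "\<kappa> (i - 1) \<rhd> a \<in> El V (ob Z (i - 1))" using El_lact[OF kp(2) a(2)] .
    \<comment> \<open>Adding the coboundary of the pair (a, 0) removes the X-component, so what
      remains comes from a cocycle of \<open>Y\<close>. This correction recurs in later chases
      through a cone.\<close>
    let ?c = "c \<lhd> e + diff Z (i - 1) \<rhd> \<kappa> (i - 1) \<rhd> a"
    have cc: "?c \<in> cycs Z i V"
      using cycs_add[OF cycs_ract[OF c epis_hom[OF a(1)]] cycs_boundary[OF k(6) ka]] .
    have "cpt \<pi> i \<rhd> ?c = ?a \<lhd> e - diff X i \<rhd> a" using kp(5) kp(3)[OF a(2)] by simp
    then have "cpt \<pi> i \<rhd> ?c = 0" using a(3) by simp
    then have eq: "?c = cpt \<iota> i \<rhd> \<rho> i \<rhd> ?c" and cy: "\<rho> i \<rhd> ?c \<in> cycs Y i V"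
      using cone_decompose[OF assms cc] by (auto simp: cycs_def)
    obtain U e' x where x: "e' \<in> epis U V" "x \<in> cycs X i U" "(\<rho> i \<rhd> ?c) \<lhd> e' - cpt f i \<rhd> x \<in> bds Y i U"
      using H_surjE[OF conjunct2[OF h] k(1) cy] .
    have "cpt \<iota> i \<rhd> ((\<rho> i \<rhd> ?c) \<lhd> e' - cpt f i \<rhd> x) \<in> bds Z i U" using bds_chmap[OF k(2) x(3)] .
    moreover have "cpt \<iota> i \<rhd> cpt f i \<rhd> x \<in> bds Z i U"
      using bds_boundary[OF k(6) El_lact[OF kp(2) cycsD(1)[OF x(2)]]] kp(6)[OF cycsD(1)[OF x(2)]] cycsD(2)[OF x(2)] by simp
    ultimately have "cpt \<iota> i \<rhd> ((\<rho> i \<rhd> ?c) \<lhd> e' - cpt f i \<rhd> x) + cpt \<iota> i \<rhd> cpt f i \<rhd> x \<in> bds Z i U"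
      using bds_add[OF k(6)] by blast
    moreover have "cpt \<iota> i \<rhd> ((\<rho> i \<rhd> ?c) \<lhd> e' - cpt f i \<rhd> x) + cpt \<iota> i \<rhd> cpt f i \<rhd> x = (cpt \<iota> i \<rhd> \<rho> i \<rhd> ?c) \<lhd> e'"
      by (simp del: lact_add)
    ultimately have "?c \<lhd> e' \<in> bds Z i U" using eq by metis
    then have "?c \<in> bds Z i V" using bds_local[OF cycsD(1)[OF cc] x(1)] by blast
    then have "?c - diff Z (i - 1) \<rhd> \<kappa> (i - 1) \<rhd> a \<in> bds Z i V" using bds_diff[OF k(6)] bds_boundary[OF k(6) ka] by blast
    then have "c \<lhd> e \<in> bds Z i V" by simp
    then show "c \<in> bds Z i W" using bds_local[OF cycsD(1)[OF c] a(1)] by blast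
  qed
qed

lemma qis_iff_cone_exact:
  assumes "is_cone X Y f Z \<iota> \<pi> \<kappa> \<rho>" shows "qis f \<longleftrightarrow> (\<forall>i. exact_at Z i)"
proof
  assume "qis f" then show "\<forall>i. exact_at Z i" using cone_exact_iff[OF assms] qisD by blast
next
  assume e: "\<forall>i. exact_at Z i"
  have "H_inj f i" for i using e cone_exact_iff[OF assms, of "i - 1"] by simp
  moreover have "H_surj f i" for i using e cone_exact_iff[OF assms, of i] by simp
  ultimately show "qis f" using qisI[OF coneD(1)[OF assms]] by blast
qed

text \<open>The denominator is the projection from the cone of \<open>f\<close>, shifted by \<open>-1\<close>, to \<open>X\<close>.\<close>

lemma acyclic_target_null:
  assumes "chmap f X Y" "\<And>i. exact_at Y i"
  obtains X' t where "chmap t X' X" "qis t" "hpic (ccomp f t) (cnull X' Y)"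
proof -
  obtain Z \<iota> \<pi> \<kappa> \<rho> where cone: "is_cone X Y f Z \<iota> \<pi> \<kappa> \<rho>" using cone_ex[OF assms(1)] by blast
  note k = coneD[OF cone]
  have piq: "qis \<pi>"
  proof (rule qisI[OF k(3)])
    fix i
    note kp = coneD_prev[OF cone, where i = i]
    show "H_inj \<pi> i"
    proof (rule H_injI[OF k(3)])
      fix W c assume c: "c \<in> cycs Z i W" "cpt \<pi> i \<rhd> c \<in> bds (shift_complex C 1 X) i W"
      then have "cpt \<pi> i \<rhd> c \<in> bds X (i + 1) W" using k(4) by simp
      then obtain V e a where a: "e \<in> epis V W" "a \<in> El V (ob X i)" "(cpt \<pi> i \<rhd> c) \<lhd> e = diff X i \<rhd> a"
        using bdsE[of "cpt \<pi> i \<rhd> c" X "i + 1" W] by simp metis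
      have ka: "\<kappa> (i - 1) \<rhd> a \<in> El V (ob Z (i - 1))" using El_lact[OF kp(2) a(2)] .
      let ?c = "c \<lhd> e + diff Z (i - 1) \<rhd> \<kappa> (i - 1) \<rhd> a"
      have cc: "?c \<in> cycs Z i V"
        using cycs_add[OF cycs_ract[OF c(1) epis_hom[OF a(1)]] cycs_boundary[OF k(6) ka]] .
      have "cpt \<pi> i \<rhd> ?c = (cpt \<pi> i \<rhd> c) \<lhd> e - diff X i \<rhd> a" using kp(5) kp(3)[OF a(2)] by simp
      then have "cpt \<pi> i \<rhd> ?c = 0" using a(3) by simp
      then have eq: "cpt \<iota> i \<rhd> \<rho> i \<rhd> ?c = ?c" and cy: "\<rho> i \<rhd> ?c \<in> cycs Y i V"
        using cone_decompose[OF cone cc] by (auto simp: cycs_def)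
      have "?c \<in> bds Z i V" using bds_chmap[OF k(2) exact_atD[OF assms(2) cy]] eq by metis
      then have "?c - diff Z (i - 1) \<rhd> \<kappa> (i - 1) \<rhd> a \<in> bds Z i V" using bds_diff[OF k(6)] bds_boundary[OF k(6) ka] by blast
      then have "c \<lhd> e \<in> bds Z i V" by simp
      then show "c \<in> bds Z i W" using bds_local[OF cycsD(1)[OF c(1)] a(1)] by blast
    qed
    show "H_surj \<pi> i"
    proof (rule H_surjI[OF k(3)])
      fix W x assume "x \<in> cycs (shift_complex C 1 X) i W"
      then have x: "x \<in> cycs X (i + 1) W" using k(4) by simp
      have "cpt f (i + 1) \<rhd> x \<in> bds Y (i + 1) W" using exact_atD[OF assms(2) cycs_chmap[OF k(1) x]] .
      then obtain V e y where y: "e \<in> epis V W" "y \<in> El V (ob Y i)" "(cpt f (i + 1) \<rhd> x) \<lhd> e = diff Y i \<rhd> y"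
        using bdsE[of "cpt f (i + 1) \<rhd> x" Y "i + 1" W] by simp metis
      have xe: "x \<lhd> e \<in> cycs X (i + 1) V" using cycs_ract[OF x epis_hom[OF y(1)]] .
      have c: "\<kappa> i \<rhd> (x \<lhd> e) + cpt \<iota> i \<rhd> (- y) \<in> cycs Z i V"
        using cone_cycle_iff[OF cone cycsD(1)[OF xe], of "- y"] y xe by simp
      have "x \<lhd> e - cpt \<pi> i \<rhd> (\<kappa> i \<rhd> (x \<lhd> e) + cpt \<iota> i \<rhd> (- y)) = 0"
        using k(11)[OF cycsD(1)[OF xe]] k(14) by simp
      then have "x \<lhd> e - cpt \<pi> i \<rhd> (\<kappa> i \<rhd> (x \<lhd> e) + cpt \<iota> i \<rhd> (- y)) \<in> bds (shift_complex C 1 X) i V"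
        using bds_zero[OF shift_complexes[OF k(4)]] episD[OF y(1)] by simp
      then show "\<exists>V. \<exists>e\<in>epis V W. \<exists>z\<in>cycs Z i V. x \<lhd> e - cpt \<pi> i \<rhd> z \<in> bds (shift_complex C 1 X) i V"
        using c y(1) by blast
    qed
  qed
  let ?t = "shift_chain_map C (- 1) \<pi>" and ?S = "shift_complex C (- 1) Z"
  have t: "chmap ?t ?S X" using chmap_shift[OF k(3), of "- 1"] k(4) by simp
  have Scx: "?S \<in> complexes" using chmapD(1)[OF t] .
  \<comment> \<open>The formula for \<rho> after the differential of the cone reads f \<pi> c =
    \<rho> d c - d \<rho> c. With the sign of the shifted differential this makes -\<rho> a
    null-homotopy.\<close>
  have "hpic (ccomp f ?t) (cnull ?S Y)"
  proof (rule hpicI[OF chmap_ccomp[OF t k(1)] chmap_cnull[OF Scx k(5)], of "\<lambda>i. - 1 \<odot> \<rho> (i - 1)"])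
    fix i
    note kp = coneD_prev[OF cone, where i = i]
    show "- 1 \<odot> \<rho> (i - 1) \<in> hom C (ob ?S i) (ob Y (i - 1))" using scale_hom[OF k(10)[of "i - 1"]] by simp
    fix W x assume "x \<in> El W (ob ?S i)"
    then have x: "x \<in> El W (ob Z (i - 1))" by simp
    show "cpt (ccomp f ?t) i \<rhd> x = cpt (cnull ?S Y) i \<rhd> x + diff Y (i - 1) \<rhd> (- 1 \<odot> \<rho> (i - 1)) \<rhd> x +
        (- 1 \<odot> \<rho> (i + 1 - 1)) \<rhd> diff ?S i \<rhd> x"
      using kp(4)[OF x] Scx k(5,6) homD(1)[OF k(10)] by (simp add: cpt_ccomp[OF t k(1)])
  qed
  then show ?thesis using that t qis_shift[OF k(3) _ piq, of "- 1"] by blast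
qed

text \<open>A null-homotopy of \<iota> g has values in the cone. Its X-component is the lift
  \<open>g'\<close>, and its Y-component is a homotopy between \<open>g\<close> and f g'.\<close>

lemma cone_lift:
  assumes cone: "is_cone X Y f Z \<iota> \<pi> \<kappa> \<rho>" and g: "chmap g W Y" and "hpic (ccomp \<iota> g) (cnull W Z)"
  obtains g' where "chmap g' W X" "hpic g (ccomp f g')"
proof -
  note k = coneD[OF cone]
  note W = chmapD(1)[OF g]
  obtain h where h0: "htpy W Z (ccomp \<iota> g) (cnull W Z) h" using hpicE[OF assms(3) chmap_ccomp[OF g k(2)]] .
  have h: "h i \<in> hom C (ob W i) (ob Z (i - 1))" for i using htpyD(2)[OF h0] .
  have hx: "cpt \<iota> i \<rhd> cpt g i \<rhd> x = diff Z (i - 1) \<rhd> h i \<rhd> x + h (i + 1) \<rhd> diff W i \<rhd> x"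
    if "x \<in> El V (ob W i)" for x V i
    using htpyD(3)[OF h0 that] W k(6) by (simp add: cpt_ccomp[OF g k(2)])
  define g' where "g' = \<lparr>src = W, tgt = X, cpt = (\<lambda>i. cpt \<pi> (i - 1) \<cdot> h i)\<rparr>"
  have g'x: "cpt g' i \<rhd> x = cpt \<pi> (i - 1) \<rhd> h i \<rhd> x" for i x
    using homD[OF h[of i]] homD[OF k(8)[of "i - 1"]] by (simp add: g'_def)
  have g'c: "chmap g' W X"
  proof (rule chmapI[OF W k(4)])
    show "cpt g' i \<in> hom C (ob W i) (ob X i)" for i
      using comp_hom[OF h coneD_prev(1)[OF cone]] by (simp add: g'_def)
    fix i V x assume x: "x \<in> El V (ob W i)"
    have "cpt \<pi> i \<rhd> cpt \<iota> i \<rhd> cpt g i \<rhd> x = - (diff X i \<rhd> cpt \<pi> (i - 1) \<rhd> h i \<rhd> x) + cpt \<pi> i \<rhd> h (i + 1) \<rhd> diff W i \<rhd> x"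
      using hx[OF x] coneD_prev(5)[OF cone, where i = i] by simp
    then show "diff X i \<rhd> cpt g' i \<rhd> x = cpt g' (i + 1) \<rhd> diff W i \<rhd> x"
      using k(14) by (simp add: g'x)
  qed (auto simp: g'_def)
  have "hpic g (ccomp f g')"
  proof (rule hpicI[OF g chmap_ccomp[OF g'c k(1)], of "\<lambda>i. \<rho> (i - 1) \<cdot> h i"])
    fix i
    show "\<rho> (i - 1) \<cdot> h i \<in> hom C (ob W i) (ob Y (i - 1))" using comp_hom[OF h k(10)] .
    fix V x assume x: "x \<in> El V (ob W i)"
    have hc: "(\<rho> (i - 1) \<cdot> h i) \<rhd> z = \<rho> (i - 1) \<rhd> h i \<rhd> z" for z i
      using homD[OF h[of i]] homD[OF k(10)[of "i - 1"]] by simp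
    have "cpt g i \<rhd> x = \<rho> i \<rhd> cpt \<iota> i \<rhd> cpt g i \<rhd> x" using k(12)[OF El_chmap[OF g x]] by simp
    also have "\<dots> = cpt f i \<rhd> cpt \<pi> (i - 1) \<rhd> h i \<rhd> x + diff Y (i - 1) \<rhd> \<rho> (i - 1) \<rhd> h i \<rhd> x
       + \<rho> i \<rhd> h (i + 1) \<rhd> diff W i \<rhd> x"
      using hx[OF x] coneD_prev(4)[OF cone El_lact[OF h x]] by simp
    finally show "cpt g i \<rhd> x = cpt (ccomp f g') i \<rhd> x + diff Y (i - 1) \<rhd> (\<rho> (i - 1) \<cdot> h i) \<rhd> x
       + (\<rho> (i + 1 - 1) \<cdot> h (i + 1)) \<rhd> diff W i \<rhd> x"
      using hc[of "i + 1"] by (simp add: cpt_ccomp[OF g'c k(1)] g'x hc)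
  qed
  then show ?thesis using that g'c by blast
qed

text \<open>If h is a null-homotopy of f g, then the pair (g, -h) is a chain map from W[1] to the
  cone, and its projection to X[1] is the shift of \<open>g\<close>.\<close>

lemma cone_colift:
  assumes cone: "is_cone X Y f Z \<iota> \<pi> \<kappa> \<rho>" and g: "chmap g W X" and "hpic (ccomp f g) (cnull W Y)"
  obtains r where "chmap r (shift_complex C 1 W) Z" "hpic (ccomp \<pi> r) (shift_chain_map C 1 g)"
proof -
  note k = coneD[OF cone]
  note W = chmapD(1)[OF g]
  obtain h where h0: "htpy W Y (ccomp f g) (cnull W Y) h" using hpicE[OF assms(3) chmap_ccomp[OF g k(1)]] .
  have h: "h i \<in> hom C (ob W i) (ob Y (i - 1))" for i using htpyD(2)[OF h0] .
  have h1: "h (i + 1) \<in> hom C (ob W (i + 1)) (ob Y i)" for i using h[of "i + 1"] by simp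
  have hx: "cpt f i \<rhd> cpt g i \<rhd> x = diff Y (i - 1) \<rhd> h i \<rhd> x + h (i + 1) \<rhd> diff W i \<rhd> x"
    if "x \<in> El V (ob W i)" for x V i
    using htpyD(3)[OF h0 that] W k(5) by (simp add: cpt_ccomp[OF g k(1)])
  define r where "r = \<lparr>src = shift_complex C 1 W, tgt = Z,
    cpt = (\<lambda>i. \<kappa> i \<cdot> cpt g (i + 1) \<oplus> - 1 \<odot> (cpt \<iota> i \<cdot> h (i + 1)))\<rparr>"
  have rx: "cpt r i \<rhd> x = \<kappa> i \<rhd> cpt g (i + 1) \<rhd> x - cpt \<iota> i \<rhd> h (i + 1) \<rhd> x" for i x
    using homD[OF h1[of i]] homD[OF k(9)[of i]] homD[OF k(7)[of i]] g by (simp add: r_def)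
  have rc: "chmap r (shift_complex C 1 W) Z"
  proof (rule chmapI[OF shift_complexes[OF W] k(6)])
    show "cpt r i \<in> hom C (ob (shift_complex C 1 W) i) (ob Z i)" for i
      using plus_hom[OF comp_hom[OF chmapD(3)[OF g] k(9)] scale_hom[OF comp_hom[OF h1 k(7)]]] by (simp add: r_def)
    fix i V x assume "x \<in> El V (ob (shift_complex C 1 W) i)"
    then have x: "x \<in> El V (ob W (i + 1))" by simp
    have "diff Z i \<rhd> cpt r i \<rhd> x = cpt \<iota> (i + 1) \<rhd> cpt f (i + 1) \<rhd> cpt g (i + 1) \<rhd> x
        - \<kappa> (i + 1) \<rhd> cpt g (i + 1 + 1) \<rhd> diff W (i + 1) \<rhd> x - cpt \<iota> (i + 1) \<rhd> diff Y i \<rhd> h (i + 1) \<rhd> x"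
      unfolding rx lact_diff k(18)[OF El_chmap[OF g x]] k(19) chmap_commute[OF g] by simp
    also have "\<dots> = cpt \<iota> (i + 1) \<rhd> h (i + 1 + 1) \<rhd> diff W (i + 1) \<rhd> x
        - \<kappa> (i + 1) \<rhd> cpt g (i + 1 + 1) \<rhd> diff W (i + 1) \<rhd> x"
      using hx[OF x] by (simp add: algebra_simps)
    also have "\<dots> = cpt r (i + 1) \<rhd> diff (shift_complex C 1 W) i \<rhd> x"
      using W by (simp add: rx algebra_simps)
    finally show "diff Z i \<rhd> cpt r i \<rhd> x = cpt r (i + 1) \<rhd> diff (shift_complex C 1 W) i \<rhd> x" .
  qed (auto simp: r_def)
  have "hpic (ccomp \<pi> r) (shift_chain_map C 1 g)"
  proof (rule hpic_eqI[OF chmap_ccomp[OF rc k(3)] chmap_shift[OF g]])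
    fix i V x assume "x \<in> El V (ob (shift_complex C 1 W) i)"
    then have x: "x \<in> El V (ob W (i + 1))" by simp
    show "cpt (ccomp \<pi> r) i \<rhd> x = cpt (shift_chain_map C 1 g) i \<rhd> x"
      using k(11)[OF El_chmap[OF g x]] k(14) by (simp add: cpt_ccomp[OF rc k(3)] rx)
  qed simp
  then show ?thesis using that rc by blast
qed

text \<open>If h is a null-homotopy of g f, then \<open>g\<close> on the Y-component plus h on the
  X-component is a chain map on the cone that restricts to \<open>g\<close>.\<close>

lemma cone_extend:
  assumes cone: "is_cone X Y f Z \<iota> \<pi> \<kappa> \<rho>" and g: "chmap g Y V" and "hpic (ccomp g f) (cnull X V)"
  obtains g' where "chmap g' Z V" "hpic (ccomp g' \<iota>) g"
proof -
  note k = coneD[OF cone]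
  note V = chmapD(2)[OF g]
  obtain h where h0: "htpy X V (ccomp g f) (cnull X V) h" using hpicE[OF assms(3) chmap_ccomp[OF k(1) g]] .
  have h: "h i \<in> hom C (ob X i) (ob V (i - 1))" for i using htpyD(2)[OF h0] .
  have h1: "h (i + 1) \<in> hom C (ob X (i + 1)) (ob V i)" for i using h[of "i + 1"] by simp
  have hx: "cpt g i \<rhd> cpt f i \<rhd> x = diff V (i - 1) \<rhd> h i \<rhd> x + h (i + 1) \<rhd> diff X i \<rhd> x"
    if "x \<in> El W (ob X i)" for x W i
    using htpyD(3)[OF h0 that] V k(4) by (simp add: cpt_ccomp[OF k(1) g])
  define r where "r = \<lparr>src = Z, tgt = V, cpt = (\<lambda>i. cpt g i \<cdot> \<rho> i \<oplus> h (i + 1) \<cdot> cpt \<pi> i)\<rparr>"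
  have rx: "cpt r i \<rhd> x = cpt g i \<rhd> \<rho> i \<rhd> x + h (i + 1) \<rhd> cpt \<pi> i \<rhd> x" for i x
    using homD[OF h1[of i]] homD[OF k(10)[of i]] homD[OF k(8)[of i]] g by (simp add: r_def)
  have rc: "chmap r Z V"
  proof (rule chmapI[OF k(6) V])
    show "cpt r i \<in> hom C (ob Z i) (ob V i)" for i
      using plus_hom[OF comp_hom[OF k(10) chmapD(3)[OF g]] comp_hom[OF k(8) h1]] by (simp add: r_def)
    fix i W x assume x: "x \<in> El W (ob Z i)"
    show "diff V i \<rhd> cpt r i \<rhd> x = cpt r (i + 1) \<rhd> diff Z i \<rhd> x"
      using hx[OF El_lact[OF k(8) x]] k(16)[OF x] k(17)[where c = x and i = i]
      by (simp add: rx chmap_commute[OF g] algebra_simps)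
  qed (auto simp: r_def)
  have "hpic (ccomp r \<iota>) g"
  proof (rule hpic_eqI[OF chmap_ccomp[OF k(2) rc] g])
    fix i W x assume x: "x \<in> El W (ob Y i)"
    show "cpt (ccomp r \<iota>) i \<rhd> x = cpt g i \<rhd> x"
      using k(12)[OF x] k(14) by (simp add: cpt_ccomp[OF k(2) rc] rx)
  qed
  then show ?thesis using that rc by blast
qed

end

section \<open>Calculus of fractions for quasi-isomorphisms\<close>

context abelian_category
begin

text \<open>The cone of the quasi-isomorphism \<open>s\<close> is acyclic, so \<iota> f becomes
  null-homotopic after composition with some quasi-isomorphism \<open>t\<close>. By
  \<open>cone_lift\<close> the map f t then factors through \<open>s\<close> up to homotopy.\<close>

lemma ore_condition:
  assumes "chmap f X Y" "chmap s Z Y" "qis s"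
  obtains W t g where "chmap t W X" "qis t" "chmap g W Z" "hpic (ccomp f t) (ccomp s g)"
proof -
  obtain K \<iota> \<pi> \<kappa> \<rho> where cone: "is_cone Z Y s K \<iota> \<pi> \<kappa> \<rho>" using cone_ex[OF assms(2)] by blast
  note k = coneD[OF cone]
  have ex: "exact_at K i" for i using qis_iff_cone_exact[OF cone] assms(3) by blast
  obtain W t where t: "chmap t W X" "qis t" "hpic (ccomp (ccomp \<iota> f) t) (cnull W K)"
    using acyclic_target_null[OF chmap_ccomp[OF assms(1) k(2)] ex] .
  have n: "hpic (ccomp \<iota> (ccomp f t)) (cnull W K)" using t(3) ccomp_assoc[OF t(1) assms(1) k(2)] by simp
  obtain g where "chmap g W Z" "hpic (ccomp f t) (ccomp s g)"
    using cone_lift[OF cone chmap_ccomp[OF t(1) assms(1)] n] .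
  then show ?thesis using that t by blast
qed

lemma shift_ccomp: "shift_chain_map C n (ccomp g f) = ccomp (shift_chain_map C n g) (shift_chain_map C n f)"
  by (simp add: shift_chain_map_def ccomp_def)

lemma shift_cnull: "shift_chain_map C n (cnull X Y) = cnull (shift_complex C n X) (shift_complex C n Y)"
  by (simp add: shift_chain_map_def cnull_def shift_complex_def)

lemma shift_chain_map_1_inverse [simp]:
  assumes "chmap f X Y"
  shows "shift_chain_map C (- 1) (shift_chain_map C 1 f) = f" "shift_chain_map C 1 (shift_chain_map C (- 1) f) = f"
  using shift_chain_map_inverse[OF assms, of 1] shift_chain_map_inverse[OF assms, of "- 1"] by auto

lemma unshift_null:
  assumes f: "chmap f X Y" and t: "chmap t W (shift_complex C 1 X)" "qis t"
    and n: "hpic (ccomp (shift_chain_map C 1 f) t) (cnull W (shift_complex C 1 Y))"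
  obtains W' t' where "chmap t' W' X" "qis t'" "hpic (ccomp f t') (cnull W' Y)"
proof -
  note XY = chmapD(1,2)[OF f]
  let ?t = "shift_chain_map C (- 1) t" and ?W = "shift_complex C (- 1) W"
  have t': "chmap ?t ?W X" using chmap_shift[OF t(1), of "- 1"] XY by simp
  have "hpic (shift_chain_map C (- 1) (ccomp (shift_chain_map C 1 f) t))
    (shift_chain_map C (- 1) (cnull W (shift_complex C 1 Y)))" using hpic_shift[OF n] by simp
  then have "hpic (ccomp f ?t) (cnull ?W Y)" using XY f by (simp add: shift_ccomp shift_cnull)
  then show ?thesis using that t' qis_shift[OF t(1) _ t(2), of "- 1"] by blast
qed

text \<open>A null-homotopy of s f makes the shift of \<open>f\<close> factor through the cone of
  \<open>s\<close>. This cone is acyclic, so some quasi-isomorphism kills the factor and with it the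
  shift of \<open>f\<close>.\<close>

lemma left_cancel_null:
  assumes f: "chmap f X Y" and s: "chmap s Y Z" "qis s" and n: "hpic (ccomp s f) (cnull X Z)"
  obtains W t where "chmap t W X" "qis t" "hpic (ccomp f t) (cnull W Y)"
proof -
  obtain K \<iota> \<pi> \<kappa> \<rho> where cone: "is_cone Y Z s K \<iota> \<pi> \<kappa> \<rho>" using cone_ex[OF s(1)] by blast
  note k = coneD[OF cone]
  have ex: "exact_at K i" for i using qis_iff_cone_exact[OF cone] s(2) by blast
  obtain r where r: "chmap r (shift_complex C 1 X) K" "hpic (ccomp \<pi> r) (shift_chain_map C 1 f)"
    using cone_colift[OF cone f n] .
  obtain W t where t: "chmap t W (shift_complex C 1 X)" "qis t" "hpic (ccomp r t) (cnull W K)"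
    using acyclic_target_null[OF r(1) ex] .
  have "hpic (ccomp (shift_chain_map C 1 f) t) (ccomp (ccomp \<pi> r) t)"
    using hpic_sym[OF hpic_ccomp_right[OF r(2) chmap_ccomp[OF r(1) k(3)] t(1)]] .
  moreover have "hpic (ccomp (ccomp \<pi> r) t) (cnull W (shift_complex C 1 Y))"
    using hpic_null_comp[OF t(3) chmap_ccomp[OF t(1) r(1)] k(3)] ccomp_assoc[OF t(1) r(1) k(3)] by simp
  ultimately have "hpic (ccomp (shift_chain_map C 1 f) t) (cnull W (shift_complex C 1 Y))" by (rule hpic_trans)
  then show ?thesis using unshift_null[OF f t(1,2)] that by blast
qed

lemma left_cancel:
  assumes f: "chmap f X Y" "chmap g X Y" and s: "chmap s Y Z" "qis s" and n: "hpic (ccomp s f) (ccomp s g)"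
  obtains W t where "chmap t W X" "qis t" "hpic (ccomp f t) (ccomp g t)"
proof -
  note X = chmapD(1)[OF f(1)] and Z = chmapD(2)[OF s(1)]
  note fg = chmap_csub[OF f]
  have "hpic (ccomp s (csub f g)) (csub (ccomp s f) (ccomp s g))"
  proof (rule hpic_eqI[OF chmap_ccomp[OF fg s(1)] chmap_csub[OF chmap_ccomp[OF f(1) s(1)] chmap_ccomp[OF f(2) s(1)]]])
    fix i W x
    show "cpt (ccomp s (csub f g)) i \<rhd> x = cpt (csub (ccomp s f) (ccomp s g)) i \<rhd> x"
      by (simp add: cpt_ccomp[OF fg s(1)] cpt_csub[OF f]
          cpt_csub[OF chmap_ccomp[OF f(1) s(1)] chmap_ccomp[OF f(2) s(1)]] cpt_ccomp[OF f(1) s(1)] cpt_ccomp[OF f(2) s(1)])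
  qed
  moreover have "hpic (csub (ccomp s f) (ccomp s g)) (cnull X Z)"
    using hpic_csub_iff[OF chmap_ccomp[OF f(1) s(1)] chmap_ccomp[OF f(2) s(1)]] n by blast
  ultimately have n0: "hpic (ccomp s (csub f g)) (cnull X Z)" by (rule hpic_trans)
  obtain W t where t: "chmap t W X" "qis t" "hpic (ccomp (csub f g) t) (cnull W Y)"
    using left_cancel_null[OF fg s n0] .
  have "hpic (csub (ccomp f t) (ccomp g t)) (ccomp (csub f g) t)"
  proof (rule hpic_eqI[OF chmap_csub[OF chmap_ccomp[OF t(1) f(1)] chmap_ccomp[OF t(1) f(2)]] chmap_ccomp[OF t(1) fg]])
    fix i W x
    show "cpt (csub (ccomp f t) (ccomp g t)) i \<rhd> x = cpt (ccomp (csub f g) t) i \<rhd> x"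
      by (simp add: cpt_ccomp[OF t(1) fg] cpt_csub[OF f]
          cpt_csub[OF chmap_ccomp[OF t(1) f(1)] chmap_ccomp[OF t(1) f(2)]] cpt_ccomp[OF t(1) f(1)] cpt_ccomp[OF t(1) f(2)])
  qed
  then have "hpic (csub (ccomp f t) (ccomp g t)) (cnull W Y)" using t(3) by (rule hpic_trans)
  then have "hpic (ccomp f t) (ccomp g t)"
    using hpic_csub_iff[OF chmap_ccomp[OF t(1) f(1)] chmap_ccomp[OF t(1) f(2)]] by blast
  then show ?thesis using that t by blast
qed

lemma cone_cycle_pi_zero:
  assumes "is_cone X Y f Z \<iota> \<pi> \<kappa> \<rho>" "c \<in> cycs Z i W" "cpt \<pi> i \<rhd> c = 0"
  shows "cpt \<iota> i \<rhd> \<rho> i \<rhd> c = c" "\<rho> i \<rhd> c \<in> cycs Y i W"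
  using cone_decompose[OF assms(1,2)] assms(3) by (auto simp: cycs_def)

text \<open>The five lemma for a square that commutes up to homotopy, chased on cocycles of the two
  cones. It allows \<open>hvanish_cone_source\<close> to replace a cone by one over the apex of a
  roof.\<close>

lemma cone_map_qis:
  assumes cone: "is_cone A B f Z \<iota> \<pi> \<kappa> \<rho>" and cone': "is_cone A' B' f' Z' \<iota>' \<pi>' \<kappa>' \<rho>'"
    and s: "chmap s A' A" "qis s" and t: "chmap t B' B" "qis t"
    and sq: "hpic (ccomp t f') (ccomp f s)"
  obtains \<phi> where "chmap \<phi> Z' Z" "qis \<phi>"
proof -
  note k = coneD[OF cone] and k' = coneD[OF cone']
  obtain h where h0: "htpy A' B (ccomp t f') (ccomp f s) h" using hpicE[OF sq chmap_ccomp[OF k'(1) t(1)]] .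
  have h: "h i \<in> hom C (ob A' i) (ob B (i - 1))" for i using htpyD(2)[OF h0] .
  have h1: "h (i + 1) \<in> hom C (ob A' (i + 1)) (ob B i)" for i using h[of "i + 1"] by simp
  have hx: "cpt t i \<rhd> cpt f' i \<rhd> x = cpt f i \<rhd> cpt s i \<rhd> x + diff B (i - 1) \<rhd> h i \<rhd> x + h (i + 1) \<rhd> diff A' i \<rhd> x"
    if "x \<in> El W (ob A' i)" for x W i
    using htpyD(3)[OF h0 that] by (simp add: cpt_ccomp[OF k'(1) t(1)] cpt_ccomp[OF s(1) k(1)])
  have hx1: "cpt t (i + 1) \<rhd> cpt f' (i + 1) \<rhd> x = cpt f (i + 1) \<rhd> cpt s (i + 1) \<rhd> x + diff B i \<rhd> h (i + 1) \<rhd> x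
      + h (i + 1 + 1) \<rhd> diff A' (i + 1) \<rhd> x" if "x \<in> El W (ob A' (i + 1))" for x W i
    using hx[OF that] by simp
  \<comment> \<open>In components (a, b) goes to (s a, t b + h a); the homotopy h corrects for the
    failure of the square to commute strictly.\<close>
  define \<phi> where "\<phi> = \<lparr>src = Z', tgt = Z, cpt = (\<lambda>i. \<kappa> i \<cdot> cpt s (i + 1) \<cdot> cpt \<pi>' i
    \<oplus> cpt \<iota> i \<cdot> (cpt t i \<cdot> \<rho>' i \<oplus> h (i + 1) \<cdot> cpt \<pi>' i))\<rparr>"
  have \<phi>x: "cpt \<phi> i \<rhd> c = \<kappa> i \<rhd> cpt s (i + 1) \<rhd> cpt \<pi>' i \<rhd> c + cpt \<iota> i \<rhd> (cpt t i \<rhd> \<rho>' i \<rhd> c + h (i + 1) \<rhd> cpt \<pi>' i \<rhd> c)" for i c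
    using homD[OF h1[of i]] homD[OF k'(10)[of i]] homD[OF k'(8)[of i]] homD[OF k(9)[of i]] homD[OF k(7)[of i]] s(1) t(1)
    by (simp add: \<phi>_def)
  have \<phi>: "chmap \<phi> Z' Z"
  proof (rule chmapI[OF k'(6) k(6)])
    show "cpt \<phi> i \<in> hom C (ob Z' i) (ob Z i)" for i
      using plus_hom[OF comp_hom[OF comp_hom[OF k'(8) chmapD(3)[OF s(1)]] k(9)]
          comp_hom[OF plus_hom[OF comp_hom[OF k'(10) chmapD(3)[OF t(1)]] comp_hom[OF k'(8) h1]] k(7)]]
      by (simp add: \<phi>_def)
    fix i W c assume c: "c \<in> El W (ob Z' i)"
    have a: "cpt \<pi>' i \<rhd> c \<in> El W (ob A' (i + 1))" using El_lact[OF k'(8) c] .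
    have "diff Z i \<rhd> cpt \<phi> i \<rhd> c = cpt \<iota> (i + 1) \<rhd> (cpt f (i + 1) \<rhd> cpt s (i + 1) \<rhd> cpt \<pi>' i \<rhd> c
        + cpt t (i + 1) \<rhd> diff B' i \<rhd> \<rho>' i \<rhd> c + diff B i \<rhd> h (i + 1) \<rhd> cpt \<pi>' i \<rhd> c)
        - \<kappa> (i + 1) \<rhd> cpt s (i + 1 + 1) \<rhd> diff A' (i + 1) \<rhd> cpt \<pi>' i \<rhd> c"
      unfolding \<phi>x lact_add k(18)[OF El_chmap[OF s(1) a]] k(19) chmap_commute[OF s(1)] chmap_commute[OF t(1)] by simp
    also have "\<dots> = cpt \<phi> (i + 1) \<rhd> diff Z' i \<rhd> c"
      unfolding \<phi>x k'(16)[OF c] k'(17) lact_add lact_uminus hx1[OF a] by simp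
    finally show "diff Z i \<rhd> cpt \<phi> i \<rhd> c = cpt \<phi> (i + 1) \<rhd> diff Z' i \<rhd> c" .
  qed (auto simp: \<phi>_def)
  have \<pi>\<phi>: "cpt \<pi> i \<rhd> cpt \<phi> i \<rhd> c = cpt s (i + 1) \<rhd> cpt \<pi>' i \<rhd> c" if "c \<in> El W (ob Z' i)" for i c W
    unfolding \<phi>x using k(11)[OF El_chmap[OF s(1) El_lact[OF k'(8) that]]] k(14) by simp
  have \<phi>\<iota>: "cpt \<phi> i \<rhd> cpt \<iota>' i \<rhd> b = cpt \<iota> i \<rhd> cpt t i \<rhd> b" if "b \<in> El W (ob B' i)" for i b W
    unfolding \<phi>x using k'(14) k'(12)[OF that] by simp
  have \<phi>\<kappa>: "cpt \<phi> i \<rhd> \<kappa>' i \<rhd> a = \<kappa> i \<rhd> cpt s (i + 1) \<rhd> a + cpt \<iota> i \<rhd> h (i + 1) \<rhd> a" if "a \<in> El W (ob A' (i + 1))" for i a W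
    unfolding \<phi>x using k'(11)[OF that] k'(13) by simp
  have "qis \<phi>"
  proof (rule qisI[OF \<phi>])
    fix i
    note kp = coneD_prev[OF cone, where i = i] and kp' = coneD_prev[OF cone', where i = i]
    show "H_surj \<phi> i"
    proof (rule H_surjI[OF \<phi>])
      fix W y assume y: "y \<in> cycs Z i W"
      note yd = cone_decompose[OF cone y]
      let ?a = "cpt \<pi> i \<rhd> y" and ?b = "\<rho> i \<rhd> y"
      obtain V1 e1 a0 where a0: "e1 \<in> epis V1 W" "a0 \<in> cycs A' (i + 1) V1"
        "?a \<lhd> e1 - cpt s (i + 1) \<rhd> a0 \<in> bds A (i + 1) V1"
        using H_surjE[OF qisD(2)[OF s(2)] s(1) yd(1)] .
      obtain V2 e2 a1 where a1: "e2 \<in> epis V2 V1" "a1 \<in> El V2 (ob A i)"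
        "(?a \<lhd> e1 - cpt s (i + 1) \<rhd> a0) \<lhd> e2 = diff A i \<rhd> a1"
        using bdsE[OF a0(3)] by simp metis
      define a' where "a' = a0 \<lhd> e2"
      have a': "a' \<in> cycs A' (i + 1) V2" unfolding a'_def using cycs_ract[OF a0(2) epis_hom[OF a1(1)]] .
      define e where "e = e1 \<cdot> e2"
      have e: "e \<in> epis V2 W" unfolding e_def using epis_comp[OF a0(1) a1(1)] .
      have xe: "x \<lhd> e = x \<lhd> e1 \<lhd> e2" for x unfolding e_def using a0(1) a1(1) by simp
      have sa: "cpt s (i + 1) \<rhd> a' = ?a \<lhd> e - diff A i \<rhd> a1"
        using a1(3) by (simp add: a'_def xe algebra_simps)
      have be: "?b \<lhd> e \<in> El V2 (ob B i)" using El_ract[OF yd(2) epis_hom[OF e]] .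
      have fa: "cpt f (i + 1) \<rhd> (?a \<lhd> e) = - (diff B i \<rhd> (?b \<lhd> e))"
        using arg_cong[OF yd(3), of "\<lambda>z. z \<lhd> e"] by (simp add: eq_neg_iff_add_eq_0)
      have fa1: "cpt f (i + 1) \<rhd> diff A i \<rhd> a1 = diff B i \<rhd> cpt f i \<rhd> a1" using chmap_commute[OF k(1)] by simp
      have ha': "h (i + 1) \<rhd> a' \<in> El V2 (ob B i)" using El_lact[OF h1 cycsD(1)[OF a']] .
      have fa1E: "cpt f i \<rhd> a1 \<in> El V2 (ob B i)" using El_chmap[OF k(1) a1(2)] .
      \<comment> \<open>For \<open>a'\<close> to be the first component of a cocycle of Z', the
        element f' a' must be a coboundary. Its image under \<open>t\<close> has a primitive, made
        from h, the second component of \<open>y\<close> and \<open>a1\<close>, and \<open>t\<close>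
        is injective on cohomology.\<close>
      have tf: "cpt t (i + 1) \<rhd> cpt f' (i + 1) \<rhd> a' = diff B i \<rhd> (h (i + 1) \<rhd> a' - ?b \<lhd> e - cpt f i \<rhd> a1)"
        unfolding hx1[OF cycsD(1)[OF a']] sa using fa fa1 cycsD(2)[OF a'] by (simp add: algebra_simps)
      have "cpt t (i + 1) \<rhd> cpt f' (i + 1) \<rhd> a' \<in> bds B (i + 1) V2"
        unfolding tf using bds_boundary[OF k(5), of "h (i + 1) \<rhd> a' - ?b \<lhd> e - cpt f i \<rhd> a1" V2 "i + 1"] ha' be fa1E by simp
      then have "cpt f' (i + 1) \<rhd> a' \<in> bds B' (i + 1) V2"
        using H_injD[OF qisD(1)[OF t(2)] t(1) cycs_chmap[OF k'(1) a']] by blast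
      then obtain V3 e3 b1 where b1: "e3 \<in> epis V3 V2" "b1 \<in> El V3 (ob B' i)"
        "(cpt f' (i + 1) \<rhd> a') \<lhd> e3 = diff B' i \<rhd> b1"
        using bdsE[of "cpt f' (i + 1) \<rhd> a'" B' "i + 1" V2] by simp metis
      have a3: "a' \<lhd> e3 \<in> cycs A' (i + 1) V3" using cycs_ract[OF a' epis_hom[OF b1(1)]] .
      define c0 where "c0 = \<kappa>' i \<rhd> (a' \<lhd> e3) + cpt \<iota>' i \<rhd> (- b1)"
      have c0: "c0 \<in> cycs Z' i V3"
        unfolding c0_def using cone_cycle_iff[OF cone' cycsD(1)[OF a3], of "- b1"] a3 b1(2,3) by simp
      have \<phi>c0: "cpt \<phi> i \<rhd> c0 = \<kappa> i \<rhd> cpt s (i + 1) \<rhd> (a' \<lhd> e3) + cpt \<iota> i \<rhd> h (i + 1) \<rhd> (a' \<lhd> e3) - cpt \<iota> i \<rhd> cpt t i \<rhd> b1"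
        unfolding c0_def using \<phi>\<kappa>[OF cycsD(1)[OF a3]] \<phi>\<iota>[OF b1(2)] by simp
      have a1e: "a1 \<lhd> e3 \<in> El V3 (ob A i)" using El_ract[OF a1(2) epis_hom[OF b1(1)]] .
      have ye: "y \<lhd> e \<lhd> e3 = \<kappa> i \<rhd> (?a \<lhd> e \<lhd> e3) + cpt \<iota> i \<rhd> (?b \<lhd> e \<lhd> e3)"
        using arg_cong[OF yd(4), of "\<lambda>z. z \<lhd> e \<lhd> e3"] by simp
      have sa3: "cpt s (i + 1) \<rhd> (a' \<lhd> e3) = ?a \<lhd> e \<lhd> e3 - diff A i \<rhd> (a1 \<lhd> e3)"
        using arg_cong[OF sa, of "\<lambda>z. z \<lhd> e3"] by simp
      \<comment> \<open>Once the first component of \<open>y\<close> is matched by \<open>c0\<close>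
        and a coboundary, \<open>b2\<close> is the second component that remains, as
        \<open>\<iota>b2\<close> shows. It is a cocycle of \<open>B\<close>, so \<open>t\<close>
        hits it up to a coboundary.\<close>
      define b2 where "b2 = ?b \<lhd> e \<lhd> e3 + cpt t i \<rhd> b1 - h (i + 1) \<rhd> (a' \<lhd> e3) + cpt f i \<rhd> (a1 \<lhd> e3)"
      have b2E: "b2 \<in> El V3 (ob B i)"
        unfolding b2_def using El_ract[OF be epis_hom[OF b1(1)]] El_chmap[OF t(1) b1(2)] El_lact[OF h1 cycsD(1)[OF a3]]
          El_chmap[OF k(1) a1e] by blast
      have \<iota>b2: "cpt \<iota> i \<rhd> b2 = y \<lhd> e \<lhd> e3 - cpt \<phi> i \<rhd> c0 + diff Z (i - 1) \<rhd> \<kappa> (i - 1) \<rhd> (a1 \<lhd> e3)"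
        unfolding b2_def ye \<phi>c0 sa3 kp(6)[OF a1e] by (simp add: algebra_simps)
      have ka1: "\<kappa> (i - 1) \<rhd> (a1 \<lhd> e3) \<in> El V3 (ob Z (i - 1))" using El_lact[OF kp(2) a1e] .
      have "cpt \<iota> i \<rhd> b2 \<in> cycs Z i V3"
        unfolding \<iota>b2
        by (intro cycs_add cycs_diff cycs_ract[OF cycs_ract[OF y epis_hom[OF e]] epis_hom[OF b1(1)]]
            cycs_chmap[OF \<phi> c0] cycs_boundary[OF k(6) ka1])
      then have b2: "b2 \<in> cycs B i V3" using cone_decompose(3)[OF cone, of "cpt \<iota> i \<rhd> b2" i V3] k(12)[OF b2E] k(14) b2E
        by (simp add: cycs_def)
      obtain V4 e4 b' where b': "e4 \<in> epis V4 V3" "b' \<in> cycs B' i V4" "b2 \<lhd> e4 - cpt t i \<rhd> b' \<in> bds B i V4"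
        using H_surjE[OF qisD(2)[OF t(2)] t(1) b2] .
      let ?c = "c0 \<lhd> e4 + cpt \<iota>' i \<rhd> b'"
      have cc: "?c \<in> cycs Z' i V4"
        using cycs_add[OF cycs_ract[OF c0 epis_hom[OF b'(1)]] cycs_chmap[OF k'(2) b'(2)]] .
      have ka2: "\<kappa> (i - 1) \<rhd> (a1 \<lhd> e3) \<lhd> e4 \<in> El V4 (ob Z (i - 1))" using El_ract[OF ka1 epis_hom[OF b'(1)]] by simp
      have eq: "cpt \<iota> i \<rhd> (b2 \<lhd> e4 - cpt t i \<rhd> b') - diff Z (i - 1) \<rhd> (\<kappa> (i - 1) \<rhd> (a1 \<lhd> e3) \<lhd> e4)
         = y \<lhd> e \<lhd> e3 \<lhd> e4 - cpt \<phi> i \<rhd> ?c"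
        using arg_cong[OF \<iota>b2, of "\<lambda>z. z \<lhd> e4"] \<phi>\<iota>[OF cycsD(1)[OF b'(2)]] by simp
      have "y \<lhd> e \<lhd> e3 \<lhd> e4 - cpt \<phi> i \<rhd> ?c \<in> bds Z i V4"
        unfolding eq[symmetric] using bds_diff[OF k(6) bds_chmap[OF k(2) b'(3)] bds_boundary[OF k(6) ka2]] .
      moreover have "y \<lhd> (e \<cdot> (e3 \<cdot> e4)) = y \<lhd> e \<lhd> e3 \<lhd> e4"
        using ract_epis_comp[OF e epis_comp[OF b1(1) b'(1)]] b1(1) b'(1) by simp
      ultimately show "\<exists>V. \<exists>e\<in>epis V W. \<exists>x\<in>cycs Z' i V. y \<lhd> e - cpt \<phi> i \<rhd> x \<in> bds Z i V"
        using epis_comp[OF e epis_comp[OF b1(1) b'(1)]] cc by metis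
    qed
    show "H_inj \<phi> i"
    proof (rule H_injI[OF \<phi>])
      fix W c assume c: "c \<in> cycs Z' i W" "cpt \<phi> i \<rhd> c \<in> bds Z i W"
      note cd = cone_decompose[OF cone' c(1)]
      have "cpt s (i + 1) \<rhd> cpt \<pi>' i \<rhd> c \<in> bds A (i + 1) W"
        using bds_chmap[OF k(3) c(2)] \<pi>\<phi>[OF cycsD(1)[OF c(1)]] k(4) by simp
      then have "cpt \<pi>' i \<rhd> c \<in> bds A' (i + 1) W" using H_injD[OF qisD(1)[OF s(2)] s(1) cd(1)] by blast
      then obtain V1 e1 a1 where a1: "e1 \<in> epis V1 W" "a1 \<in> El V1 (ob A' i)" "(cpt \<pi>' i \<rhd> c) \<lhd> e1 = diff A' i \<rhd> a1"
        using bdsE[of "cpt \<pi>' i \<rhd> c" A' "i + 1" W] by simp metis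
      have ka: "\<kappa>' (i - 1) \<rhd> a1 \<in> El V1 (ob Z' (i - 1))" using El_lact[OF kp'(2) a1(2)] .
      \<comment> \<open>A coboundary removes the first component, so that \<open>c\<close> may be
        replaced by \<iota>' b for a cocycle \<open>b\<close> of B'.\<close>
      let ?c = "c \<lhd> e1 + diff Z' (i - 1) \<rhd> \<kappa>' (i - 1) \<rhd> a1"
      have cc: "?c \<in> cycs Z' i V1"
        using cycs_add[OF cycs_ract[OF c(1) epis_hom[OF a1(1)]] cycs_boundary[OF k'(6) ka]] .
      have "cpt \<pi>' i \<rhd> ?c = (cpt \<pi>' i \<rhd> c) \<lhd> e1 - diff A' i \<rhd> a1" using kp'(5) kp'(3)[OF a1(2)] by simp
      then have p0: "cpt \<pi>' i \<rhd> ?c = 0" using a1(3) by simp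
      define b where "b = \<rho>' i \<rhd> ?c"
      have eq: "cpt \<iota>' i \<rhd> b = ?c" and b: "b \<in> cycs B' i V1"
        unfolding b_def by (fact cone_cycle_pi_zero[OF cone' cc p0])+
      have "cpt \<phi> i \<rhd> ?c \<in> bds Z i V1"
        using bds_add[OF k(6) bds_ract[OF c(2) epis_hom[OF a1(1)]] bds_chmap[OF \<phi> bds_boundary[OF k'(6) ka]]] by simp
      then have "cpt \<iota> i \<rhd> cpt t i \<rhd> b \<in> bds Z i V1" using \<phi>\<iota>[OF cycsD(1)[OF b]] eq by metis
      then obtain V2 e2 z where z: "e2 \<in> epis V2 V1" "z \<in> El V2 (ob Z (i - 1))"
        "(cpt \<iota> i \<rhd> cpt t i \<rhd> b) \<lhd> e2 = diff Z (i - 1) \<rhd> z" using bdsE by metis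
      have z3: "cpt \<iota> i \<rhd> cpt t i \<rhd> (b \<lhd> e2) = diff Z (i - 1) \<rhd> z" using z(3) by simp
      have be: "b \<lhd> e2 \<in> cycs B' i V2" using cycs_ract[OF b epis_hom[OF z(1)]] .
      let ?a = "cpt \<pi> (i - 1) \<rhd> z"
      have "diff A i \<rhd> ?a = 0"
        using arg_cong[OF z3, of "\<lambda>x. cpt \<pi> i \<rhd> x"] k(14) kp(5)[of z] by simp
      then have a: "?a \<in> cycs A i V2" using cycsI[OF El_lact[OF kp(1) z(2)]] by blast
      \<comment> \<open>Injectivity of \<open>t\<close> does not apply to \<open>b\<close> directly:
        t b is a coboundary in the cone only, so in \<open>B\<close> it agrees with f a up to a
        coboundary. Subtracting f' a' from \<open>b\<close>, where s a' is cohomologous to a,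
        repairs this; and \<iota>' f' a' is a coboundary of Z'.\<close>
      have tb: "cpt t i \<rhd> (b \<lhd> e2) = cpt f i \<rhd> ?a + diff B (i - 1) \<rhd> \<rho> (i - 1) \<rhd> z"
        using arg_cong[OF z3, of "\<lambda>x. \<rho> i \<rhd> x"] k(12)[OF El_chmap[OF t(1) cycsD(1)[OF be]]] kp(4)[OF z(2)] by simp
      obtain V3 e3 a' where a': "e3 \<in> epis V3 V2" "a' \<in> cycs A' i V3" "?a \<lhd> e3 - cpt s i \<rhd> a' \<in> bds A i V3"
        using H_surjE[OF qisD(2)[OF s(2)] s(1) a] .
      have tf: "cpt t i \<rhd> cpt f' i \<rhd> a' = cpt f i \<rhd> cpt s i \<rhd> a' + diff B (i - 1) \<rhd> h i \<rhd> a'"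
        using hx[OF cycsD(1)[OF a'(2)]] cycsD(2)[OF a'(2)] by simp
      have bb: "b \<lhd> e2 \<lhd> e3 - cpt f' i \<rhd> a' \<in> cycs B' i V3"
        using cycs_diff[OF cycs_ract[OF be epis_hom[OF a'(1)]] cycs_chmap[OF k'(1) a'(2)]] .
      have zz: "\<rho> (i - 1) \<rhd> z \<lhd> e3 \<in> El V3 (ob B (i - 1))" using El_ract[OF El_lact[OF k(10) z(2)] epis_hom[OF a'(1)]] by simp
      have "cpt t i \<rhd> (b \<lhd> e2 \<lhd> e3 - cpt f' i \<rhd> a') = cpt f i \<rhd> (?a \<lhd> e3 - cpt s i \<rhd> a')
          + diff B (i - 1) \<rhd> (\<rho> (i - 1) \<rhd> z \<lhd> e3 - h i \<rhd> a')"
        using arg_cong[OF tb, of "\<lambda>x. x \<lhd> e3"] tf by (simp add: algebra_simps)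
      also have "\<dots> \<in> bds B i V3"
        using bds_add[OF k(5) bds_chmap[OF k(1) a'(3)] bds_boundary[OF k(5) El_diff[OF zz El_lact[OF h cycsD(1)[OF a'(2)]]]]] .
      finally have "b \<lhd> e2 \<lhd> e3 - cpt f' i \<rhd> a' \<in> bds B' i V3" using H_injD[OF qisD(1)[OF t(2)] t(1) bb] by blast
      then have 1: "cpt \<iota>' i \<rhd> (b \<lhd> e2 \<lhd> e3 - cpt f' i \<rhd> a') \<in> bds Z' i V3" using bds_chmap[OF k'(2)] by blast
      have 2: "cpt \<iota>' i \<rhd> cpt f' i \<rhd> a' \<in> bds Z' i V3"
        using bds_boundary[OF k'(6) El_lact[OF kp'(2) cycsD(1)[OF a'(2)]]] kp'(6)[OF cycsD(1)[OF a'(2)]] cycsD(2)[OF a'(2)] by simp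
      have "(cpt \<iota>' i \<rhd> b) \<lhd> (e2 \<cdot> e3) \<in> bds Z' i V3" using bds_add[OF k'(6) 1 2] z(1) a'(1) by simp
      then have "?c \<in> bds Z' i V1" unfolding eq using bds_local[OF cycsD(1)[OF cc] epis_comp[OF z(1) a'(1)]] by blast
      then have "?c - diff Z' (i - 1) \<rhd> \<kappa>' (i - 1) \<rhd> a1 \<in> bds Z' i V1" using bds_diff[OF k'(6)] bds_boundary[OF k'(6) ka] by blast
      then have "c \<lhd> e1 \<in> bds Z' i V1" by simp
      then show "c \<in> bds Z' i W" using bds_local[OF cycsD(1)[OF c(1)] a1(1)] by blast
    qed
  qed
  then show ?thesis using that \<phi> by blast
qed

text \<open>This is \<open>Hom(X, Z) = 0\<close> in the derived category, in terms of roofs.\<close>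

definition hvanish :: "('a, 'b) complex_data \<Rightarrow> ('a, 'b) complex_data \<Rightarrow> bool" where
  "hvanish X Z \<longleftrightarrow> (\<forall>W s f. chmap s W X \<and> qis s \<and> chmap f W Z \<longrightarrow>
     (\<exists>V t. chmap t V W \<and> qis t \<and> hpic (ccomp f t) (cnull V Z)))"

lemma hvanishE:
  assumes "hvanish X Z" "chmap s W X" "qis s" "chmap f W Z"
  obtains V t where "chmap t V W" "qis t" "hpic (ccomp f t) (cnull V Z)"
  using assms unfolding hvanish_def by blast

lemma hvanishI:
  assumes "\<And>W s f. chmap s W X \<Longrightarrow> qis s \<Longrightarrow> chmap f W Z \<Longrightarrow>
     \<exists>V t. chmap t V W \<and> qis t \<and> hpic (ccomp f t) (cnull V Z)"
  shows "hvanish X Z"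
  using assms unfolding hvanish_def by blast

lemma null_compose:
  assumes "chmap t V W" "chmap g W A" "chmap t' U V" "chmap f W B" "hpic (ccomp f t) (ccomp k g')" "chmap g' V A'"
    "chmap k A' B" "hpic (ccomp g' t') (cnull U A')"
  shows "hpic (ccomp f (ccomp t t')) (cnull U B)"
proof -
  have "hpic (ccomp (ccomp f t) t') (ccomp (ccomp k g') t')"
    using hpic_ccomp_right[OF assms(5) chmap_ccomp[OF assms(1,4)] assms(3)] .
  moreover have "hpic (ccomp k (ccomp g' t')) (cnull U B)"
    using hpic_null_comp[OF assms(8) chmap_ccomp[OF assms(3,6)] assms(7)] .
  ultimately show ?thesis
    using hpic_trans ccomp_assoc[OF assms(3,1,4)] ccomp_assoc[OF assms(3,6,7)] by metis
qed

text \<open>Composition with \<open>q\<close> turns roofs over X' into roofs over \<open>X\<close>.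
  Conversely the Ore condition moves a roof over \<open>X\<close> to one over X' at the price of
  refining its apex, and vanishing is asked for after refinement only.\<close>

lemma hvanish_qis_left:
  assumes q: "chmap q X' X" "qis q" shows "hvanish X Z \<longleftrightarrow> hvanish X' Z"
proof
  assume v: "hvanish X Z"
  show "hvanish X' Z"
  proof (rule hvanishI)
    fix W s f assume s: "chmap s W X'" "qis s" "chmap f W Z"
    show "\<exists>V t. chmap t V W \<and> qis t \<and> hpic (ccomp f t) (cnull V Z)"
      using hvanishE[OF v chmap_ccomp[OF s(1) q(1)] qis_ccomp[OF s(1) q(1) s(2) q(2)] s(3)] by metis
  qed
next
  assume v: "hvanish X' Z"
  show "hvanish X Z"
  proof (rule hvanishI)
    fix W s f assume s: "chmap s W X" "qis s" "chmap f W Z"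
    obtain V t g where t: "chmap t V W" "qis t" "chmap g V X'" "hpic (ccomp s t) (ccomp q g)"
      using ore_condition[OF s(1) q] .
    have "qis (ccomp q g)" using qis_hpic[OF t(4) chmap_ccomp[OF t(1) s(1)] qis_ccomp[OF t(1) s(1) t(2) s(2)]] .
    then have g: "qis g" using qis_cancel_left[OF t(3) q(1)] q(2) by blast
    obtain U t' where t': "chmap t' U V" "qis t'" "hpic (ccomp (ccomp f t) t') (cnull U Z)"
      using hvanishE[OF v t(3) g chmap_ccomp[OF t(1) s(3)]] .
    then show "\<exists>V t. chmap t V W \<and> qis t \<and> hpic (ccomp f t) (cnull V Z)"
      using chmap_ccomp[OF t'(1) t(1)] qis_ccomp[OF t'(1) t(1) t'(2) t(2)] ccomp_assoc[OF t'(1) t(1) s(3)] by metis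
  qed
qed

text \<open>In one direction the Ore condition factors the numerator through \<open>q\<close>, in
  the other \<open>left_cancel_null\<close> cancels \<open>q\<close>. Both cost a further
  denominator, which the definition of \<open>hvanish\<close> allows.\<close>

lemma hvanish_qis_right:
  assumes q: "chmap q Z Z'" "qis q" shows "hvanish X Z \<longleftrightarrow> hvanish X Z'"
proof
  assume v: "hvanish X Z"
  show "hvanish X Z'"
  proof (rule hvanishI)
    fix W s f assume s: "chmap s W X" "qis s" "chmap f W Z'"
    obtain V t g where t: "chmap t V W" "qis t" "chmap g V Z" "hpic (ccomp f t) (ccomp q g)"
      using ore_condition[OF s(3) q] .
    obtain U t' where t': "chmap t' U V" "qis t'" "hpic (ccomp g t') (cnull U Z)"
      using hvanishE[OF v chmap_ccomp[OF t(1) s(1)] qis_ccomp[OF t(1) s(1) t(2) s(2)] t(3)] .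
    have "hpic (ccomp f (ccomp t t')) (cnull U Z')"
      using null_compose[OF t(1) s(1) t'(1) s(3) t(4) t(3) q(1) t'(3)] .
    then show "\<exists>V t. chmap t V W \<and> qis t \<and> hpic (ccomp f t) (cnull V Z')"
      using chmap_ccomp[OF t'(1) t(1)] qis_ccomp[OF t'(1) t(1) t'(2) t(2)] by blast
  qed
next
  assume v: "hvanish X Z'"
  show "hvanish X Z"
  proof (rule hvanishI)
    fix W s f assume s: "chmap s W X" "qis s" "chmap f W Z"
    obtain V t where t: "chmap t V W" "qis t" "hpic (ccomp (ccomp q f) t) (cnull V Z')"
      using hvanishE[OF v s(1,2) chmap_ccomp[OF s(3) q(1)]] .
    have n: "hpic (ccomp q (ccomp f t)) (cnull V Z')" using t(3) ccomp_assoc[OF t(1) s(3) q(1)] by simp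
    obtain U t' where t': "chmap t' U V" "qis t'" "hpic (ccomp (ccomp f t) t') (cnull U Z)"
      using left_cancel_null[OF chmap_ccomp[OF t(1) s(3)] q n] .
    then show "\<exists>V t. chmap t V W \<and> qis t \<and> hpic (ccomp f t) (cnull V Z)"
      using chmap_ccomp[OF t'(1) t(1)] qis_ccomp[OF t'(1) t(1) t'(2) t(2)] ccomp_assoc[OF t'(1) t(1) s(3)] by metis
  qed
qed

lemma hvanish_shift_imp:
  assumes v: "hvanish X Z" and n: "n = 1 \<or> n = - 1" and cx: "X \<in> complexes" "Z \<in> complexes"
  shows "hvanish (shift_complex C n X) (shift_complex C n Z)"
proof (rule hvanishI)
  fix W s f assume s: "chmap s W (shift_complex C n X)" "qis s" "chmap f W (shift_complex C n Z)"
  have m: "- n = 1 \<or> - n = - 1" using n by auto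
  let ?sh = "shift_chain_map C (- n)" and ?W = "shift_complex C (- n) W"
  have s': "chmap (?sh s) ?W X" "chmap (?sh f) ?W Z"
    using chmap_shift[OF s(1) m] chmap_shift[OF s(3) m] shift_inverse[OF cx(1) n] shift_inverse[OF cx(2) n] by simp_all
  obtain V t where t: "chmap t V ?W" "qis t" "hpic (ccomp (?sh f) t) (cnull V Z)"
    using hvanishE[OF v s'(1) qis_shift[OF s(1) m s(2)] s'(2)] .
  have W: "shift_complex C n ?W = W" using shift_inverse[OF chmapD(1)[OF s(1)] m] by simp
  have t': "chmap (shift_chain_map C n t) (shift_complex C n V) W" using chmap_shift[OF t(1) n] W by simp
  have "hpic (ccomp (shift_chain_map C n (?sh f)) (shift_chain_map C n t)) (cnull (shift_complex C n V) (shift_complex C n Z))"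
    using hpic_shift[OF t(3) n] by (simp add: shift_ccomp shift_cnull)
  then have "hpic (ccomp f (shift_chain_map C n t)) (cnull (shift_complex C n V) (shift_complex C n Z))"
    using shift_chain_map_inverse[OF s(3) m] by simp
  then show "\<exists>V t. chmap t V W \<and> qis t \<and> hpic (ccomp f t) (cnull V (shift_complex C n Z))"
    using t' qis_shift[OF t(1) n t(2)] by blast
qed

lemma hvanish_shift:
  assumes "X \<in> complexes" "Z \<in> complexes"
  shows "hvanish (shift_complex C 1 X) Z \<longleftrightarrow> hvanish X (shift_complex C (- 1) Z)"
  using hvanish_shift_imp[of "shift_complex C 1 X" Z "- 1"] hvanish_shift_imp[of X "shift_complex C (- 1) Z" 1]
    assms shift_complexes by auto

text \<open>Exactness of Hom(-, Z) at \<open>B\<close>: an arrow on \<open>B\<close> that vanishes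
  on \<open>A\<close> extends to the cone, where it vanishes. An arrow given by a roof lives on the
  apex \<open>W\<close> instead of \<open>B\<close>, and the cone has to be rebuilt there.\<close>

lemma hvanish_cone_source:
  assumes cone: "is_cone A B f K \<iota> \<pi> \<kappa> \<rho>" and v: "hvanish A Z" "hvanish K Z"
  shows "hvanish B Z"
proof (rule hvanishI)
  note k = coneD[OF cone]
  fix W s g assume s: "chmap s W B" "qis s" "chmap g W Z"
  obtain A' s' f' where a: "chmap s' A' A" "qis s'" "chmap f' A' W" "hpic (ccomp f s') (ccomp s f')"
    using ore_condition[OF k(1) s(1,2)] .
  obtain A'' t where t: "chmap t A'' A'" "qis t" "hpic (ccomp (ccomp g f') t) (cnull A'' Z)"
    using hvanishE[OF v(1) a(1,2) chmap_ccomp[OF a(3) s(3)]] .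
  let ?s = "ccomp s' t" and ?f = "ccomp f' t"
  have st: "chmap ?s A'' A" "qis ?s" "chmap ?f A'' W"
    using chmap_ccomp[OF t(1) a(1)] qis_ccomp[OF t(1) a(1) t(2) a(2)] chmap_ccomp[OF t(1) a(3)] .
  have "hpic (ccomp (ccomp s f') t) (ccomp (ccomp f s') t)"
    using hpic_ccomp_right[OF hpic_sym[OF a(4)] chmap_ccomp[OF a(3) s(1)] t(1)] .
  then have sq: "hpic (ccomp s ?f) (ccomp f ?s)"
    using ccomp_assoc[OF t(1) a(3) s(1)] ccomp_assoc[OF t(1) a(1) k(1)] by simp
  have n: "hpic (ccomp g ?f) (cnull A'' Z)" using t(3) ccomp_assoc[OF t(1) a(3) s(3)] by simp
  \<comment> \<open>The cone of A'' -> W takes the place of \<open>K\<close>, to which it is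
    quasi-isomorphic by \<open>cone_map_qis\<close>. So the extension g' of \<open>g\<close> is
    killed by a denominator \<open>u\<close>, and \<open>u\<close> is pulled back to
    \<open>W\<close> along \<iota>'.\<close>
  obtain K' \<iota>' \<pi>' \<kappa>' \<rho>' where cone': "is_cone A'' W ?f K' \<iota>' \<pi>' \<kappa>' \<rho>'" using cone_ex[OF st(3)] by blast
  note k' = coneD[OF cone']
  obtain \<phi> where \<phi>: "chmap \<phi> K' K" "qis \<phi>" using cone_map_qis[OF cone cone' st(1,2) s(1,2) sq] .
  obtain g' where g': "chmap g' K' Z" "hpic (ccomp g' \<iota>') g" using cone_extend[OF cone' s(3) n] .
  obtain D u where u: "chmap u D K'" "qis u" "hpic (ccomp g' u) (cnull D Z)" using hvanishE[OF v(2) \<phi> g'(1)] .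
  obtain E w h where w: "chmap w E W" "qis w" "chmap h E D" "hpic (ccomp \<iota>' w) (ccomp u h)"
    using ore_condition[OF k'(2) u(1,2)] .
  have 1: "hpic (ccomp g w) (ccomp (ccomp g' \<iota>') w)"
    using hpic_sym[OF hpic_ccomp_right[OF g'(2) chmap_ccomp[OF k'(2) g'(1)] w(1)]] .
  have 2: "hpic (ccomp g' (ccomp \<iota>' w)) (ccomp g' (ccomp u h))"
    using hpic_ccomp_left[OF w(4) chmap_ccomp[OF w(1) k'(2)] g'(1)] .
  have 3: "hpic (ccomp (ccomp g' u) h) (cnull E Z)"
    using hpic_null_comp_right[OF u(3) chmap_ccomp[OF u(1) g'(1)] w(3)] .
  have "hpic (ccomp g w) (cnull E Z)"
    using 1 2 3 hpic_trans ccomp_assoc[OF w(1) k'(2) g'(1)] ccomp_assoc[OF w(3) u(1) g'(1)] by metis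
  then show "\<exists>V t. chmap t V W \<and> qis t \<and> hpic (ccomp g t) (cnull V Z)" using w by blast
qed

text \<open>Exactness of Hom(X, -) at \<open>B\<close>: an arrow to \<open>B\<close> that dies in
  the cone lifts to \<open>A\<close>, where it dies.\<close>

lemma hvanish_cone_target:
  assumes cone: "is_cone A B f K \<iota> \<pi> \<kappa> \<rho>" and v: "hvanish X A" "hvanish X K"
  shows "hvanish X B"
proof (rule hvanishI)
  note k = coneD[OF cone]
  fix W s g assume s: "chmap s W X" "qis s" "chmap g W B"
  obtain V t where t: "chmap t V W" "qis t" "hpic (ccomp (ccomp \<iota> g) t) (cnull V K)"
    using hvanishE[OF v(2) s(1,2) chmap_ccomp[OF s(3) k(2)]] .
  have n: "hpic (ccomp \<iota> (ccomp g t)) (cnull V K)" using t(3) ccomp_assoc[OF t(1) s(3) k(2)] by simp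
  obtain g' where g': "chmap g' V A" "hpic (ccomp g t) (ccomp f g')"
    using cone_lift[OF cone chmap_ccomp[OF t(1) s(3)] n] .
  obtain U t' where t': "chmap t' U V" "qis t'" "hpic (ccomp g' t') (cnull U A)"
    using hvanishE[OF v(1) chmap_ccomp[OF t(1) s(1)] qis_ccomp[OF t(1) s(1) t(2) s(2)] g'(1)] .
  have "hpic (ccomp g (ccomp t t')) (cnull U B)"
    using null_compose[OF t(1) s(1) t'(1) s(3) g'(2) g'(1) k(1) t'(3)] .
  then show "\<exists>V t. chmap t V W \<and> qis t \<and> hpic (ccomp g t) (cnull V B)"
    using chmap_ccomp[OF t'(1) t(1)] qis_ccomp[OF t'(1) t(1) t'(2) t(2)] by blast
qed

text \<open>Exactness of Hom(X, -) at \<open>A\<close>. The preceding term of the long sequence is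
  Hom(X, K[-1]), written here as Hom(X[1], K); an arrow that dies in \<open>B\<close> comes from it
  by \<open>cone_colift\<close>.\<close>

lemma hvanish_cone_fibre:
  assumes cone: "is_cone A B f K \<iota> \<pi> \<kappa> \<rho>" and v: "hvanish X B" "hvanish (shift_complex C 1 X) K"
  shows "hvanish X A"
proof (rule hvanishI)
  note k = coneD[OF cone]
  fix W s g assume s: "chmap s W X" "qis s" "chmap g W A"
  obtain V t where t: "chmap t V W" "qis t" "hpic (ccomp (ccomp f g) t) (cnull V B)"
    using hvanishE[OF v(1) s(1,2) chmap_ccomp[OF s(3) k(1)]] .
  have n: "hpic (ccomp f (ccomp g t)) (cnull V B)" using t(3) ccomp_assoc[OF t(1) s(3) k(1)] by simp
  note gt = chmap_ccomp[OF t(1) s(3)] and st = chmap_ccomp[OF t(1) s(1)]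
  obtain r where r: "chmap r (shift_complex C 1 V) K" "hpic (ccomp \<pi> r) (shift_chain_map C 1 (ccomp g t))"
    using cone_colift[OF cone gt n] .
  have q: "chmap (shift_chain_map C 1 (ccomp s t)) (shift_complex C 1 V) (shift_complex C 1 X)"
    "qis (shift_chain_map C 1 (ccomp s t))"
    using chmap_shift[OF st, of 1] qis_shift[OF st _ qis_ccomp[OF t(1) s(1) t(2) s(2)], of 1] by auto
  obtain U u where u: "chmap u U (shift_complex C 1 V)" "qis u" "hpic (ccomp r u) (cnull U K)"
    using hvanishE[OF v(2) q r(1)] .
  have 1: "hpic (ccomp (shift_chain_map C 1 (ccomp g t)) u) (ccomp (ccomp \<pi> r) u)"
    using hpic_sym[OF hpic_ccomp_right[OF r(2) chmap_ccomp[OF r(1) k(3)] u(1)]] .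
  have 2: "hpic (ccomp (ccomp \<pi> r) u) (cnull U (shift_complex C 1 A))"
    using hpic_null_comp[OF u(3) chmap_ccomp[OF u(1) r(1)] k(3)] ccomp_assoc[OF u(1) r(1) k(3)] by simp
  obtain U' u' where u': "chmap u' U' V" "qis u'" "hpic (ccomp (ccomp g t) u') (cnull U' A)"
    using unshift_null[OF gt u(1,2) hpic_trans[OF 1 2]] .
  then show "\<exists>V t. chmap t V W \<and> qis t \<and> hpic (ccomp g t) (cnull V A)"
    using chmap_ccomp[OF u'(1) t(1)] qis_ccomp[OF u'(1) t(1) u'(2) t(2)] ccomp_assoc[OF u'(1) t(1) s(3)] by metis
qed

end

text \<open>The premises of \<open>S_saturated\<close> say that in the localisation \<open>f\<close> has a right inverse (from \<open>q\<close>) and,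
  being identified with \<open>x\<close> by means of \<open>p\<close> and \<open>t\<close>, also a left inverse (from \<open>g\<close>).\<close>

locale fraction_system =
  fixes K :: "('o, 'm, 'k, 'z) lincat_scheme" (structure) and S :: "'m set"
  assumes dom_obj: "f \<in> Arr K \<Longrightarrow> Dom K f \<in> Obj K"
    and cod_obj: "f \<in> Arr K \<Longrightarrow> Cod K f \<in> Obj K"
    and ident_hom: "X \<in> Obj K \<Longrightarrow> \<one> X \<in> hom K X X"
    and comp_hom: "f \<in> hom K X Y \<Longrightarrow> g \<in> hom K Y Z \<Longrightarrow> g \<cdot> f \<in> hom K X Z"
    and comp_assoc: "f \<in> hom K W X \<Longrightarrow> g \<in> hom K X Y \<Longrightarrow> h \<in> hom K Y Z \<Longrightarrow> (h \<cdot> g) \<cdot> f = h \<cdot> (g \<cdot> f)"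
    and comp_ident_right: "f \<in> hom K X Y \<Longrightarrow> f \<cdot> \<one> X = f"
    and comp_ident_left: "f \<in> hom K X Y \<Longrightarrow> \<one> Y \<cdot> f = f"
    and null_hom: "X \<in> Obj K \<Longrightarrow> Y \<in> Obj K \<Longrightarrow> Null K X Y \<in> hom K X Y"
    and null_comp: "f \<in> hom K X Y \<Longrightarrow> Z \<in> Obj K \<Longrightarrow> Null K Y Z \<cdot> f = Null K X Z"
    and S_arr: "S \<subseteq> Arr K"
    and S_ident: "X \<in> Obj K \<Longrightarrow> \<one> X \<in> S"
    and S_comp: "s \<in> S \<Longrightarrow> t \<in> S \<Longrightarrow> s \<in> hom K X Y \<Longrightarrow> t \<in> hom K Y Z \<Longrightarrow> t \<cdot> s \<in> S"
    and S_ore: "f \<in> hom K X Y \<Longrightarrow> s \<in> hom K Z Y \<Longrightarrow> s \<in> S \<Longrightarrow>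
      \<exists>W. \<exists>t\<in>hom K W X. \<exists>g\<in>hom K W Z. t \<in> S \<and> f \<cdot> t = s \<cdot> g"
    and S_cancel: "f \<in> hom K X Y \<Longrightarrow> g \<in> hom K X Y \<Longrightarrow> s \<in> hom K Y Z \<Longrightarrow> s \<in> S \<Longrightarrow> s \<cdot> f = s \<cdot> g \<Longrightarrow>
      \<exists>W. \<exists>t\<in>hom K W X. t \<in> S \<and> f \<cdot> t = g \<cdot> t"
    and S_two_of_three: "s \<in> hom K X Y \<Longrightarrow> t \<in> hom K Y Z \<Longrightarrow> t \<in> S \<Longrightarrow> t \<cdot> s \<in> S \<Longrightarrow> s \<in> S"
    and S_saturated: "\<lbrakk>t \<in> hom K V Y; t \<in> S; p \<in> hom K U W; p \<in> S; f \<in> hom K W Y; x \<in> hom K U V;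
      f \<cdot> p = t \<cdot> x; g \<in> hom K V Z; g \<cdot> x \<in> S; q \<in> hom K Q W; f \<cdot> q \<in> S\<rbrakk> \<Longrightarrow> f \<in> S"
begin

lemma homD: assumes "f \<in> hom K X Y" shows "f \<in> Arr K" "Dom K f = X" "Cod K f = Y" "X \<in> Obj K" "Y \<in> Obj K"
  using assms dom_obj cod_obj by (auto simp: hom_def)

lemma comp_eq_extend:
  assumes "f \<cdot> g = h \<cdot> k" "w \<in> hom K V W" "g \<in> hom K W X" "f \<in> hom K X Y" "k \<in> hom K W X'" "h \<in> hom K X' Y"
  shows "f \<cdot> (g \<cdot> w) = h \<cdot> (k \<cdot> w)"
  using comp_assoc[OF assms(2,3,4)] comp_assoc[OF assms(2,5,6)] assms(1) by simp

section \<open>Roofs and their equivalence\<close>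

definition roof :: "'o \<Rightarrow> 'o \<Rightarrow> 'o \<Rightarrow> 'm \<Rightarrow> 'm \<Rightarrow> bool" where
  "roof X W Y s f \<longleftrightarrow> s \<in> hom K W X \<and> s \<in> S \<and> f \<in> hom K W Y"

lemma roofD: assumes "roof X W Y s f" shows "s \<in> hom K W X" "s \<in> S" "f \<in> hom K W Y"
  using assms by (auto simp: roof_def)

lemma roofs_iff: "(s, f) \<in> roofs K S \<longleftrightarrow> (\<exists>X W Y. roof X W Y s f)"
  by (auto simp: roofs_def roof_def hom_def)

lemma roof_in_roofs: "roof X W Y s f \<Longrightarrow> (s, f) \<in> roofs K S"
  using roofs_iff by blast

lemma roof_eq_iff:
  assumes "roof X W Y s f" "roof X' W' Y' s' f'"
  shows "roof_eq K S (s, f) (s', f') \<longleftrightarrow> X = X' \<and> Y = Y' \<and>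
    (\<exists>V. \<exists>u\<in>hom K V W. \<exists>v\<in>hom K V W'. s \<cdot> u \<in> S \<and> s \<cdot> u = s' \<cdot> v \<and> f \<cdot> u = f' \<cdot> v)"
proof -
  note d = homD(2,3)[OF roofD(1)[OF assms(1)]] homD(2,3)[OF roofD(3)[OF assms(1)]]
    homD(2,3)[OF roofD(1)[OF assms(2)]] homD(2,3)[OF roofD(3)[OF assms(2)]]
  have "(\<exists>u\<in>Arr K. \<exists>v\<in>Arr K. Dom K u = Dom K v \<and> Cod K u = W \<and> Cod K v = W' \<and> P u v) \<longleftrightarrow>
      (\<exists>V. \<exists>u\<in>hom K V W. \<exists>v\<in>hom K V W'. P u v)" for P
  proof
    assume "\<exists>u\<in>Arr K. \<exists>v\<in>Arr K. Dom K u = Dom K v \<and> Cod K u = W \<and> Cod K v = W' \<and> P u v"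
    then obtain u v where u: "u \<in> Arr K" "v \<in> Arr K" "Dom K u = Dom K v" "Cod K u = W" "Cod K v = W'" "P u v" by blast
    then have "u \<in> hom K (Dom K v) W" "v \<in> hom K (Dom K v) W'" by (simp_all add: hom_def)
    then show "\<exists>V. \<exists>u\<in>hom K V W. \<exists>v\<in>hom K V W'. P u v" using u(6) by blast
  next
    assume "\<exists>V. \<exists>u\<in>hom K V W. \<exists>v\<in>hom K V W'. P u v"
    then obtain V u v where u: "u \<in> hom K V W" "v \<in> hom K V W'" "P u v" by blast
    then show "\<exists>u\<in>Arr K. \<exists>v\<in>Arr K. Dom K u = Dom K v \<and> Cod K u = W \<and> Cod K v = W' \<and> P u v"
      using homD(1-3)[OF u(1)] homD(1-3)[OF u(2)] by (intro bexI[of _ u] bexI[of _ v]) simp_all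
  qed
  note ex = this[of "\<lambda>u v. s \<cdot> u \<in> S \<and> s \<cdot> u = s' \<cdot> v \<and> f \<cdot> u = f' \<cdot> v"]
  show ?thesis unfolding roof_eq_def prod.case d ex ..
qed

lemma roof_eqE:
  assumes "roof_eq K S (s, f) (s', f')" "roof X W Y s f" "roof X' W' Y' s' f'"
  obtains V u v where "X' = X" "Y' = Y" "u \<in> hom K V W" "v \<in> hom K V W'" "s \<cdot> u \<in> S" "s \<cdot> u = s' \<cdot> v" "f \<cdot> u = f' \<cdot> v"
  using assms(1) unfolding roof_eq_iff[OF assms(2,3)] by blast

lemma roof_eqI:
  assumes "roof X W Y s f" "roof X W' Y s' f'" "u \<in> hom K V W" "v \<in> hom K V W'" "s \<cdot> u \<in> S" "s \<cdot> u = s' \<cdot> v" "f \<cdot> u = f' \<cdot> v"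
  shows "roof_eq K S (s, f) (s', f')"
  unfolding roof_eq_iff[OF assms(1,2)] using assms(3-7) by blast

lemma roof_eq_refl: assumes "roof X W Y s f" shows "roof_eq K S (s, f) (s, f)"
proof -
  note r = roofD[OF assms]
  have i: "\<one> W \<in> hom K W W" using ident_hom homD(4)[OF r(1)] .
  show ?thesis using roof_eqI[OF assms assms i i] comp_ident_right[OF r(1)] r(2) by simp
qed

lemma roof_eq_sym:
  assumes "roof X W Y s f" "roof X' W' Y' s' f'" "roof_eq K S (s, f) (s', f')"
  shows "roof_eq K S (s', f') (s, f)"
proof -
  obtain V u v where u: "X' = X" "Y' = Y" "u \<in> hom K V W" "v \<in> hom K V W'" "s \<cdot> u \<in> S" "s \<cdot> u = s' \<cdot> v" "f \<cdot> u = f' \<cdot> v"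
    using roof_eqE[OF assms(3,1,2)] .
  have "roof X W' Y s' f'" using assms(2) u(1,2) by simp
  then show ?thesis using roof_eqI[OF _ assms(1) u(4,3)] u(5-7) by simp
qed

text \<open>The Ore condition for s v and s w makes the two routes agree after composition with
  \<open>s\<close>; cancelling \<open>s\<close> costs one more denominator. The assumption concerns
  s w and not \<open>w\<close> itself, as in the definition of \<open>roof_eq\<close>.\<close>

lemma common_refinement:
  assumes "s \<in> hom K A X" "s \<in> S" "v \<in> hom K V A" "w \<in> hom K W A" "s \<cdot> w \<in> S"
  obtains U t g where "t \<in> hom K U V" "t \<in> S" "g \<in> hom K U W" "v \<cdot> t = w \<cdot> g"
proof -
  have sv: "s \<cdot> v \<in> hom K V X" and sw: "s \<cdot> w \<in> hom K W X" using comp_hom assms by blast+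
  obtain U1 t g where t: "t \<in> hom K U1 V" "g \<in> hom K U1 W" "t \<in> S" "(s \<cdot> v) \<cdot> t = (s \<cdot> w) \<cdot> g"
    using S_ore[OF sv sw assms(5)] by blast
  have eq: "s \<cdot> (v \<cdot> t) = s \<cdot> (w \<cdot> g)"
    using t(4) comp_assoc[OF t(1) assms(3,1)] comp_assoc[OF t(2) assms(4,1)] by simp
  have vt: "v \<cdot> t \<in> hom K U1 A" and wg: "w \<cdot> g \<in> hom K U1 A" using comp_hom t assms by blast+
  obtain U e where e: "e \<in> hom K U U1" "e \<in> S" "(v \<cdot> t) \<cdot> e = (w \<cdot> g) \<cdot> e"
    using S_cancel[OF vt wg assms(1,2) eq] by blast
  have "v \<cdot> (t \<cdot> e) = w \<cdot> (g \<cdot> e)"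
    using e(3) comp_assoc[OF e(1) t(1) assms(3)] comp_assoc[OF e(1) t(2) assms(4)] by simp
  moreover have "t \<cdot> e \<in> hom K U V" "g \<cdot> e \<in> hom K U W" using comp_hom e t by blast+
  moreover have "t \<cdot> e \<in> S" using S_comp[OF e(2) t(3) e(1) t(1)] .
  ultimately show ?thesis using that by blast
qed

text \<open>The two given refinements meet at the middle roof, and \<open>common_refinement\<close>
  over its apex glues them.\<close>

lemma roof_eq_trans:
  assumes r: "roof X W Y s f" "roof X1 W1 Y1 s1 f1" "roof X2 W2 Y2 s2 f2"
    and e: "roof_eq K S (s, f) (s1, f1)" "roof_eq K S (s1, f1) (s2, f2)"
  shows "roof_eq K S (s, f) (s2, f2)"
proof -
  obtain V u v where u: "X1 = X" "Y1 = Y" "u \<in> hom K V W" "v \<in> hom K V W1" "s \<cdot> u \<in> S" "s \<cdot> u = s1 \<cdot> v" "f \<cdot> u = f1 \<cdot> v"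
    using roof_eqE[OF e(1) r(1,2)] .
  obtain V' u' v' where u': "X2 = X1" "Y2 = Y1" "u' \<in> hom K V' W1" "v' \<in> hom K V' W2" "s1 \<cdot> u' \<in> S"
    "s1 \<cdot> u' = s2 \<cdot> v'" "f1 \<cdot> u' = f2 \<cdot> v'"
    using roof_eqE[OF e(2) r(2,3)] .
  note h = roofD[OF r(1)] and h1 = roofD[OF r(2)[unfolded u(1,2)]] and h2 = roofD[OF r(3)[unfolded u'(1,2) u(1,2)]]
  obtain U t g where t: "t \<in> hom K U V" "t \<in> S" "g \<in> hom K U V'" "v \<cdot> t = u' \<cdot> g"
    using common_refinement[OF h1(1,2) u(4) u'(3,5)] .
  have ut: "u \<cdot> t \<in> hom K U W" and vg: "v' \<cdot> g \<in> hom K U W2" using comp_hom t u(3) u'(4) by blast+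
  have su: "s \<cdot> u \<in> hom K V X" using comp_hom u(3) h(1) by blast
  have 1: "s \<cdot> (u \<cdot> t) = s2 \<cdot> (v' \<cdot> g)"
    using comp_eq_extend[OF u(6) t(1) u(3) h(1) u(4) h1(1)] comp_eq_extend[OF u'(6) t(3) u'(3) h1(1) u'(4) h2(1)] t(4) by simp
  have 2: "f \<cdot> (u \<cdot> t) = f2 \<cdot> (v' \<cdot> g)"
    using comp_eq_extend[OF u(7) t(1) u(3) h(3) u(4) h1(3)] comp_eq_extend[OF u'(7) t(3) u'(3) h1(3) u'(4) h2(3)] t(4) by simp
  have 3: "s \<cdot> (u \<cdot> t) \<in> S" using S_comp[OF t(2) u(5) t(1) su] comp_assoc[OF t(1) u(3) h(1)] by simp
  have "roof X W2 Y s2 f2" using r(3) u(1,2) u'(1,2) by simp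
  then show ?thesis using roof_eqI[OF r(1) _ ut vg 3 1 2] by blast
qed

lemma frac_eq_iff:
  assumes "roof X W Y s f" "roof X' W' Y' s' f'"
  shows "frac K S s f = frac K S s' f' \<longleftrightarrow> roof_eq K S (s, f) (s', f')"
proof
  assume "frac K S s f = frac K S s' f'"
  moreover have "(s', f') \<in> frac K S s' f'" using roof_eq_refl[OF assms(2)] roof_in_roofs[OF assms(2)] by (simp add: frac_def)
  ultimately show "roof_eq K S (s, f) (s', f')" by (auto simp: frac_def)
next
  assume e: "roof_eq K S (s, f) (s', f')"
  note e' = roof_eq_sym[OF assms e]
  have sub: "frac K S p g \<subseteq> frac K S p' g'"
    if "roof A B D p g" "roof A' B' D' p' g'" "roof_eq K S (p', g') (p, g)" for A B D p g A' B' D' p' g'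
  proof
    fix r assume r: "r \<in> frac K S p g"
    obtain a b where ab: "r = (a, b)" by (cases r)
    then have m: "(a, b) \<in> roofs K S" "roof_eq K S (p, g) (a, b)" using r by (auto simp: frac_def)
    then obtain A2 B2 D2 where "roof A2 B2 D2 a b" using roofs_iff by blast
    then have "roof_eq K S (p', g') (a, b)" using roof_eq_trans[OF that(2,1) _ that(3) m(2)] by blast
    then show "r \<in> frac K S p' g'" using m(1) ab by (simp add: frac_def)
  qed
  show "frac K S s f = frac K S s' f'"
    using sub[OF assms e'] sub[OF assms(2,1) e] by blast
qed

lemma frac_memD:
  assumes "roof X W Y s f" "(a, b) \<in> frac K S s f"
  obtains V where "roof X V Y a b" "frac K S a b = frac K S s f"
proof -
  obtain X' V Y' where r: "roof X' V Y' a b" and e: "roof_eq K S (s, f) (a, b)"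
    using assms(2) roofs_iff by (auto simp: frac_def)
  have "X' = X" "Y' = Y" using roof_eqE[OF e assms(1) r] by blast+
  then show ?thesis using that r frac_eq_iff[OF assms(1) r] e by simp
qed

lemma frac_self: "roof X W Y s f \<Longrightarrow> (s, f) \<in> frac K S s f"
  using roof_eq_refl roof_in_roofs by (simp add: frac_def)

section \<open>The localised category\<close>

abbreviation L where "L \<equiv> localisation K S"

text \<open>\<open>Dom\<close> and \<open>Cod\<close> are read off an arbitrarily chosen
  representative; this works because all roofs of a class have the same ends.\<close>

lemma frac_ends:
  assumes "roof X W Y s f"
  shows "Dom L (frac K S s f) = X" "Cod L (frac K S s f) = Y" "frac K S s f \<in> Arr L"
proof -
  have "some_rep (frac K S s f) \<in> frac K S s f" unfolding some_rep_def by (rule someI[of _ "(s, f)"]) (rule frac_self[OF assms])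
  moreover obtain a b where ab: "some_rep (frac K S s f) = (a, b)" by force
  ultimately obtain V where "roof X V Y a b" using frac_memD[OF assms] by metis
  then have "Cod K a = X" "Cod K b = Y" using homD(3) roofD by blast+
  then show "Dom L (frac K S s f) = X" "Cod L (frac K S s f) = Y" using ab by (simp_all add: localisation_def)
  show "frac K S s f \<in> Arr L" using roof_in_roofs[OF assms] by (auto simp: localisation_def)
qed

lemma frac_hom: "roof X W Y s f \<Longrightarrow> frac K S s f \<in> hom L X Y"
  using frac_ends by (simp add: hom_def)

lemma L_homE:
  assumes "F \<in> hom L X Y" obtains W s f where "roof X W Y s f" "F = frac K S s f"
proof -
  obtain s f where F: "F = frac K S s f" "(s, f) \<in> roofs K S" using assms by (auto simp: hom_def localisation_def)
  then obtain X' W Y' where r: "roof X' W Y' s f" using roofs_iff by blast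
  then have "X' = X" "Y' = Y" using frac_ends[OF r] assms F by (auto simp: hom_def)
  then show ?thesis using that r F by blast
qed

text \<open>The composite may depend neither on the two representatives nor on the square that
  completes them. One statement covers both, since two completions of the same pair of roofs are a
  special case.\<close>

lemma frac_comp_welldef:
  assumes r: "roof X W Y s f" "roof Y V Z t g" and r': "roof X W' Y s1 f1" "roof Y V' Z t1 g1"
    and e: "roof_eq K S (s, f) (s1, f1)" "roof_eq K S (t, g) (t1, g1)"
    and sq: "a \<in> hom K A W" "a \<in> S" "b \<in> hom K A V" "f \<cdot> a = t \<cdot> b"
    and sq': "a1 \<in> hom K A1 W'" "a1 \<in> S" "b1 \<in> hom K A1 V'" "f1 \<cdot> a1 = t1 \<cdot> b1"
  shows "frac K S (s \<cdot> a) (g \<cdot> b) = frac K S (s1 \<cdot> a1) (g1 \<cdot> b1)"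
proof -
  note h = roofD[OF r(1)] roofD[OF r(2)] and h' = roofD[OF r'(1)] roofD[OF r'(2)]
  have R: "roof X A Z (s \<cdot> a) (g \<cdot> b)" "roof X A1 Z (s1 \<cdot> a1) (g1 \<cdot> b1)"
    unfolding roof_def using comp_hom[OF sq(1) h(1)] S_comp[OF sq(2) h(2) sq(1) h(1)] comp_hom[OF sq(3) h(6)]
      comp_hom[OF sq'(1) h'(1)] S_comp[OF sq'(2) h'(2) sq'(1) h'(1)] comp_hom[OF sq'(3) h'(6)] by blast+
  obtain D u v where u: "u \<in> hom K D W" "v \<in> hom K D W'" "s \<cdot> u \<in> S" "s \<cdot> u = s1 \<cdot> v" "f \<cdot> u = f1 \<cdot> v"
    using roof_eqE[OF e(1) r(1) r'(1)] .
  obtain D' p q where p: "p \<in> hom K D' V" "q \<in> hom K D' V'" "t \<cdot> p \<in> S" "t \<cdot> p = t1 \<cdot> q" "g \<cdot> p = g1 \<cdot> q"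
    using roof_eqE[OF e(2) r(2) r'(2)] .
  text \<open>Pass to a common denominator step by step: first \<open>u x = a y\<close>, then \<open>v x' = a1 y'\<close>.\<close>
  have sa: "s \<cdot> a \<in> S" and sa1: "s1 \<cdot> a1 \<in> S" using R roofD(2) by blast+
  obtain E x y where x: "x \<in> hom K E D" "x \<in> S" "y \<in> hom K E A" "u \<cdot> x = a \<cdot> y"
    using common_refinement[OF h(1,2) u(1) sq(1) sa] .
  have vx: "v \<cdot> x \<in> hom K E W'" using comp_hom x(1) u(2) .
  obtain E1 x1 y1 where x1: "x1 \<in> hom K E1 E" "x1 \<in> S" "y1 \<in> hom K E1 A1" "(v \<cdot> x) \<cdot> x1 = a1 \<cdot> y1"
    using common_refinement[OF h'(1,2) vx sq'(1) sa1] .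
  have yx: "y \<cdot> x1 \<in> hom K E1 A" and xx: "x \<cdot> x1 \<in> hom K E1 D" using comp_hom x1(1) x by blast+
  have e1: "u \<cdot> (x \<cdot> x1) = a \<cdot> (y \<cdot> x1)" using comp_eq_extend[OF x(4) x1(1) x(1) u(1) x(3) sq(1)] .
  have e2: "v \<cdot> (x \<cdot> x1) = a1 \<cdot> y1" using x1(4) comp_assoc[OF x1(1) x(1) u(2)] by simp
  have bY: "b \<cdot> (y \<cdot> x1) \<in> hom K E1 V" and by1: "b1 \<cdot> y1 \<in> hom K E1 V'" using comp_hom yx sq(3) x1(3) sq'(3) by blast+
  have m: "t \<cdot> (b \<cdot> (y \<cdot> x1)) = t1 \<cdot> (b1 \<cdot> y1)"
  proof -
    have "t \<cdot> (b \<cdot> (y \<cdot> x1)) = f \<cdot> (a \<cdot> (y \<cdot> x1))" using comp_eq_extend[OF sq(4) yx sq(1) h(3) sq(3) h(4)] by simp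
    also have "\<dots> = f1 \<cdot> (v \<cdot> (x \<cdot> x1))" using comp_eq_extend[OF u(5) xx u(1) h(3) u(2) h'(3)] e1 by simp
    also have "\<dots> = t1 \<cdot> (b1 \<cdot> y1)" using comp_eq_extend[OF sq'(4) x1(3) sq'(1) h'(3) sq'(3) h'(4)] e2 by simp
    finally show ?thesis .
  qed
  \<comment> \<open>The numerators of the second pair of roofs are compared through their refinement
    (p, q). The equation involving \<open>q\<close> is at first known only after composition with
    \<open>t1\<close>, whence the additional denominator \<open>d\<close> below.\<close>
  obtain E2 c w where c: "c \<in> hom K E2 E1" "c \<in> S" "w \<in> hom K E2 D'" "(b \<cdot> (y \<cdot> x1)) \<cdot> c = p \<cdot> w"
    using common_refinement[OF h(4,5) bY p(1,3)] .
  have t1w: "t1 \<cdot> ((b1 \<cdot> y1) \<cdot> c) = t1 \<cdot> (q \<cdot> w)"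
  proof -
    have "t1 \<cdot> ((b1 \<cdot> y1) \<cdot> c) = t \<cdot> ((b \<cdot> (y \<cdot> x1)) \<cdot> c)"
      using comp_eq_extend[OF m c(1) bY h(4) by1 h'(4)] by simp
    also have "\<dots> = t1 \<cdot> (q \<cdot> w)" using comp_eq_extend[OF p(4) c(3) p(1) h(4) p(2) h'(4)] c(4) by simp
    finally show ?thesis .
  qed
  have by1c: "(b1 \<cdot> y1) \<cdot> c \<in> hom K E2 V'" and qw: "q \<cdot> w \<in> hom K E2 V'" and pw: "p \<cdot> w \<in> hom K E2 V"
    using comp_hom c by1 p by blast+
  obtain E3 d where d: "d \<in> hom K E3 E2" "d \<in> S" "((b1 \<cdot> y1) \<cdot> c) \<cdot> d = (q \<cdot> w) \<cdot> d"
    using S_cancel[OF by1c qw h'(4,5) t1w] by blast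
  have cd: "c \<cdot> d \<in> hom K E3 E1" "c \<cdot> d \<in> S" using comp_hom[OF d(1) c(1)] S_comp[OF d(2) c(2) d(1) c(1)] by blast+
  have wd: "w \<cdot> d \<in> hom K E3 D'" using comp_hom d(1) c(3) .
  let ?U = "(y \<cdot> x1) \<cdot> (c \<cdot> d)" and ?V = "y1 \<cdot> (c \<cdot> d)"
  have U: "?U \<in> hom K E3 A" and V: "?V \<in> hom K E3 A1" using comp_hom cd(1) yx x1(3) by blast+
  have xxcd: "(x \<cdot> x1) \<cdot> (c \<cdot> d) \<in> hom K E3 D" using comp_hom cd(1) xx .
  have xxS: "(x \<cdot> x1) \<cdot> (c \<cdot> d) \<in> S"
    using S_comp[OF cd(2) S_comp[OF x1(2) x(2) x1(1) x(1)] cd(1) xx] .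
  have aU: "a \<cdot> ?U = u \<cdot> ((x \<cdot> x1) \<cdot> (c \<cdot> d))" using comp_eq_extend[OF e1 cd(1) xx u(1) yx sq(1)] by simp
  have aV: "a1 \<cdot> ?V = v \<cdot> ((x \<cdot> x1) \<cdot> (c \<cdot> d))" using comp_eq_extend[OF e2 cd(1) xx u(2) x1(3) sq'(1)] by simp
  have 1: "(s \<cdot> a) \<cdot> ?U = (s1 \<cdot> a1) \<cdot> ?V"
    using comp_assoc[OF U sq(1) h(1)] comp_assoc[OF V sq'(1) h'(1)] aU aV
      comp_eq_extend[OF u(4) xxcd u(1) h(1) u(2) h'(1)] by simp
  have 2: "(s \<cdot> a) \<cdot> ?U \<in> S"
    using comp_assoc[OF U sq(1) h(1)] aU comp_assoc[OF xxcd u(1) h(1)] S_comp[OF xxS u(3) xxcd comp_hom[OF u(1) h(1)]] by simp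
  have bU: "b \<cdot> ?U = p \<cdot> (w \<cdot> d)"
  proof -
    have "b \<cdot> ?U = (b \<cdot> (y \<cdot> x1)) \<cdot> (c \<cdot> d)" using comp_assoc[OF cd(1) yx sq(3)] by simp
    also have "\<dots> = ((b \<cdot> (y \<cdot> x1)) \<cdot> c) \<cdot> d" using comp_assoc[OF d(1) c(1) bY] by simp
    also have "\<dots> = p \<cdot> (w \<cdot> d)" using c(4) comp_assoc[OF d(1) c(3) p(1)] by simp
    finally show ?thesis .
  qed
  have bV: "b1 \<cdot> ?V = q \<cdot> (w \<cdot> d)"
  proof -
    have "b1 \<cdot> ?V = (b1 \<cdot> y1) \<cdot> (c \<cdot> d)" using comp_assoc[OF cd(1) x1(3) sq'(3)] by simp
    also have "\<dots> = ((b1 \<cdot> y1) \<cdot> c) \<cdot> d" using comp_assoc[OF d(1) c(1) by1] by simp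
    also have "\<dots> = q \<cdot> (w \<cdot> d)" using d(3) comp_assoc[OF d(1) c(3) p(2)] by simp
    finally show ?thesis .
  qed
  have 3: "(g \<cdot> b) \<cdot> ?U = (g1 \<cdot> b1) \<cdot> ?V"
    using comp_assoc[OF U sq(3) h(6)] comp_assoc[OF V sq'(3) h'(6)] bU bV
      comp_eq_extend[OF p(5) wd p(1) h(6) p(2) h'(6)] by simp
  show ?thesis using frac_eq_iff[OF R] roof_eqI[OF R U V 2 1 3] by blast
qed

text \<open>Evaluates the definite description in \<open>frac_comp\<close>: the given square is one
  candidate, and by \<open>frac_comp_welldef\<close> all candidates yield the same fraction.\<close>

lemma L_comp:
  assumes r: "roof X W Y s f" "roof Y V Z t g"
    and sq: "a \<in> hom K A W" "a \<in> S" "b \<in> hom K A V" "f \<cdot> a = t \<cdot> b"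
  shows "Comp L (frac K S t g) (frac K S s f) = frac K S (s \<cdot> a) (g \<cdot> b)"
proof -
  let ?P = "\<lambda>E. \<exists>s' f' t' g' a' b'.
     (s', f') \<in> frac K S s f \<and> (t', g') \<in> frac K S t g \<and> a' \<in> S \<inter> Arr K \<and> b' \<in> Arr K \<and>
     Dom K a' = Dom K b' \<and> Cod K a' = Dom K f' \<and> Cod K b' = Dom K t' \<and>
     f' \<cdot> a' = t' \<cdot> b' \<and> E = frac K S (s' \<cdot> a') (g' \<cdot> b')"
  have "(THE E. ?P E) = frac K S (s \<cdot> a) (g \<cdot> b)"
  proof (rule the_equality)
    show "?P (frac K S (s \<cdot> a) (g \<cdot> b))"
      using frac_self[OF r(1)] frac_self[OF r(2)] sq homD(1-3)[OF sq(1)] homD(1-3)[OF sq(3)]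
        homD(2)[OF roofD(3)[OF r(1)]] homD(2)[OF roofD(1)[OF r(2)]]
      by (intro exI[of _ s] exI[of _ f] exI[of _ t] exI[of _ g] exI[of _ a] exI[of _ b]) simp
    fix E assume "?P E"
    then obtain s' f' t' g' a' b' where m: "(s', f') \<in> frac K S s f" "(t', g') \<in> frac K S t g"
      and a': "a' \<in> S" "a' \<in> Arr K" "b' \<in> Arr K" "Dom K a' = Dom K b'" "Cod K a' = Dom K f'" "Cod K b' = Dom K t'"
        "f' \<cdot> a' = t' \<cdot> b'" and E: "E = frac K S (s' \<cdot> a') (g' \<cdot> b')" by blast
    obtain W' where r1: "roof X W' Y s' f'" "frac K S s' f' = frac K S s f" using frac_memD[OF r(1) m(1)] .
    obtain V' where r2: "roof Y V' Z t' g'" "frac K S t' g' = frac K S t g" using frac_memD[OF r(2) m(2)] .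
    have d: "Dom K f' = W'" "Dom K t' = V'" using homD(2)[OF roofD(3)[OF r1(1)]] homD(2)[OF roofD(1)[OF r2(1)]] by auto
    have ah: "a' \<in> hom K (Dom K b') W'" "b' \<in> hom K (Dom K b') V'" using a' d by (auto simp: hom_def)
    show "E = frac K S (s \<cdot> a) (g \<cdot> b)"
      unfolding E
      using frac_comp_welldef[OF r1(1) r2(1) r(1) r(2) _ _ ah(1) a'(1) ah(2) a'(7) sq]
        frac_eq_iff[OF r1(1) r(1)] frac_eq_iff[OF r2(1) r(2)] r1(2) r2(2) by simp
  qed
  then show ?thesis by (simp add: localisation_def frac_comp_def)
qed

lemma roof_ident: "X \<in> Obj K \<Longrightarrow> roof X X X (\<one> X) (\<one> X)"
  using ident_hom S_ident by (simp add: roof_def)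

lemma L_fields [simp]: "Obj L = Obj K" "Ident L X = frac K S (\<one> X) (\<one> X)" "Null L X Y = frac K S (\<one> X) (Null K X Y)"
  by (simp_all add: localisation_def)

lemma L_ident_left: assumes "F \<in> hom L X Y" shows "Comp L (Ident L Y) F = F"
proof -
  obtain W s f where r: "roof X W Y s f" "F = frac K S s f" using L_homE[OF assms] .
  note h = roofD[OF r(1)]
  have i: "\<one> W \<in> hom K W W" "\<one> W \<in> S" "Y \<in> Obj K" using ident_hom S_ident homD(4,5)[OF h(3)] by auto
  show ?thesis
    using L_comp[OF r(1) roof_ident[OF i(3)] i(1,2) h(3)] comp_ident_right[OF h(3)] comp_ident_left[OF h(3)]
      comp_ident_right[OF h(1)] r(2) by simp
qed

lemma L_ident_right: assumes "F \<in> hom L X Y" shows "Comp L F (Ident L X) = F"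
proof -
  obtain W s f where r: "roof X W Y s f" "F = frac K S s f" using L_homE[OF assms] .
  note h = roofD[OF r(1)]
  have i: "\<one> W \<in> hom K W W" "X \<in> Obj K" using ident_hom homD(4,5)[OF h(1)] by auto
  show ?thesis
    using L_comp[OF roof_ident[OF i(2)] r(1) h(1,2) i(1)] comp_ident_right[OF h(3)] comp_ident_left[OF h(1)]
      comp_ident_right[OF h(1)] r(2) by simp
qed

lemma L_ident_hom: "X \<in> Obj K \<Longrightarrow> Ident L X \<in> hom L X X"
  using frac_hom[OF roof_ident] by simp

lemma L_ident_iso: "X \<in> Obj K \<Longrightarrow> is_iso L (Ident L X)"
  using L_ident_hom[of X] L_ident_left[OF L_ident_hom[of X]] unfolding is_iso_def by (auto simp: hom_def)

text \<open>Saturation forces the numerator of an invertible fraction into \<open>S\<close>. So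
  isomorphic objects are joined by a roof with both legs in \<open>S\<close>, along which invariants
  such as cohomology can be transported.\<close>

lemma L_isomorphic_iff:
  "isomorphic L X Y \<longleftrightarrow> (\<exists>W. \<exists>s\<in>hom K W X. \<exists>f\<in>hom K W Y. s \<in> S \<and> f \<in> S)"
proof
  assume "isomorphic L X Y"
  then obtain a where a: "a \<in> hom L X Y" "is_iso L a" by (auto simp: isomorphic_def)
  then obtain b where b: "b \<in> hom L Y X" "Comp L b a = Ident L X" "Comp L a b = Ident L Y"
    by (auto simp: is_iso_def hom_def)
  obtain W s f where r: "roof X W Y s f" "a = frac K S s f" using L_homE[OF a(1)] .
  obtain V t g where q: "roof Y V X t g" "b = frac K S t g" using L_homE[OF b(1)] .
  note h = roofD[OF r(1)] and k = roofD[OF q(1)]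
  have X: "X \<in> Obj K" and Y: "Y \<in> Obj K" using homD(5)[OF h(1)] homD(5)[OF k(1)] .
  obtain A s' f' where s': "s' \<in> hom K A W" "f' \<in> hom K A V" "s' \<in> S" "f \<cdot> s' = t \<cdot> f'"
    using S_ore[OF h(3) k(1,2)] by blast
  have c: "roof X A X (s \<cdot> s') (g \<cdot> f')"
    unfolding roof_def using comp_hom[OF s'(1) h(1)] S_comp[OF s'(3) h(2) s'(1) h(1)] comp_hom[OF s'(2) k(3)] by blast
  have "frac K S (s \<cdot> s') (g \<cdot> f') = frac K S (\<one> X) (\<one> X)"
    using L_comp[OF r(1) q(1) s'(1,3,2,4)] b(2) r(2) q(2) by simp
  then have "roof_eq K S (s \<cdot> s', g \<cdot> f') (\<one> X, \<one> X)" using frac_eq_iff[OF c roof_ident[OF X]] by blast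
  then obtain U u v where u: "u \<in> hom K U A" "v \<in> hom K U X" "(s \<cdot> s') \<cdot> u \<in> S" "(s \<cdot> s') \<cdot> u = \<one> X \<cdot> v" "(g \<cdot> f') \<cdot> u = \<one> X \<cdot> v"
    using roof_eqE[OF _ c roof_ident[OF X]] by metis
  obtain B t' g' where t': "t' \<in> hom K B V" "g' \<in> hom K B W" "t' \<in> S" "g \<cdot> t' = s \<cdot> g'"
    using S_ore[OF k(3) h(1,2)] by blast
  have c': "roof Y B Y (t \<cdot> t') (f \<cdot> g')"
    unfolding roof_def using comp_hom[OF t'(1) k(1)] S_comp[OF t'(3) k(2) t'(1) k(1)] comp_hom[OF t'(2) h(3)] by blast
  have "frac K S (t \<cdot> t') (f \<cdot> g') = frac K S (\<one> Y) (\<one> Y)"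
    using L_comp[OF q(1) r(1) t'(1,3,2,4)] b(3) r(2) q(2) by simp
  then have "roof_eq K S (t \<cdot> t', f \<cdot> g') (\<one> Y, \<one> Y)" using frac_eq_iff[OF c' roof_ident[OF Y]] by blast
  then obtain U' u' v' where u': "u' \<in> hom K U' B" "v' \<in> hom K U' Y" "(t \<cdot> t') \<cdot> u' \<in> S" "(t \<cdot> t') \<cdot> u' = \<one> Y \<cdot> v'" "(f \<cdot> g') \<cdot> u' = \<one> Y \<cdot> v'"
    using roof_eqE[OF _ c' roof_ident[OF Y]] by metis
  have su: "s' \<cdot> u \<in> hom K U W" and fu: "f' \<cdot> u \<in> hom K U V" and gu: "g' \<cdot> u' \<in> hom K U' W"
    using comp_hom u(1) s' u'(1) t' by blast+
  have "s \<cdot> (s' \<cdot> u) \<in> S" using u(3) comp_assoc[OF u(1) s'(1) h(1)] by simp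
  then have sS: "s' \<cdot> u \<in> S" using S_two_of_three[OF su h(1,2)] by blast
  have eq: "f \<cdot> (s' \<cdot> u) = t \<cdot> (f' \<cdot> u)" using comp_eq_extend[OF s'(4) u(1) s'(1) h(3) s'(2) k(1)] .
  have gS: "g \<cdot> (f' \<cdot> u) \<in> S" using u(3,4,5) comp_assoc[OF u(1) s'(2) k(3)] by simp
  have fS: "f \<cdot> (g' \<cdot> u') \<in> S" using u'(3,4,5) comp_assoc[OF u'(1) t'(2) h(3)] by simp
  \<comment> \<open>From b a = 1 comes the left inverse of \<open>f\<close>, relative to the square
    f s' = t f' restricted along \<open>u\<close>; from a b = 1 comes the right inverse g' u'. These
    are the premises of \<open>S_saturated\<close>.\<close>
  have "f \<in> S" using S_saturated[OF k(1,2) su sS h(3) fu eq k(3) gS gu fS] .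
  then show "\<exists>W. \<exists>s\<in>hom K W X. \<exists>f\<in>hom K W Y. s \<in> S \<and> f \<in> S" using h by blast
next
  assume "\<exists>W. \<exists>s\<in>hom K W X. \<exists>f\<in>hom K W Y. s \<in> S \<and> f \<in> S"
  then obtain W s f where s: "s \<in> hom K W X" "s \<in> S" "f \<in> hom K W Y" "f \<in> S" by blast
  have r: "roof X W Y s f" "roof Y W X f s" using s by (auto simp: roof_def)
  have W: "W \<in> Obj K" and XY: "X \<in> Obj K" "Y \<in> Obj K" using homD[OF s(1)] homD[OF s(3)] by auto
  note i = ident_hom[OF W] S_ident[OF W]
  have d: "frac K S p p = frac K S (\<one> Z) (\<one> Z)" if p: "p \<in> hom K W Z" "p \<in> S" and Z: "Z \<in> Obj K" for p Z
  proof -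
    have rp: "roof Z W Z p p" using p by (simp add: roof_def)
    have "roof_eq K S (p, p) (\<one> Z, \<one> Z)"
      using roof_eqI[OF rp roof_ident[OF Z] i(1) p(1)] comp_ident_right[OF p(1)] comp_ident_left[OF p(1)] p(2) by simp
    then show ?thesis using frac_eq_iff[OF rp roof_ident[OF Z]] by blast
  qed
  have 1: "Comp L (frac K S f s) (frac K S s f) = Ident L X"
    using L_comp[OF r i(1,2,1)] comp_ident_right[OF s(1)] comp_ident_right[OF s(3)] d[OF s(1,2) XY(1)] by simp
  have 2: "Comp L (frac K S s f) (frac K S f s) = Ident L Y"
    using L_comp[OF r(2,1) i(1,2,1)] comp_ident_right[OF s(1)] comp_ident_right[OF s(3)] d[OF s(3,4) XY(2)] by simp
  have "is_iso L (frac K S s f)"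
    unfolding is_iso_def using frac_ends[OF r(1)] frac_hom[OF r(2)] 1 2 by auto
  then show "isomorphic L X Y" using frac_hom[OF r(1)] by (auto simp: isomorphic_def)
qed

text \<open>The zero roof has an identity as denominator. Comparing a roof with it leaves one
  condition, that the numerator is killed by some arrow of \<open>S\<close>; two-out-of-three puts
  the refining arrow into \<open>S\<close>.\<close>

lemma L_null_iff:
  assumes "X \<in> Obj K" "Y \<in> Obj K"
  shows "hom L X Y = {Null L X Y} \<longleftrightarrow>
    (\<forall>W. \<forall>s\<in>hom K W X. \<forall>f\<in>hom K W Y. s \<in> S \<longrightarrow> (\<exists>V. \<exists>t\<in>hom K V W. t \<in> S \<and> f \<cdot> t = Null K V Y))"
proof -
  have n: "roof X X Y (\<one> X) (Null K X Y)" using ident_hom S_ident null_hom assms by (simp add: roof_def)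
  have *: "frac K S (\<one> X) (Null K X Y) = frac K S s f \<longleftrightarrow> (\<exists>V. \<exists>t\<in>hom K V W. t \<in> S \<and> f \<cdot> t = Null K V Y)"
    if r: "roof X W Y s f" for W s f
  proof -
    note h = roofD[OF r]
    show ?thesis
      unfolding frac_eq_iff[OF n r]
    proof
      assume "roof_eq K S (\<one> X, Null K X Y) (s, f)"
      then obtain V u v where u: "u \<in> hom K V X" "v \<in> hom K V W" "\<one> X \<cdot> u \<in> S" "\<one> X \<cdot> u = s \<cdot> v" "Null K X Y \<cdot> u = f \<cdot> v"
        using roof_eqE[OF _ n r] by metis
      have "v \<in> S" using S_two_of_three[OF u(2) h(1,2)] u(3,4) by simp
      moreover have "f \<cdot> v = Null K V Y" using u(5) null_comp[OF u(1) assms(2)] by simp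
      ultimately show "\<exists>V. \<exists>t\<in>hom K V W. t \<in> S \<and> f \<cdot> t = Null K V Y" using u(2) by blast
    next
      assume "\<exists>V. \<exists>t\<in>hom K V W. t \<in> S \<and> f \<cdot> t = Null K V Y"
      then obtain V t where t: "t \<in> hom K V W" "t \<in> S" "f \<cdot> t = Null K V Y" by blast
      have st: "s \<cdot> t \<in> hom K V X" "s \<cdot> t \<in> S" using comp_hom[OF t(1) h(1)] S_comp[OF t(2) h(2) t(1) h(1)] .
      show "roof_eq K S (\<one> X, Null K X Y) (s, f)"
        using roof_eqI[OF n r st(1) t(1)] comp_ident_left[OF st(1)] st(2) null_comp[OF st(1) assms(2)] t(3) by simp
    qed
  qed
  show ?thesis
  proof
    assume e: "hom L X Y = {Null L X Y}"
    show "\<forall>W. \<forall>s\<in>hom K W X. \<forall>f\<in>hom K W Y. s \<in> S \<longrightarrow> (\<exists>V. \<exists>t\<in>hom K V W. t \<in> S \<and> f \<cdot> t = Null K V Y)"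
    proof (intro allI ballI impI)
      fix W s f assume "s \<in> hom K W X" "f \<in> hom K W Y" "s \<in> S"
      then have r: "roof X W Y s f" by (simp add: roof_def)
      then show "\<exists>V. \<exists>t\<in>hom K V W. t \<in> S \<and> f \<cdot> t = Null K V Y" using *[OF r] frac_hom[OF r] e by simp
    qed
  next
    assume e: "\<forall>W. \<forall>s\<in>hom K W X. \<forall>f\<in>hom K W Y. s \<in> S \<longrightarrow> (\<exists>V. \<exists>t\<in>hom K V W. t \<in> S \<and> f \<cdot> t = Null K V Y)"
    have "F = Null L X Y" if F: "F \<in> hom L X Y" for F
    proof -
      obtain W s f where r: "roof X W Y s f" "F = frac K S s f" using L_homE[OF F] .
      then show ?thesis using *[OF r(1)] e roofD[OF r(1)] by simp
    qed
    moreover have "Null L X Y \<in> hom L X Y" using frac_hom[OF n] by simp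
    ultimately show "hom L X Y = {Null L X Y}" by blast
  qed
qed

end

section \<open>The derived category\<close>

context abelian_category
begin

lemma Cb_simps [simp]:
  "Obj (Cb C) = complexes" "Arr (Cb C) = chain_maps C" "Dom (Cb C) = src" "Cod (Cb C) = tgt"
  "Ident (Cb C) X = cident X" "Comp (Cb C) g f = ccomp g f" "Null (Cb C) X Y = cnull X Y"
  by (simp_all add: Cb_def cident_def ccomp_def cnull_def)

lemma hom_Cb: "hom (Cb C) X Y = {f. chmap f X Y}"
  by (auto simp: hom_def chmap_def)

lemma Plus_Cb: "Plus (Cb C) f g = \<lparr>src = src f, tgt = tgt f, cpt = (\<lambda>i. cpt f i \<oplus> cpt g i)\<rparr>"
  by (simp add: Cb_def)

lemma chmap_eqI:
  assumes "chmap f X Y" "chmap g X Y" "\<And>i W x. x \<in> El W (ob X i) \<Longrightarrow> cpt f i \<rhd> x = cpt g i \<rhd> x"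
  shows "f = g"
proof -
  have "cpt f i = cpt g i" for i using arr_eqI[OF chmapD(3)[OF assms(1)] chmapD(3)[OF assms(2)] assms(3)] .
  then have "cpt f = cpt g" by (rule ext)
  then show ?thesis using chmap_ends[OF assms(1)] chmap_ends[OF assms(2)] by simp
qed

lemma null_homotopic_iff:
  assumes "chmap f X Y" shows "f \<in> null_homotopic C \<longleftrightarrow> hpic f (cnull X Y)"
proof
  note XY = chmapD(1,2)[OF assms]
  assume "f \<in> null_homotopic C"
  then obtain h where h: "\<And>i. h i \<in> hom C (ob X i) (ob Y (i - 1))"
    "\<And>i. cpt f i = (diff Y (i - 1) \<cdot> h i) \<oplus> (h (i + 1) \<cdot> diff X i)"
    unfolding null_homotopic_def using chmap_ends[OF assms] by auto
  show "hpic f (cnull X Y)"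
  proof (rule hpicI[OF assms chmap_cnull[OF XY] h(1)])
    fix i W x
    show "cpt f i \<rhd> x = cpt (cnull X Y) i \<rhd> x + diff Y (i - 1) \<rhd> h i \<rhd> x + h (i + 1) \<rhd> diff X i \<rhd> x"
      using XY homD[OF h(1)[of i]] homD[OF h(1)[of "i + 1"]] by (simp add: h(2))
  qed
next
  note XY = chmapD(1,2)[OF assms]
  assume n: "hpic f (cnull X Y)"
  obtain h where h0: "htpy X Y f (cnull X Y) h" using hpicE[OF n assms] .
  note h = htpyD(2)[OF h0]
  have eq: "cpt f i = (diff Y (i - 1) \<cdot> h i) \<oplus> (h (i + 1) \<cdot> diff X i)" for i
  proof (rule arr_eqI[OF chmapD(3)[OF assms]])
    have d: "diff Y (i - 1) \<in> hom C (ob Y (i - 1)) (ob Y i)" using complexD(2)[OF XY(2), of "i - 1"] by simp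
    have h1: "h (i + 1) \<in> hom C (ob X (i + 1)) (ob Y i)" using h[of "i + 1"] by simp
    show "(diff Y (i - 1) \<cdot> h i) \<oplus> (h (i + 1) \<cdot> diff X i) \<in> hom C (ob X i) (ob Y i)"
      using plus_hom[OF comp_hom[OF h d] comp_hom[OF complexD(2)[OF XY(1)] h1]] .
    fix x W assume x: "x \<in> El W (ob X i)"
    show "cpt f i \<rhd> x = ((diff Y (i - 1) \<cdot> h i) \<oplus> (h (i + 1) \<cdot> diff X i)) \<rhd> x"
      using htpyD(3)[OF h0 x] XY homD[OF h[of i]] homD[OF h[of "i + 1"]] by simp
  qed
  have "\<exists>h. \<forall>i. h i \<in> hom C (ob X i) (ob Y (i - 1)) \<and>
     cpt f i = (diff Y (i - 1) \<cdot> h i) \<oplus> (h (i + 1) \<cdot> diff X i)"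
    using h eq by blast
  then show "f \<in> null_homotopic C"
    unfolding null_homotopic_def using chmap_ends[OF assms] assms by (simp add: chmap_def)
qed

text \<open>The coset modulo null-homotopic maps is the homotopy class. Thus \<open>some_rep\<close>
  returns a homotopic map, and arrows of the homotopy category can be handled by
  representatives.\<close>

lemma Kb_class_eq:
  assumes "chmap f X Y" shows "Kb_class C f = {g. hpic g f}"
proof (rule set_eqI, rule iffI)
  note XY = chmapD(1,2)[OF assms]
  fix g assume "g \<in> Kb_class C f"
  then obtain n where n: "n \<in> null_homotopic C" "chmap n X Y" "g = Plus (Cb C) f n"
    unfolding Kb_class_def coset_def using chmap_ends[OF assms] by (auto simp: hom_Cb)
  have n0: "hpic n (cnull X Y)" using null_homotopic_iff[OF n(2)] n(1) by blast
  obtain h where h0: "htpy X Y n (cnull X Y) h" using hpicE[OF n0 n(2)] .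
  note h = htpyD[OF h0]
  have gx: "cpt g i \<rhd> x = cpt f i \<rhd> x + cpt n i \<rhd> x" for i x
    using assms n(2) unfolding n(3) Plus_Cb by simp
  have g: "chmap g X Y"
  proof (rule chmapI[OF XY])
    show "src g = X" "tgt g = Y" unfolding n(3) Plus_Cb using chmap_ends[OF assms] by simp_all
    show "cpt g i \<in> hom C (ob X i) (ob Y i)" for i
      unfolding n(3) Plus_Cb using plus_hom[OF chmapD(3)[OF assms] chmapD(3)[OF n(2)]] by simp
    show "diff Y i \<rhd> cpt g i \<rhd> x = cpt g (i + 1) \<rhd> diff X i \<rhd> x" for i x
      by (simp add: gx chmap_commute[OF assms] chmap_commute[OF n(2)])
  qed
  have "hpic g f"
  proof (rule hpicI[OF g assms h(2)])
    fix i W x assume x: "x \<in> El W (ob X i)"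
    show "cpt g i \<rhd> x = cpt f i \<rhd> x + diff Y (i - 1) \<rhd> h i \<rhd> x + h (i + 1) \<rhd> diff X i \<rhd> x"
      using h(3)[OF x] XY by (simp add: gx algebra_simps)
  qed
  then show "g \<in> {g. hpic g f}" by simp
next
  note XY = chmapD(1,2)[OF assms]
  fix g assume "g \<in> {g. hpic g f}"
  then have gf: "hpic g f" by simp
  have g: "chmap g X Y" using hpic_chmap(2)[OF gf assms] .
  let ?n = "csub g f"
  have n: "chmap ?n X Y" using chmap_csub[OF g assms] .
  have m: "?n \<in> null_homotopic C" using null_homotopic_iff[OF n] hpic_csub_iff[OF g assms] gf by blast
  have "chmap (Plus (Cb C) f ?n) X Y"
  proof (rule chmapI[OF XY])
    show "src (Plus (Cb C) f ?n) = X" "tgt (Plus (Cb C) f ?n) = Y" unfolding Plus_Cb using chmap_ends[OF assms] by simp_all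
    show "cpt (Plus (Cb C) f ?n) i \<in> hom C (ob X i) (ob Y i)" for i
      unfolding Plus_Cb using plus_hom[OF chmapD(3)[OF assms] chmapD(3)[OF n]] by simp
    show "diff Y i \<rhd> cpt (Plus (Cb C) f ?n) i \<rhd> x = cpt (Plus (Cb C) f ?n) (i + 1) \<rhd> diff X i \<rhd> x" for i x
      using assms n unfolding Plus_Cb by (simp add: chmap_commute[OF assms] chmap_commute[OF n])
  qed
  then have "g = Plus (Cb C) f ?n"
  proof (rule chmap_eqI[OF g])
    fix i W x
    show "cpt g i \<rhd> x = cpt (Plus (Cb C) f ?n) i \<rhd> x" using assms n cpt_csub[OF g assms] unfolding Plus_Cb by simp
  qed
  then show "g \<in> Kb_class C f"
    unfolding Kb_class_def coset_def using m n chmap_ends[OF assms] by (auto simp: hom_Cb)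
qed

lemma Kb_class_eq_iff:
  assumes "chmap f X Y" "chmap g X' Y'" shows "Kb_class C f = Kb_class C g \<longleftrightarrow> hpic f g"
proof
  assume "Kb_class C f = Kb_class C g"
  moreover have "f \<in> Kb_class C f" using Kb_class_eq[OF assms(1)] hpic_refl[OF assms(1)] by simp
  ultimately show "hpic f g" using Kb_class_eq[OF assms(2)] by simp
next
  assume h: "hpic f g"
  show "Kb_class C f = Kb_class C g"
    unfolding Kb_class_eq[OF assms(1)] Kb_class_eq[OF assms(2)]
    using hpic_trans[OF _ h] hpic_trans[OF _ hpic_sym[OF h]] by blast
qed

lemma some_rep_Kb: assumes "chmap f X Y" shows "hpic (some_rep (Kb_class C f)) f"
proof -
  have "f \<in> Kb_class C f" using Kb_class_eq[OF assms] hpic_refl[OF assms] by simp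
  then have "some_rep (Kb_class C f) \<in> Kb_class C f" unfolding some_rep_def by (rule someI)
  then show ?thesis using Kb_class_eq[OF assms] by simp
qed

lemma some_rep_Kb_chmap: "chmap f X Y \<Longrightarrow> chmap (some_rep (Kb_class C f)) X Y"
  using hpic_chmap(2)[OF some_rep_Kb] .

lemma Kb_fields:
  "Obj (Kb C) = complexes" "Arr (Kb C) = Kb_class C ` chain_maps C"
  "Ident (Kb C) X = Kb_class C (cident X)" "Null (Kb C) X Y = Kb_class C (cnull X Y)"
  "Dom (Kb C) F = src (some_rep F)" "Cod (Kb C) F = tgt (some_rep F)"
  "Comp (Kb C) G F = Kb_class C (ccomp (some_rep G) (some_rep F))"
  by (simp_all add: Kb_def quotient_cat_def Kb_class_def)

lemma Kb_hom_iff: "F \<in> hom (Kb C) X Y \<longleftrightarrow> (\<exists>f. chmap f X Y \<and> F = Kb_class C f)"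
proof
  assume F: "F \<in> hom (Kb C) X Y"
  then obtain f where f: "f \<in> chain_maps C" "F = Kb_class C f" by (auto simp: hom_def Kb_fields)
  have "chmap f (src f) (tgt f)" using f chain_maps_chmap by blast
  then show "\<exists>f. chmap f X Y \<and> F = Kb_class C f"
    using F f chmap_ends[OF some_rep_Kb_chmap] by (auto simp: hom_def Kb_fields)
next
  assume "\<exists>f. chmap f X Y \<and> F = Kb_class C f"
  then obtain f where f: "chmap f X Y" "F = Kb_class C f" by blast
  then have "f \<in> chain_maps C" by (simp add: chmap_def)
  then show "F \<in> hom (Kb C) X Y"
    using f chmap_ends[OF some_rep_Kb_chmap[OF f(1)]] by (auto simp: hom_def Kb_fields)
qed

lemma Kb_homI: "chmap f X Y \<Longrightarrow> Kb_class C f \<in> hom (Kb C) X Y"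
  using Kb_hom_iff by blast

lemma Kb_comp:
  assumes "chmap f X Y" "chmap g Y Z"
  shows "Comp (Kb C) (Kb_class C g) (Kb_class C f) = Kb_class C (ccomp g f)"
proof -
  note f = some_rep_Kb_chmap[OF assms(1)] and g = some_rep_Kb_chmap[OF assms(2)]
  have "hpic (ccomp (some_rep (Kb_class C g)) (some_rep (Kb_class C f))) (ccomp g f)"
    using hpic_trans[OF hpic_ccomp_right[OF some_rep_Kb[OF assms(2)] g f] hpic_ccomp_left[OF some_rep_Kb[OF assms(1)] f assms(2)]] .
  then show ?thesis unfolding Kb_fields using Kb_class_eq_iff[OF chmap_ccomp[OF f g] chmap_ccomp[OF assms]] by blast
qed

lemma Kb_class_qis_iff: assumes "chmap f X Y" shows "Kb_class C f \<in> Kb_quasi_isos C \<longleftrightarrow> qis f"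
proof
  assume "Kb_class C f \<in> Kb_quasi_isos C"
  then obtain g where g: "qis g" "Kb_class C f = Kb_class C g" by (auto simp: Kb_quasi_isos_def quasi_isos_eq)
  have gc: "chmap g (src g) (tgt g)" using g(1) chain_maps_chmap by (simp add: qis_def)
  have "hpic f g" using Kb_class_eq_iff[OF assms gc] g(2) by blast
  then show "qis f" using qis_hpic[OF hpic_sym gc] g(1) by blast
qed (auto simp: Kb_quasi_isos_def quasi_isos_eq)

text \<open>The passage to homotopy classes is what makes these axioms available: the squares of
  \<open>ore_condition\<close> and the cancellation in \<open>left_cancel\<close> hold up to
  homotopy only. Saturation is checked on cohomology.\<close>

lemma Kb_fraction_system: "fraction_system (Kb C) (Kb_quasi_isos C)"
proof
  let ?K = "Kb C" and ?S = "Kb_quasi_isos C"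
  show "Dom ?K F \<in> Obj ?K" "Cod ?K F \<in> Obj ?K" if "F \<in> Arr ?K" for F
  proof -
    obtain f where f: "f \<in> chain_maps C" "F = Kb_class C f" using \<open>F \<in> Arr ?K\<close> by (auto simp: Kb_fields)
    then have c: "chmap f (src f) (tgt f)" using chain_maps_chmap by blast
    show "Dom ?K F \<in> Obj ?K" "Cod ?K F \<in> Obj ?K"
      using chmap_ends[OF some_rep_Kb_chmap[OF c]] chmapD(1,2)[OF c] f(2) by (simp_all add: Kb_fields)
  qed
  show "Ident ?K X \<in> hom ?K X X" if "X \<in> Obj ?K" for X
    using that chmap_cident by (auto simp: Kb_fields intro: Kb_homI)
  show "Comp ?K G F \<in> hom ?K X Z" if FG: "F \<in> hom ?K X Y" "G \<in> hom ?K Y Z" for F G X Y Z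
  proof -
    obtain f g where f: "chmap f X Y" "F = Kb_class C f" and g: "chmap g Y Z" "G = Kb_class C g"
      using FG Kb_hom_iff by metis
    show ?thesis using Kb_comp[OF f(1) g(1)] Kb_homI[OF chmap_ccomp[OF f(1) g(1)]] f(2) g(2) by simp
  qed
  show "Comp ?K (Comp ?K H G) F = Comp ?K H (Comp ?K G F)"
    if FGH: "F \<in> hom ?K W X" "G \<in> hom ?K X Y" "H \<in> hom ?K Y Z" for F G H W X Y Z
  proof -
    obtain f g h where f: "chmap f W X" "F = Kb_class C f" and g: "chmap g X Y" "G = Kb_class C g"
      and h: "chmap h Y Z" "H = Kb_class C h" using FGH Kb_hom_iff by metis
    show ?thesis unfolding f(2) g(2) h(2)
      using Kb_comp[OF f(1) g(1)] Kb_comp[OF g(1) h(1)] Kb_comp[OF chmap_ccomp[OF f(1) g(1)] h(1)]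
        Kb_comp[OF f(1) chmap_ccomp[OF g(1) h(1)]] ccomp_assoc[OF f(1) g(1) h(1)] by simp
  qed
  show "Comp ?K F (Ident ?K X) = F" "Comp ?K (Ident ?K Y) F = F" if F: "F \<in> hom ?K X Y" for F X Y
  proof -
    obtain f where f: "chmap f X Y" "F = Kb_class C f" using F Kb_hom_iff by blast
    note i = chmap_cident[OF chmapD(1)[OF f(1)]] chmap_cident[OF chmapD(2)[OF f(1)]]
    show "Comp ?K F (Ident ?K X) = F" "Comp ?K (Ident ?K Y) F = F"
      using Kb_comp[OF i(1) f(1)] Kb_comp[OF f(1) i(2)] ccomp_cident[OF f(1)] f(2) by (simp_all add: Kb_fields(3))
  qed
  show "Null ?K X Y \<in> hom ?K X Y" if "X \<in> Obj ?K" "Y \<in> Obj ?K" for X Y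
    using that chmap_cnull by (auto simp: Kb_fields intro: Kb_homI)
  show "Comp ?K (Null ?K Y Z) F = Null ?K X Z" if F: "F \<in> hom ?K X Y" "Z \<in> Obj ?K" for F X Y Z
  proof -
    obtain f where f: "chmap f X Y" "F = Kb_class C f" using F Kb_hom_iff by blast
    note XY = chmapD(1,2)[OF f(1)]
    have Z: "Z \<in> complexes" using F(2) by (simp add: Kb_fields)
    note n = chmap_cnull[OF XY(2) Z] chmap_cnull[OF XY(1) Z]
    have "hpic (ccomp (cnull Y Z) f) (cnull X Z)"
      using hpic_null_comp_right[OF hpic_refl[OF n(1)] n(1) f(1)] .
    then show ?thesis using Kb_comp[OF f(1) n(1)] Kb_class_eq_iff[OF chmap_ccomp[OF f(1) n(1)] n(2)] f(2)
      by (simp add: Kb_fields(4))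
  qed
  show "?S \<subseteq> Arr ?K" by (auto simp: Kb_quasi_isos_def quasi_isos_eq qis_def Kb_fields)
  show "Ident ?K X \<in> ?S" if "X \<in> Obj ?K" for X
    using that qis_cident by (auto simp: Kb_fields Kb_class_qis_iff[OF chmap_cident])
  show "Comp ?K T U \<in> ?S" if st: "U \<in> ?S" "T \<in> ?S" "U \<in> hom ?K X Y" "T \<in> hom ?K Y Z" for U T X Y Z
  proof -
    obtain s t where s: "chmap s X Y" "U = Kb_class C s" and t: "chmap t Y Z" "T = Kb_class C t"
      using st(3,4) Kb_hom_iff by metis
    show ?thesis using st(1,2) Kb_class_qis_iff[OF s(1)] Kb_class_qis_iff[OF t(1)]
        Kb_class_qis_iff[OF chmap_ccomp[OF s(1) t(1)]] qis_ccomp[OF s(1) t(1)] Kb_comp[OF s(1) t(1)] s(2) t(2) by simp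
  qed
  show "\<exists>W. \<exists>T\<in>hom ?K W X. \<exists>G\<in>hom ?K W Z. T \<in> ?S \<and> Comp ?K F T = Comp ?K U G"
    if fs: "F \<in> hom ?K X Y" "U \<in> hom ?K Z Y" "U \<in> ?S" for F U X Y Z
  proof -
    obtain f s where f: "chmap f X Y" "F = Kb_class C f" and s: "chmap s Z Y" "U = Kb_class C s"
      using fs(1,2) Kb_hom_iff by metis
    have "qis s" using fs(3) s Kb_class_qis_iff[OF s(1)] by simp
    then obtain W t g where t: "chmap t W X" "qis t" "chmap g W Z" "hpic (ccomp f t) (ccomp s g)"
      using ore_condition[OF f(1) s(1)] by blast
    have "Comp ?K F (Kb_class C t) = Comp ?K U (Kb_class C g)"
      using Kb_comp[OF t(1) f(1)] Kb_comp[OF t(3) s(1)] f(2) s(2) t(4)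
        Kb_class_eq_iff[OF chmap_ccomp[OF t(1) f(1)] chmap_ccomp[OF t(3) s(1)]] by simp
    then show ?thesis using Kb_homI[OF t(1)] Kb_homI[OF t(3)] Kb_class_qis_iff[OF t(1)] t(2) by blast
  qed
  show "\<exists>W. \<exists>T\<in>hom ?K W X. T \<in> ?S \<and> Comp ?K F T = Comp ?K G T"
    if fg: "F \<in> hom ?K X Y" "G \<in> hom ?K X Y" "U \<in> hom ?K Y Z" "U \<in> ?S" "Comp ?K U F = Comp ?K U G" for F G U X Y Z
  proof -
    obtain f g s where f: "chmap f X Y" "F = Kb_class C f" and g: "chmap g X Y" "G = Kb_class C g"
      and s: "chmap s Y Z" "U = Kb_class C s" using fg(1-3) Kb_hom_iff by metis
    have q: "qis s" using fg(4) s Kb_class_qis_iff[OF s(1)] by simp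
    have "hpic (ccomp s f) (ccomp s g)"
      using fg(5) Kb_comp[OF f(1) s(1)] Kb_comp[OF g(1) s(1)] f(2) g(2) s(2)
        Kb_class_eq_iff[OF chmap_ccomp[OF f(1) s(1)] chmap_ccomp[OF g(1) s(1)]] by simp
    then obtain W t where t: "chmap t W X" "qis t" "hpic (ccomp f t) (ccomp g t)"
      using left_cancel[OF f(1) g(1) s(1) q] by blast
    have "Comp ?K F (Kb_class C t) = Comp ?K G (Kb_class C t)"
      using Kb_comp[OF t(1) f(1)] Kb_comp[OF t(1) g(1)] f(2) g(2) t(3)
        Kb_class_eq_iff[OF chmap_ccomp[OF t(1) f(1)] chmap_ccomp[OF t(1) g(1)]] by simp
    then show ?thesis using Kb_homI[OF t(1)] Kb_class_qis_iff[OF t(1)] t(2) by blast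
  qed
  show "U \<in> ?S" if st: "U \<in> hom ?K X Y" "T \<in> hom ?K Y Z" "T \<in> ?S" "Comp ?K T U \<in> ?S" for U T X Y Z
  proof -
    obtain s t where s: "chmap s X Y" "U = Kb_class C s" and t: "chmap t Y Z" "T = Kb_class C t"
      using st(1,2) Kb_hom_iff by metis
    show ?thesis using st(3,4) Kb_class_qis_iff[OF s(1)] Kb_class_qis_iff[OF t(1)]
        Kb_class_qis_iff[OF chmap_ccomp[OF s(1) t(1)]] qis_cancel_left[OF s(1) t(1)] Kb_comp[OF s(1) t(1)] s(2) t(2) by simp
  qed
  show "F \<in> ?S" if a: "T \<in> hom ?K V Y" "T \<in> ?S" "P \<in> hom ?K U W" "P \<in> ?S" "F \<in> hom ?K W Y" "X \<in> hom ?K U V"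
    "Comp ?K F P = Comp ?K T X" "G \<in> hom ?K V Z" "Comp ?K G X \<in> ?S" "Q \<in> hom ?K Q' W" "Comp ?K F Q \<in> ?S"
  for T V Y P U W F X G Z Q Q'
  proof -
    obtain t p f x g q where t: "chmap t V Y" "T = Kb_class C t" and p: "chmap p U W" "P = Kb_class C p"
      and f: "chmap f W Y" "F = Kb_class C f" and x: "chmap x U V" "X = Kb_class C x"
      and g: "chmap g V Z" "G = Kb_class C g" and q: "chmap q Q' W" "Q = Kb_class C q"
      using a(1,3,5,6,8,10) Kb_hom_iff by metis
    have tq: "qis t" and pq: "qis p" using a(2,4) t p Kb_class_qis_iff by metis+
    have gx: "qis (ccomp g x)" using a(9) g x Kb_comp[OF x(1) g(1)] Kb_class_qis_iff[OF chmap_ccomp[OF x(1) g(1)]] by simp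
    have fq: "qis (ccomp f q)" using a(11) f q Kb_comp[OF q(1) f(1)] Kb_class_qis_iff[OF chmap_ccomp[OF q(1) f(1)]] by simp
    have eq: "hpic (ccomp t x) (ccomp f p)"
      using a(7) Kb_comp[OF p(1) f(1)] Kb_comp[OF x(1) t(1)] f p x t
        Kb_class_eq_iff[OF chmap_ccomp[OF x(1) t(1)] chmap_ccomp[OF p(1) f(1)]] by simp
    \<comment> \<open>On cohomology \<open>x\<close> is injective because g x is; hence so is t x,
      which is homotopic to f p. As \<open>p\<close> is surjective there, \<open>f\<close> is
      injective. Surjectivity of \<open>f\<close> follows from f q alone.\<close>
    have "H_inj f i" for i
    proof -
      have "H_inj x i" using H_comp(3)[OF x(1) g(1)] qisD(1)[OF gx] by blast
      then have "H_inj (ccomp t x) i" using H_comp(1)[OF x(1) t(1)] qisD(1)[OF tq] by blast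
      then have "H_inj (ccomp f p) i" using hpic_H(1)[OF eq chmap_ccomp[OF x(1) t(1)]] by blast
      then show ?thesis using H_comp(5)[OF p(1) f(1)] qisD(2)[OF pq] by blast
    qed
    moreover have "H_surj f i" for i using H_comp(4)[OF q(1) f(1)] qisD(2)[OF fq] by blast
    ultimately have "qis f" using qisI[OF f(1)] by blast
    then show ?thesis using f Kb_class_qis_iff[OF f(1)] by simp
  qed
qed

interpretation Db: fraction_system "Kb C" "Kb_quasi_isos C"
  by (rule Kb_fraction_system)

lemma Db_fields:
  "Obj (Db C) = complexes" "Arr (Db C) = Arr (Db_lin C)" "Dom (Db C) = Dom (Db_lin C)" "Cod (Db C) = Cod (Db_lin C)"
  "Ident (Db C) = Ident (Db_lin C)" "Comp (Db C) = Comp (Db_lin C)" "Null (Db C) = Null (Db_lin C)"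
  "Shift (Db C) = shift_complex C" "Triangles (Db C) = Db_triangles C"
  by (simp_all add: Db_def lincat.defs Db_lin_def localisation_def Kb_fields)

lemma hom_Db: "hom (Db C) = hom (Db_lin C)"
  by (simp add: hom_def Db_fields fun_eq_iff)

lemma Db_isomorphic_iff:
  "isomorphic (Db C) X Y \<longleftrightarrow> (\<exists>W s f. chmap s W X \<and> qis s \<and> chmap f W Y \<and> qis f)"
proof -
  have "isomorphic (Db C) X Y \<longleftrightarrow> isomorphic (Db_lin C) X Y"
    by (simp add: isomorphic_def is_iso_def hom_def Db_fields)
  also have "\<dots> \<longleftrightarrow> (\<exists>W. \<exists>s\<in>hom (Kb C) W X. \<exists>f\<in>hom (Kb C) W Y. s \<in> Kb_quasi_isos C \<and> f \<in> Kb_quasi_isos C)"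
    unfolding Db_lin_def by (rule Db.L_isomorphic_iff)
  also have "\<dots> \<longleftrightarrow> (\<exists>W s f. chmap s W X \<and> qis s \<and> chmap f W Y \<and> qis f)"
  proof
    assume "\<exists>W. \<exists>s\<in>hom (Kb C) W X. \<exists>f\<in>hom (Kb C) W Y. s \<in> Kb_quasi_isos C \<and> f \<in> Kb_quasi_isos C"
    then obtain W s f where "s\<in>hom (Kb C) W X" "f\<in>hom (Kb C) W Y" "s \<in> Kb_quasi_isos C" "f \<in> Kb_quasi_isos C" by blast
    then show "\<exists>W s f. chmap s W X \<and> qis s \<and> chmap f W Y \<and> qis f" using Kb_hom_iff Kb_class_qis_iff by metis
  next
    assume "\<exists>W s f. chmap s W X \<and> qis s \<and> chmap f W Y \<and> qis f"
    then obtain W s f where "chmap s W X" "qis s" "chmap f W Y" "qis f" by blast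
    then show "\<exists>W. \<exists>s\<in>hom (Kb C) W X. \<exists>f\<in>hom (Kb C) W Y. s \<in> Kb_quasi_isos C \<and> f \<in> Kb_quasi_isos C"
      using Kb_homI Kb_class_qis_iff by metis
  qed
  finally show ?thesis .
qed

text \<open>Combines the criterion for zero fractions with the description of arrows by chain maps.
  The orthogonality conditions in \<open>t_structure\<close> and \<open>right_perp\<close> are used
  in the form of the right-hand side.\<close>

lemma Db_null_iff:
  assumes "X \<in> complexes" "Y \<in> complexes"
  shows "hom (Db C) X Y = {Null (Db C) X Y} \<longleftrightarrow> hvanish X Y"
proof -
  have "hom (Db C) X Y = {Null (Db C) X Y} \<longleftrightarrow> hom (Db_lin C) X Y = {Null (Db_lin C) X Y}"
    by (simp add: hom_Db Db_fields)
  also have "\<dots> \<longleftrightarrow> (\<forall>W. \<forall>s\<in>hom (Kb C) W X. \<forall>f\<in>hom (Kb C) W Y. s \<in> Kb_quasi_isos C \<longrightarrow>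
      (\<exists>V. \<exists>t\<in>hom (Kb C) V W. t \<in> Kb_quasi_isos C \<and> Comp (Kb C) f t = Null (Kb C) V Y))"
    unfolding Db_lin_def by (rule Db.L_null_iff) (use assms in \<open>simp_all add: Kb_fields\<close>)
  also have "\<dots> \<longleftrightarrow> hvanish X Y"
  proof
    assume h: "\<forall>W. \<forall>s\<in>hom (Kb C) W X. \<forall>f\<in>hom (Kb C) W Y. s \<in> Kb_quasi_isos C \<longrightarrow>
      (\<exists>V. \<exists>t\<in>hom (Kb C) V W. t \<in> Kb_quasi_isos C \<and> Comp (Kb C) f t = Null (Kb C) V Y)"
    show "hvanish X Y"
    proof (rule hvanishI)
      fix W s f assume s: "chmap s W X" "qis s" "chmap f W Y"
      obtain V T where T: "T\<in>hom (Kb C) V W" "T \<in> Kb_quasi_isos C" "Comp (Kb C) (Kb_class C f) T = Null (Kb C) V Y"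
        using h Kb_homI[OF s(1)] Kb_homI[OF s(3)] Kb_class_qis_iff[OF s(1)] s(2) by blast
      obtain t where t: "chmap t V W" "T = Kb_class C t" using T(1) Kb_hom_iff by blast
      have "qis t" using T(2) t Kb_class_qis_iff[OF t(1)] by simp
      moreover have "hpic (ccomp f t) (cnull V Y)"
        using T(3) t Kb_comp[OF t(1) s(3)] Kb_class_eq_iff[OF chmap_ccomp[OF t(1) s(3)] chmap_cnull[OF chmapD(1)[OF t(1)] assms(2)]]
        by (simp add: Kb_fields)
      ultimately show "\<exists>V t. chmap t V W \<and> qis t \<and> hpic (ccomp f t) (cnull V Y)" using t by blast
    qed
  next
    assume v: "hvanish X Y"
    show "\<forall>W. \<forall>s\<in>hom (Kb C) W X. \<forall>f\<in>hom (Kb C) W Y. s \<in> Kb_quasi_isos C \<longrightarrow>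
      (\<exists>V. \<exists>t\<in>hom (Kb C) V W. t \<in> Kb_quasi_isos C \<and> Comp (Kb C) f t = Null (Kb C) V Y)"
    proof (intro allI ballI impI)
      fix W U F assume a: "U\<in>hom (Kb C) W X" "F\<in>hom (Kb C) W Y" "U \<in> Kb_quasi_isos C"
      obtain s f where s: "chmap s W X" "U = Kb_class C s" and f: "chmap f W Y" "F = Kb_class C f"
        using a(1,2) Kb_hom_iff by metis
      have q: "qis s" using a(3) s Kb_class_qis_iff[OF s(1)] by simp
      obtain V t where t: "chmap t V W" "qis t" "hpic (ccomp f t) (cnull V Y)" using hvanishE[OF v s(1) q f(1)] .
      have "Comp (Kb C) F (Kb_class C t) = Null (Kb C) V Y"
        using t(3) f Kb_comp[OF t(1) f(1)] Kb_class_eq_iff[OF chmap_ccomp[OF t(1) f(1)] chmap_cnull[OF chmapD(1)[OF t(1)] assms(2)]]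
        by (simp add: Kb_fields)
      then show "\<exists>V. \<exists>t\<in>hom (Kb C) V W. t \<in> Kb_quasi_isos C \<and> Comp (Kb C) F t = Null (Kb C) V Y"
        using Kb_homI[OF t(1)] Kb_class_qis_iff[OF t(1)] t(2) by blast
    qed
  qed
  finally show ?thesis .
qed

section \<open>Shifted arrows and distinguished triangles\<close>

lemma shift_Kb_class:
  assumes "chmap f X Y" "n = 1 \<or> n = - 1"
  shows "shift_chain_map C n ` Kb_class C f = Kb_class C (shift_chain_map C n f)"
  unfolding Kb_class_eq[OF assms(1)] Kb_class_eq[OF chmap_shift[OF assms]]
proof (intro equalityI subsetI)
  fix g assume "g \<in> shift_chain_map C n ` {g. hpic g f}"
  then show "g \<in> {g. hpic g (shift_chain_map C n f)}" using hpic_shift[OF _ assms(2)] by auto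
next
  fix g assume "g \<in> {g. hpic g (shift_chain_map C n f)}"
  then have h: "hpic g (shift_chain_map C n f)" by simp
  have m: "- n = 1 \<or> - n = - 1" using assms(2) by auto
  have g: "chmap g (shift_complex C n X) (shift_complex C n Y)" using hpic_chmap(2)[OF h chmap_shift[OF assms]] .
  have "hpic (shift_chain_map C (- n) g) f" using hpic_shift[OF h m] shift_chain_map_inverse[OF assms] by simp
  moreover have "g = shift_chain_map C n (shift_chain_map C (- n) g)" using shift_chain_map_inverse[OF g m] by simp
  ultimately show "g \<in> shift_chain_map C n ` {g. hpic g f}" by blast
qed

text \<open>A cone triangle is seen to be distinguished by means of identity arrows, and
  \<open>Db_triangles\<close> involves the shift of one of them. The shift acts on the roofs of a
  class one by one, so its value on an identity must be compared with the identity of the shift as a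
  set of roofs. The witnesses for the equivalence of roofs are shifted along.\<close>

lemma frac_ident_shift_subset:
  assumes "X \<in> complexes" "n = 1 \<or> n = - 1"
  shows "Db_shift_arrow C n (Ident (Db_lin C) X) \<subseteq> Ident (Db_lin C) (shift_complex C n X)"
proof
  fix r assume "r \<in> Db_shift_arrow C n (Ident (Db_lin C) X)"
  then obtain a b where r: "r = (shift_chain_map C n ` a, shift_chain_map C n ` b)"
    and ab: "(a, b) \<in> frac (Kb C) (Kb_quasi_isos C) (Kb_class C (cident X)) (Kb_class C (cident X))"
    unfolding Db_shift_arrow_def Db_lin_def by (auto simp: Db.L_fields Kb_fields(3))
  have iX: "Db.roof X X X (Kb_class C (cident X)) (Kb_class C (cident X))"
    using Db.roof_ident[of X] assms by (simp add: Kb_fields)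
  obtain W where ro: "Db.roof X W X a b" using Db.frac_memD[OF iX ab] .
  have e: "roof_eq (Kb C) (Kb_quasi_isos C) (Kb_class C (cident X), Kb_class C (cident X)) (a, b)" using ab by (simp add: frac_def)
  obtain s f where s: "chmap s W X" "a = Kb_class C s" "qis s" and f: "chmap f W X" "b = Kb_class C f"
    using Db.roofD[OF ro] Kb_hom_iff Kb_class_qis_iff by metis
  obtain V U U' where U: "U \<in> hom (Kb C) V X" "U' \<in> hom (Kb C) V W" "Comp (Kb C) (Kb_class C (cident X)) U \<in> Kb_quasi_isos C"
    "Comp (Kb C) (Kb_class C (cident X)) U = Comp (Kb C) a U'" "Comp (Kb C) (Kb_class C (cident X)) U = Comp (Kb C) b U'"
    using Db.roof_eqE[OF e iX ro] by metis
  obtain u v where u: "chmap u V X" "U = Kb_class C u" and v: "chmap v V W" "U' = Kb_class C v"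
    using U(1,2) Kb_hom_iff by metis
  note iC = chmap_cident[OF assms(1)]
  have uq: "qis u" and us: "hpic u (ccomp s v)" and uf: "hpic u (ccomp f v)"
    using U(3-5) Kb_comp[OF u(1) iC] Kb_comp[OF v(1) s(1)] Kb_comp[OF v(1) f(1)] ccomp_cident[OF u(1)]
      Kb_class_qis_iff[OF u(1)] Kb_class_eq_iff[OF u(1) chmap_ccomp[OF v(1) s(1)]]
      Kb_class_eq_iff[OF u(1) chmap_ccomp[OF v(1) f(1)]] u(2) v(2) s(2) f(2) by simp_all
  let ?sh = "shift_chain_map C n" and ?S = "shift_complex C n"
  note sh = chmap_shift[OF s(1) assms(2)] chmap_shift[OF f(1) assms(2)] chmap_shift[OF u(1) assms(2)] chmap_shift[OF v(1) assms(2)]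
  have X': "?S X \<in> complexes" using shift_complexes assms by blast
  have ro': "Db.roof (?S X) (?S W) (?S X) (Kb_class C (?sh s)) (Kb_class C (?sh f))"
    unfolding Db.roof_def using Kb_homI[OF sh(1)] Kb_homI[OF sh(2)] Kb_class_qis_iff[OF sh(1)] qis_shift[OF s(1) assms(2) s(3)] by blast
  have iX': "Db.roof (?S X) (?S X) (?S X) (Kb_class C (cident (?S X))) (Kb_class C (cident (?S X)))"
    using Db.roof_ident[of "?S X"] X' by (simp add: Kb_fields)
  have c: "Comp (Kb C) (Kb_class C (cident (?S X))) (Kb_class C (?sh u)) = Kb_class C (?sh u)"
    using Kb_comp[OF sh(3) chmap_cident[OF X']] ccomp_cident[OF sh(3)] by simp
  have "roof_eq (Kb C) (Kb_quasi_isos C) (Kb_class C (cident (?S X)), Kb_class C (cident (?S X))) (Kb_class C (?sh s), Kb_class C (?sh f))"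
  proof (rule Db.roof_eqI[OF iX' ro' Kb_homI[OF sh(3)] Kb_homI[OF sh(4)]])
    show "Comp (Kb C) (Kb_class C (cident (?S X))) (Kb_class C (?sh u)) \<in> Kb_quasi_isos C"
      unfolding c using Kb_class_qis_iff[OF sh(3)] qis_shift[OF u(1) assms(2) uq] by blast
    show "Comp (Kb C) (Kb_class C (cident (?S X))) (Kb_class C (?sh u)) = Comp (Kb C) (Kb_class C (?sh s)) (Kb_class C (?sh v))"
      unfolding c Kb_comp[OF sh(4,1)] using Kb_class_eq_iff[OF sh(3) chmap_ccomp[OF sh(4,1)]] hpic_shift[OF us assms(2)] by (simp add: shift_ccomp)
    show "Comp (Kb C) (Kb_class C (cident (?S X))) (Kb_class C (?sh u)) = Comp (Kb C) (Kb_class C (?sh f)) (Kb_class C (?sh v))"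
      unfolding c Kb_comp[OF sh(4,2)] using Kb_class_eq_iff[OF sh(3) chmap_ccomp[OF sh(4,2)]] hpic_shift[OF uf assms(2)] by (simp add: shift_ccomp)
  qed
  then have "(Kb_class C (?sh s), Kb_class C (?sh f)) \<in>
      frac (Kb C) (Kb_quasi_isos C) (Kb_class C (cident (?S X))) (Kb_class C (cident (?S X)))"
    using Db.roof_in_roofs[OF ro'] by (simp add: frac_def)
  then show "r \<in> Ident (Db_lin C) (?S X)"
    unfolding r s(2) f(2) shift_Kb_class[OF s(1) assms(2)] shift_Kb_class[OF f(1) assms(2)] Db_lin_def
    by (simp add: Db.L_fields Kb_fields(3))
qed

lemma Db_shift_ident:
  assumes "X \<in> complexes"
  shows "Db_shift_arrow C 1 (Ident (Db_lin C) X) = Ident (Db_lin C) (shift_complex C 1 X)"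
proof
  show "Db_shift_arrow C 1 (Ident (Db_lin C) X) \<subseteq> Ident (Db_lin C) (shift_complex C 1 X)"
    using frac_ident_shift_subset assms by blast
  have X': "shift_complex C 1 X \<in> complexes" using shift_complexes assms by blast
  show "Ident (Db_lin C) (shift_complex C 1 X) \<subseteq> Db_shift_arrow C 1 (Ident (Db_lin C) X)"
  proof
    fix r assume r: "r \<in> Ident (Db_lin C) (shift_complex C 1 X)"
    obtain a b where ab: "r = (a, b)" by (cases r)
    have m: "(a, b) \<in> frac (Kb C) (Kb_quasi_isos C) (Kb_class C (cident (shift_complex C 1 X))) (Kb_class C (cident (shift_complex C 1 X)))"
      using r ab unfolding Db_lin_def by (simp add: Db.L_fields Kb_fields(3))
    have iX: "Db.roof (shift_complex C 1 X) (shift_complex C 1 X) (shift_complex C 1 X)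
        (Kb_class C (cident (shift_complex C 1 X))) (Kb_class C (cident (shift_complex C 1 X)))"
      using Db.roof_ident[of "shift_complex C 1 X"] X' by (simp add: Kb_fields)
    obtain W where ro: "Db.roof (shift_complex C 1 X) W (shift_complex C 1 X) a b" using Db.frac_memD[OF iX m] .
    obtain s f where s: "chmap s W (shift_complex C 1 X)" "a = Kb_class C s" and f: "chmap f W (shift_complex C 1 X)" "b = Kb_class C f"
      using Db.roofD[OF ro] Kb_hom_iff by metis
    \<comment> \<open>The reverse inclusion uses the first one for the shift by -1: shift the roof
      back, which lands in the identity class of \<open>X\<close>, and then forth again.\<close>
    let ?a = "shift_chain_map C (- 1) ` a" and ?b = "shift_chain_map C (- 1) ` b"
    have "(?a, ?b) \<in> Db_shift_arrow C (- 1) (Ident (Db_lin C) (shift_complex C 1 X))"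
      unfolding Db_shift_arrow_def using r ab by force
    then have mem: "(?a, ?b) \<in> Ident (Db_lin C) X" using frac_ident_shift_subset[OF X', of "- 1"] assms by auto
    have eq: "shift_chain_map C 1 ` ?a = a" "shift_chain_map C 1 ` ?b = b"
      using shift_Kb_class[OF s(1), of "- 1"] shift_Kb_class[OF f(1), of "- 1"]
        shift_Kb_class[OF chmap_shift[OF s(1), of "- 1"], of 1] shift_Kb_class[OF chmap_shift[OF f(1), of "- 1"], of 1]
        s f by simp_all
    show "r \<in> Db_shift_arrow C 1 (Ident (Db_lin C) X)"
      unfolding Db_shift_arrow_def ab
      by (rule image_eqI[OF _ mem]) (simp only: prod.case eq)
  qed
qed

lemma Db_class_hom: assumes "chmap f X Y" shows "Db_class C f \<in> hom (Db_lin C) X Y"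
proof -
  note X = chmapD(1)[OF assms]
  have "Db.roof X X Y (Kb_class C (cident X)) (Kb_class C f)"
    unfolding Db.roof_def
    using Kb_homI[OF chmap_cident[OF X]] Kb_homI[OF assms] Kb_class_qis_iff[OF chmap_cident[OF X]] qis_cident[OF X] by blast
  then show ?thesis using Db.frac_hom chmap_ends[OF assms] by (simp add: Db_class_def Db_lin_def)
qed

lemma cone_triangle_distinguished:
  assumes cone: "is_cone X Y f Z \<iota> \<pi> \<kappa> \<rho>"
  shows "(Db_class C f, Db_class C \<iota>, Db_class C \<pi>) \<in> Triangles (Db C)"
    "Db_class C f \<in> hom (Db C) X Y" "Db_class C \<iota> \<in> hom (Db C) Y Z" "Db_class C \<pi> \<in> hom (Db C) Z (shift_complex C 1 X)"
proof -
  note k = coneD[OF cone]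
  note F = Db_class_hom[OF k(1)] and I = Db_class_hom[OF k(2)] and P = Db_class_hom[OF k(3)]
  show "Db_class C f \<in> hom (Db C) X Y" "Db_class C \<iota> \<in> hom (Db C) Y Z" "Db_class C \<pi> \<in> hom (Db C) Z (shift_complex C 1 X)"
    using F I P by (simp_all add: hom_Db)
  have e: "src f = X" "tgt f = Y" "tgt \<iota> = Z" using chmap_ends[OF k(1)] chmap_ends[OF k(2)] by auto
  have o: "X \<in> Obj (Kb C)" "Y \<in> Obj (Kb C)" "Z \<in> Obj (Kb C)" using k(4-6) by (simp_all add: Kb_fields)
  let ?D = "Db_lin C"
  note id = Db.L_ident_hom[folded Db_lin_def] Db.L_ident_iso[folded Db_lin_def]
  note un = Db.L_ident_left[folded Db_lin_def] Db.L_ident_right[folded Db_lin_def]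
  show "(Db_class C f, Db_class C \<iota>, Db_class C \<pi>) \<in> Triangles (Db C)"
    unfolding Db_fields Db_triangles_def Let_def
  proof (intro CollectI, unfold prod.case, intro conjI)
    show "Db_class C f \<in> Arr ?D" "Db_class C \<iota> \<in> Arr ?D" "Db_class C \<pi> \<in> Arr ?D"
      "Cod ?D (Db_class C f) = Dom ?D (Db_class C \<iota>)" "Cod ?D (Db_class C \<iota>) = Dom ?D (Db_class C \<pi>)"
      "Cod ?D (Db_class C \<pi>) = shift_complex C 1 (Dom ?D (Db_class C f))"
      using F I P by (auto simp: hom_def)
    have d: "Dom ?D (Db_class C f) = X" "Dom ?D (Db_class C \<iota>) = Y" "Dom ?D (Db_class C \<pi>) = Z"
      using F I P by (auto simp: hom_def)
    show "\<exists>f' \<iota>' \<pi>'. cone_triangle C f' \<iota>' \<pi>' \<and>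
        (\<exists>a b c. a \<in> hom ?D (Dom ?D (Db_class C f)) (src f') \<and> b \<in> hom ?D (Dom ?D (Db_class C \<iota>)) (tgt f') \<and>
           c \<in> hom ?D (Dom ?D (Db_class C \<pi>)) (tgt \<iota>') \<and> is_iso ?D a \<and> is_iso ?D b \<and> is_iso ?D c \<and>
           Comp ?D b (Db_class C f) = Comp ?D (Db_class C f') a \<and>
           Comp ?D c (Db_class C \<iota>) = Comp ?D (Db_class C \<iota>') b \<and>
           Comp ?D (Db_shift_arrow C 1 a) (Db_class C \<pi>) = Comp ?D (Db_class C \<pi>') c)"
      unfolding d
    proof (rule exI[of _ f], rule exI[of _ \<iota>], rule exI[of _ \<pi>], rule conjI)
      show "cone_triangle C f \<iota> \<pi>" using cone cone_triangle_iff by blast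
      show "\<exists>a b c. a \<in> hom ?D X (src f) \<and> b \<in> hom ?D Y (tgt f) \<and> c \<in> hom ?D Z (tgt \<iota>) \<and>
           is_iso ?D a \<and> is_iso ?D b \<and> is_iso ?D c \<and>
           Comp ?D b (Db_class C f) = Comp ?D (Db_class C f) a \<and>
           Comp ?D c (Db_class C \<iota>) = Comp ?D (Db_class C \<iota>) b \<and>
           Comp ?D (Db_shift_arrow C 1 a) (Db_class C \<pi>) = Comp ?D (Db_class C \<pi>) c"
        unfolding e
        by (rule exI[of _ "Ident ?D X"], rule exI[of _ "Ident ?D Y"], rule exI[of _ "Ident ?D Z"])
          (simp only: Db_shift_ident[OF k(4)] id(1)[OF o(1)] id(1)[OF o(2)] id(1)[OF o(3)]
            id(2)[OF o(1)] id(2)[OF o(2)] id(2)[OF o(3)] un(1)[OF F] un(2)[OF F] un(1)[OF I] un(2)[OF I]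
            un(1)[OF P] un(2)[OF P] simp_thms)
    qed
  qed
qed

text \<open>Only the three objects of the triangle are retained, up to isomorphism. This suffices
  because the aisle, its orthogonal and the vanishing conditions are invariant under
  isomorphism.\<close>

lemma triangle_obtain_cone:
  assumes "(u, v, w) \<in> Triangles (Db C)" "u \<in> hom (Db C) X Y" "v \<in> hom (Db C) Y Z" "w \<in> hom (Db C) Z X'"
  obtains A B f K \<iota> \<pi> \<kappa> \<rho> where "is_cone A B f K \<iota> \<pi> \<kappa> \<rho>"
    "isomorphic (Db C) X A" "isomorphic (Db C) Y B" "isomorphic (Db C) Z K"
proof -
  have d: "Dom (Db_lin C) u = X" "Dom (Db_lin C) v = Y" "Dom (Db_lin C) w = Z"
    using assms(2-4) by (auto simp: hom_Db hom_def)
  obtain f \<iota> \<pi> a b c where t: "cone_triangle C f \<iota> \<pi>" "a \<in> hom (Db_lin C) X (src f)" "b \<in> hom (Db_lin C) Y (tgt f)"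
    "c \<in> hom (Db_lin C) Z (tgt \<iota>)" "is_iso (Db_lin C) a" "is_iso (Db_lin C) b" "is_iso (Db_lin C) c"
    using assms(1) unfolding Db_fields Db_triangles_def Let_def by (auto simp: d)
  obtain A B K \<kappa> \<rho> where cone: "is_cone A B f K \<iota> \<pi> \<kappa> \<rho>" using t(1) cone_triangle_iff by blast
  have e: "src f = A" "tgt f = B" "tgt \<iota> = K" using chmap_ends coneD(1,2)[OF cone] by blast+
  have "isomorphic (Db C) X A" "isomorphic (Db C) Y B" "isomorphic (Db C) Z K"
    using t(2-7) e by (auto simp: isomorphic_def is_iso_def hom_def Db_fields)
  then show ?thesis using that cone by blast
qed

end

section \<open>Stalk complexes and truncation\<close>

context abelian_category
begin

text \<open>Rotation of a triangle: the map from the cone of \<iota> to X[1] is \<pi> after the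
  projection \<rho>' to \<open>Z\<close>. This projection is not a chain map, but its defect lies in
  the image of \<iota>, which \<pi> kills.\<close>

lemma cone_rotate:
  assumes cone: "is_cone X Y f Z \<iota> \<pi> \<kappa> \<rho>" and cone': "is_cone Y Z \<iota> M \<iota>' \<pi>' \<kappa>' \<rho>'"
  obtains \<theta> where "chmap \<theta> M (shift_complex C 1 X)" "qis \<theta>"
proof -
  note k = coneD[OF cone] and k' = coneD[OF cone']
  let ?S = "shift_complex C 1 X"
  have S: "?S \<in> complexes" using chmapD(2)[OF k(3)] .
  define \<theta> where "\<theta> = \<lparr>src = M, tgt = ?S, cpt = (\<lambda>i. cpt \<pi> i \<cdot> \<rho>' i)\<rparr>"
  have \<theta>x: "cpt \<theta> i \<rhd> c = cpt \<pi> i \<rhd> \<rho>' i \<rhd> c" for i c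
    using homD[OF k'(10)[of i]] homD[OF k(8)[of i]] by (simp add: \<theta>_def)
  have \<theta>: "chmap \<theta> M ?S"
  proof (rule chmapI[OF k'(6) S])
    show "cpt \<theta> i \<in> hom C (ob M i) (ob ?S i)" for i
      using comp_hom[OF k'(10) k(8)] by (simp add: \<theta>_def)
    fix i W c assume c: "c \<in> El W (ob M i)"
    show "diff ?S i \<rhd> cpt \<theta> i \<rhd> c = cpt \<theta> (i + 1) \<rhd> diff M i \<rhd> c"
      using k'(16)[OF c] k(4) k(14) k(17) by (simp add: \<theta>x)
  qed (auto simp: \<theta>_def)
  have "qis \<theta>"
  proof (rule qisI[OF \<theta>])
    fix i
    note kp = coneD_prev[OF cone, where i = i] and kp' = coneD_prev[OF cone', where i = i]
    show "H_inj \<theta> i"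
    proof (rule H_injI[OF \<theta>])
      fix W c assume c: "c \<in> cycs M i W" "cpt \<theta> i \<rhd> c \<in> bds ?S i W"
      note cd = cone_decompose[OF cone' c(1)]
      define y z where "y = cpt \<pi>' i \<rhd> c" and "z = \<rho>' i \<rhd> c"
      have y: "y \<in> cycs Y (i + 1) W" and z: "z \<in> El W (ob Z i)"
        and yz: "cpt \<iota> (i + 1) \<rhd> y + diff Z i \<rhd> z = 0" and ceq: "\<kappa>' i \<rhd> y + cpt \<iota>' i \<rhd> z = c"
        using cd by (simp_all add: y_def z_def)
      have yy: "y + (cpt f (i + 1) \<rhd> cpt \<pi> i \<rhd> z + diff Y i \<rhd> \<rho> i \<rhd> z) = 0"
        using arg_cong[OF yz, of "\<lambda>x. \<rho> (i + 1) \<rhd> x"] k(12)[OF cycsD(1)[OF y]] k(16)[OF z] by simp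
      have "cpt \<pi> i \<rhd> z \<in> bds X (i + 1) W" using c(2) k(4) by (simp add: \<theta>x z_def)
      then obtain V e x where x: "e \<in> epis V W" "x \<in> El V (ob X i)" "(cpt \<pi> i \<rhd> z) \<lhd> e = diff X i \<rhd> x"
        using bdsE[of "cpt \<pi> i \<rhd> z" X "i + 1" W] by simp metis
      \<comment> \<open>A primitive of \<open>c\<close> is a pair of elements of Y^i and Z^(i-1).
        The second is -\<kappa> x, with \<open>x\<close> a primitive of \<pi> z; the first is the
        remaining component \<rho> z, corrected by f x.\<close>
      define y' where "y' = (\<rho> i \<rhd> z) \<lhd> e + cpt f i \<rhd> x"
      have y': "y' \<in> El V (ob Y i)"
        unfolding y'_def using El_ract[OF El_lact[OF k(10) z] epis_hom[OF x(1)]] El_chmap[OF k(1) x(2)] by blast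
      define z' where "z' = - (\<kappa> (i - 1) \<rhd> x)"
      have z': "z' \<in> El V (ob Z (i - 1))" unfolding z'_def using El_uminus[OF El_lact[OF kp(2) x(2)]] .
      define c' where "c' = \<kappa>' (i - 1) \<rhd> y' + cpt \<iota>' (i - 1) \<rhd> z'"
      have c': "c' \<in> El V (ob M (i - 1))"
        unfolding c'_def using El_add[OF El_lact[OF kp'(2) y'] El_lact[OF k'(7) z']] .
      have dz': "diff Z (i - 1) \<rhd> z' = \<kappa> i \<rhd> diff X i \<rhd> x - cpt \<iota> i \<rhd> cpt f i \<rhd> x"
        unfolding z'_def using kp(6)[OF x(2)] by simp
      have zdec: "\<kappa> i \<rhd> ((cpt \<pi> i \<rhd> z) \<lhd> e) + cpt \<iota> i \<rhd> ((\<rho> i \<rhd> z) \<lhd> e) = z \<lhd> e"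
        using arg_cong[OF k(15)[OF z], of "\<lambda>x. x \<lhd> e"] by simp
      have s1: "cpt \<iota> i \<rhd> y' + diff Z (i - 1) \<rhd> z' = z \<lhd> e"
        unfolding dz' y'_def zdec[symmetric] x(3) by (simp add: algebra_simps)
      have ye: "y \<lhd> e = - (cpt f (i + 1) \<rhd> ((cpt \<pi> i \<rhd> z) \<lhd> e) + diff Y i \<rhd> ((\<rho> i \<rhd> z) \<lhd> e))"
        unfolding eq_neg_iff_add_eq_0 using arg_cong[OF yy, of "\<lambda>x. x \<lhd> e"] by simp
      have s2: "- (diff Y i \<rhd> y') = y \<lhd> e"
        unfolding ye y'_def x(3) using chmap_commute[OF k(1), of i x] by simp
      have "diff M (i - 1) \<rhd> c' = cpt \<iota>' i \<rhd> (cpt \<iota> i \<rhd> y' + diff Z (i - 1) \<rhd> z') + \<kappa>' i \<rhd> (- (diff Y i \<rhd> y'))"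
        unfolding c'_def using kp'(6)[OF y'] kp'(7) by (simp add: algebra_simps)
      also have "\<dots> = c \<lhd> e" unfolding s1 s2 using arg_cong[OF ceq, of "\<lambda>x. x \<lhd> e"] by (simp add: algebra_simps)
      finally show "c \<in> bds M i W" using bdsI[OF cycsD(1)[OF c(1)] x(1) c'] by simp
    qed
    show "H_surj \<theta> i"
    proof (rule H_surjI[OF \<theta>])
      fix W x assume "x \<in> cycs ?S i W"
      then have x: "x \<in> cycs X (i + 1) W" using k(4) by simp
      note xE = cycsD(1)[OF x]
      have y: "- (cpt f (i + 1) \<rhd> x) \<in> cycs Y (i + 1) W" using cycs_uminus[OF cycs_chmap[OF k(1) x]] .
      have z: "\<kappa> i \<rhd> x \<in> El W (ob Z i)" using El_lact[OF k(9) xE] .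
      have c: "\<kappa>' i \<rhd> (- (cpt f (i + 1) \<rhd> x)) + cpt \<iota>' i \<rhd> \<kappa> i \<rhd> x \<in> cycs M i W"
        using cone_cycle_iff[OF cone' cycsD(1)[OF y] z] y k(18)[OF xE] cycsD(2)[OF x] by simp
      have W: "W \<in> Obj C" using El_obj[OF xE] by simp
      have "x \<lhd> \<one> W - cpt \<theta> i \<rhd> (\<kappa>' i \<rhd> (- (cpt f (i + 1) \<rhd> x)) + cpt \<iota>' i \<rhd> \<kappa> i \<rhd> x) = 0"
        unfolding \<theta>x using k'(13) k'(12)[OF z] k(11)[OF xE] xE by simp
      then show "\<exists>V. \<exists>e\<in>epis V W. \<exists>c\<in>cycs M i V. x \<lhd> e - cpt \<theta> i \<rhd> c \<in> bds ?S i V"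
        using epis_ident[OF W] c bds_zero[OF S W] by metis
    qed
  qed
  then show ?thesis using that \<theta> by blast
qed

text \<open>Exactness of Hom(-, Z) at \<open>K\<close>, with outer term Hom(A[1], Z). Rotation makes
  it exactness at the middle of the triangle B -> K -> A[1].\<close>

lemma hvanish_cone_cofibre:
  assumes cone: "is_cone A B f K \<iota> \<pi> \<kappa> \<rho>" and v: "hvanish B Z" "hvanish (shift_complex C 1 A) Z"
  shows "hvanish K Z"
proof -
  obtain M \<iota>' \<pi>' \<kappa>' \<rho>' where cone': "is_cone B K \<iota> M \<iota>' \<pi>' \<kappa>' \<rho>'" using cone_ex[OF coneD(2)[OF cone]] by blast
  obtain \<theta> where "chmap \<theta> M (shift_complex C 1 A)" "qis \<theta>" using cone_rotate[OF cone cone'] .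
  then have "hvanish M Z" using hvanish_qis_left v(2) by blast
  then show ?thesis using hvanish_cone_source[OF cone' v(1)] by blast
qed

text \<open>Exactness of Hom(-, Z) at \<open>A\<close>, with outer term Hom(K[-1], Z), written as
  Hom(K, Z[1]). It is \<open>hvanish_cone_cofibre\<close> for the rotated triangle, shifted
  back.\<close>

lemma hvanish_cone_source_fibre:
  assumes cone: "is_cone A B f K \<iota> \<pi> \<kappa> \<rho>" and Z: "Z \<in> complexes"
    and v: "hvanish B Z" "hvanish K (shift_complex C 1 Z)"
  shows "hvanish A Z"
proof -
  note k = coneD[OF cone]
  obtain M \<iota>' \<pi>' \<kappa>' \<rho>' where cone': "is_cone B K \<iota> M \<iota>' \<pi>' \<kappa>' \<rho>'" using cone_ex[OF k(2)] by blast
  obtain \<theta> where \<theta>: "chmap \<theta> M (shift_complex C 1 A)" "qis \<theta>" using cone_rotate[OF cone cone'] .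
  have "hvanish (shift_complex C 1 B) (shift_complex C 1 Z)" using hvanish_shift_imp[OF v(1) _ k(5) Z] by simp
  then have "hvanish M (shift_complex C 1 Z)" using hvanish_cone_cofibre[OF cone' v(2)] by blast
  then have "hvanish (shift_complex C 1 A) (shift_complex C 1 Z)" using hvanish_qis_left[OF \<theta>] by blast
  then show ?thesis using hvanish_shift[OF k(4) shift_complexes[OF Z]] Z by simp
qed

text \<open>A chain map that is zero in the derived category is zero on cohomology: it is
  null-homotopic after a quasi-isomorphism \<open>t\<close>, and every cocycle comes from
  \<open>t\<close> locally and up to a coboundary. This turns orthogonality into information on
  elements.\<close>

lemma hvanish_bds:
  assumes "hvanish X Z" "chmap f X Z" "x \<in> cycs X i W" shows "cpt f i \<rhd> x \<in> bds Z i W"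
proof -
  note XZ = chmapD(1,2)[OF assms(2)]
  obtain V t where t: "chmap t V X" "qis t" "hpic (ccomp f t) (cnull V Z)"
    using hvanishE[OF assms(1) chmap_cident[OF XZ(1)] qis_cident[OF XZ(1)] assms(2)] .
  note V = chmapD(1)[OF t(1)]
  obtain U e v where v: "e \<in> epis U W" "v \<in> cycs V i U" "x \<lhd> e - cpt t i \<rhd> v \<in> bds X i U"
    using H_surjE[OF qisD(2)[OF t(2)] t(1) assms(3)] .
  have "cpt f i \<rhd> cpt t i \<rhd> v \<in> bds Z i U"
    using hpic_bds[OF t(3) chmap_ccomp[OF t(1) assms(2)] v(2)] V XZ by (simp add: cpt_ccomp[OF t(1) assms(2)])
  then have "cpt f i \<rhd> (x \<lhd> e - cpt t i \<rhd> v) + cpt f i \<rhd> cpt t i \<rhd> v \<in> bds Z i U"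
    using bds_add[OF XZ(2) bds_chmap[OF assms(2) v(3)]] by blast
  then have "(cpt f i \<rhd> x) \<lhd> e \<in> bds Z i U" by simp
  then show ?thesis using bds_local[OF El_chmap[OF assms(2) cycsD(1)[OF assms(3)]] v(1)] by blast
qed

lemma hvanish_self_exact: assumes "hvanish X X" "X \<in> complexes" shows "exact_at X i"
  unfolding exact_at_def
proof (intro allI subsetI)
  fix W x assume x: "x \<in> cycs X i W"
  show "x \<in> bds X i W" using hvanish_bds[OF assms(1) chmap_cident[OF assms(2)] x] cycsD(1)[OF x] by simp
qed

lemma H_exact_source: "chmap f X Y \<Longrightarrow> exact_at X i \<Longrightarrow> H_inj f i"
  by (rule H_injI) (auto dest: exact_atD)

lemma H_exact_target: assumes "chmap f X Y" "exact_at Y i" shows "H_surj f i"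
proof (rule H_surjI[OF assms(1)])
  fix W y assume y: "y \<in> cycs Y i W"
  have W: "W \<in> Obj C" using El_obj[OF cycsD(1)[OF y]] by simp
  have 0: "0 \<in> cycs X i W" using bds_cycs[OF chmapD(1)[OF assms(1)] bds_zero[OF chmapD(1)[OF assms(1)] W]] .
  have "y \<lhd> \<one> W - cpt f i \<rhd> 0 \<in> bds Y i W" using exact_atD[OF assms(2) y] cycsD(1)[OF y] by simp
  then show "\<exists>V. \<exists>e\<in>epis V W. \<exists>x\<in>cycs X i V. y \<lhd> e - cpt f i \<rhd> x \<in> bds Y i V"
    using epis_ident[OF W] 0 by blast
qed

lemma exact_transfer:
  assumes f: "chmap f X Y"
  shows "H_inj f i \<Longrightarrow> exact_at Y i \<Longrightarrow> exact_at X i" "H_surj f i \<Longrightarrow> exact_at X i \<Longrightarrow> exact_at Y i"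
proof -
  note XY = chmapD(1,2)[OF f]
  show "exact_at X i" if "H_inj f i" "exact_at Y i"
    unfolding exact_at_def using H_injD[OF that(1) f] exact_atD[OF that(2) cycs_chmap[OF f]] by blast
  show "exact_at Y i" if h: "H_surj f i" "exact_at X i"
    unfolding exact_at_def
  proof (intro allI subsetI)
    fix W y assume y: "y \<in> cycs Y i W"
    obtain V e x where x: "e \<in> epis V W" "x \<in> cycs X i V" "y \<lhd> e - cpt f i \<rhd> x \<in> bds Y i V"
      using H_surjE[OF h(1) f y] .
    have "y \<lhd> e \<in> bds Y i V" using bds_add[OF XY(2) x(3) bds_chmap[OF f exact_atD[OF h(2) x(2)]]] by simp
    then show "y \<in> bds Y i W" using bds_local[OF cycsD(1)[OF y] x(1)] by blast
  qed
qed

lemma hvanish_acyclic_source: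
  assumes "\<And>i. exact_at X i" "Z \<in> complexes" shows "hvanish X Z"
proof (rule hvanishI)
  fix W s f assume s: "chmap s W X" "qis s" "chmap f W Z"
  note W = chmapD(1)[OF s(1)]
  have e: "exact_at W i" for i using exact_transfer(1)[OF s(1) qisD(1)[OF s(2)] assms(1)] .
  obtain V t where t: "chmap t V W" "qis t" "hpic (ccomp (cident W) t) (cnull V W)"
    using acyclic_target_null[OF chmap_cident[OF W] e] .
  have "hpic t (cnull V W)" using t(3) ccomp_cident(2)[OF t(1)] by simp
  then show "\<exists>V t. chmap t V W \<and> qis t \<and> hpic (ccomp f t) (cnull V Z)"
    using hpic_null_comp[OF _ t(1) s(3)] t by blast
qed

lemma hvanish_acyclic_target: assumes "\<And>i. exact_at Z i" shows "hvanish X Z"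
proof (rule hvanishI)
  fix W s f assume "chmap s W X" "qis s" "chmap f W Z"
  then show "\<exists>V t. chmap t V W \<and> qis t \<and> hpic (ccomp f t) (cnull V Z)"
    using acyclic_target_null[OF _ assms] by metis
qed

text \<open>The zero object that \<open>stalk\<close> chooses for the degrees other than 0.\<close>

definition zobj :: 'a where "zobj = (SOME Z. zero_object C Z)"

lemma zero_zobj: "zero_object C zobj"
  unfolding zobj_def using someI_ex[OF ex_zero_object] .

lemma zobj_obj [simp]: "zobj \<in> Obj C"
  using zero_zobj by (simp add: zero_object_def)

lemma zero_object_exact:
  assumes "X \<in> complexes" "zero_object C (ob X i)" shows "exact_at X i"
  unfolding exact_at_def
proof (intro allI subsetI)
  fix W x assume x: "x \<in> cycs X i W"
  then have "x = 0" using zero_object_El[OF assms(2) cycsD(1)] by blast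
  then show "x \<in> bds X i W" using bds_zero[OF assms(1)] El_obj[OF cycsD(1)[OF x]] by simp
qed

lemma null_zero_hom: "zero_object C Z \<Longrightarrow> f \<in> hom C X Z \<Longrightarrow> f \<rhd> x = 0" "zero_object C Z \<Longrightarrow> g \<in> hom C Z X \<Longrightarrow> g \<rhd> x = 0"
proof -
  assume Z: "zero_object C Z"
  then have Zo: "Z \<in> Obj C" by (simp add: zero_object_def)
  show "f \<rhd> x = 0" if f: "f \<in> hom C X Z"
  proof -
    have "f = Null C X Z" using Z f null_hom[OF homD(4,5)[OF f]] homD(4)[OF f] unfolding zero_object_def by blast
    then show ?thesis using lact_null[OF homD(4,5)[OF f]] by simp
  qed
  show "g \<rhd> x = 0" if g: "g \<in> hom C Z X"
  proof -
    have "g = Null C Z X" using Z g null_hom[OF homD(4,5)[OF g]] homD(5)[OF g] unfolding zero_object_def by blast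
    then show ?thesis using lact_null[OF homD(4,5)[OF g]] by simp
  qed
qed

abbreviation stk :: "'a \<Rightarrow> ('a, 'b) complex_data" where "stk A \<equiv> stalk C A"

lemma ob_stalk: "ob (stk A) i = (if i = 0 then A else zobj)"
  by (simp add: stalk_def zobj_def Let_def)

lemma stalk_complex: assumes "A \<in> Obj C" shows "stk A \<in> complexes"
proof (rule complexI)
  have d: "diff (stk A) i = Null C (ob (stk A) i) (ob (stk A) (i + 1))" for i
    by (simp add: stalk_def Let_def)
  show o: "ob (stk A) i \<in> Obj C" for i using assms by (simp add: ob_stalk)
  show "diff (stk A) i \<in> hom C (ob (stk A) i) (ob (stk A) (i + 1))" for i unfolding d using null_hom o by blast
  show "diff (stk A) (i + 1) \<rhd> diff (stk A) i \<rhd> x = 0" for i x unfolding d using o by simp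
  show "\<forall>i. i < 0 \<or> 0 < i \<longrightarrow> zero_object C (ob (stk A) i)" using zero_zobj by (simp add: ob_stalk)
qed

lemma stalk_exact: "A \<in> Obj C \<Longrightarrow> i \<noteq> 0 \<Longrightarrow> exact_at (stk A) i"
  using zero_object_exact[OF stalk_complex] zero_zobj by (simp add: ob_stalk)

lemma bds_zero_prev:
  assumes "X \<in> complexes" "zero_object C (ob X (i - 1))" "x \<in> bds X i W" shows "x = 0"
proof -
  obtain V e y where y: "x \<in> El W (ob X i)" "e \<in> epis V W" "y \<in> El V (ob X (i - 1))" "x \<lhd> e = diff X (i - 1) \<rhd> y"
    using bdsE[OF assms(3)] .
  have "y = 0" using zero_object_El[OF assms(2) y(3)] .
  then show ?thesis using epis_cancel[OF y(2,1)] y(4) by simp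
qed

lemma cycs_zero_next:
  assumes "X \<in> complexes" "zero_object C (ob X (i + 1))" shows "cycs X i W = El W (ob X i)"
  using null_zero_hom(1)[OF assms(2) complexD(2)[OF assms(1)]] by (auto simp: cycs_def)

lemma cycs_stalk: "A \<in> Obj C \<Longrightarrow> cycs (stk A) 0 W = El W A"
  using cycs_zero_next[OF stalk_complex, of A 0] zero_zobj by (simp add: ob_stalk)

lemma bds_stalk: assumes "A \<in> Obj C" "x \<in> bds (stk A) 0 W" shows "x = 0"
  using bds_zero_prev[OF stalk_complex[OF assms(1)] _ assms(2)] zero_zobj by (simp add: ob_stalk)

lemma chmap_to_stalk:
  assumes X: "X \<in> complexes" and g: "g \<in> hom C (ob X 0) A"
    and z: "\<And>W x. x \<in> El W (ob X (- 1)) \<Longrightarrow> g \<rhd> diff X (- 1) \<rhd> x = 0"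
  obtains q where "chmap q X (stk A)" "\<forall>x. cpt q 0 \<rhd> x = g \<rhd> x"
proof -
  have A: "A \<in> Obj C" using homD(5)[OF g] .
  note S = stalk_complex[OF A]
  define q where "q = \<lparr>src = X, tgt = stk A, cpt = (\<lambda>i. if i = 0 then g else Null C (ob X i) (ob (stk A) i))\<rparr>"
  have "chmap q X (stk A)"
  proof (rule chmapI[OF X S])
    show h: "cpt q i \<in> hom C (ob X i) (ob (stk A) i)" for i
      using g null_hom complexD(1)[OF X] complexD(1)[OF S] by (simp add: q_def ob_stalk)
    fix i W x assume x: "x \<in> El W (ob X i)"
    have "diff (stk A) i \<rhd> y = 0" for y
      by (simp add: stalk_def Let_def) (use A in \<open>simp add: zobj_def[symmetric]\<close>)
    moreover have "cpt q (i + 1) \<rhd> diff X i \<rhd> x = 0"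
    proof (cases "i = - 1")
      case True then show ?thesis using z x by (simp add: q_def)
    next
      case False
      then have "zero_object C (ob (stk A) (i + 1))" using zero_zobj by (simp add: ob_stalk)
      then show ?thesis using null_zero_hom(1) h by blast
    qed
    ultimately show "diff (stk A) i \<rhd> cpt q i \<rhd> x = cpt q (i + 1) \<rhd> diff X i \<rhd> x" by simp
  qed (auto simp: q_def)
  then show ?thesis using that by (simp add: q_def)
qed

lemma stalk_map:
  assumes g: "g \<in> hom C A B"
  obtains q where "chmap q (stk A) (stk B)" "\<forall>x. cpt q 0 \<rhd> x = g \<rhd> x"
proof (rule chmap_to_stalk[OF stalk_complex[OF homD(4)[OF g]], of g B])
  show "g \<in> hom C (ob (stk A) 0) B" using g by (simp add: ob_stalk)
  have "zero_object C (ob (stk A) (- 1))" using zero_zobj by (simp add: ob_stalk)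
  then show "g \<rhd> diff (stk A) (- 1) \<rhd> x = 0" for x
    using null_zero_hom(2)[OF _ complexD(2)[OF stalk_complex[OF homD(4)[OF g]]]] by simp
qed (use that in blast)

lemma stalk_isomorphic:
  assumes "isomorphic C A B" shows "isomorphic (Db C) (stk A) (stk B)"
proof -
  obtain g where g: "g \<in> hom C A B" "is_iso C g" using assms by (auto simp: isomorphic_def)
  obtain q where q: "chmap q (stk A) (stk B)" "\<forall>x. cpt q 0 \<rhd> x = g \<rhd> x" using stalk_map[OF g(1)] .
  note o = homD(4,5)[OF g(1)] and me = iso_mono_epi[OF g]
  note S = chmapD(1,2)[OF q(1)]
  have "qis q"
  proof (rule qisI[OF q(1)])
    fix i
    show "H_inj q i"
    proof (cases "i = 0")
      case True
      show ?thesis unfolding True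
      proof (rule H_injI[OF q(1)])
        fix W x assume x: "x \<in> cycs (stk A) 0 W" "cpt q 0 \<rhd> x \<in> bds (stk B) 0 W"
        have xE: "x \<in> El W A" using x(1) cycs_stalk[OF o(1)] by simp
        have "g \<rhd> x = 0" using bds_stalk[OF o(2) x(2)] q(2) by simp
        then have "x = 0" using me(1) xE unfolding mono_iff[OF g(1)] by blast
        then show "x \<in> bds (stk A) 0 W" using bds_zero[OF S(1)] El_obj[OF xE] by simp
      qed
    qed (use H_exact_source[OF q(1)] stalk_exact[OF o(1)] in blast)
    show "H_surj q i"
    proof (cases "i = 0")
      case True
      show ?thesis unfolding True
      proof (rule H_surjI[OF q(1)])
        fix W y assume "y \<in> cycs (stk B) 0 W"
        then have y: "y \<in> El W B" using cycs_stalk[OF o(2)] by simp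
        obtain V e x where x: "e \<in> epis V W" "x \<in> El V A" "g \<rhd> x = y \<lhd> e" using epi_lift[OF me(2) y] .
        have "y \<lhd> e - cpt q 0 \<rhd> x \<in> bds (stk B) 0 V" using bds_zero[OF S(2)] q(2) x(3) episD(4)[OF x(1)] by simp
        then show "\<exists>V. \<exists>e\<in>epis V W. \<exists>x\<in>cycs (stk A) 0 V. y \<lhd> e - cpt q 0 \<rhd> x \<in> bds (stk B) 0 V"
          using x cycs_stalk[OF o(1)] by blast
      qed
    qed (use H_exact_target[OF q(1)] stalk_exact[OF o(2)] in blast)
  qed
  then show ?thesis unfolding Db_isomorphic_iff using chmap_cident[OF S(1)] qis_cident[OF S(1)] q(1) by blast
qed

text \<open>The monomorphism \<open>m\<close> is any subobject of the cocycles in degree \<open>n\<close> through which the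
  incoming differential factors (by \<open>j\<close>): all cocycles, the coboundaries, or a torsion part in between.\<close>

definition trunc_data :: "('a, 'b) complex_data \<Rightarrow> int \<Rightarrow> 'b \<Rightarrow> 'b \<Rightarrow> bool" where
  "trunc_data X n m j \<longleftrightarrow> X \<in> complexes \<and> m \<in> hom C (Dom C m) (ob X n) \<and> is_mono C m \<and>
     (\<forall>x. diff X n \<rhd> m \<rhd> x = 0) \<and> j \<in> hom C (ob X (n - 1)) (Dom C m) \<and> m \<cdot> j = diff X (n - 1)"

definition trunc :: "('a, 'b) complex_data \<Rightarrow> int \<Rightarrow> 'b \<Rightarrow> 'b \<Rightarrow> ('a, 'b) complex_data" where
  "trunc X n m j = \<lparr>ob = (\<lambda>i. if i < n then ob X i else if i = n then Dom C m else zobj),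
     diff = (\<lambda>i. if i < n - 1 then diff X i else if i = n - 1 then j
       else Null C (if i = n then Dom C m else zobj) zobj)\<rparr>"

definition trunc_incl :: "('a, 'b) complex_data \<Rightarrow> int \<Rightarrow> 'b \<Rightarrow> 'b \<Rightarrow> ('a, 'b) chain_map" where
  "trunc_incl X n m j = \<lparr>src = trunc X n m j, tgt = X,
     cpt = (\<lambda>i. if i < n then \<one> (ob X i) else if i = n then m else Null C zobj (ob X i))\<rparr>"

text \<open>Primitives of cocycles of degree at most n live below degree n, where the subcomplex is
  all of \<open>X\<close>. Hence the inclusion is injective on cohomology up to degree n for every
  admissible \<open>m\<close>. Surjectivity in degree n itself depends on how many cocycles
  \<open>m\<close> contains and is left to the applications.\<close>

lemma trunc_facts:
  assumes "trunc_data X n m j"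
  defines "T \<equiv> trunc X n m j" and "f \<equiv> trunc_incl X n m j"
  shows "chmap f T X" "ob T n = Dom C m" "\<And>i. i < n \<Longrightarrow> ob T i = ob X i" "\<And>i. i > n \<Longrightarrow> zero_object C (ob T i)"
    "\<And>x. cpt f n \<rhd> x = m \<rhd> x" "\<And>i. i \<le> n \<Longrightarrow> H_inj f i" "\<And>i. i < n \<Longrightarrow> H_surj f i"
    "\<And>i. i > n \<Longrightarrow> exact_at T i" "\<And>x i W. i < n \<Longrightarrow> x \<in> El W (ob X i) \<Longrightarrow> cpt f i \<rhd> x = x"
proof -
  have X: "X \<in> complexes" and m: "m \<in> hom C (Dom C m) (ob X n)" and mm: "is_mono C m"
    and dm: "\<And>x. diff X n \<rhd> m \<rhd> x = 0" and j: "j \<in> hom C (ob X (n - 1)) (Dom C m)" and mj: "m \<cdot> j = diff X (n - 1)"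
    using assms(1) by (auto simp: trunc_data_def)
  have mjx: "m \<rhd> j \<rhd> x = diff X (n - 1) \<rhd> x" for x
    using lact_comp[of j m x] mj homD[OF j] homD[OF m] by simp
  have m0: "x = 0" if "x \<in> El W (Dom C m)" "m \<rhd> x = 0" for x W using mm that unfolding mono_iff[OF m] by blast
  have P: "Dom C m \<in> Obj C" using homD(4)[OF m] .
  show obn: "ob T n = Dom C m" and obl: "\<And>i. i < n \<Longrightarrow> ob T i = ob X i" and obg: "\<And>i. i > n \<Longrightarrow> zero_object C (ob T i)"
    using zero_zobj by (auto simp: T_def trunc_def)
  have dl: "diff T i = diff X i" if "i < n - 1" for i using that by (simp add: T_def trunc_def)
  have dj: "diff T (n - 1) = j" by (simp add: T_def trunc_def)
  have fl: "cpt f i \<rhd> x = x" if "i < n" "x \<in> El W (ob X i)" for i x W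
    using that by (simp add: f_def trunc_incl_def)
  have fn: "cpt f n \<rhd> x = m \<rhd> x" for x by (simp add: f_def trunc_incl_def)
  show "\<And>x. cpt f n \<rhd> x = m \<rhd> x" by (rule fn)
  show "\<And>x i W. i < n \<Longrightarrow> x \<in> El W (ob X i) \<Longrightarrow> cpt f i \<rhd> x = x" by (rule fl)
  have To: "ob T i \<in> Obj C" for i
    using complexD(1)[OF X] P by (simp add: T_def trunc_def)
  have Td: "diff T i \<in> hom C (ob T i) (ob T (i + 1))" for i
  proof -
    consider "i < n - 1" | "i = n - 1" | "i \<ge> n" by linarith
    then show ?thesis
    proof cases
      case 1 then show ?thesis using complexD(2)[OF X, of i] by (simp add: T_def trunc_def)
    next
      case 2 then show ?thesis using j by (simp add: T_def trunc_def)
    next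
      case 3 then show ?thesis using null_hom P by (simp add: T_def trunc_def)
    qed
  qed
  have fh: "cpt f i \<in> hom C (ob T i) (ob X i)" for i
    using ident_hom null_hom complexD(1)[OF X] m by (simp add: f_def trunc_incl_def T_def trunc_def)
  have com: "diff X i \<rhd> cpt f i \<rhd> x = cpt f (i + 1) \<rhd> diff T i \<rhd> x" if x: "x \<in> El W (ob T i)" for i x W
  proof -
    consider "i < n - 1" | "i = n - 1" | "i = n" | "i > n" by linarith
    then show ?thesis
    proof cases
      case 1
      then have xX: "x \<in> El W (ob X i)" using x obl by simp
      have "diff X i \<rhd> x \<in> El W (ob X (i + 1))" using El_lact[OF complexD(2)[OF X] xX] .
      then show ?thesis using 1 fl[of "i + 1"] fl[OF _ xX] dl[OF 1] by simp
    next
      case 2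
      then have xX: "x \<in> El W (ob X i)" using x obl by simp
      show ?thesis using 2 fl[OF _ xX] fn dj mjx by simp
    next
      case 3
      have "cpt f (i + 1) \<rhd> y = 0" for y
        using null_zero_hom(2)[OF obg fh] 3 by simp
      then show ?thesis using 3 fn dm by simp
    next
      case 4
      then have "cpt f i \<rhd> y = 0" "cpt f (i + 1) \<rhd> y = 0" for y
        using null_zero_hom(2)[OF obg fh] by simp_all
      then show ?thesis by simp
    qed
  qed
  have fl0: "x = 0" if "i \<le> n" "x \<in> El W (ob T i)" "cpt f i \<rhd> x = 0" for i x W
    using that fl[of i x W] fn m0[of x W] obl[of i] obn by (cases "i = n") auto
  have T: "T \<in> complexes"
  proof -
    obtain a b where ab: "\<forall>i. i < a \<or> b < i \<longrightarrow> zero_object C (ob X i)" using complex_bounded[OF X] .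
    show ?thesis
    proof (rule complexI[OF To Td])
      fix i W x assume x: "x \<in> El W (ob T i)"
      have e1: "diff T i \<rhd> x \<in> El W (ob T (i + 1))" using El_lact[OF Td x] .
      have e2: "diff T (i + 1) \<rhd> diff T i \<rhd> x \<in> El W (ob T (i + 1 + 1))" using El_lact[OF Td e1] .
      \<comment> \<open>Up to degree n the inclusion is mono, so the square of the differential can
        be tested in \<open>X\<close>; above n the objects are zero.\<close>
      show "diff T (i + 1) \<rhd> diff T i \<rhd> x = 0"
      proof (cases "i + 1 + 1 \<le> n")
        case True
        have "cpt f (i + 1 + 1) \<rhd> diff T (i + 1) \<rhd> diff T i \<rhd> x = diff X (i + 1) \<rhd> diff X i \<rhd> cpt f i \<rhd> x"
          using com[OF e1] com[OF x] by simp
        then have "cpt f (i + 1 + 1) \<rhd> diff T (i + 1) \<rhd> diff T i \<rhd> x = 0" using complexD(3)[OF X] by simp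
        then show ?thesis using fl0[OF True e2] by blast
      next
        case False
        then show ?thesis using zero_object_El[OF obg e2] by simp
      qed
    next
      show "\<forall>i. i < min a n \<or> n < i \<longrightarrow> zero_object C (ob T i)" using obg obl ab by auto
    qed
  qed
  show f: "chmap f T X"
    by (rule chmapI[OF T X _ _ fh com]) (auto simp: f_def T_def trunc_incl_def)
  show "H_inj f i" if "i \<le> n" for i
  proof (rule H_injI[OF f])
    fix W x assume x: "x \<in> cycs T i W" "cpt f i \<rhd> x \<in> bds X i W"
    obtain V e y where y: "e \<in> epis V W" "y \<in> El V (ob X (i - 1))" "(cpt f i \<rhd> x) \<lhd> e = diff X (i - 1) \<rhd> y"
      using bdsE[OF x(2)] by metis
    have yT: "y \<in> El V (ob T (i - 1))" using y(2) obl that by simp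
    have xe: "x \<lhd> e \<in> El V (ob T i)" using El_ract[OF cycsD(1)[OF x(1)] epis_hom[OF y(1)]] .
    have "cpt f i \<rhd> (x \<lhd> e - diff T (i - 1) \<rhd> y) = 0"
      using y(3) com[OF yT] fl[OF _ y(2)] that by simp
    then have "x \<lhd> e = diff T (i - 1) \<rhd> y" using fl0[OF that El_diff[OF xe El_diff_prev[OF T yT]]] by simp
    then show "x \<in> bds T i W" using bdsI[OF cycsD(1)[OF x(1)] y(1) yT] by blast
  qed
  show "H_surj f i" if "i < n" for i
  proof (rule H_surjI[OF f])
    fix W y assume y: "y \<in> cycs X i W"
    have W: "W \<in> Obj C" using El_obj[OF cycsD(1)[OF y]] by simp
    have yT: "y \<in> El W (ob T i)" using cycsD(1)[OF y] obl[OF that] by simp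
    have "cpt f (i + 1) \<rhd> diff T i \<rhd> y = 0" using com[OF yT] fl[OF that cycsD(1)[OF y]] cycsD(2)[OF y] by simp
    then have "diff T i \<rhd> y = 0" using fl0[OF _ El_lact[OF Td yT]] that by simp
    then have "y \<in> cycs T i W" using cycsI[OF yT] by blast
    moreover have "y \<lhd> \<one> W - cpt f i \<rhd> y \<in> bds X i W"
      using fl[OF that cycsD(1)[OF y]] cycsD(1)[OF y] bds_zero[OF X W] by simp
    ultimately show "\<exists>V. \<exists>e\<in>epis V W. \<exists>x\<in>cycs T i V. y \<lhd> e - cpt f i \<rhd> x \<in> bds X i V"
      using epis_ident[OF W] by blast
  qed
  show "exact_at T i" if "i > n" for i using zero_object_exact[OF T obg[OF that]] .
qed

text \<open>Below degree n take \<open>g\<close> itself; in degree n the lift of the identity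
  element of X^n yields the arrow. The inclusion is mono up to degree n and the truncation is zero
  above, so compatibility with the differentials is automatic.\<close>

lemma trunc_factor:
  assumes "trunc_data Z n m j" "chmap g X Z" "\<And>i. i > n \<Longrightarrow> zero_object C (ob X i)"
    "\<And>W x. x \<in> El W (ob X n) \<Longrightarrow> \<exists>z\<in>El W (Dom C m). m \<rhd> z = cpt g n \<rhd> x"
  obtains g' where "chmap g' X (trunc Z n m j)" "ccomp (trunc_incl Z n m j) g' = g"
proof -
  note t = trunc_facts[OF assms(1)]
  let ?T = "trunc Z n m j" and ?f = "trunc_incl Z n m j"
  note X = chmapD(1)[OF assms(2)] and gh = chmapD(3)[OF assms(2)] and T = chmapD(1)[OF t(1)]
  have Xn: "ob X n \<in> Obj C" using complexD(1)[OF X] .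
  obtain z where z: "z \<in> El (ob X n) (Dom C m)" "m \<rhd> z = cpt g n \<rhd> emb (\<one> (ob X n))"
    using assms(4)[OF emb_El[OF ident_hom[OF Xn]]] by blast
  obtain u where u: "u \<in> hom C (ob X n) (Dom C m)" "z = emb u" using El_obtain[OF z(1)] .
  have m: "m \<in> hom C (Dom C m) (ob Z n)" and mm: "is_mono C m" using assms(1) by (auto simp: trunc_data_def)
  have "m \<cdot> u = cpt g n"
    using emb_inj[OF comp_hom[OF u(1) m] gh] z u emb_comp_lact[OF u(1) m] emb_ident_lact[OF gh] by simp
  then have mu: "m \<rhd> u \<rhd> x = cpt g n \<rhd> x" for x
    using lact_comp[of u m x] homD[OF u(1)] homD[OF m] by simp
  define g' where "g' = \<lparr>src = X, tgt = ?T, cpt = (\<lambda>i. if i < n then cpt g i else if i = n then u else Null C (ob X i) (ob ?T i))\<rparr>"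
  have g'h: "cpt g' i \<in> hom C (ob X i) (ob ?T i)" for i
  proof -
    consider "i < n" | "i = n" | "i > n" by linarith
    then show ?thesis
    proof cases
      case 1 then show ?thesis using gh[of i] t(3)[OF 1] by (simp add: g'_def)
    next
      case 2 then show ?thesis using u(1) t(2) by (simp add: g'_def)
    next
      case 3 then show ?thesis using null_hom complexD(1)[OF X] complexD(1)[OF T] by (simp add: g'_def)
    qed
  qed
  have fg: "cpt ?f i \<rhd> cpt g' i \<rhd> x = cpt g i \<rhd> x" if x: "x \<in> El W (ob X i)" for i x W
  proof -
    consider "i < n" | "i = n" | "i > n" by linarith
    then show ?thesis
    proof cases
      case 1 then show ?thesis using t(9)[OF 1 El_chmap[OF assms(2) x]] by (simp add: g'_def)
    next
      case 2 then show ?thesis using t(5) mu by (simp add: g'_def)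
    next
      case 3 then have "x = 0" using zero_object_El[OF assms(3) x] by simp
      then show ?thesis by simp
    qed
  qed
  have f0: "x = 0" if x: "i \<le> n" "x \<in> El W (ob ?T i)" "cpt ?f i \<rhd> x = 0" for i x W
  proof (cases "i = n")
    case True then show ?thesis using x t(2,5) mm unfolding mono_iff[OF m] by metis
  next
    case False then show ?thesis using x t(3)[of i] t(9)[of i x W] by simp
  qed
  have c: "chmap g' X ?T"
  proof (rule chmapI[OF X T _ _ g'h])
    fix i W x assume x: "x \<in> El W (ob X i)"
    have dx: "diff X i \<rhd> x \<in> El W (ob X (i + 1))" using El_lact[OF complexD(2)[OF X] x] .
    have e: "diff ?T i \<rhd> cpt g' i \<rhd> x - cpt g' (i + 1) \<rhd> diff X i \<rhd> x \<in> El W (ob ?T (i + 1))"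
      using El_diff[OF El_lact[OF complexD(2)[OF T] El_lact[OF g'h x]] El_lact[OF g'h dx]] .
    have "cpt ?f (i + 1) \<rhd> (diff ?T i \<rhd> cpt g' i \<rhd> x - cpt g' (i + 1) \<rhd> diff X i \<rhd> x) = 0"
      unfolding lact_diff chmap_commute[OF t(1), symmetric] fg[OF x] fg[OF dx] using chmap_commute[OF assms(2)] by simp
    then have "diff ?T i \<rhd> cpt g' i \<rhd> x - cpt g' (i + 1) \<rhd> diff X i \<rhd> x = 0"
      using f0[OF _ e] zero_object_El[OF t(4) e] by (cases "i + 1 \<le> n") auto
    then show "diff ?T i \<rhd> cpt g' i \<rhd> x = cpt g' (i + 1) \<rhd> diff X i \<rhd> x" by simp
  qed (auto simp: g'_def)
  have "ccomp ?f g' = g"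
    using chmap_eqI[OF chmap_ccomp[OF c t(1)] assms(2)] fg cpt_ccomp[OF c t(1)] by simp
  then show ?thesis using that c by blast
qed

lemma mono_ofI: "m \<in> hom C A B \<Longrightarrow> (\<And>x W. x \<in> El W A \<Longrightarrow> m \<rhd> x = 0 \<Longrightarrow> x = 0) \<Longrightarrow> is_mono C m"
  using mono_iff by blast

lemma cohom_trunc_data:
  assumes "X \<in> complexes" "cohom_data C X n (k, p)"
  obtains j where "trunc_data X n k j" "\<forall>x. p \<rhd> j \<rhd> x = 0"
proof -
  note a = cohom_dataD[OF assms]
  obtain j where j: "j \<in> hom C (ob X (n - 1)) (Dom C k)" "k \<cdot> j = diff X (n - 1)" "is_cokernel C p j"
    and k: "is_kernel C k (diff X n)" using assms(2) unfolding cohom_data_def by auto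
  have "diff X n \<rhd> k \<rhd> x = 0" for x using kernelD(2)[OF k complexD(2)[OF assms(1)]] .
  moreover have "is_mono C k" using a(5) by (rule mono_ofI[OF a(1)])
  ultimately have "trunc_data X n k j" unfolding trunc_data_def using assms(1) a(1) j(1,2) by blast
  then show ?thesis using that cokernelD(2)[OF j(3,1)] by blast
qed

text \<open>Here \<open>m\<close> is the kernel of the differential in degree n, the usual
  truncation. For n = 0 the quotient map from the cocycles to H^0 kills the coboundaries and so is a
  chain map to the stalk: the truncation is the apex of a span from the complex to its zeroth
  cohomology.\<close>

lemma truncation_ex:
  assumes "X \<in> complexes"
  obtains T f where "chmap f T X" "\<forall>i>n. zero_object C (ob T i)" "\<forall>i>n. exact_at T i"
    "\<forall>i\<le>n. H_inj f i \<and> H_surj f i"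
    "n = 0 \<longrightarrow> (\<exists>q. chmap q T (stk (cohom C 0 X)) \<and> H_inj q 0 \<and> H_surj q 0)"
proof -
  obtain k p where kp: "cohom_choice C X n = (k, p)" by force
  have d: "cohom_data C X n (k, p)" using cohom_data_choice[OF assms, of n] kp by simp
  note a = cohom_dataD[OF assms d]
  obtain j where td: "trunc_data X n k j" and pj: "\<forall>x. p \<rhd> j \<rhd> x = 0" using cohom_trunc_data[OF assms d] by blast
  note t = trunc_facts[OF td]
  let ?T = "trunc X n k j" and ?f = "trunc_incl X n k j"
  note T = chmapD(1)[OF t(1)]
  have cT: "cycs ?T n W = El W (Dom C k)" for W using cycs_zero_next[OF T] t(4) t(2) by simp
  have s: "H_surj ?f n"
  proof (rule H_surjI[OF t(1)])
    fix W y assume y: "y \<in> cycs X n W"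
    have W: "W \<in> Obj C" using El_obj[OF cycsD(1)[OF y]] by simp
    obtain z where z: "z \<in> El W (Dom C k)" "k \<rhd> z = y" using a(4)[OF y] by blast
    have "y \<lhd> \<one> W - cpt ?f n \<rhd> z \<in> bds X n W" using t(5) z cycsD(1)[OF y] bds_zero[OF assms W] by simp
    then show "\<exists>V. \<exists>e\<in>epis V W. \<exists>x\<in>cycs ?T n V. y \<lhd> e - cpt ?f n \<rhd> x \<in> bds X n V"
      using epis_ident[OF W] z(1) cT by blast
  qed
  have st: "\<exists>q. chmap q ?T (stk (cohom C 0 X)) \<and> H_inj q 0 \<and> H_surj q 0" if n: "n = 0"
  proof -
    have co: "cohom C 0 X = Cod C p" using kp n by (simp add: cohom_def)
    have Q: "Cod C p \<in> Obj C" using episD(5)[OF a(2)] .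
    have ph: "p \<in> hom C (ob ?T 0) (Cod C p)" using epis_hom[OF a(2)] t(2) n by simp
    have dj: "diff ?T (- 1) = j" by (simp add: trunc_def n)
    obtain q where q: "chmap q ?T (stk (Cod C p))" "\<forall>x. cpt q 0 \<rhd> x = p \<rhd> x"
      using chmap_to_stalk[OF T ph] pj dj by auto
    have "H_inj q 0"
    proof (rule H_injI[OF q(1)])
      fix W x assume x: "x \<in> cycs ?T 0 W" "cpt q 0 \<rhd> x \<in> bds (stk (Cod C p)) 0 W"
      have "p \<rhd> x = 0" using bds_stalk[OF Q x(2)] q(2) by simp
      then have "k \<rhd> x \<in> bds X 0 W" using a(6) x(1) cT n by simp
      then show "x \<in> bds ?T 0 W" using H_injD[OF t(6) t(1), of 0 x W] x(1) t(5) n by simp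
    qed
    moreover have "H_surj q 0"
    proof (rule H_surjI[OF q(1)])
      fix W y assume "y \<in> cycs (stk (Cod C p)) 0 W"
      then have y: "y \<in> El W (Cod C p)" using cycs_stalk[OF Q] by simp
      obtain V e x where x: "e \<in> epis V W" "x \<in> El V (Dom C k)" "p \<rhd> x = y \<lhd> e" using epi_lift[OF a(2) y] .
      have "y \<lhd> e - cpt q 0 \<rhd> x \<in> bds (stk (Cod C p)) 0 V"
        using bds_zero[OF stalk_complex[OF Q]] q(2) x(3) episD(4)[OF x(1)] by simp
      then show "\<exists>V. \<exists>e\<in>epis V W. \<exists>x\<in>cycs ?T 0 V. y \<lhd> e - cpt q 0 \<rhd> x \<in> bds (stk (Cod C p)) 0 V"
        using x cT n by blast
    qed
    ultimately show ?thesis using q(1) co by auto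
  qed
  have "H_surj ?f i" if "i \<le> n" for i using that s t(7) by (cases "i = n") auto
  then show ?thesis using that[OF t(1)] t(4,6,8) st by blast
qed

end

section \<open>Cohomology classes and short exact sequences\<close>

context abelian_category
begin

text \<open>The class of a cocycle in the chosen cohomology object: lift along \<open>k\<close>,
  then project by \<open>p\<close>. The lift along a monomorphism is unique, so the choice operator
  is harmless.\<close>

definition hcls :: "('a, 'b) complex_data \<Rightarrow> int \<Rightarrow> 'a \<Rightarrow> ('a, 'b, 'c, 'd) gelt \<Rightarrow> ('a, 'b, 'c, 'd) gelt" where
  "hcls X i W x = snd (cohom_choice C X i) \<rhd>
     (SOME z. z \<in> El W (Dom C (fst (cohom_choice C X i))) \<and> fst (cohom_choice C X i) \<rhd> z = x)"

lemma cohom_choiceE: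
  assumes "X \<in> complexes"
  obtains k p where "cohom_choice C X i = (k, p)" "cohom_data C X i (k, p)" "cohom C i X = Cod C p"
    "\<forall>W. \<forall>z\<in>El W (Dom C k). hcls X i W (k \<rhd> z) = p \<rhd> z"
proof -
  obtain k p where kp: "cohom_choice C X i = (k, p)" by force
  have d: "cohom_data C X i (k, p)" using cohom_data_choice[OF assms, of i] kp by simp
  note a = cohom_dataD[OF assms d]
  have "hcls X i W (k \<rhd> z) = p \<rhd> z" if z: "z \<in> El W (Dom C k)" for W z
  proof -
    let ?z = "SOME z'. z' \<in> El W (Dom C k) \<and> k \<rhd> z' = k \<rhd> z"
    have s: "?z \<in> El W (Dom C k) \<and> k \<rhd> ?z = k \<rhd> z" by (rule someI[of _ z]) (use z in simp)
    then have "k \<rhd> (?z - z) = 0" by simp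
    then have "?z - z = 0" using a(5) El_diff s z by blast
    then show ?thesis by (simp add: hcls_def kp)
  qed
  then show ?thesis using that kp d by (simp add: cohom_def)
qed

lemma hcls_facts:
  assumes "X \<in> complexes" "x \<in> cycs X i W"
  shows "hcls X i W x \<in> El W (cohom C i X)" "hcls X i W x = 0 \<longleftrightarrow> x \<in> bds X i W"
    "y \<in> cycs X i W \<Longrightarrow> hcls X i W (x - y) = hcls X i W x - hcls X i W y"
    "e \<in> hom C V W \<Longrightarrow> hcls X i V (x \<lhd> e) = hcls X i W x \<lhd> e"
proof -
  obtain k p where kp: "cohom_data C X i (k, p)" "cohom C i X = Cod C p"
    and h: "\<forall>W. \<forall>z\<in>El W (Dom C k). hcls X i W (k \<rhd> z) = p \<rhd> z" using cohom_choiceE[OF assms(1)] by metis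
  note a = cohom_dataD[OF assms(1) kp(1)]
  obtain z where z: "z \<in> El W (Dom C k)" "k \<rhd> z = x" using a(4)[OF assms(2)] by blast
  have hx: "hcls X i W x = p \<rhd> z" using h z by blast
  show "hcls X i W x \<in> El W (cohom C i X)" unfolding hx kp(2) using El_lact[OF epis_hom[OF a(2)] z(1)] .
  show "hcls X i W x = 0 \<longleftrightarrow> x \<in> bds X i W" unfolding hx using a(6)[OF z(1)] z(2) by simp
  show "hcls X i W (x - y) = hcls X i W x - hcls X i W y" if y: "y \<in> cycs X i W"
  proof -
    obtain z' where z': "z' \<in> El W (Dom C k)" "k \<rhd> z' = y" using a(4)[OF y] by blast
    have "hcls X i W (k \<rhd> (z - z')) = p \<rhd> (z - z')" using h El_diff[OF z(1) z'(1)] by blast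
    moreover have "hcls X i W y = p \<rhd> z'" using h z' by blast
    ultimately show ?thesis using hx z'(2) z(2) by simp
  qed
  show "hcls X i V (x \<lhd> e) = hcls X i W x \<lhd> e" if e: "e \<in> hom C V W"
  proof -
    have "hcls X i V (k \<rhd> (z \<lhd> e)) = p \<rhd> (z \<lhd> e)" using h El_ract[OF z(1) e] by blast
    then show ?thesis using z(2) hx lact_ract[of k z e] lact_ract[of p z e] by simp
  qed
qed

lemma hcls_lift:
  assumes "X \<in> complexes" "y \<in> El W (cohom C i X)"
  obtains V e x where "e \<in> epis V W" "x \<in> cycs X i V" "hcls X i V x = y \<lhd> e"
proof -
  obtain k p where kp: "cohom_data C X i (k, p)" "cohom C i X = Cod C p"
    and h: "\<forall>W. \<forall>z\<in>El W (Dom C k). hcls X i W (k \<rhd> z) = p \<rhd> z" using cohom_choiceE[OF assms(1)] by metis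
  note a = cohom_dataD[OF assms(1) kp(1)]
  obtain V e z where z: "e \<in> epis V W" "z \<in> El V (Dom C k)" "p \<rhd> z = y \<lhd> e" using epi_lift[OF a(2)] assms(2) kp(2) by metis
  then show ?thesis using that[OF z(1) a(3)[OF z(2)]] h by simp
qed

lemma cohom_map_facts:
  assumes "chmap f X Y"
  shows "cohom_map C i f \<in> hom C (cohom C i X) (cohom C i Y)"
    "x \<in> cycs X i W \<Longrightarrow> cohom_map C i f \<rhd> hcls X i W x = hcls Y i W (cpt f i \<rhd> x)"
proof -
  note XY = chmapD(1,2)[OF assms]
  obtain k p where kp: "cohom_choice C X i = (k, p)" "cohom_data C X i (k, p)" "cohom C i X = Cod C p"
    and h: "\<forall>W. \<forall>z\<in>El W (Dom C k). hcls X i W (k \<rhd> z) = p \<rhd> z" using cohom_choiceE[OF XY(1)] .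
  obtain k' p' where kp': "cohom_choice C Y i = (k', p')" "cohom_data C Y i (k', p')" "cohom C i Y = Cod C p'"
    and h': "\<forall>W. \<forall>z\<in>El W (Dom C k'). hcls Y i W (k' \<rhd> z) = p' \<rhd> z" using cohom_choiceE[OF XY(2)] .
  note a = cohom_dataD[OF XY(1) kp(2)] and b = cohom_dataD[OF XY(2) kp'(2)]
  have "cohom_map C i f = (THE h. h \<in> hom C (Cod C p) (Cod C p') \<and>
      (\<exists>u\<in>hom C (Dom C k) (Dom C k'). k' \<cdot> u = cpt f i \<cdot> k \<and> h \<cdot> p = p' \<cdot> u))"
    using chmap_ends[OF assms] by (simp add: cohom_map_def kp(1,3) kp'(1,3))
  then have m: "cohom_map C i f \<in> hom C (Cod C p) (Cod C p')"
    and "\<exists>u\<in>hom C (Dom C k) (Dom C k'). k' \<cdot> u = cpt f i \<cdot> k \<and> cohom_map C i f \<cdot> p = p' \<cdot> u"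
    using theI'[OF cohom_data_map(1)[OF assms kp(2) kp'(2)]] by simp_all
  then obtain u where u: "u \<in> hom C (Dom C k) (Dom C k')" "k' \<cdot> u = cpt f i \<cdot> k" "cohom_map C i f \<cdot> p = p' \<cdot> u" by blast
  show "cohom_map C i f \<in> hom C (cohom C i X) (cohom C i Y)" using m kp(3) kp'(3) by simp
  assume "x \<in> cycs X i W"
  then obtain z where z: "z \<in> El W (Dom C k)" "k \<rhd> z = x" using a(4) by blast
  have 1: "k' \<rhd> u \<rhd> z = cpt f i \<rhd> x"
    using lact_comp[of u k' z] lact_comp[of k "cpt f i" z] u(2) z(2) homD[OF u(1)] homD[OF b(1)] homD[OF a(1)] assms by simp
  have "cohom_map C i f \<rhd> p \<rhd> z = p' \<rhd> u \<rhd> z"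
    using lact_comp[of p "cohom_map C i f" z] lact_comp[of u p' z] u(3) homD[OF m] episD[OF a(2)] episD[OF b(2)] homD[OF u(1)] by simp
  then show "cohom_map C i f \<rhd> hcls X i W x = hcls Y i W (cpt f i \<rhd> x)"
    using h z h' El_lact[OF u(1) z(1)] 1 by metis
qed

text \<open>The part H^0(A) -> H^0(B) -> H^0(K) of the long exact sequence. The neighbouring terms
  H^(-1)(K) and H^1(A) vanish by assumption, which makes it short exact. In this way a triangle of
  complexes becomes a sequence in the abelian category.\<close>

lemma cone_cohom_exact:
  assumes cone: "is_cone A B f K \<iota> \<pi> \<kappa> \<rho>" and ex: "exact_at A 1" "exact_at K (- 1)"
  defines "h1 \<equiv> cohom_map C 0 f" and "h2 \<equiv> cohom_map C 0 \<iota>"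
  shows "h1 \<in> hom C (cohom C 0 A) (cohom C 0 B)" "h2 \<in> hom C (cohom C 0 B) (cohom C 0 K)"
    "is_mono C h1" "h2 \<in> epis (cohom C 0 B) (cohom C 0 K)"
    "y \<in> El W (cohom C 0 A) \<Longrightarrow> h2 \<rhd> h1 \<rhd> y = 0"
    "y \<in> El W (cohom C 0 B) \<Longrightarrow> h2 \<rhd> y = 0 \<Longrightarrow>
       \<exists>V e x. e \<in> epis V W \<and> x \<in> El V (cohom C 0 A) \<and> h1 \<rhd> x = y \<lhd> e"
proof -
  note k = coneD[OF cone] and kp = coneD_prev[OF cone, where i = 0]
  note m1 = cohom_map_facts[OF k(1), where i = 0, folded h1_def]
  note m2 = cohom_map_facts[OF k(2), where i = 0, folded h2_def]
  show h1: "h1 \<in> hom C (cohom C 0 A) (cohom C 0 B)" and h2: "h2 \<in> hom C (cohom C 0 B) (cohom C 0 K)" using m1(1) m2(1) .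
  have inj: "H_inj f 0" using cone_exact_iff[OF cone, of "- 1"] ex(2) by simp
  show "is_mono C h1"
  proof (rule mono_ofI[OF h1])
    fix y W assume y: "y \<in> El W (cohom C 0 A)" "h1 \<rhd> y = 0"
    obtain V e a where a: "e \<in> epis V W" "a \<in> cycs A 0 V" "hcls A 0 V a = y \<lhd> e" using hcls_lift[OF k(4) y(1)] .
    have "hcls B 0 V (cpt f 0 \<rhd> a) = (h1 \<rhd> y) \<lhd> e" using m1(2)[OF a(2)] a(3) by simp
    then have "cpt f 0 \<rhd> a \<in> bds B 0 V" using hcls_facts(2)[OF k(5) cycs_chmap[OF k(1) a(2)]] y(2) by simp
    then have "a \<in> bds A 0 V" using H_injD[OF inj k(1) a(2)] by blast
    then show "y = 0" using hcls_facts(2)[OF k(4) a(2)] a(3) epis_cancel[OF a(1) y(1)] by simp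
  qed
  show "h2 \<in> epis (cohom C 0 B) (cohom C 0 K)"
  proof (rule episI_lift[OF h2])
    fix y W assume y: "y \<in> El W (cohom C 0 K)"
    obtain V e c where c: "e \<in> epis V W" "c \<in> cycs K 0 V" "hcls K 0 V c = y \<lhd> e" using hcls_lift[OF k(6) y] .
    have "cpt \<pi> 0 \<rhd> c \<in> bds A 1 V" using exact_atD[OF ex(1)] cone_decompose(1)[OF cone c(2)] by simp
    then obtain U e' a where a: "e' \<in> epis U V" "a \<in> El U (ob A 0)" "(cpt \<pi> 0 \<rhd> c) \<lhd> e' = diff A 0 \<rhd> a"
      using bdsE[of "cpt \<pi> 0 \<rhd> c" A 1 V] by simp metis
    have ka: "\<kappa> (- 1) \<rhd> a \<in> El U (ob K (0 - 1))" using El_lact[OF kp(2) a(2)] by simp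
    \<comment> \<open>\<pi> c is a coboundary because H^1(A) = 0. Correction by the coboundary of
      \<kappa> a leaves a cocycle with the same class that comes from \<open>B\<close>.\<close>
    define c' where "c' = c \<lhd> e' + diff K (0 - 1) \<rhd> \<kappa> (- 1) \<rhd> a"
    have c1: "c \<lhd> e' \<in> cycs K 0 U" using cycs_ract[OF c(2) epis_hom[OF a(1)]] .
    have c': "c' \<in> cycs K 0 U" unfolding c'_def using cycs_add[OF c1 cycs_boundary[OF k(6) ka]] .
    have "cpt \<pi> 0 \<rhd> c' = 0" unfolding c'_def using a(3) kp(3)[OF a(2)] kp(5)[where c = "\<kappa> (- 1) \<rhd> a"] by simp
    note p0 = cone_cycle_pi_zero[OF cone c' this]
    have "c \<lhd> e' - cpt \<iota> 0 \<rhd> \<rho> 0 \<rhd> c' \<in> bds K 0 U"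
      unfolding p0(1) using bds_uminus[OF bds_boundary[OF k(6) ka]] by (simp add: c'_def)
    then have "hcls K 0 U (c \<lhd> e') = hcls K 0 U (cpt \<iota> 0 \<rhd> \<rho> 0 \<rhd> c')"
      using hcls_facts(2)[OF k(6) cycs_diff[OF c1 cycs_chmap[OF k(2) p0(2)]]]
        hcls_facts(3)[OF k(6) c1 cycs_chmap[OF k(2) p0(2)]] by simp
    then have "h2 \<rhd> hcls B 0 U (\<rho> 0 \<rhd> c') = y \<lhd> (e \<cdot> e')"
      using m2(2)[OF p0(2)] hcls_facts(4)[OF k(6) c(2) epis_hom[OF a(1)]] c(1,3) a(1) by simp
    then show "\<exists>V e x. e \<in> epis V W \<and> x \<in> El V (cohom C 0 B) \<and> h2 \<rhd> x = y \<lhd> e"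
      using epis_comp[OF c(1) a(1)] hcls_facts(1)[OF k(5) p0(2)] by blast
  qed
  show "h2 \<rhd> h1 \<rhd> y = 0" if y: "y \<in> El W (cohom C 0 A)"
  proof -
    obtain V e a where a: "e \<in> epis V W" "a \<in> cycs A 0 V" "hcls A 0 V a = y \<lhd> e" using hcls_lift[OF k(4) y(1)] .
    note aE = cycsD[OF a(2)]
    have "cpt \<iota> 0 \<rhd> cpt f 0 \<rhd> a \<in> bds K 0 V"
      using bds_boundary[OF k(6) El_lact[OF kp(2) aE(1)]] kp(6)[OF aE(1)] aE(2) by simp
    then have "hcls K 0 V (cpt \<iota> 0 \<rhd> cpt f 0 \<rhd> a) = 0"
      using hcls_facts(2)[OF k(6) cycs_chmap[OF k(2) cycs_chmap[OF k(1) a(2)]]] by simp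
    then have "(h2 \<rhd> h1 \<rhd> y) \<lhd> e = 0"
      using m2(2)[OF cycs_chmap[OF k(1) a(2)]] m1(2)[OF a(2)] a(3) by simp
    then show ?thesis using epis_cancel[OF a(1) El_lact[OF h2 El_lact[OF h1 y]]] by blast
  qed
  show "\<exists>V e x. e \<in> epis V W \<and> x \<in> El V (cohom C 0 A) \<and> h1 \<rhd> x = y \<lhd> e"
    if y: "y \<in> El W (cohom C 0 B)" "h2 \<rhd> y = 0"
  proof -
    obtain V e b where b: "e \<in> epis V W" "b \<in> cycs B 0 V" "hcls B 0 V b = y \<lhd> e" using hcls_lift[OF k(5) y(1)] .
    have "hcls K 0 V (cpt \<iota> 0 \<rhd> b) = (h2 \<rhd> y) \<lhd> e" using m2(2)[OF b(2)] b(3) by simp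
    then have "cpt \<iota> 0 \<rhd> b \<in> bds K 0 V" using hcls_facts(2)[OF k(6) cycs_chmap[OF k(2) b(2)]] y(2) by simp
    then obtain U e' c where c: "e' \<in> epis U V" "c \<in> El U (ob K (0 - 1))" "(cpt \<iota> 0 \<rhd> b) \<lhd> e' = diff K (0 - 1) \<rhd> c"
      using bdsE by metis
    have be: "b \<lhd> e' \<in> cycs B 0 U" using cycs_ract[OF b(2) epis_hom[OF c(1)]] .
    have eq: "cpt \<iota> 0 \<rhd> (b \<lhd> e') = diff K (0 - 1) \<rhd> c" using c(3) by simp
    define a where "a = cpt \<pi> (0 - 1) \<rhd> c"
    have "diff A 0 \<rhd> a = 0"
      using arg_cong[OF eq, of "\<lambda>z. cpt \<pi> 0 \<rhd> z"] k(14) kp(5)[of c] by (simp add: a_def)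
    then have a: "a \<in> cycs A 0 U" using cycsI[OF El_lact[OF kp(1) c(2), folded a_def]] by blast
    have "b \<lhd> e' = cpt f 0 \<rhd> a + diff B (0 - 1) \<rhd> \<rho> (0 - 1) \<rhd> c"
      using arg_cong[OF eq, of "\<lambda>z. \<rho> 0 \<rhd> z"] k(12)[OF cycsD(1)[OF be]] kp(4)[OF c(2)] by (simp add: a_def)
    then have "b \<lhd> e' - cpt f 0 \<rhd> a \<in> bds B 0 U" using bds_boundary[OF k(5) El_lact[OF k(10) c(2)]] by simp
    then have "hcls B 0 U (b \<lhd> e') = hcls B 0 U (cpt f 0 \<rhd> a)"
      using hcls_facts(2)[OF k(5) cycs_diff[OF be cycs_chmap[OF k(1) a]]]
        hcls_facts(3)[OF k(5) be cycs_chmap[OF k(1) a]] by simp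
    then have "h1 \<rhd> hcls A 0 U a = y \<lhd> (e \<cdot> e')"
      using m1(2)[OF a] hcls_facts(4)[OF k(5) b(2) epis_hom[OF c(1)]] b(1,3) c(1) by simp
    then show ?thesis using epis_comp[OF b(1) c(1)] hcls_facts(1)[OF k(4) a] by blast
  qed
qed

text \<open>A chase supplies preimages only after a restriction, whereas a kernel needs them over
  the given test object. The monomorphism \<open>f\<close> is the kernel of some \<open>c\<close>,
  and c y = 0 may be checked after restriction.\<close>

lemma short_exactI:
  assumes f: "f \<in> hom C A B" and g: "g \<in> epis B D" and m: "is_mono C f"
    and 0: "\<And>W x. x \<in> El W A \<Longrightarrow> g \<rhd> f \<rhd> x = 0"
    and ex: "\<And>W y. y \<in> El W B \<Longrightarrow> g \<rhd> y = 0 \<Longrightarrow> \<exists>V e x. e \<in> epis V W \<and> x \<in> El V A \<and> f \<rhd> x = y \<lhd> e"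
  shows "short_exact C f g"
proof -
  note gh = epis_hom[OF g]
  have m0: "x = 0" if "x \<in> El W A" "f \<rhd> x = 0" for x W using m that unfolding mono_iff[OF f] by blast
  obtain c where c: "is_kernel C f c" using mono_normal[OF m] by blast
  then have ch: "c \<in> hom C B (Cod C c)" using homD[OF f] by (auto simp: is_kernel_def hom_def)
  note cD = kernelD[OF c ch]
  have k: "is_kernel C f g"
  proof (rule kernelI[OF f gh])
    have "g \<cdot> f = Null C A D"
      using 0 homD[OF f] homD[OF gh] by (intro arr_eqI[OF comp_hom[OF f gh] null_hom]) auto
    then show "g \<rhd> f \<rhd> z = 0" for z
      using lact_comp[of f g z] homD[OF f] homD[OF gh] by simp
    show "z = 0" if "z \<in> El W A" "f \<rhd> z = 0" for z W using m0 that .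
    fix y W assume y: "y \<in> El W B" "g \<rhd> y = 0"
    obtain V e x where x: "e \<in> epis V W" "x \<in> El V A" "f \<rhd> x = y \<lhd> e" using ex[OF y] by blast
    have "(c \<rhd> y) \<lhd> e = c \<rhd> f \<rhd> x" using x(3) by simp
    then have "c \<rhd> y = 0" using cD(2) epis_cancel[OF x(1) El_lact[OF ch y(1)]] by simp
    then show "\<exists>z\<in>El W A. f \<rhd> z = y" using cD(4)[OF y(1)] homD[OF f] by simp
  qed
  moreover have "is_cokernel C g f" using epi_cokernel_kernel[OF _ k] g by (simp add: epis_def)
  ultimately show ?thesis by (simp add: short_exact_def)
qed

lemma short_exactD:
  assumes "short_exact C f g" "f \<in> hom C A B" "g \<in> hom C B D"
  shows "is_mono C f" "g \<in> epis B D" "g \<rhd> f \<rhd> x = 0"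
    "y \<in> El W B \<Longrightarrow> g \<rhd> y = 0 \<Longrightarrow> \<exists>x\<in>El W A. f \<rhd> x = y"
    "x \<in> El W A \<Longrightarrow> f \<rhd> x = 0 \<Longrightarrow> x = 0"
proof -
  have k: "is_kernel C f g" and c: "is_cokernel C g f" using assms(1) by (auto simp: short_exact_def)
  note kD = kernelD[OF k assms(3)]
  have d: "Dom C f = A" "Cod C g = D" using homD(2)[OF assms(2)] homD(3)[OF assms(3)] .
  show "g \<in> epis B D" using cokernelD(3)[OF c assms(2)] d by simp
  show "g \<rhd> f \<rhd> x = 0" by (rule kD(2))
  show "y \<in> El W B \<Longrightarrow> g \<rhd> y = 0 \<Longrightarrow> \<exists>x\<in>El W A. f \<rhd> x = y" using kD(4) d by simp
  show "x \<in> El W A \<Longrightarrow> f \<rhd> x = 0 \<Longrightarrow> x = 0" for x W using kD(3) d by simp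
  then show "is_mono C f" using mono_ofI[OF assms(2)] by blast
qed

lemma Db_iso_facts:
  assumes "isomorphic (Db C) X Y"
  shows "X \<in> complexes" "Y \<in> complexes" "exact_at X i \<longleftrightarrow> exact_at Y i"
    "isomorphic C (cohom C i X) (cohom C i Y)" "hvanish X Z \<longleftrightarrow> hvanish Y Z" "hvanish Z X \<longleftrightarrow> hvanish Z Y"
    "n = 1 \<or> n = - 1 \<Longrightarrow> isomorphic (Db C) (shift_complex C n X) (shift_complex C n Y)"
    "isomorphic (Db C) Y X"
proof -
  obtain W s f where s: "chmap s W X" "qis s" "chmap f W Y" "qis f" using assms Db_isomorphic_iff by blast
  show "X \<in> complexes" "Y \<in> complexes" using chmapD s by blast+
  show "exact_at X i \<longleftrightarrow> exact_at Y i"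
    using exact_transfer[OF s(1)] exact_transfer[OF s(3)] qisD[OF s(2)] qisD[OF s(4)] by blast
  show "isomorphic C (cohom C i X) (cohom C i Y)"
    using isomorphic_trans[OF isomorphic_sym] cohom_isomorphic[OF s(1)] cohom_isomorphic[OF s(3)]
      qisD[OF s(2)] qisD[OF s(4)] by metis
  show "hvanish X Z \<longleftrightarrow> hvanish Y Z" using hvanish_qis_left[OF s(1,2)] hvanish_qis_left[OF s(3,4)] by blast
  show "hvanish Z X \<longleftrightarrow> hvanish Z Y" using hvanish_qis_right[OF s(1,2)] hvanish_qis_right[OF s(3,4)] by blast
  show "isomorphic (Db C) (shift_complex C n X) (shift_complex C n Y)" if n: "n = 1 \<or> n = - 1"
    unfolding Db_isomorphic_iff
    using chmap_shift[OF s(1) n] chmap_shift[OF s(3) n] qis_shift[OF s(1) n s(2)] qis_shift[OF s(3) n s(4)] by blast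
  show "isomorphic (Db C) Y X" unfolding Db_isomorphic_iff using s by blast
qed

lemma Db_isoI: "chmap f X Y \<Longrightarrow> qis f \<Longrightarrow> isomorphic (Db C) X Y"
  unfolding Db_isomorphic_iff using chmap_cident qis_cident chmapD(1) by blast

lemma cohom_obj: "X \<in> complexes \<Longrightarrow> cohom C i X \<in> Obj C"
  using homD(4)[OF cohom_map_facts(1)[OF chmap_cident]] .

text \<open>The truncation at 0 maps both to \<open>X\<close> and to the stalk of H^0. If all other
  cohomology vanishes, both maps are quasi-isomorphisms and form a roof.\<close>

lemma concentrated_stalk:
  assumes X: "X \<in> complexes" and ex: "\<And>i. i \<noteq> 0 \<Longrightarrow> exact_at X i"
  shows "isomorphic (Db C) X (stk (cohom C 0 X))"
proof -
  obtain T f where T: "chmap f T X" "\<forall>i>0. exact_at T i" "\<forall>i\<le>0. H_inj f i \<and> H_surj f i"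
    and q: "\<exists>q. chmap q T (stk (cohom C 0 X)) \<and> H_inj q 0 \<and> H_surj q 0"
    using truncation_ex[OF X, of 0] by metis
  obtain q where q: "chmap q T (stk (cohom C 0 X))" "H_inj q 0" "H_surj q 0" using q by blast
  have fq: "qis f"
  proof (rule qisI[OF T(1)])
    show "H_inj f i" for i using T(2,3) H_exact_source[OF T(1)] by (cases "i \<le> 0") auto
    show "H_surj f i" for i using T(3) ex[of i] H_exact_target[OF T(1)] by (cases "i \<le> 0") auto
  qed
  have Tex: "exact_at T i" if "i \<noteq> 0" for i using exact_transfer(1)[OF T(1) qisD(1)[OF fq] ex[OF that]] .
  have "qis q"
  proof (rule qisI[OF q(1)])
    show "H_inj q i" for i using q(2) H_exact_source[OF q(1) Tex] by (cases "i = 0") auto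
    show "H_surj q i" for i using q(3) H_exact_target[OF q(1) stalk_exact[OF cohom_obj[OF X]]] by (cases "i = 0") auto
  qed
  then show ?thesis unfolding Db_isomorphic_iff using T(1) fq q(1) by blast
qed

lemma stalk_cohom: assumes "A \<in> Obj C" shows "isomorphic C (cohom C 0 (stk A)) A"
proof -
  note S = stalk_complex[OF assms]
  have "zero_object C (ob (stk A) (- 1))" using zero_zobj by (simp add: ob_stalk)
  then have d0: "diff (stk A) (- 1) \<rhd> x = 0" for x using null_zero_hom(2)[OF _ complexD(2)[OF S]] by blast
  have i: "\<one> A \<in> hom C A A" using ident_hom assms .
  have "diff (stk A) 0 \<rhd> x = 0" for x
    using null_zero_hom(1)[OF _ complexD(2)[OF S]] zero_zobj by (simp add: ob_stalk)
  then have k: "is_kernel C (\<one> A) (diff (stk A) 0)"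
    using complexD(2)[OF S, of 0] by (intro kernelI[of _ A A _ "ob (stk A) 1"]) (auto simp: i ob_stalk)
  have j: "diff (stk A) (- 1) \<in> hom C (ob (stk A) (- 1)) A" using complexD(2)[OF S, of "- 1"] by (simp add: ob_stalk)
  have "is_cokernel C (\<one> A) (diff (stk A) (- 1))"
    using comp_ident_right by (intro cokernelI[OF epis_ident[OF assms] j]) (auto simp: d0)
  then have d: "cohom_data C (stk A) 0 (\<one> A, \<one> A)"
    unfolding cohom_data_def using k j comp_ident_left[OF j] assms by auto
  note c = chmap_cident[OF S]
  show ?thesis
    using cohom_data_isomorphic[OF c H_cident(1)[OF S] H_cident(2)[OF S] _ d, of "fst (cohom_choice C (stk A) 0)" "snd (cohom_choice C (stk A) 0)"]
      cohom_data_choice[OF S] assms by (simp add: cohom_def)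
qed

lemma right_perp_Db:
  assumes "U \<subseteq> complexes"
  shows "right_perp (Db C) U = {Y \<in> complexes. \<forall>X\<in>U. hvanish X Y}"
proof -
  have "(\<forall>X\<in>U. hom (Db C) X Y = {Null (Db C) X Y}) \<longleftrightarrow> (\<forall>X\<in>U. hvanish X Y)" if "Y \<in> complexes" for Y
    by (intro ball_cong refl Db_null_iff[OF subsetD[OF assms] that])
  then show ?thesis unfolding right_perp_def Db_fields(1) by (intro Collect_cong conj_cong refl)
qed

lemma zero_object_isomorphic: assumes "zero_object C A" "zero_object C B" shows "isomorphic C A B"
proof -
  have o: "A \<in> Obj C" "B \<in> Obj C" using assms by (auto simp: zero_object_def)
  have n: "Null C A B \<in> hom C A B" using null_hom o .
  have m: "is_mono C (Null C A B)" using zero_object_El[OF assms(1)] by (intro mono_ofI[OF n]) blast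
  have "Null C A B \<in> epis A B" using zero_object_El_left[OF assms(2)] by (intro episI[OF n]) blast
  then show ?thesis using mono_epi_iso[OF n m] isomorphicI[OF n] by (simp add: epis_def)
qed

lemma isomorphic_obj: "isomorphic C A B \<Longrightarrow> B \<in> Obj C"
  unfolding isomorphic_def using homD(5) by blast

end

section \<open>From t-structures to torsion pairs\<close>

text \<open>\<open>P\<close> stands for the orthogonal of \<open>U\<close>. The second component of
  the t-structure is P[1], so the third term of a decomposition triangle lies in P[1][-1] = P, and
  \<open>P\<close> is the set to work with.\<close>

locale intermediate_t_structure = abelian_category +
  fixes U :: "('a, 'b) complex_data set" and P
  defines "P \<equiv> right_perp (Db C) U"
  assumes t_str: "t_structure (Db C) (U, shift_complex C 1 ` P)"
    and stalk_U: "A \<in> Obj C \<Longrightarrow> shift_complex C 1 (stk A) \<in> U"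
    and stalk_P: "A \<in> Obj C \<Longrightarrow> shift_complex C (- 1) (stk A) \<in> P"
begin

lemma U_complex: "X \<in> U \<Longrightarrow> X \<in> complexes"
  using t_str by (auto simp: t_structure_def strict_subcat_def Db_fields)

lemma P_iff: "Y \<in> P \<longleftrightarrow> Y \<in> complexes \<and> (\<forall>X\<in>U. hvanish X Y)"
  using right_perp_Db U_complex by (auto simp: P_def)

lemma U_iso: "X \<in> U \<Longrightarrow> isomorphic (Db C) X Y \<Longrightarrow> Y \<in> U"
  using t_str Db_iso_facts(2) by (auto simp: t_structure_def strict_subcat_def Db_fields)

lemma P_iso: "X \<in> P \<Longrightarrow> isomorphic (Db C) X Y \<Longrightarrow> Y \<in> P"
  using Db_iso_facts(2,6) P_iff by blast

lemma P_shift_image: "shift_complex C (- 1) ` shift_complex C 1 ` P = P"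
  using P_iff by (auto simp: image_image)

lemma U_shift: assumes "X \<in> U" shows "shift_complex C 1 X \<in> U"
proof -
  have "X \<in> shift_complex C (- 1) ` U" using t_str assms by (auto simp: t_structure_def Db_fields)
  then obtain X' where "X' \<in> U" "X = shift_complex C (- 1) X'" by blast
  then show ?thesis using U_complex by simp
qed

lemma P_shift: assumes "Y \<in> P" shows "shift_complex C (- 1) Y \<in> P"
proof -
  have "Y \<in> shift_complex C 1 ` P"
    using t_str assms P_shift_image by (auto simp: t_structure_def Db_fields)
  then obtain Y' where "Y' \<in> P" "Y = shift_complex C 1 Y'" by blast
  then show ?thesis using P_iff by simp
qed

lemma decomposition:
  assumes "Y \<in> complexes"
  obtains A B f K \<iota> \<pi> \<kappa> \<rho> where "is_cone A B f K \<iota> \<pi> \<kappa> \<rho>" "A \<in> U" "K \<in> P" "isomorphic (Db C) Y B"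
proof -
  have "\<forall>Y \<in> Obj (Db C). \<exists>X \<in> U. \<exists>Z \<in> Shift (Db C) (-1) ` shift_complex C 1 ` P.
      \<exists>u \<in> hom (Db C) X Y. \<exists>v \<in> hom (Db C) Y Z. \<exists>w \<in> hom (Db C) Z (Shift (Db C) 1 X). (u, v, w) \<in> Triangles (Db C)"
    using t_str unfolding t_structure_def prod.case by (elim conjE)
  then have "\<forall>Y \<in> complexes. \<exists>X \<in> U. \<exists>Z \<in> shift_complex C (-1) ` shift_complex C 1 ` P.
      \<exists>u \<in> hom (Db C) X Y. \<exists>v \<in> hom (Db C) Y Z. \<exists>w \<in> hom (Db C) Z (shift_complex C 1 X). (u, v, w) \<in> Triangles (Db C)"
    unfolding Db_fields(1,8) .
  from bspec[OF this assms]
  obtain X Z u v w where t: "X \<in> U" "Z \<in> shift_complex C (- 1) ` shift_complex C 1 ` P" "u \<in> hom (Db C) X Y"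
    "v \<in> hom (Db C) Y Z" "w \<in> hom (Db C) Z (shift_complex C 1 X)" "(u, v, w) \<in> Triangles (Db C)"
    by (elim bexE)
  obtain A B f K \<iota> \<pi> \<kappa> \<rho> where "is_cone A B f K \<iota> \<pi> \<kappa> \<rho>" "isomorphic (Db C) X A" "isomorphic (Db C) Y B" "isomorphic (Db C) Z K"
    using triangle_obtain_cone[OF t(6,3,4,5)] .
  then show ?thesis using that U_iso[OF t(1)] P_iso[of Z K] t(2) P_shift_image by blast
qed

text \<open>Take a triangle A -> X -> K with \<open>A\<close> in \<open>U\<close> and
  \<open>K\<close> in \<open>P\<close>. Neither X nor A[1] has nonzero arrows to \<open>K\<close>,
  hence neither has \<open>K\<close> itself. A complex without nonzero endomorphisms is acyclic, so
  A -> X is an isomorphism.\<close>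

lemma U_left_perp:
  assumes X: "X \<in> complexes" and v: "\<And>Z. Z \<in> P \<Longrightarrow> hvanish X Z" shows "X \<in> U"
proof -
  obtain A B f K \<iota> \<pi> \<kappa> \<rho> where cone: "is_cone A B f K \<iota> \<pi> \<kappa> \<rho>" and AK: "A \<in> U" "K \<in> P" and iso: "isomorphic (Db C) X B"
    using decomposition[OF X] .
  have K: "K \<in> complexes" using AK(2) P_iff by blast
  have "hvanish B K" using v[OF AK(2)] Db_iso_facts(5)[OF iso] by blast
  moreover have "hvanish (shift_complex C 1 A) K" using AK P_iff U_shift by blast
  ultimately have "hvanish K K" using hvanish_cone_cofibre[OF cone] by blast
  then have "qis f" using qis_iff_cone_exact[OF cone] hvanish_self_exact K by blast
  then have "isomorphic (Db C) A B" using Db_isoI coneD(1)[OF cone] by blast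
  then have "B \<in> U" using U_iso AK by blast
  then show ?thesis using U_iso Db_iso_facts(8)[OF iso] by blast
qed

lemma U_extension: "is_cone A B f K \<iota> \<pi> \<kappa> \<rho> \<Longrightarrow> A \<in> U \<Longrightarrow> K \<in> U \<Longrightarrow> B \<in> U"
  using U_left_perp[of B] hvanish_cone_source P_iff coneD(5) by metis

lemma P_extension: "is_cone A B f K \<iota> \<pi> \<kappa> \<rho> \<Longrightarrow> A \<in> P \<Longrightarrow> K \<in> P \<Longrightarrow> B \<in> P"
  using hvanish_cone_target P_iff coneD(5) by metis

text \<open>The cone of the truncation at n is exact up to degree n, and above n wherever
  \<open>X\<close> is. That the objects of \<open>A\<close> above n are zero, and not only exact, is
  recorded for \<open>U_low\<close>.\<close>

lemma truncation_cone:
  assumes "X \<in> complexes"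
  obtains A f K \<iota> \<pi> \<kappa> \<rho> where "is_cone A X f K \<iota> \<pi> \<kappa> \<rho>" "\<forall>i>n. exact_at A i" "\<forall>i\<le>n. H_inj f i \<and> H_surj f i"
    "\<forall>i\<le>n. exact_at K i" "\<forall>i>n. exact_at X i \<longrightarrow> exact_at K i" "\<forall>i>n. zero_object C (ob A i)"
proof -
  obtain A f where A: "chmap f A X" "\<forall>i>n. zero_object C (ob A i)" "\<forall>i>n. exact_at A i" "\<forall>i\<le>n. H_inj f i \<and> H_surj f i"
    using truncation_ex[OF assms, of n] by metis
  obtain K \<iota> \<pi> \<kappa> \<rho> where cone: "is_cone A X f K \<iota> \<pi> \<kappa> \<rho>" using cone_ex[OF A(1)] by blast
  have inj: "H_inj f i" for i using A(3,4) H_exact_source[OF A(1)] by (cases "i \<le> n") auto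
  have "\<forall>i\<le>n. exact_at K i" using cone_exact_iff[OF cone] inj A(4) by blast
  moreover have "\<forall>i>n. exact_at X i \<longrightarrow> exact_at K i" using cone_exact_iff[OF cone] inj H_exact_target[OF A(1)] by blast
  ultimately show ?thesis using that cone A by blast
qed

text \<open>Induction on the number of degrees in which cohomology may occur. The topmost one, in
  degree -1, contributes a stalk shifted by 1, which is in \<open>U\<close> by assumption. What lies
  below is the shift of a complex covered by the induction hypothesis, and \<open>U\<close> is
  closed under shift and extensions.\<close>

lemma low_in_U:
  assumes "X \<in> complexes" "\<And>i. i > - 1 \<Longrightarrow> exact_at X i" shows "X \<in> U"
proof -
  have "\<forall>X\<in>complexes. (\<forall>i>- 1. exact_at X i) \<and> (\<forall>i< - int n. exact_at X i) \<longrightarrow> X \<in> U" for n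
  proof (induction n)
    case 0
    show ?case
    proof (intro ballI impI)
      fix X assume X: "X \<in> complexes" and h: "(\<forall>i>- 1. exact_at X i) \<and> (\<forall>i< - int 0. exact_at X i)"
      have "exact_at X i" for i using h by (cases "i < 0") auto
      then show "X \<in> U" using U_left_perp[OF X] hvanish_acyclic_source P_iff by blast
    qed
  next
    case (Suc n)
    show ?case
    proof (intro ballI impI)
      fix X assume X: "X \<in> complexes" and h: "(\<forall>i>- 1. exact_at X i) \<and> (\<forall>i< - int (Suc n). exact_at X i)"
      obtain A f K \<iota> \<pi> \<kappa> \<rho> where cone: "is_cone A X f K \<iota> \<pi> \<kappa> \<rho>" and A: "\<forall>i>-2. exact_at A i" "\<forall>i\<le>-2. H_inj f i \<and> H_surj f i"
        and K: "\<forall>i\<le>-2. exact_at K i" "\<forall>i>-2. exact_at X i \<longrightarrow> exact_at K i" using truncation_cone[OF X, of "-2"] by metis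
      note k = coneD[OF cone]
      \<comment> \<open>The shift by -1 raises degrees by one: \<open>?K\<close> is concentrated in
        degree 0, and the cohomology of \<open>?A\<close> lies in degrees -n to -1, as the induction
        hypothesis demands.\<close>
      let ?A = "shift_complex C (- 1) A" and ?K = "shift_complex C (- 1) K"
      have Kc: "?K \<in> complexes" and Ac: "?A \<in> complexes" using shift_complexes k by blast+
      have "exact_at ?K i" if "i \<noteq> 0" for i
      proof (cases "i < 0")
        case True then show ?thesis using K(1) k(6) by simp
      next
        case False then show ?thesis using K(2) h k(6) that by simp
      qed
      then have "isomorphic (Db C) ?K (stk (cohom C 0 ?K))" using concentrated_stalk[OF Kc] by blast
      then have "isomorphic (Db C) K (shift_complex C 1 (stk (cohom C 0 ?K)))"
        using Db_iso_facts(7)[of ?K "stk (cohom C 0 ?K)" 1] k(6) by simp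
      then have KU: "K \<in> U" using U_iso[OF stalk_U[OF cohom_obj[OF Kc]]] Db_iso_facts(8) by blast
      have "exact_at A i" if "i < - int (Suc n)" for i
      proof (cases "i \<le> - 2")
        case True then show ?thesis using exact_transfer(1)[OF k(1)] A(2) h that by blast
      qed (use A(1) in auto)
      then have "?A \<in> U" using Suc Ac A(1) k(4) by simp
      then have "A \<in> U" using U_shift[of ?A] k(4) by simp
      then show "X \<in> U" using U_extension[OF cone] KU by blast
    qed
  qed
  moreover obtain a b where ab: "\<forall>i. i < a \<or> b < i \<longrightarrow> zero_object C (ob X i)" using complex_bounded[OF assms(1)] .
  moreover have "\<forall>i< - int (nat (- a)). exact_at X i" using zero_object_exact[OF assms(1)] ab by auto
  ultimately show ?thesis using assms by blast
qed

text \<open>The dual induction: the lowest cohomology, in degree 1, contributes a stalk shifted by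
  -1, and the rest is the shift by -1 of a complex covered by the hypothesis.\<close>

lemma high_in_P:
  assumes "X \<in> complexes" "\<And>i. i < 1 \<Longrightarrow> exact_at X i" shows "X \<in> P"
proof -
  have "\<forall>X\<in>complexes. (\<forall>i<1. exact_at X i) \<and> (\<forall>i>int n. exact_at X i) \<longrightarrow> X \<in> P" for n
  proof (induction n)
    case 0
    show ?case
    proof (intro ballI impI)
      fix X assume X: "X \<in> complexes" and h: "(\<forall>i<1. exact_at X i) \<and> (\<forall>i>int 0. exact_at X i)"
      have "exact_at X i" for i using h by (cases "i < 1") auto
      then show "X \<in> P" using X hvanish_acyclic_target P_iff by blast
    qed
  next
    case (Suc n)
    show ?case
    proof (intro ballI impI)
      fix X assume X: "X \<in> complexes" and h: "(\<forall>i<1. exact_at X i) \<and> (\<forall>i>int (Suc n). exact_at X i)"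
      obtain A f K \<iota> \<pi> \<kappa> \<rho> where cone: "is_cone A X f K \<iota> \<pi> \<kappa> \<rho>" and A: "\<forall>i>1. exact_at A i" "\<forall>i\<le>1. H_inj f i \<and> H_surj f i"
        and K: "\<forall>i\<le>1. exact_at K i" "\<forall>i>1. exact_at X i \<longrightarrow> exact_at K i" using truncation_cone[OF X, of 1] by metis
      note k = coneD[OF cone]
      let ?A = "shift_complex C 1 A" and ?K = "shift_complex C 1 K"
      have Kc: "?K \<in> complexes" and Ac: "?A \<in> complexes" using shift_complexes k by blast+
      have "exact_at ?A i" if "i \<noteq> 0" for i
      proof (cases "i > 0")
        case True then show ?thesis using A(1) k(4) by simp
      next
        case False
        then have "i + 1 < 1" using that by simp
        then show ?thesis using exact_transfer(1)[OF k(1), of "i + 1"] A(2) h k(4) by simp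
      qed
      then have "isomorphic (Db C) ?A (stk (cohom C 0 ?A))" using concentrated_stalk[OF Ac] by blast
      then have "isomorphic (Db C) A (shift_complex C (- 1) (stk (cohom C 0 ?A)))"
        using Db_iso_facts(7)[of ?A "stk (cohom C 0 ?A)" "- 1"] k(4) by simp
      then have AP: "A \<in> P" using P_iso[OF stalk_P[OF cohom_obj[OF Ac]]] Db_iso_facts(8) by blast
      have "exact_at K i" if "i > int (Suc n)" for i using K h that by (cases "i \<le> 1") auto
      then have "?K \<in> P" using Suc Kc K(1) k(6) by simp
      then have "K \<in> P" using P_shift[of ?K] k(6) by simp
      then show "X \<in> P" using P_extension[OF cone] AP by blast
    qed
  qed
  moreover obtain a b where ab: "\<forall>i. i < a \<or> b < i \<longrightarrow> zero_object C (ob X i)" using complex_bounded[OF assms(1)] .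
  moreover have "\<forall>i>int (nat b). exact_at X i" using zero_object_exact[OF assms(1)] ab by auto
  ultimately show ?thesis using assms by blast
qed

text \<open>The cone \<open>K\<close> of the truncation at 0 lies in \<open>P\<close> by
  \<open>high_in_P\<close>, so X -> K vanishes in the derived category and hence on cohomology. But
  in positive degrees this map loses no cohomology, so there is none.\<close>

lemma U_low: assumes "X \<in> U" "i > 0" shows "exact_at X i"
  unfolding exact_at_def
proof (intro allI subsetI)
  fix W x assume x: "x \<in> cycs X i W"
  have X: "X \<in> complexes" using U_complex assms by blast
  obtain A f K \<iota> \<pi> \<kappa> \<rho> where cone: "is_cone A X f K \<iota> \<pi> \<kappa> \<rho>" and K: "\<forall>i\<le>0. exact_at K i" and A: "\<forall>i>0. zero_object C (ob A i)"
    using truncation_cone[OF X, of 0] by metis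
  note k = coneD[OF cone] and kp = coneD_prev[OF cone, where i = i]
  have "K \<in> P" using high_in_P[OF k(6)] K by simp
  then have "hvanish X K" using P_iff assms by blast
  then have "cpt \<iota> i \<rhd> x \<in> bds K i W" using hvanish_bds k(2) x by blast
  then obtain V e c where c: "e \<in> epis V W" "c \<in> El V (ob K (i - 1))" "(cpt \<iota> i \<rhd> x) \<lhd> e = diff K (i - 1) \<rhd> c"
    using bdsE by metis
  have eq: "cpt \<iota> i \<rhd> (x \<lhd> e) = diff K (i - 1) \<rhd> c" using c(3) by simp
  \<comment> \<open>K^(i-1) is the sum of A^i and X^(i-1), and A^i is a zero object since i > 0. So
    a primitive in \<open>K\<close> is a primitive in \<open>X\<close>.\<close>
  have "cpt \<pi> (i - 1) \<rhd> c = 0" using zero_object_El[OF _ El_lact[OF kp(1) c(2)]] A assms(2) by blast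
  then have "x \<lhd> e = diff X (i - 1) \<rhd> \<rho> (i - 1) \<rhd> c"
    using arg_cong[OF eq, of "\<lambda>z. \<rho> i \<rhd> z"] k(12)[OF El_ract[OF cycsD(1)[OF x] epis_hom[OF c(1)]]] kp(4)[OF c(2)] by simp
  then show "x \<in> bds X i W" using bdsI[OF cycsD(1)[OF x] c(1) El_lact[OF k(10) c(2)]] by blast
qed

text \<open>The truncation of \<open>Z\<close> at -1 lies in \<open>U\<close> by
  \<open>low_in_U\<close>, so its map to \<open>Z\<close> vanishes on cohomology. In negative
  degrees this map is also surjective there.\<close>

lemma P_high: assumes "Z \<in> P" "i < 0" shows "exact_at Z i"
  unfolding exact_at_def
proof (intro allI subsetI)
  fix W z assume z: "z \<in> cycs Z i W"
  have Z: "Z \<in> complexes" using P_iff assms by blast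
  obtain A f K \<iota> \<pi> \<kappa> \<rho> where cone: "is_cone A Z f K \<iota> \<pi> \<kappa> \<rho>" and A: "\<forall>i>- 1. exact_at A i" "\<forall>i\<le>- 1. H_inj f i \<and> H_surj f i"
    using truncation_cone[OF Z, of "- 1"] by metis
  note k = coneD[OF cone]
  have "A \<in> U" using low_in_U[OF k(4)] A by simp
  then have v: "hvanish A Z" using P_iff assms by blast
  have "H_surj f i" using A(2) assms(2) by simp
  then obtain V e a where a: "e \<in> epis V W" "a \<in> cycs A i V" "z \<lhd> e - cpt f i \<rhd> a \<in> bds Z i V"
    using H_surjE[OF _ k(1) z] by metis
  have "z \<lhd> e \<in> bds Z i V" using bds_add[OF Z a(3) hvanish_bds[OF v k(1) a(2)]] by simp
  then show "z \<in> bds Z i W" using bds_local[OF cycsD(1)[OF z] a(1)] by blast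
qed

text \<open>The map from the truncation at 0 to the stalk of H^0 forgets the cohomology in degrees
  at most -1. In its cone this part appears one degree lower, in degrees at most -2. The bound -2
  leaves room for shifting the cone back by one degree in \<open>U_cohomI\<close>.\<close>

lemma cohom_stalk_cone:
  assumes X: "X \<in> complexes"
  obtains T f q K \<iota> \<pi> \<kappa> \<rho> where "chmap f T X" "\<forall>i\<le>0. H_inj f i \<and> H_surj f i" "\<forall>i>0. exact_at T i"
    "is_cone T (stk (cohom C 0 X)) q K \<iota> \<pi> \<kappa> \<rho>" "\<forall>i>-2. exact_at K i"
proof -
  obtain T f where T: "chmap f T X" "\<forall>i>0. exact_at T i" "\<forall>i\<le>0. H_inj f i \<and> H_surj f i"
    and q: "\<exists>q. chmap q T (stk (cohom C 0 X)) \<and> H_inj q 0 \<and> H_surj q 0"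
    using truncation_ex[OF X, of 0] by metis
  obtain q where q: "chmap q T (stk (cohom C 0 X))" "H_inj q 0" "H_surj q 0" using q by blast
  obtain K \<iota> \<pi> \<kappa> \<rho> where cone: "is_cone T (stk (cohom C 0 X)) q K \<iota> \<pi> \<kappa> \<rho>" using cone_ex[OF q(1)] by blast
  have inj: "H_inj q i" if "i \<ge> 0" for i using q(2) H_exact_source[OF q(1)] T(2) that by (cases "i = 0") auto
  have sur: "H_surj q i" for i using q(3) H_exact_target[OF q(1) stalk_exact[OF cohom_obj[OF X]]] by (cases "i = 0") auto
  have "\<forall>i>-2. exact_at K i" using cone_exact_iff[OF cone] inj sur by simp
  then show ?thesis using that T cone by blast
qed

lemma truncation_iso:
  assumes "chmap f T X" "\<forall>i\<le>0. H_inj f i \<and> H_surj f i" "\<forall>i>0. exact_at T i" "\<And>i. i > 0 \<Longrightarrow> exact_at X i"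
  shows "isomorphic (Db C) T X"
proof -
  have "H_inj f i" "H_surj f i" for i
    using assms H_exact_source[OF assms(1), of i] H_exact_target[OF assms(1), of i] by (cases "i \<le> 0"; auto)+
  then show ?thesis using Db_isoI[OF assms(1)] qisI[OF assms(1)] by blast
qed

text \<open>In the triangle from \<open>T\<close> over the stalk to \<open>K\<close>, the first term
  is isomorphic to \<open>X\<close> and the last is covered by \<open>low_in_U\<close>; the middle
  term is an extension of the two.\<close>

lemma U_cohom: assumes "X \<in> U" shows "stk (cohom C 0 X) \<in> U"
proof -
  have X: "X \<in> complexes" using U_complex assms .
  obtain T f q K \<iota> \<pi> \<kappa> \<rho> where T: "chmap f T X" "\<forall>i\<le>0. H_inj f i \<and> H_surj f i" "\<forall>i>0. exact_at T i"
    and cone: "is_cone T (stk (cohom C 0 X)) q K \<iota> \<pi> \<kappa> \<rho>" and K: "\<forall>i>-2. exact_at K i" using cohom_stalk_cone[OF X] .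
  have "isomorphic (Db C) T X" using truncation_iso[OF T] U_low[OF assms] by blast
  then have "T \<in> U" using U_iso[OF assms] Db_iso_facts(8) by blast
  moreover have "K \<in> U" using low_in_U[OF coneD(6)[OF cone]] K by simp
  ultimately show ?thesis using U_extension[OF cone] by blast
qed

text \<open>The triangle of \<open>U_cohom\<close> read backwards: \<open>T\<close> lies between
  K[-1], which has cohomology in degrees at most -1 only, and the stalk. Here \<open>T\<close> is
  the first term of the cone and not its middle, so it is shown to be left orthogonal to
  \<open>P\<close> instead of using \<open>U_extension\<close>.\<close>

lemma U_cohomI:
  assumes X: "X \<in> complexes" and ex: "\<And>i. i > 0 \<Longrightarrow> exact_at X i" and st: "stk (cohom C 0 X) \<in> U" shows "X \<in> U"
proof -
  obtain T f q K \<iota> \<pi> \<kappa> \<rho> where T: "chmap f T X" "\<forall>i\<le>0. H_inj f i \<and> H_surj f i" "\<forall>i>0. exact_at T i"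
    and cone: "is_cone T (stk (cohom C 0 X)) q K \<iota> \<pi> \<kappa> \<rho>" and K: "\<forall>i>-2. exact_at K i" using cohom_stalk_cone[OF X] .
  note k = coneD[OF cone]
  let ?K = "shift_complex C (- 1) K"
  have Kc: "?K \<in> complexes" using shift_complexes k(6) by blast
  have KU: "?K \<in> U" using low_in_U[OF Kc] K k(6) by simp
  have "T \<in> U"
  proof (rule U_left_perp[OF k(4)])
    fix Z assume Z: "Z \<in> P"
    then have Zc: "Z \<in> complexes" and v: "hvanish (stk (cohom C 0 X)) Z" "hvanish ?K Z" using P_iff st KU by blast+
    have "hvanish K (shift_complex C 1 Z)" using hvanish_shift_imp[OF v(2) _ Kc Zc, of 1] k(6) by simp
    then show "hvanish T Z" using hvanish_cone_source_fibre[OF cone Zc v(1)] by blast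
  qed
  then show ?thesis using U_iso truncation_iso[OF T ex] by blast
qed

text \<open>The truncation \<open>A\<close> of \<open>Z\<close> at 0 is again in \<open>P\<close>:
  an arrow from \<open>U\<close> to \<open>A\<close> dies in \<open>Z\<close>, so it comes from an
  arrow to K[-1], and these vanish. By \<open>P_high\<close> the complex \<open>A\<close> then has
  cohomology in degree 0 only and is isomorphic to the stalk of H^0(A), which is H^0(Z).\<close>

lemma P_cohom: assumes "Z \<in> P" shows "stk (cohom C 0 Z) \<in> P"
proof -
  have Z: "Z \<in> complexes" using P_iff assms by blast
  obtain A f K \<iota> \<pi> \<kappa> \<rho> where cone: "is_cone A Z f K \<iota> \<pi> \<kappa> \<rho>" and A: "\<forall>i>0. exact_at A i" "\<forall>i\<le>0. H_inj f i \<and> H_surj f i"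
    and K: "\<forall>i\<le>0. exact_at K i" using truncation_cone[OF Z, of 0] by metis
  note k = coneD[OF cone]
  have KP: "K \<in> P" using high_in_P[OF k(6)] K by simp
  have "hvanish W A" if "W \<in> U" for W
    using hvanish_cone_fibre[OF cone] KP assms U_shift[OF that] that P_iff by blast
  then have AP: "A \<in> P" using P_iff k(4) by blast
  have "exact_at A i" if "i \<noteq> 0" for i
    using that A(1) P_high[OF AP] by (cases "i > 0") auto
  then have "isomorphic (Db C) A (stk (cohom C 0 A))" using concentrated_stalk[OF k(4)] by blast
  moreover have "isomorphic C (cohom C 0 A) (cohom C 0 Z)" using cohom_isomorphic[OF k(1)] A(2) by blast
  ultimately show ?thesis using P_iso[OF P_iso[OF AP]] stalk_isomorphic by blast
qed

lemma trace_torsion_pair: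
  defines "T \<equiv> {A \<in> Obj C. stk A \<in> U}" and "F \<equiv> {A \<in> Obj C. stk A \<in> P}"
  shows "torsion_pair C (T, F)"
  unfolding torsion_pair_def prod.case
proof (intro conjI)
  have T_iso: "B \<in> T" if "A \<in> T" "isomorphic C A B" "B \<in> Obj C" for A B
    using that stalk_isomorphic U_iso by (auto simp: T_def)
  have F_iso: "B \<in> F" if "A \<in> F" "isomorphic C A B" "B \<in> Obj C" for A B
    using that stalk_isomorphic P_iso by (auto simp: F_def)
  show "strict_subcat C T" unfolding strict_subcat_def using T_iso by (auto simp: T_def)
  show "strict_subcat C F" unfolding strict_subcat_def using F_iso by (auto simp: F_def)
  show "\<forall>X\<in>T. \<forall>Y\<in>F. hom C X Y = {Null C X Y}"
  proof (intro ballI)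
    fix X Y assume XY: "X \<in> T" "Y \<in> F"
    then have o: "X \<in> Obj C" "Y \<in> Obj C" and v: "hvanish (stk X) (stk Y)" using P_iff by (auto simp: T_def F_def)
    have "f = Null C X Y" if f: "f \<in> hom C X Y" for f
    proof (rule arr_eqI[OF f null_hom[OF o]])
      obtain q where q: "chmap q (stk X) (stk Y)" "\<forall>x. cpt q 0 \<rhd> x = f \<rhd> x" using stalk_map[OF f] .
      fix x W assume "x \<in> El W X"
      then have "cpt q 0 \<rhd> x \<in> bds (stk Y) 0 W" using hvanish_bds[OF v q(1)] cycs_stalk[OF o(1)] by blast
      then show "f \<rhd> x = Null C X Y \<rhd> x" using bds_stalk[OF o(2)] q(2) o by simp
    qed
    then show "hom C X Y = {Null C X Y}" using null_hom[OF o] by blast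
  qed
  show "\<forall>Y\<in>Obj C. \<exists>X\<in>T. \<exists>Z\<in>F. \<exists>f\<in>hom C X Y. \<exists>g\<in>hom C Y Z. short_exact C f g"
  proof
    fix Y assume Y: "Y \<in> Obj C"
    obtain A B f K \<iota> \<pi> \<kappa> \<rho> where cone: "is_cone A B f K \<iota> \<pi> \<kappa> \<rho>" and AK: "A \<in> U" "K \<in> P" and iso: "isomorphic (Db C) (stk Y) B"
      using decomposition[OF stalk_complex[OF Y]] .
    note k = coneD[OF cone]
    have "isomorphic C (cohom C 0 B) Y"
      using isomorphic_trans[OF isomorphic_sym[OF Db_iso_facts(4)[OF iso]] stalk_cohom[OF Y]] .
    then obtain \<phi> where \<phi>: "\<phi> \<in> hom C (cohom C 0 B) Y" "is_iso C \<phi>" by (auto simp: isomorphic_def)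
    then obtain \<psi> where \<psi>: "\<psi> \<in> hom C Y (cohom C 0 B)" "\<psi> \<cdot> \<phi> = \<one> (cohom C 0 B)" "\<phi> \<cdot> \<psi> = \<one> Y"
      using is_iso_iff[OF \<phi>(1)] by blast
    have \<psi>\<phi>: "\<psi> \<rhd> \<phi> \<rhd> x = x" if "x \<in> El W (cohom C 0 B)" for x W
      using lact_comp[of \<phi> \<psi> x] \<psi> homD[OF \<phi>(1)] homD[OF \<psi>(1)] that by simp
    have \<phi>\<psi>: "\<phi> \<rhd> \<psi> \<rhd> x = x" if "x \<in> El W Y" for x W
      using lact_comp[of \<psi> \<phi> x] \<psi> homD[OF \<phi>(1)] homD[OF \<psi>(1)] that by simp
    let ?h1 = "cohom_map C 0 f" and ?h2 = "cohom_map C 0 \<iota>"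
    \<comment> \<open>H^1(A) and H^(-1)(K) vanish, so the decomposition triangle of the stalk yields
      a short exact sequence. Its middle term is only isomorphic to \<open>Y\<close>; hence its maps
      are composed with \<phi> and \<psi>.\<close>
    note h = cone_cohom_exact[OF cone U_low[OF AK(1)] P_high[OF AK(2)], simplified]
    have f': "\<phi> \<cdot> ?h1 \<in> hom C (cohom C 0 A) Y" and g': "?h2 \<cdot> \<psi> \<in> hom C Y (cohom C 0 K)"
      using comp_hom h(1,2) \<phi>(1) \<psi>(1) by blast+
    have fx: "(\<phi> \<cdot> ?h1) \<rhd> x = \<phi> \<rhd> ?h1 \<rhd> x" for x using homD[OF h(1)] homD[OF \<phi>(1)] by simp
    have gx: "(?h2 \<cdot> \<psi>) \<rhd> x = ?h2 \<rhd> \<psi> \<rhd> x" for x using homD[OF h(2)] homD[OF \<psi>(1)] by simp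
    have "short_exact C (\<phi> \<cdot> ?h1) (?h2 \<cdot> \<psi>)"
    proof (rule short_exactI[OF f'])
      show "?h2 \<cdot> \<psi> \<in> epis Y (cohom C 0 K)"
      proof (rule episI_lift[OF g'])
        fix y W assume y: "y \<in> El W (cohom C 0 K)"
        obtain V e x where x: "e \<in> epis V W" "x \<in> El V (cohom C 0 B)" "?h2 \<rhd> x = y \<lhd> e" using epi_lift[OF h(4) y] .
        then show "\<exists>V e x. e \<in> epis V W \<and> x \<in> El V Y \<and> (?h2 \<cdot> \<psi>) \<rhd> x = y \<lhd> e"
          using gx \<psi>\<phi>[OF x(2)] El_lact[OF \<phi>(1) x(2)] by metis
      qed
      show "is_mono C (\<phi> \<cdot> ?h1)"
      proof (rule mono_ofI[OF f'])
        fix x W assume x: "x \<in> El W (cohom C 0 A)" "(\<phi> \<cdot> ?h1) \<rhd> x = 0"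
        have "?h1 \<rhd> x = \<psi> \<rhd> \<phi> \<rhd> ?h1 \<rhd> x" using \<psi>\<phi>[OF El_lact[OF h(1) x(1)]] by simp
        then have "?h1 \<rhd> x = 0" using x(2) fx by simp
        then show "x = 0" using h(3) x(1) unfolding mono_iff[OF h(1)] by blast
      qed
      show "(?h2 \<cdot> \<psi>) \<rhd> (\<phi> \<cdot> ?h1) \<rhd> x = 0" if "x \<in> El W (cohom C 0 A)" for x W
        using h(5)[OF that] fx gx \<psi>\<phi>[OF El_lact[OF h(1) that]] by simp
      fix W y assume y: "y \<in> El W Y" "(?h2 \<cdot> \<psi>) \<rhd> y = 0"
      obtain V e x where x: "e \<in> epis V W" "x \<in> El V (cohom C 0 A)" "?h1 \<rhd> x = (\<psi> \<rhd> y) \<lhd> e"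
        using h(6)[OF El_lact[OF \<psi>(1) y(1)]] gx y(2) by metis
      have "(\<phi> \<cdot> ?h1) \<rhd> x = y \<lhd> e" using fx x(3) \<phi>\<psi>[OF El_ract[OF y(1) epis_hom[OF x(1)]]] by simp
      then show "\<exists>V e x. e \<in> epis V W \<and> x \<in> El V (cohom C 0 A) \<and> (\<phi> \<cdot> ?h1) \<rhd> x = y \<lhd> e" using x by blast
    qed
    moreover have "cohom C 0 A \<in> T" "cohom C 0 K \<in> F"
      using U_cohom[OF AK(1)] P_cohom[OF AK(2)] cohom_obj k by (auto simp: T_def F_def)
    ultimately show "\<exists>X\<in>T. \<exists>Z\<in>F. \<exists>f\<in>hom C X Y. \<exists>g\<in>hom C Y Z. short_exact C f g" using f' g' by blast
  qed
qed

lemma lift_trace: "lift_aisle C {A \<in> Obj C. stk A \<in> U} = U"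
proof (intro equalityI subsetI)
  fix X assume "X \<in> lift_aisle C {A \<in> Obj C. stk A \<in> U}"
  then have X: "X \<in> complexes" "\<And>i. i > 0 \<Longrightarrow> exact_at X i" "stk (cohom C 0 X) \<in> U"
    using zero_cohom_iff by (auto simp: lift_aisle_def Db_fields)
  show "X \<in> U" using U_cohomI[OF X] .
next
  fix X assume X: "X \<in> U"
  then show "X \<in> lift_aisle C {A \<in> Obj C. stk A \<in> U}"
    using U_complex[OF X] U_low[OF X] U_cohom[OF X] cohom_obj zero_cohom_iff by (auto simp: lift_aisle_def Db_fields)
qed

end

section \<open>From torsion pairs to t-structures\<close>

locale torsion_theory = abelian_category +
  fixes T F assumes tp: "torsion_pair C (T, F)"
begin

lemma T_obj: "A \<in> T \<Longrightarrow> A \<in> Obj C" and F_obj: "A \<in> F \<Longrightarrow> A \<in> Obj C"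
  using tp by (auto simp: torsion_pair_def strict_subcat_def)

lemma T_iso: assumes "A \<in> T" "isomorphic C A B" shows "B \<in> T"
proof -
  have "\<forall>X\<in>T. \<forall>Y\<in>Obj C. isomorphic C X Y \<longrightarrow> Y \<in> T"
    using tp unfolding torsion_pair_def prod.case strict_subcat_def by (elim conjE)
  then show ?thesis using assms isomorphic_obj by blast
qed

lemma F_iso: assumes "A \<in> F" "isomorphic C A B" shows "B \<in> F"
proof -
  have "\<forall>X\<in>F. \<forall>Y\<in>Obj C. isomorphic C X Y \<longrightarrow> Y \<in> F"
    using tp unfolding torsion_pair_def prod.case strict_subcat_def by (elim conjE)
  then show ?thesis using assms isomorphic_obj by blast
qed

lemma T_F_arr: assumes "A \<in> T" "B \<in> F" "f \<in> hom C A B" shows "f \<rhd> x = 0"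
proof -
  have "f = Null C A B" using tp assms by (auto simp: torsion_pair_def)
  then show ?thesis using lact_null homD(4,5)[OF assms(3)] by simp
qed

lemma torsion_sequence:
  assumes "Y \<in> Obj C"
  obtains X Z f g where "X \<in> T" "Z \<in> F" "f \<in> hom C X Y" "g \<in> hom C Y Z" "short_exact C f g"
proof -
  have "\<forall>Y \<in> Obj C. \<exists>X \<in> T. \<exists>Z \<in> F. \<exists>f \<in> hom C X Y. \<exists>g \<in> hom C Y Z. short_exact C f g"
    using tp unfolding torsion_pair_def prod.case by (elim conjE)
  from bspec[OF this assms] show ?thesis using that by (elim bexE)
qed

text \<open>The torsion part of a zero object embeds into it and so is zero, and closure under
  isomorphism brings in every other zero object. This places complexes with vanishing H^0, such as
  the shifts below, in the aisle.\<close>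

lemma zero_in_T: assumes "zero_object C A" shows "A \<in> T"
proof -
  have A: "A \<in> Obj C" using assms by (simp add: zero_object_def)
  obtain X Z f g where s: "X \<in> T" "f \<in> hom C X A" "g \<in> hom C A Z" "short_exact C f g" using torsion_sequence[OF A] .
  have "x = 0" if x: "x \<in> El W X" for x W
    using short_exactD(5)[OF s(4,2,3) x] zero_object_El[OF assms El_lact[OF s(2) x]] by blast
  then have "zero_object C X" using zero_object_iff T_obj s(1) by blast
  then show ?thesis using T_iso s(1) zero_object_isomorphic assms by blast
qed

lemma zero_in_F: assumes "zero_object C A" shows "A \<in> F"
proof -
  have A: "A \<in> Obj C" using assms by (simp add: zero_object_def)
  obtain X Z f g where s: "Z \<in> F" "f \<in> hom C X A" "g \<in> hom C A Z" "short_exact C f g" using torsion_sequence[OF A] .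
  have "x = 0" if x: "x \<in> El W Z" for x W
  proof -
    obtain V e y where y: "e \<in> epis V W" "y \<in> El V A" "g \<rhd> y = x \<lhd> e" using epi_lift[OF short_exactD(2)[OF s(4,2,3)] x] .
    then show ?thesis using zero_object_El[OF assms y(2)] epis_cancel[OF y(1) x] by simp
  qed
  then have "zero_object C Z" using zero_object_iff F_obj s(1) by blast
  then show ?thesis using F_iso s(1) zero_object_isomorphic assms by blast
qed

text \<open>The map from the torsion part of \<open>Y\<close> is zero, so in the torsion sequence
  the map to the torsion-free part is mono as well as epi.\<close>

lemma F_right_perp: assumes "Y \<in> Obj C" "\<And>A. A \<in> T \<Longrightarrow> hom C A Y = {Null C A Y}" shows "Y \<in> F"
proof -
  obtain X Z f g where s: "X \<in> T" "Z \<in> F" "f \<in> hom C X Y" "g \<in> hom C Y Z" "short_exact C f g" using torsion_sequence[OF assms(1)] .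
  note sD = short_exactD[OF s(5,3,4)]
  have "f = Null C X Y" using assms(2)[OF s(1)] s(3) by blast
  then have f0: "f \<rhd> x = 0" for x using lact_null homD(4,5)[OF s(3)] by simp
  have "is_mono C g"
  proof (rule mono_ofI[OF s(4)])
    fix y W assume "y \<in> El W Y" "g \<rhd> y = 0"
    then show "y = 0" using sD(4) f0 by metis
  qed
  then have "is_iso C g" using mono_epi_iso[OF s(4)] sD(2) by (simp add: epis_def)
  then show ?thesis using F_iso[OF s(2)] isomorphic_sym isomorphicI[OF s(4)] by blast
qed

abbreviation "U \<equiv> lift_aisle C T"
abbreviation "P \<equiv> right_perp (Db C) U"

lemma U_iff: "X \<in> U \<longleftrightarrow> X \<in> complexes \<and> (\<forall>i>0. exact_at X i) \<and> cohom C 0 X \<in> T"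
  using zero_cohom_iff by (auto simp: lift_aisle_def Db_fields)

lemma P_iff: "Y \<in> P \<longleftrightarrow> Y \<in> complexes \<and> (\<forall>X\<in>U. hvanish X Y)"
proof -
  have "U \<subseteq> complexes" using U_iff by blast
  then show ?thesis unfolding right_perp_Db[OF \<open>U \<subseteq> complexes\<close>] by blast
qed

lemma U_iso: "X \<in> U \<Longrightarrow> isomorphic (Db C) X Y \<Longrightarrow> Y \<in> U"
  using Db_iso_facts(2,3,4) T_iso by (meson U_iff)

lemma P_iso: "X \<in> P \<Longrightarrow> isomorphic (Db C) X Y \<Longrightarrow> Y \<in> P"
  using Db_iso_facts(2,6) P_iff by blast

text \<open>H^0 of the shift is H^1 of \<open>X\<close>, which vanishes, and zero objects belong to
  \<open>T\<close>.\<close>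

lemma U_shift: assumes "X \<in> U" shows "shift_complex C 1 X \<in> U"
proof -
  have X: "X \<in> complexes" "\<forall>i>0. exact_at X i" using assms U_iff by blast+
  have S: "shift_complex C 1 X \<in> complexes" using shift_complexes X(1) by blast
  have "exact_at (shift_complex C 1 X) i" if "i \<ge> 0" for i using X that by simp
  then show ?thesis using U_iff S zero_cohom_iff[OF S, of 0] zero_in_T by simp
qed

lemma P_shift: assumes "Y \<in> P" shows "shift_complex C (- 1) Y \<in> P"
proof -
  have Y: "Y \<in> complexes" using assms P_iff by blast
  have "hvanish X (shift_complex C (- 1) Y)" if "X \<in> U" for X
    using hvanish_shift[of X Y] U_shift[OF that] assms P_iff that U_iff Y by blast
  then show ?thesis using P_iff shift_complexes Y by blast
qed

text \<open>\<open>m\<close> is the kernel of the cokernel of the differential into degree 0, that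
  is, its image. A subcomplex that ends with this image has no cohomology in degree 0, and none
  below by assumption. As \<open>m\<close> is a kernel, coboundaries lift to it over the same test
  object, as \<open>trunc_factor\<close> demands.\<close>

lemma acyclic_image_truncation:
  assumes Z: "Z \<in> complexes" and ex: "\<And>i. i < 0 \<Longrightarrow> exact_at Z i"
  obtains m j where "trunc_data Z 0 m j" "\<forall>i. exact_at (trunc Z 0 m j) i"
    "\<forall>W. \<forall>x\<in>bds Z 0 W. \<exists>z\<in>El W (Dom C m). m \<rhd> z = x"
proof -
  have d1: "diff Z (- 1) \<in> hom C (ob Z (- 1)) (ob Z 0)" using complexD(2)[OF Z, of "- 1"] by simp
  note d0 = complexD(2)[OF Z, of 0]
  have dd: "diff Z 0 \<rhd> diff Z (- 1) \<rhd> x = 0" for x using complexD(4)[OF Z, of 0] by simp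
  obtain c where c: "is_cokernel C c (diff Z (- 1))" using ex_cokernel homD(1)[OF d1] by blast
  note cD = cokernelD[OF c d1]
  obtain m where m: "is_kernel C m c" using ex_kernel homD(1)[OF cD(1)] by blast
  note mD = kernelD[OF m cD(1)]
  have "c \<rhd> emb (diff Z (- 1)) = 0" using cD(2)[of "emb (\<one> (ob Z (- 1)))"] emb_ident_lact[OF d1] by simp
  then obtain z where z: "z \<in> El (ob Z (- 1)) (Dom C m)" "m \<rhd> z = emb (diff Z (- 1))" using mD(4)[OF emb_El[OF d1]] by blast
  obtain j where j: "j \<in> hom C (ob Z (- 1)) (Dom C m)" "z = emb j" using El_obtain[OF z(1)] .
  have mj: "m \<cdot> j = diff Z (- 1)"
    using emb_inj[OF comp_hom[OF j(1) mD(1)] d1] z j emb_comp_lact[OF j(1) mD(1)] by simp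
  have mjx: "m \<rhd> j \<rhd> x = diff Z (- 1) \<rhd> x" for x
    using lact_comp[of j m x] mj homD[OF j(1)] homD[OF mD(1)] by simp
  have "diff Z 0 \<cdot> diff Z (- 1) = Null C (ob Z (- 1)) (ob Z (0 + 1))" using null_compI[OF d1 d0] dd by blast
  then obtain u where u: "u \<in> hom C (Cod C c) (ob Z (0 + 1))" "u \<cdot> c = diff Z 0" using cD(4)[OF d0] by blast
  have dm: "diff Z 0 \<rhd> m \<rhd> x = 0" for x
    using lact_comp[of c u "m \<rhd> x"] u homD[OF u(1)] homD[OF cD(1)] mD(2) by simp
  have mono: "is_mono C m" using mD(3) by (rule mono_ofI[OF mD(1)])
  have td: "trunc_data Z 0 m j" unfolding trunc_data_def using Z mD(1) mono dm j(1) mj by simp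
  note t = trunc_facts[OF td]
  have "exact_at (trunc Z 0 m j) i" for i
  proof -
    consider "i < 0" | "i = 0" | "i > 0" by linarith
    then show ?thesis
    proof cases
      case 1 then show ?thesis using exact_transfer(1)[OF t(1) t(6) ex] by simp
    next
      case 2
      have "x \<in> bds (trunc Z 0 m j) 0 W" if x: "x \<in> cycs (trunc Z 0 m j) 0 W" for x W
      proof -
        have xm: "x \<in> El W (Dom C m)" using cycsD(1)[OF x] t(2) by simp
        obtain V e y where y: "e \<in> epis V W" "y \<in> El V (ob Z (- 1))" "diff Z (- 1) \<rhd> y = (m \<rhd> x) \<lhd> e"
          using cokernel_lift[OF c d1 El_lact[OF mD(1) xm]] mD(2) by metis
        have "m \<rhd> x \<in> bds Z 0 W" using bdsI[OF El_lact[OF mD(1) xm] y(1), of y] y by simp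
        then show ?thesis using H_injD[OF t(6) t(1) x] t(5) by simp
      qed
      then show ?thesis using 2 by (auto simp: exact_at_def)
    next
      case 3 then show ?thesis using t(8) by simp
    qed
  qed
  moreover have "\<exists>z\<in>El W (Dom C m). m \<rhd> z = x" if x: "x \<in> bds Z 0 W" for x W
  proof -
    obtain V e y where y: "x \<in> El W (ob Z 0)" "e \<in> epis V W" "y \<in> El V (ob Z (0 - 1))" "x \<lhd> e = diff Z (0 - 1) \<rhd> y"
      using bdsE[OF x] .
    have "(c \<rhd> x) \<lhd> e = 0" using y(4) cD(2) by simp
    then have "c \<rhd> x = 0" using epis_cancel[OF y(2) El_lact[OF cD(1) y(1)]] by blast
    then show ?thesis using mD(4)[OF y(1)] by blast
  qed
  ultimately show ?thesis using that td by blast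
qed

text \<open>After truncation, a map from the aisle to such a complex factors through an acyclic
  subcomplex, since it induces the zero map on cohomology.\<close>

lemma lift_aisle_vanish:
  assumes W: "W \<in> U" and Z: "Z \<in> complexes" and ex: "\<And>i. i < 0 \<Longrightarrow> exact_at Z i" and F: "cohom C 0 Z \<in> F"
  shows "hvanish W Z"
proof (rule hvanishI)
  fix V s g assume s: "chmap s V W" "qis s" "chmap g V Z"
  have Vlow: "exact_at V i" if "i > 0" for i
    using exact_transfer(1)[OF s(1) qisD(1)[OF s(2)]] W U_iff that by blast
  obtain X f where X: "chmap f X V" "\<forall>i>0. zero_object C (ob X i)" "\<forall>i>0. exact_at X i" "\<forall>i\<le>0. H_inj f i \<and> H_surj f i"
    using truncation_ex[OF chmapD(1)[OF s(1)], of 0] by metis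
  have q: "qis f"
  proof (rule qisI[OF X(1)])
    show "H_inj f i" for i using X(3,4) H_exact_source[OF X(1)] by (cases "i \<le> 0") auto
    show "H_surj f i" for i using X(4) Vlow H_exact_target[OF X(1)] by (cases "i \<le> 0") auto
  qed
  note sf = chmap_ccomp[OF X(1) s(1)] and gf = chmap_ccomp[OF X(1) s(3)]
  note Xc = chmapD(1)[OF X(1)]
  have sq: "qis (ccomp s f)" using qis_ccomp[OF X(1) s(1) q s(2)] .
  have XT: "cohom C 0 X \<in> T"
    using T_iso isomorphic_sym[OF cohom_isomorphic[OF sf qisD(1)[OF sq] qisD(2)[OF sq]]] W U_iff by blast
  obtain m j where td: "trunc_data Z 0 m j" and tex: "\<forall>i. exact_at (trunc Z 0 m j) i"
    and im: "\<forall>W. \<forall>x\<in>bds Z 0 W. \<exists>z\<in>El W (Dom C m). m \<rhd> z = x" using acyclic_image_truncation[OF Z ex] .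
  \<comment> \<open>\<open>X\<close> is zero above degree 0, so every element of X^0 is a cocycle.
    Its class goes to zero because the induced arrow runs from an object of \<open>T\<close> to an
    object of \<open>F\<close>.\<close>
  have fac: "\<exists>z\<in>El W (Dom C m). m \<rhd> z = cpt (ccomp g f) 0 \<rhd> x" if x: "x \<in> El W (ob X 0)" for x W
  proof -
    have xc: "x \<in> cycs X 0 W" using cycs_zero_next[OF Xc, of 0] X(2) x by simp
    note c = cohom_map_facts[OF gf, where i = 0]
    have "hcls Z 0 W (cpt (ccomp g f) 0 \<rhd> x) = 0"
      using c(2)[OF xc] T_F_arr[OF XT F c(1)] by simp
    then have "cpt (ccomp g f) 0 \<rhd> x \<in> bds Z 0 W" using hcls_facts(2)[OF Z cycs_chmap[OF gf xc]] by blast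
    then show ?thesis using im by blast
  qed
  obtain g' where g': "chmap g' X (trunc Z 0 m j)" "ccomp (trunc_incl Z 0 m j) g' = ccomp g f"
    using trunc_factor[OF td gf _ fac] X(2) by blast
  obtain Y t where t: "chmap t Y X" "qis t" "hpic (ccomp g' t) (cnull Y (trunc Z 0 m j))"
    using acyclic_target_null[OF g'(1)] tex by blast
  note incl = trunc_facts(1)[OF td]
  have "hpic (ccomp (trunc_incl Z 0 m j) (ccomp g' t)) (cnull Y Z)"
    using hpic_null_comp[OF t(3) chmap_ccomp[OF t(1) g'(1)] incl] .
  then have "hpic (ccomp g (ccomp f t)) (cnull Y Z)"
    using ccomp_assoc[OF t(1) g'(1) incl] g'(2) ccomp_assoc[OF t(1) X(1) s(3)] by simp
  then show "\<exists>Y t. chmap t Y V \<and> qis t \<and> hpic (ccomp g t) (cnull Y Z)"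
    using chmap_ccomp[OF t(1) X(1)] qis_ccomp[OF t(1) X(1) t(2) q] by blast
qed

text \<open>The part of \<open>Y\<close> in the aisle is the subcomplex with the cocycles in degree \<open>0\<close> that represent
  the torsion part of the cohomology, and with zero in positive degrees.\<close>

lemma torsion_decomposition:
  assumes Y: "Y \<in> complexes"
  obtains X f K \<iota> \<pi> \<kappa> \<rho> where "is_cone X Y f K \<iota> \<pi> \<kappa> \<rho>" "X \<in> U" "K \<in> P"
proof -
  obtain k p where d: "cohom_data C Y 0 (k, p)" and co: "cohom C 0 Y = Cod C p"
    and hk: "\<forall>W. \<forall>z\<in>El W (Dom C k). hcls Y 0 W (k \<rhd> z) = p \<rhd> z" using cohom_choiceE[OF Y, of 0] by metis
  note a = cohom_dataD[OF Y d]
  note ph = epis_hom[OF a(2)]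
  have Q: "Cod C p \<in> Obj C" using homD(5)[OF ph] .
  obtain A B t q where s: "A \<in> T" "B \<in> F" "t \<in> hom C A (Cod C p)" "q \<in> hom C (Cod C p) B" "short_exact C t q"
    using torsion_sequence[OF Q] .
  note sD = short_exactD[OF s(5,3,4)]
  have qp: "q \<cdot> p \<in> hom C (Dom C k) B" using comp_hom ph s(4) .
  have qpx: "(q \<cdot> p) \<rhd> x = q \<rhd> p \<rhd> x" for x using homD[OF ph] homD[OF s(4)] by simp
  \<comment> \<open>The elements of the domain of \<open>n\<close> are the cocycles whose class lies
    in the torsion part, the kernel of \<open>q\<close>; the arrow k n embeds this domain into
    Y^0.\<close>
  obtain n where n: "is_kernel C n (q \<cdot> p)" using ex_kernel homD(1)[OF qp] by blast
  note nD = kernelD[OF n qp]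
  obtain j where td0: "trunc_data Y 0 k j" and pj: "\<forall>x. p \<rhd> j \<rhd> x = 0" using cohom_trunc_data[OF Y d] .
  have j: "j \<in> hom C (ob Y (0 - 1)) (Dom C k)" and kj: "k \<cdot> j = diff Y (0 - 1)" and dk: "\<And>x. diff Y 0 \<rhd> k \<rhd> x = 0"
    using td0 by (auto simp: trunc_data_def)
  have "(q \<cdot> p) \<rhd> emb j = 0" using pj[rule_format, of "emb (\<one> (ob Y (0 - 1)))"] emb_ident_lact[OF j] qpx by simp
  then obtain z where z: "z \<in> El (ob Y (0 - 1)) (Dom C n)" "n \<rhd> z = emb j" using nD(4)[OF emb_El[OF j]] by blast
  obtain j' where j': "j' \<in> hom C (ob Y (0 - 1)) (Dom C n)" "z = emb j'" using El_obtain[OF z(1)] .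
  have nj: "n \<cdot> j' = j" using emb_inj[OF comp_hom[OF j'(1) nD(1)] j] z j' emb_comp_lact[OF j'(1) nD(1)] by simp
  let ?m = "k \<cdot> n"
  have m: "?m \<in> hom C (Dom C n) (ob Y 0)" using comp_hom nD(1) a(1) .
  have dm: "Dom C ?m = Dom C n" using homD(2)[OF m] .
  have mx: "?m \<rhd> x = k \<rhd> n \<rhd> x" for x using homD[OF nD(1)] homD[OF a(1)] by simp
  have mono: "is_mono C ?m"
  proof (rule mono_ofI[OF m])
    fix x W assume x: "x \<in> El W (Dom C n)" "?m \<rhd> x = 0"
    then show "x = 0" using nD(3)[OF x(1)] a(5)[OF El_lact[OF nD(1) x(1)]] mx by simp
  qed
  have "?m \<cdot> j' = diff Y (0 - 1)" using comp_assoc[OF j'(1) nD(1) a(1)] nj kj by simp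
  then have td: "trunc_data Y 0 ?m j'" unfolding trunc_data_def dm using Y m mono mx dk j'(1) by simp
  note tr = trunc_facts[OF td]
  let ?X = "trunc Y 0 ?m j'" and ?f = "trunc_incl Y 0 ?m j'"
  note X = chmapD(1)[OF tr(1)]
  have cX: "cycs ?X 0 W = El W (Dom C n)" for W using cycs_zero_next[OF X, of 0] tr(4) tr(2) dm by simp
  obtain K \<iota> \<pi> \<kappa> \<rho> where cone: "is_cone ?X Y ?f K \<iota> \<pi> \<kappa> \<rho>" using cone_ex[OF tr(1)] by blast
  note kc = coneD[OF cone]
  have Kex: "exact_at K i" if "i < 0" for i using cone_exact_iff[OF cone] tr(6,7) that by simp
  let ?h1 = "cohom_map C 0 ?f" and ?h2 = "cohom_map C 0 \<iota>"
  note h = cone_cohom_exact[OF cone, simplified, OF tr(8)[of 1, simplified] Kex[of "- 1", simplified]]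
  have h1: "?h1 \<rhd> hcls ?X 0 W z = p \<rhd> n \<rhd> z" if z: "z \<in> El W (Dom C n)" for z W
    using cohom_map_facts(2)[OF tr(1)] z cX tr(5) mx hk El_lact[OF nD(1) z] by simp
  have qh1: "q \<rhd> ?h1 \<rhd> y = 0" if y: "y \<in> El W (cohom C 0 ?X)" for y W
  proof -
    obtain V e z where z: "e \<in> epis V W" "z \<in> cycs ?X 0 V" "hcls ?X 0 V z = y \<lhd> e" using hcls_lift[OF X y] .
    have "(q \<rhd> ?h1 \<rhd> y) \<lhd> e = q \<rhd> ?h1 \<rhd> hcls ?X 0 V z" using z(3) by simp
    also have "\<dots> = 0" using h1[of z V] z(2) cX qpx nD(2)[of z] by simp
    finally show ?thesis using epis_cancel[OF z(1) El_lact[OF s(4)]] El_lact[OF h(1) y] co by simp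
  qed
  \<comment> \<open>Every class in the torsion part is represented, locally, by a cocycle of the
    subcomplex. This will show that \<open>r\<close> is epi and that the map to H^0(K) kills the
    torsion part.\<close>
  have lift: "\<exists>V e x. e \<in> epis V W \<and> x \<in> El V (cohom C 0 ?X) \<and> ?h1 \<rhd> x = (t \<rhd> y) \<lhd> e" if y: "y \<in> El W A" for y W
  proof -
    obtain V e z where z: "e \<in> epis V W" "z \<in> El V (Dom C k)" "p \<rhd> z = (t \<rhd> y) \<lhd> e"
      using epi_lift[OF a(2) El_lact[OF s(3) y]] .
    have "(q \<cdot> p) \<rhd> z = 0" using qpx z(3) sD(3) by simp
    then obtain w where w: "w \<in> El V (Dom C n)" "n \<rhd> w = z" using nD(4)[OF z(2)] by blast
    have "?h1 \<rhd> hcls ?X 0 V w = (t \<rhd> y) \<lhd> e" using h1[OF w(1)] w(2) z(3) by simp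
    moreover have "hcls ?X 0 V w \<in> El V (cohom C 0 ?X)" using hcls_facts(1)[OF X] w(1) cX by blast
    ultimately show ?thesis using z(1) by blast
  qed
  have hX: "cohom C 0 ?X \<in> Obj C" using cohom_obj[OF X] .
  have h1h: "?h1 \<in> hom C (cohom C 0 ?X) (Cod C p)" using h(1) co by simp
  \<comment> \<open>The map induced on H^0 by the inclusion lands in the kernel \<open>t\<close> of
    \<open>q\<close> and so factors through \<open>A\<close> by an arrow \<open>r\<close>. It is
    mono because H^(-1)(K) = 0, hence so is \<open>r\<close>; thus \<open>r\<close> identifies H^0
    of the subcomplex with the torsion part.\<close>
  have "q \<rhd> emb ?h1 = 0" using qh1[OF emb_El[OF ident_hom[OF hX]]] emb_ident_lact[OF h1h] by simp
  then obtain z1 where z1: "z1 \<in> El (cohom C 0 ?X) A" "t \<rhd> z1 = emb ?h1" using sD(4)[OF emb_El[OF h1h]] by blast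
  obtain r where r: "r \<in> hom C (cohom C 0 ?X) A" "z1 = emb r" using El_obtain[OF z1(1)] .
  have "t \<cdot> r = ?h1" using emb_inj[OF comp_hom[OF r(1) s(3)] h1h] z1 r emb_comp_lact[OF r(1) s(3)] by simp
  then have tr': "t \<rhd> r \<rhd> x = ?h1 \<rhd> x" for x using lact_comp[of r t x] homD[OF r(1)] homD[OF s(3)] by simp
  have "is_mono C r"
  proof (rule mono_ofI[OF r(1)])
    fix x W assume x: "x \<in> El W (cohom C 0 ?X)" "r \<rhd> x = 0"
    then show "x = 0" using h(3) tr'[of x] unfolding mono_iff[OF h(1)] by simp
  qed
  moreover have "r \<in> epis (cohom C 0 ?X) A"
  proof (rule episI_lift[OF r(1)])
    fix y W assume y: "y \<in> El W A"
    obtain V e x where x: "e \<in> epis V W" "x \<in> El V (cohom C 0 ?X)" "?h1 \<rhd> x = (t \<rhd> y) \<lhd> e" using lift[OF y] by blast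
    have "t \<rhd> (r \<rhd> x - y \<lhd> e) = 0" using tr' x(3) by simp
    then have "r \<rhd> x = y \<lhd> e" using sD(5)[OF El_diff[OF El_lact[OF r(1) x(2)] El_ract[OF y epis_hom[OF x(1)]]]] by simp
    then show "\<exists>V e x. e \<in> epis V W \<and> x \<in> El V (cohom C 0 ?X) \<and> r \<rhd> x = y \<lhd> e" using x by blast
  qed
  ultimately have "isomorphic C (cohom C 0 ?X) A" using mono_epi_iso[OF r(1)] isomorphicI[OF r(1)] by (simp add: epis_def)
  then have "cohom C 0 ?X \<in> T" using T_iso[OF s(1)] isomorphic_sym by blast
  then have XU: "?X \<in> U" using U_iff X tr(8) by blast
  have h2h: "?h2 \<in> hom C (Cod C p) (cohom C 0 K)" using h(2) co by simp
  have cq: "is_cokernel C q t" using s(5) by (simp add: short_exact_def)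
  have h2t: "?h2 \<rhd> t \<rhd> y = 0" if y: "y \<in> El W A" for y W
  proof -
    obtain V e x where x: "e \<in> epis V W" "x \<in> El V (cohom C 0 ?X)" "?h1 \<rhd> x = (t \<rhd> y) \<lhd> e" using lift[OF y] by blast
    have "(?h2 \<rhd> t \<rhd> y) \<lhd> e = ?h2 \<rhd> ?h1 \<rhd> x" using x(3) by simp
    then have "(?h2 \<rhd> t \<rhd> y) \<lhd> e = 0" using h(5)[OF x(2)] by simp
    then show ?thesis using epis_cancel[OF x(1) El_lact[OF h2h El_lact[OF s(3) y]]] by blast
  qed
  \<comment> \<open>The map to H^0(K) kills the torsion part and factors through the cokernel
    \<open>q\<close> by an arrow \<open>w\<close>. Exactness at H^0(Y) makes \<open>w\<close> mono,
    surjectivity of the map makes it epi, so H^0(K) is the torsion-free part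
    \<open>B\<close>.\<close>
  have "?h2 \<cdot> t = Null C A (cohom C 0 K)"
    using h2t homD[OF s(3)] homD[OF h2h] by (intro arr_eqI[OF comp_hom[OF s(3) h2h] null_hom]) auto
  then obtain w where w: "w \<in> hom C B (cohom C 0 K)" "w \<cdot> q = ?h2"
    using cokernelD(4)[OF cq s(3) h2h] homD(3)[OF s(4)] by auto
  have wq: "w \<rhd> q \<rhd> x = ?h2 \<rhd> x" for x using lact_comp[of q w x] w homD[OF w(1)] homD[OF s(4)] by simp
  have "is_mono C w"
  proof (rule mono_ofI[OF w(1)])
    fix y W assume y: "y \<in> El W B" "w \<rhd> y = 0"
    obtain V e x where x: "e \<in> epis V W" "x \<in> El V (Cod C p)" "q \<rhd> x = y \<lhd> e" using epi_lift[OF sD(2) y(1)] .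
    have "?h2 \<rhd> x = (w \<rhd> y) \<lhd> e" using wq[of x] x(3) by simp
    then have "?h2 \<rhd> x = 0" using y(2) by simp
    then obtain V' e' x' where x': "e' \<in> epis V' V" "x' \<in> El V' (cohom C 0 ?X)" "?h1 \<rhd> x' = x \<lhd> e'"
      using h(6)[of x V] x(2) co by auto
    have "(q \<rhd> x) \<lhd> e' = 0" using x'(3) qh1[OF x'(2)] by simp
    then have "q \<rhd> x = 0" using epis_cancel[OF x'(1) El_lact[OF s(4) x(2)]] by blast
    then show "y = 0" using epis_cancel[OF x(1) y(1)] x(3) by simp
  qed
  moreover have "w \<in> epis B (cohom C 0 K)"
  proof (rule episI_lift[OF w(1)])
    fix y W assume y: "y \<in> El W (cohom C 0 K)"
    obtain V e x where x: "e \<in> epis V W" "x \<in> El V (cohom C 0 Y)" "?h2 \<rhd> x = y \<lhd> e" using epi_lift[OF h(4) y] .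
    then show "\<exists>V e x. e \<in> epis V W \<and> x \<in> El V B \<and> w \<rhd> x = y \<lhd> e"
      using wq El_lact[OF s(4)] co by metis
  qed
  ultimately have "isomorphic C B (cohom C 0 K)" using mono_epi_iso[OF w(1)] isomorphicI[OF w(1)] by (simp add: epis_def)
  then have "cohom C 0 K \<in> F" using F_iso[OF s(2)] by blast
  then have "K \<in> P" using P_iff lift_aisle_vanish[OF _ kc(6) Kex] kc(6) by blast
  then show ?thesis using that cone XU by blast
qed

lemma stalk_in_U_iff: assumes A: "A \<in> Obj C" shows "stk A \<in> U \<longleftrightarrow> A \<in> T"
proof -
  have "cohom C 0 (stk A) \<in> T \<longleftrightarrow> A \<in> T"
    using T_iso stalk_cohom[OF A] isomorphic_sym[OF stalk_cohom[OF A]] by blast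
  moreover have "\<forall>i>0. exact_at (stk A) i" using stalk_exact[OF A] by simp
  ultimately show ?thesis using U_iff stalk_complex[OF A] by blast
qed

text \<open>One direction tests orthogonality on the stalks of torsion objects only. The other is
  \<open>lift_aisle_vanish\<close>, which applies because a stalk has no cohomology in negative
  degrees.\<close>

lemma stalk_in_P_iff: assumes A: "A \<in> Obj C" shows "stk A \<in> P \<longleftrightarrow> A \<in> F"
proof
  assume P: "stk A \<in> P"
  show "A \<in> F"
  proof (rule F_right_perp[OF A])
    fix B assume B: "B \<in> T"
    then have o: "B \<in> Obj C" and v: "hvanish (stk B) (stk A)" using T_obj stalk_in_U_iff P P_iff by blast+
    have "f = Null C B A" if f: "f \<in> hom C B A" for f
    proof (rule arr_eqI[OF f null_hom[OF o A]])
      obtain q where q: "chmap q (stk B) (stk A)" "\<forall>x. cpt q 0 \<rhd> x = f \<rhd> x" using stalk_map[OF f] .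
      fix x W assume "x \<in> El W B"
      then have "cpt q 0 \<rhd> x \<in> bds (stk A) 0 W" using hvanish_bds[OF v q(1)] cycs_stalk[OF o] by blast
      then show "f \<rhd> x = Null C B A \<rhd> x" using bds_stalk[OF A] q(2) o A by simp
    qed
    then show "hom C B A = {Null C B A}" using null_hom[OF o A] by blast
  qed
next
  assume F: "A \<in> F"
  have "cohom C 0 (stk A) \<in> F" using F_iso[OF F isomorphic_sym[OF stalk_cohom[OF A]]] .
  then have "hvanish W (stk A)" if "W \<in> U" for W
    using lift_aisle_vanish[OF that stalk_complex[OF A]] stalk_exact[OF A] by simp
  then show "stk A \<in> P" using P_iff stalk_complex[OF A] by blast
qed

lemma P_shift_image: "shift_complex C (- 1) ` shift_complex C 1 ` P = P"
  using P_iff by (auto simp: image_image)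

lemma lift_t_structure: "t_structure (Db C) (U, shift_complex C 1 ` P)"
  unfolding t_structure_def prod.case Db_fields(1,8) P_shift_image
proof (intro conjI)
  show "strict_subcat (Db C) U"
    unfolding strict_subcat_def Db_fields(1) using U_iso U_iff by blast
  show "strict_subcat (Db C) (shift_complex C 1 ` P)"
    unfolding strict_subcat_def Db_fields(1)
  proof (intro conjI ballI impI)
    show "shift_complex C 1 ` P \<subseteq> complexes" using P_iff shift_complexes by auto
    fix X Y assume "X \<in> shift_complex C 1 ` P" and Y: "Y \<in> complexes" and iso: "isomorphic (Db C) X Y"
    then obtain Z where Z: "Z \<in> P" "X = shift_complex C 1 Z" by blast
    have "isomorphic (Db C) Z (shift_complex C (- 1) Y)"
      using Db_iso_facts(7)[OF iso, of "- 1"] Z P_iff by simp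
    then have "shift_complex C (- 1) Y \<in> P" using P_iso Z(1) by blast
    then have "shift_complex C 1 (shift_complex C (- 1) Y) \<in> shift_complex C 1 ` P" by (rule imageI)
    then show "Y \<in> shift_complex C 1 ` P" using Y by simp
  qed
  show "\<forall>X\<in>U. \<forall>Y\<in>P. hom (Db C) X Y = {Null (Db C) X Y}"
    using P_iff U_iff Db_null_iff by blast
  show "U \<subseteq> shift_complex C (- 1) ` U"
  proof
    fix X assume X: "X \<in> U"
    have "shift_complex C (- 1) (shift_complex C 1 X) \<in> shift_complex C (- 1) ` U" using U_shift[OF X] by (rule imageI)
    then show "X \<in> shift_complex C (- 1) ` U" using X U_iff by simp
  qed
  show "P \<subseteq> shift_complex C 1 ` P"
  proof
    fix X assume X: "X \<in> P"
    have "shift_complex C 1 (shift_complex C (- 1) X) \<in> shift_complex C 1 ` P" using P_shift[OF X] by (rule imageI)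
    then show "X \<in> shift_complex C 1 ` P" using X P_iff by simp
  qed
  show "\<forall>Y\<in>complexes. \<exists>X\<in>U. \<exists>Z\<in>P. \<exists>u\<in>hom (Db C) X Y. \<exists>v\<in>hom (Db C) Y Z.
      \<exists>w\<in>hom (Db C) Z (shift_complex C 1 X). (u, v, w) \<in> Triangles (Db C)"
  proof
    fix Y assume Y: "Y \<in> complexes"
    obtain X f K \<iota> \<pi> \<kappa> \<rho> where c: "is_cone X Y f K \<iota> \<pi> \<kappa> \<rho>" "X \<in> U" "K \<in> P" using torsion_decomposition[OF Y] .
    show "\<exists>X\<in>U. \<exists>Z\<in>P. \<exists>u\<in>hom (Db C) X Y. \<exists>v\<in>hom (Db C) Y Z.
      \<exists>w\<in>hom (Db C) Z (shift_complex C 1 X). (u, v, w) \<in> Triangles (Db C)"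
      using c(2,3) cone_triangle_distinguished[OF c(1)] by blast
  qed
qed

lemma stalk_shift_in_U: assumes "A \<in> Obj C" shows "shift_complex C 1 (stk A) \<in> U"
proof -
  note S = stalk_complex[OF assms]
  have c: "shift_complex C 1 (stk A) \<in> complexes" using shift_complexes S by blast
  have "exact_at (shift_complex C 1 (stk A)) i" if "i \<ge> 0" for i using S stalk_exact[OF assms] that by simp
  then show ?thesis using U_iff c zero_cohom_iff[OF c, of 0] zero_in_T by simp
qed

lemma stalk_shift_in_P: assumes "A \<in> Obj C" shows "shift_complex C (- 1) (stk A) \<in> P"
proof -
  note S = stalk_complex[OF assms]
  have c: "shift_complex C (- 1) (stk A) \<in> complexes" using shift_complexes S by blast
  have e: "exact_at (shift_complex C (- 1) (stk A)) i" if "i \<le> 0" for i using S stalk_exact[OF assms] that by simp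
  then have "cohom C 0 (shift_complex C (- 1) (stk A)) \<in> F" using zero_cohom_iff[OF c, of 0] zero_in_F by simp
  then show ?thesis using P_iff c lift_aisle_vanish[OF _ c] e by simp
qed

end

section \<open>The lift and the trace are mutually inverse\<close>

context abelian_category
begin

lemma trace_lift:
  assumes "p \<in> torsion_pairs C"
  shows "lift_map C p \<in> intermediate_t_structures C" "trace_map C (lift_map C p) = p"
proof -
  obtain T F where p: "p = (T, F)" "torsion_pair C (T, F)" using assms by (cases p) (simp add: torsion_pairs_def)
  then interpret torsion_theory C T F by unfold_locales
  show "lift_map C p \<in> intermediate_t_structures C"
    unfolding p(1) lift_map_def intermediate_t_structures_def prod.case Db_fields(8) mem_Collect_eq
    using lift_t_structure stalk_shift_in_U stalk_shift_in_P by blast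
  show "trace_map C (lift_map C p) = p"
    unfolding p(1) lift_map_def trace_map_def prod.case
    using stalk_in_U_iff stalk_in_P_iff T_obj F_obj by blast
qed

lemma lift_trace_map:
  assumes "q \<in> intermediate_t_structures C"
  shows "trace_map C q \<in> torsion_pairs C" "lift_map C (trace_map C q) = q"
proof -
  obtain U where q: "q = (U, shift_complex C 1 ` right_perp (Db C) U)"
    and t: "t_structure (Db C) (U, shift_complex C 1 ` right_perp (Db C) U)"
    and s: "\<forall>X\<in>Obj C. shift_complex C 1 (stk X) \<in> U" "\<forall>X\<in>Obj C. shift_complex C (- 1) (stk X) \<in> right_perp (Db C) U"
    using assms unfolding intermediate_t_structures_def Db_fields(8) by auto
  interpret intermediate_t_structure C U "right_perp (Db C) U"
    using t s by unfold_locales auto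
  show "trace_map C q \<in> torsion_pairs C"
    unfolding q trace_map_def torsion_pairs_def prod.case using trace_torsion_pair by simp
  show "lift_map C (trace_map C q) = q"
    unfolding q trace_map_def lift_map_def prod.case lift_trace Db_fields(8) ..
qed

end

theorem proposition2p4:
  fixes H :: "('o, 'm, 'k::alg_closed_field) lincat"
  assumes "hereditary_category H"
  shows "bij_betw (lift_map H) (torsion_pairs H) (intermediate_t_structures H)
    \<and> bij_betw (trace_map H) (intermediate_t_structures H) (torsion_pairs H)
    \<and> (\<forall>p \<in> torsion_pairs H. trace_map H (lift_map H p) = p)
    \<and> (\<forall>q \<in> intermediate_t_structures H. lift_map H (trace_map H q) = q)"
proof -
  interpret abelian_category H using assms by (simp add: hereditary_category_def)
  have "bij_betw (lift_map H) (torsion_pairs H) (intermediate_t_structures H)"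
    by (rule bij_betw_byWitness[where f' = "trace_map H"]) (auto simp: trace_lift lift_trace_map)
  moreover have "bij_betw (trace_map H) (intermediate_t_structures H) (torsion_pairs H)"
    by (rule bij_betw_byWitness[where f' = "lift_map H"]) (auto simp: trace_lift lift_trace_map)
  ultimately show ?thesis by (auto simp: trace_lift lift_trace_map)
qed

end
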